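(* Assume (A1)–(A7) below. Then for every $k=1,\dots,r$ there exists a local maximum $\hat\varphi_{k,n}$ of $\hat\chi_n(\varphi)$ on $[0,\pi/D]$ such that $n(\hat\varphi_{k,n}-\varphi_k)\to0$ almost surely as $n\to\infty$.
   Context: $N=N(n)$. (A1) $N\le n$, $n\to\infty$, $N/n\to c\in(0,1]$. (A2) $X_n=L_n\Gamma_nR_n^*$ random $N\times n$ with $L_n,\Gamma_n,R_n$ independent, $L_n$ Haar on $\mathcal U(N)$, $\Gamma_n$ $N\times N$ diagonal nonnegative, $R_n$ an $n\times N$ submatrix (made of $N$ columns) of a Haar matrix on $\mathcal U(n)$. $Q_n(z)=(X_nX_n^*-zI_N)^{-1}$, $\alpha_n(z)=N^{-1}\operatorname{tr}Q_n(z)$. (A3) For all $\Im z>0$, $\alpha_n(z)\to m(z)$ a.s., with $m(z)=\int\frac{\pi(dt)}{t-z}$ the Stieltjes transform of a probability measure $\pi$ supported on a compact $[\lambda_-,\lambda_+]$ ($m$ extended off the support by the same integral); $\tilde m(z)=cm(z)-(1-c)/z$. (A4) $\|X_nX_n^*\|\to\lambda_+$ a.s. (A5) $P_n$ deterministic of rank $r$ (fixed) for $n$ large, SVD $P_n=U_n\Omega_nV_n^*$, $\Omega_n=\operatorname{diag}(\omega_{1,n}\ge\dots\ge\omega_{r,n})\to O=\operatorname{diag}(\omega_1I_{j_1},\dots,\omega_sI_{j_s})$, $\omega_1>\dots>\omega_s>0$, $\sum j_i=r$. (A6) $P_n=B_n(\varphi_1,\dots,\varphi_r)S_n^*$ where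 $B_n=[b_n(\varphi_1),\dots,b_n(\varphi_r)]$, $b_n(\varphi)=N^{-1/2}[\exp(-\imath D\ell\varphi)]_{\ell=0}^{N-1}$ for $\varphi\in[0,\pi/D]$, $D>0$ a constant, the $\varphi_k\in[0,\pi/D]$ pairwise distinct, and $S_n$ is a deterministic $n\times r$ matrix with $\sqrt n(S_n^*S_n-O^2)=\mathcal O(1)$. (A7) With $g(x)=xm(x)\tilde m(x)$ for $x>\lambda_+$ and $g(\lambda_+^+)=\lim_{x\downarrow\lambda_+}g(x)$: $\omega_s^2>1/g(\lambda_+^+)$. Let $\hat\lambda_{1,n}\ge\dots\ge\hat\lambda_{N,n}$ be the eigenvalues of $\Sigma_n\Sigma_n^*$, $\Sigma_n=X_n+P_n$, with orthonormal eigenvectors $\hat u_{k,n}$. Define for $\lambda>\lambda_+$ $\zeta(\lambda)=\frac{(\lambda m(\lambda)\tilde m(\lambda))'}{\lambda m(\lambda)^2\tilde m(\lambda)}$ and (when $\hat\lambda_{r,n}>\lambda_+$) $\hat\chi_n(\varphi)=\sum_{k=1}^r|b_n(\varphi)^*\hat u_{k,n}|^2\zeta(\hat\lambda_{k,n})$. *)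

theory Defs
  imports "HOL-Probability.Probability" "Jordan_Normal_Form.Schur_Decomposition"
begin

definition unitary_mat :: "nat \<Rightarrow> complex mat \<Rightarrow> bool" where
  "unitary_mat k U \<longleftrightarrow> U \<in> carrier_mat k k \<and> mat_adjoint U * U = 1\<^sub>m k"

definition mat_trace :: "complex mat \<Rightarrow> complex" where
  "mat_trace A = (\<Sum>i<dim_row A. A $$ (i, i))"

definition vnorm :: "complex vec \<Rightarrow> real" where
  "vnorm v = sqrt (\<Sum>i<dim_vec v. (cmod (v $ i))\<^sup>2)"

definition op_norm :: "complex mat \<Rightarrow> real" where
  "op_norm A = Sup {vnorm (A *\<^sub>v v) | v. v \<in> carrier_vec (dim_col A) \<and> vnorm v = 1}"

definition vinner :: "complex vec \<Rightarrow> complex vec \<Rightarrow> complex" where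
  "vinner v w = (\<Sum>i<dim_vec v. cnj (v $ i) * w $ i)"

definition mat_space :: "nat \<Rightarrow> nat \<Rightarrow> complex mat measure" where
  "mat_space m n = vimage_algebra (carrier_mat m n)
      (\<lambda>A. \<lambda>p\<in>{..<m} \<times> {..<n}. A $$ p) (PiM ({..<m} \<times> {..<n}) (\<lambda>_. borel))"

definition haar_unitary :: "nat \<Rightarrow> complex mat measure \<Rightarrow> bool" where
  "haar_unitary k H \<longleftrightarrow> sets H = sets (mat_space k k) \<and> prob_space H \<and>
     (AE A in H. unitary_mat k A) \<and>
     (\<forall>U. unitary_mat k U \<longrightarrow> distr H (mat_space k k) (\<lambda>A. U * A) = H)"

definition stieltjes :: "real measure \<Rightarrow> complex \<Rightarrow> complex" where
  "stieltjes \<pi> z = (LINT t|\<pi>. 1 / (complex_of_real t - z))"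

definition stieltjes_tilde :: "real \<Rightarrow> real measure \<Rightarrow> complex \<Rightarrow> complex" where
  "stieltjes_tilde c \<pi> z = complex_of_real c * stieltjes \<pi> z - complex_of_real (1 - c) / z"

text \<open>g(x) = x m(x) mtilde(x) for real x (real-valued for x right of the support).\<close>
definition gfun :: "real \<Rightarrow> real measure \<Rightarrow> real \<Rightarrow> real" where
  "gfun c \<pi> x = Re (complex_of_real x * stieltjes \<pi> (complex_of_real x)
                    * stieltjes_tilde c \<pi> (complex_of_real x))"

definition zeta :: "real \<Rightarrow> real measure \<Rightarrow> real \<Rightarrow> real" where
  "zeta c \<pi> x = deriv (gfun c \<pi>) x /
     (x * (Re (stieltjes \<pi> (complex_of_real x)))\<^sup>2 * Re (stieltjes_tilde c \<pi> (complex_of_real x)))"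

definition steer :: "real \<Rightarrow> nat \<Rightarrow> real \<Rightarrow> complex vec" where
  "steer D N \<phi> = vec N (\<lambda>l. exp (- \<i> * complex_of_real (D * real l * \<phi>)) / complex_of_real (sqrt (real N)))"

definition chi_hat :: "real \<Rightarrow> real measure \<Rightarrow> real \<Rightarrow> nat \<Rightarrow> nat \<Rightarrow> (nat \<Rightarrow> real) \<Rightarrow> (nat \<Rightarrow> complex vec) \<Rightarrow> real \<Rightarrow> real" where
  "chi_hat c \<pi> D N r lam u \<phi> = (\<Sum>k<r. (cmod (vinner (steer D N \<phi>) (u k)))\<^sup>2 * zeta c \<pi> (lam k))"

definition local_max_on :: "real set \<Rightarrow> (real \<Rightarrow> real) \<Rightarrow> real \<Rightarrow> bool" where
  "local_max_on S f x \<longleftrightarrow> x \<in> S \<and> (\<exists>e>0. \<forall>y\<in>S. \<bar>y - x\<bar> < e \<longrightarrow> f y \<le> f x)"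

end

theory Submission
  imports Defs
begin

text \<open>
  The estimator only has to be controlled at the countably many test points \<open>\<phi>\<^sub>k + s / n\<close> with \<open>s = 0\<close>
  or \<open>s = 1 / j\<close>, \<open>s = - 1 / j\<close>: almost surely \<open>\<chi>\<close> tends
  there to the squared modulus of \<open>(exp(\<i> \<tau>) - 1) / (\<i> \<tau>)\<close> at \<open>\<tau> = D c s\<close>, which is \<open>1\<close> at \<open>s = 0\<close> and less than \<open>1\<close> elsewhere, so a local maximum is trapped in each window
  of width \<open>1 / (j n)\<close>.

  Write \<open>P = B S\<^sup>*\<close>. In the left singular basis of the noise, with \<open>e = L\<^sup>* u\<close>, \<open>q = B\<^sup>* u\<close> and
  \<open>p = S\<^sup>* \<Sigma>\<^sup>* u\<close>, the eigenvalue equation reads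
  \<open>(\<lambda> - \<gamma>\<^sub>i\<^sup>2) e\<^sub>i = \<gamma>\<^sub>i (R\<^sup>* S q)\<^sub>i + (L\<^sup>* B p)\<^sub>i\<close>. Hence everything depends on sums of the form
  \<open>\<Sum>\<^sub>i h(\<gamma>\<^sub>i\<^sup>2) cnj a\<^sub>i b\<^sub>i\<close>, where \<open>a\<close> and \<open>b\<close> are images of deterministic vectors under \<open>L\<^sup>*\<close> or
  \<open>\<Gamma> R\<^sup>*\<close>. By rotational invariance a deterministic vector may be replaced by a random vector of
  signs, and the fourth moment of a Rademacher chaos then gives almost sure convergence of these
  sums. In the limit the \<open>q\<close> of the \<open>r\<close> leading eigenvectors, scaled by the square root of \<open>\<zeta>\<close>, form an orthonormal
  basis, and Parseval's identity yields the limit of \<open>\<chi>\<close>. That there are \<open>r\<close> eigenvalues beyond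
  \<open>\<lambda>\<^sub>+\<close> follows from the min-max principle with the approximate eigenvectors given by the same formula.
\<close>


section \<open>Fourth moments of Rademacher chaos\<close>

text \<open>Once the fixed vector is exchanged for signs, the estimate holds for each realisation
  with orthonormal columns, so no Haar integral is computed: invariance and independence are all
  that is taken from the law. Fourth moments of order \<open>n\<close>^-2 are summable, while second
  moments of order 1/n would not be. Null sets can be united only over countably many statements;
  hence powers x^k, the points \<i> y with natural y, and countably many s.

  The values \<open>Om k\<close> may coincide, so single eigenvectors need not converge, and no
  limit of a single eigenvalue is established. Instead all finitely many scalars attached to the
  eigenvectors are made to converge along a finer filter. If the k-th entry of q does not vanish in
  the limit, the secular equation determines \<open>Om k\<close> from the eigenvalue. Therefore each
  entry of the Gram matrix of the eigenvectors is a positive multiple of the corresponding entry for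
  the vectors q. This makes Parseval's identity applicable also across distinct limits of
  eigenvalues, and its outcome does not depend on the filter.\<close>

definition sign_of :: "nat set \<Rightarrow> nat \<Rightarrow> real" where
  "sign_of A i = (if i \<in> A then 1 else - 1)"

definition sign_mean :: "nat \<Rightarrow> (nat set \<Rightarrow> real) \<Rightarrow> real" where
  "sign_mean n F = (\<Sum>A\<in>Pow {..<n}. F A) / 2 ^ n"

lemma sign_of_insert:
  "sign_of (insert n A) i = (if i = n then 1 else sign_of A i)"
  by (auto simp: sign_of_def)

lemma abs_sign_of [simp]: "\<bar>sign_of A i\<bar> = 1" "(sign_of A i)\<^sup>2 = 1"
  by (auto simp: sign_of_def)

text \<open>Conditioning on all signs but the last: subsets of {..<Suc n} come in pairs A, insert n
  A. Both hypercontractive inductions rest on this step.\<close>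

lemma sign_mean_Suc:
  "sign_mean (Suc n) F = sign_mean n (\<lambda>A. (F A + F (insert n A)) / 2)"
proof -
  have "Pow {..<Suc n} = Pow {..<n} \<union> insert n ` Pow {..<n}"
    by (simp add: lessThan_Suc Pow_insert)
  moreover have "Pow {..<n} \<inter> insert n ` Pow {..<n} = {}"
    by auto
  moreover have "inj_on (insert n) (Pow {..<n})"
    by (rule inj_onI) (metis Diff_insert_absorb PowD insertCI insert_Diff_single lessThan_iff less_irrefl subsetD insert_ident)
  ultimately have "(\<Sum>A\<in>Pow {..<Suc n}. F A) = (\<Sum>A\<in>Pow {..<n}. F A) + (\<Sum>A\<in>Pow {..<n}. F (insert n A))"
    by (simp add: sum.union_disjoint sum.reindex)
  then show ?thesis
    by (simp add: sign_mean_def sum.distrib sum_divide_distrib [symmetric])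
qed

lemma sign_mean_mono:
  assumes "\<And>A. A \<subseteq> {..<n} \<Longrightarrow> F A \<le> G A" shows "sign_mean n F \<le> sign_mean n G"
  unfolding sign_mean_def by (intro divide_right_mono sum_mono) (use assms in auto)

lemma sign_mean_cong:
  assumes "\<And>A. A \<subseteq> {..<n} \<Longrightarrow> F A = G A" shows "sign_mean n F = sign_mean n G"
  unfolding sign_mean_def using assms by (auto intro!: sum.cong)

lemma sign_mean_add: "sign_mean n (\<lambda>A. F A + G A) = sign_mean n F + sign_mean n G"
  by (simp add: sign_mean_def sum.distrib add_divide_distrib)

lemma sign_mean_cmult: "sign_mean n (\<lambda>A. c * F A) = c * sign_mean n F"
  by (simp add: sign_mean_def sum_distrib_left)

lemma sign_mean_const [simp]: "sign_mean n (\<lambda>A. c) = c"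
  by (simp add: sign_mean_def card_Pow)

lemma sign_mean_nonneg: "(\<And>A. 0 \<le> F A) \<Longrightarrow> 0 \<le> sign_mean n F"
  by (simp add: sign_mean_def sum_nonneg)

lemma sign_mean_Cauchy_Schwarz:
  assumes "sign_mean n (\<lambda>A. f A ^ 4) \<le> P\<^sup>2" "sign_mean n (\<lambda>A. h A ^ 4) \<le> Q\<^sup>2" "0 \<le> P" "0 \<le> Q"
  shows "sign_mean n (\<lambda>A. (f A)\<^sup>2 * (h A)\<^sup>2) \<le> P * Q"
proof -
  have "(\<Sum>A\<in>Pow {..<n}. (f A)\<^sup>2 * (h A)\<^sup>2)\<^sup>2
      \<le> (\<Sum>A\<in>Pow {..<n}. ((f A)\<^sup>2)\<^sup>2) * (\<Sum>A\<in>Pow {..<n}. ((h A)\<^sup>2)\<^sup>2)"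
    by (rule Cauchy_Schwarz_ineq_sum)
  then have "(sign_mean n (\<lambda>A. (f A)\<^sup>2 * (h A)\<^sup>2))\<^sup>2 \<le> sign_mean n (\<lambda>A. f A ^ 4) * sign_mean n (\<lambda>A. h A ^ 4)"
    by (simp add: sign_mean_def power_divide power2_eq_square[of "2 ^ n"] divide_right_mono)
  also have "\<dots> \<le> P\<^sup>2 * Q\<^sup>2"
    by (intro mult_mono assms sign_mean_nonneg) auto
  also have "\<dots> = (P * Q)\<^sup>2" by (simp add: power_mult_distrib)
  finally show ?thesis
    by (rule power2_le_imp_le) (use assms in auto)
qed

text \<open>Averaging (f - h)^4 and (f + h)^4 cancels the odd mixed terms. The surviving term 6 f^2
  h^2 is controlled by Cauchy-Schwarz from the two fourth moments; stating the bounds as squares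
  keeps square roots out.\<close>

lemma fourth_mean_step:
  assumes f: "\<And>A. A \<subseteq> {..<n} \<Longrightarrow> F A = f A - h A"
    and f': "\<And>A. A \<subseteq> {..<n} \<Longrightarrow> F (insert n A) = f A + h A"
    and "sign_mean n (\<lambda>A. f A ^ 4) \<le> P\<^sup>2" "sign_mean n (\<lambda>A. h A ^ 4) \<le> Q\<^sup>2" "0 \<le> P" "0 \<le> Q"
  shows "sign_mean (Suc n) (\<lambda>A. F A ^ 4) \<le> P\<^sup>2 + 6 * (P * Q) + Q\<^sup>2"
proof -
  have "sign_mean (Suc n) (\<lambda>A. F A ^ 4)
      = sign_mean n (\<lambda>A. f A ^ 4 + 6 * ((f A)\<^sup>2 * (h A)\<^sup>2) + h A ^ 4)"
    unfolding sign_mean_Suc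
    by (rule sign_mean_cong) (simp add: f f' field_simps power4_eq_xxxx power2_eq_square)
  also have "\<dots> = sign_mean n (\<lambda>A. f A ^ 4) + 6 * sign_mean n (\<lambda>A. (f A)\<^sup>2 * (h A)\<^sup>2)
      + sign_mean n (\<lambda>A. h A ^ 4)"
    by (simp add: sign_mean_add sign_mean_cmult)
  finally show ?thesis
    using sign_mean_Cauchy_Schwarz[OF assms(3-6)] assms(3,4) by simp
qed

text \<open>The two fourth moment bounds are the degree one and two cases of Bonami's
  hypercontractive inequality, proved by induction on the number of signs.\<close>

lemma linear_sign_fourth_mean:
  "sign_mean n (\<lambda>A. (\<Sum>i<n. b i * sign_of A i) ^ 4) \<le> (3 * (\<Sum>i<n. (b i)\<^sup>2))\<^sup>2"
proof (induction n)
  case (Suc n)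
  have eq: "(\<Sum>i<Suc n. b i * sign_of (insert n A) i) = (\<Sum>i<n. b i * sign_of A i) + b n"
      "(\<Sum>i<Suc n. b i * sign_of A i) = (\<Sum>i<n. b i * sign_of A i) - b n" if "A \<subseteq> {..<n}" for A
    using that by (auto simp: sign_of_insert sign_of_def intro!: sum.cong)
  have "sign_mean (Suc n) (\<lambda>A. (\<Sum>i<Suc n. b i * sign_of A i) ^ 4)
      \<le> (3 * (\<Sum>i<n. (b i)\<^sup>2))\<^sup>2 + 6 * ((3 * (\<Sum>i<n. (b i)\<^sup>2)) * (b n)\<^sup>2) + ((b n)\<^sup>2)\<^sup>2"
    by (rule fourth_mean_step[where h = "\<lambda>_. b n", OF eq(2,1) Suc.IH])
      (auto intro: sum_nonneg)
  \<comment> \<open>The constant C has to satisfy 6 C \<le> 2 C^2 for the mixed term to be absorbed,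
    which is where 3 comes from.\<close>
  also have "\<dots> \<le> (3 * ((\<Sum>i<n. (b i)\<^sup>2) + (b n)\<^sup>2))\<^sup>2"
    using zero_le_square[of "(b n)\<^sup>2"] by (simp add: power2_eq_square field_simps)
  finally show ?case by simp
qed (simp add: sign_mean_def)

lemma quadratic_sign_fourth_mean:
  "sign_mean n (\<lambda>A. (\<Sum>j<n. (\<Sum>i<j. a i j * sign_of A i) * sign_of A j) ^ 4)
    \<le> (9 * (\<Sum>j<n. \<Sum>i<j. (a i j)\<^sup>2))\<^sup>2"
proof (induction n)
  case (Suc n)
  let ?f = "\<lambda>A. \<Sum>j<n. (\<Sum>i<j. a i j * sign_of A i) * sign_of A j"
  let ?h = "\<lambda>A. \<Sum>i<n. a i n * sign_of A i"
  have eq: "(\<Sum>j<Suc n. (\<Sum>i<j. a i j * sign_of (insert n A) i) * sign_of (insert n A) j) = ?f A + ?h A"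
      "(\<Sum>j<Suc n. (\<Sum>i<j. a i j * sign_of A i) * sign_of A j) = ?f A - ?h A" if "A \<subseteq> {..<n}" for A
    using that by (auto simp: sign_of_insert sign_of_def intro!: sum.cong)
  let ?s = "\<Sum>j<n. \<Sum>i<j. (a i j)\<^sup>2" and ?u = "\<Sum>i<n. (a i n)\<^sup>2"
  have nn: "0 \<le> ?s" "0 \<le> ?u" by (auto intro!: sum_nonneg)
  have "sign_mean (Suc n) (\<lambda>A. (\<Sum>j<Suc n. (\<Sum>i<j. a i j * sign_of A i) * sign_of A j) ^ 4)
      \<le> (9 * ?s)\<^sup>2 + 6 * ((9 * ?s) * (3 * ?u)) + (3 * ?u)\<^sup>2"
    by (rule fourth_mean_step[OF eq(2,1) Suc.IH linear_sign_fourth_mean]) (use nn in auto)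
  \<comment> \<open>The new sign multiplies a linear form, bounded with constant 3, so absorbing the
    mixed term needs 6 * C * 3 \<le> 2 C^2, that is C = 9.\<close>
  also have "\<dots> \<le> (9 * (?s + ?u))\<^sup>2"
    using nn by (simp add: power2_eq_square field_simps)
  finally show ?case by simp
qed (simp add: sign_mean_def)

lemma sum_symmetric_square:
  fixes f :: "nat \<Rightarrow> nat \<Rightarrow> real"
  assumes "\<And>j k. f j k = f k j"
  shows "(\<Sum>j<m. \<Sum>k<m. f j k) = (\<Sum>j<m. f j j) + 2 * (\<Sum>j<m. \<Sum>k<j. f k j)"
proof (induction m)
  case (Suc m)
  have "(\<Sum>j<m. f j m) = (\<Sum>j<m. f m j)" using assms by simp
  then show ?case using Suc by (simp add: sum.distrib assms)
qed simp

section \<open>Quadratic and linear forms in random signs\<close>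

text \<open>The condition A^* A = 1 for a possibly rectangular array with \<open>m\<close> rows and
  \<open>N\<close> columns, so that one notion serves the square factor \<open>L\<close> and the
  tall factor \<open>R\<close>.\<close>

definition orthonormal_cols :: "nat \<Rightarrow> nat \<Rightarrow> (nat \<Rightarrow> nat \<Rightarrow> complex) \<Rightarrow> bool" where
  "orthonormal_cols m N A \<longleftrightarrow> (\<forall>i<N. \<forall>k<N. (\<Sum>j<m. cnj (A j i) * A j k) = (if i = k then 1 else 0))"

lemma orthonormal_cols_unit:
  assumes "orthonormal_cols m N A" "i < N"
  shows "(\<Sum>j<m. (cmod (A j i))\<^sup>2) = 1"
proof -
  have "complex_of_real (\<Sum>j<m. (cmod (A j i))\<^sup>2) = (\<Sum>j<m. cnj (A j i) * A j i)"
    by (simp add: complex_norm_square mult.commute del: of_real_power)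
  also have "\<dots> = 1" using assms by (auto simp: orthonormal_cols_def)
  finally show ?thesis by (metis of_real_eq_1_iff)
qed

lemma orthonormal_cols_sum_square:
  assumes "orthonormal_cols m N A"
  shows "(\<Sum>j<m. (cmod (\<Sum>i<N. d i * cnj (A j i)))\<^sup>2) = (\<Sum>i<N. (cmod (d i))\<^sup>2)"
proof -
  have "complex_of_real (\<Sum>j<m. (cmod (\<Sum>i<N. d i * cnj (A j i)))\<^sup>2)
      = (\<Sum>j<m. \<Sum>i<N. \<Sum>l<N. (d i * cnj (A j i)) * (cnj (d l) * A j l))"
    by (simp add: complex_norm_square sum_product del: of_real_power)
  also have "\<dots> = (\<Sum>i<N. \<Sum>l<N. \<Sum>j<m. (d i * cnj (A j i)) * (cnj (d l) * A j l))"
    by (subst sum.swap, rule sum.cong[OF refl], subst sum.swap) simp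
  also have "\<dots> = (\<Sum>i<N. \<Sum>l<N. d i * cnj (d l) * (\<Sum>j<m. cnj (A j i) * A j l))"
    by (simp add: sum_distrib_left mult_ac)
  also have "\<dots> = (\<Sum>i<N. \<Sum>l<N. if i = l then d i * cnj (d l) else 0)"
    using assms by (intro sum.cong refl) (auto simp: orthonormal_cols_def)
  also have "\<dots> = complex_of_real (\<Sum>i<N. (cmod (d i))\<^sup>2)"
    by (simp add: complex_norm_square del: of_real_power)
  finally show ?thesis by (simp only: of_real_eq_iff)
qed

text \<open>The kernel is A diag(d) A^*. For a fixed row the isometry of the conjugated columns
  reduces the sum over \<open>k\<close> to a weighted sum of |A j i|^2, and summing over
  \<open>j\<close> uses that columns are unit vectors.\<close>

lemma orthonormal_cols_frobenius:
  assumes A: "orthonormal_cols m N A"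
  shows "(\<Sum>j<m. \<Sum>k<m. (cmod (\<Sum>i<N. complex_of_real (d i) * A j i * cnj (A k i)))\<^sup>2) = (\<Sum>i<N. (d i)\<^sup>2)"
proof -
  have "(\<Sum>k<m. (cmod (\<Sum>i<N. complex_of_real (d i) * A j i * cnj (A k i)))\<^sup>2)
      = (\<Sum>i<N. (d i)\<^sup>2 * (cmod (A j i))\<^sup>2)" for j
    using orthonormal_cols_sum_square[OF A, of "\<lambda>i. complex_of_real (d i) * A j i"]
    by (simp add: norm_mult power_mult_distrib)
  then have "(\<Sum>j<m. \<Sum>k<m. (cmod (\<Sum>i<N. complex_of_real (d i) * A j i * cnj (A k i)))\<^sup>2)
      = (\<Sum>i<N. (d i)\<^sup>2 * (\<Sum>j<m. (cmod (A j i))\<^sup>2))"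
    by (simp, subst sum.swap) (simp add: sum_distrib_left)
  also have "\<dots> = (\<Sum>i<N. (d i)\<^sup>2)"
    by (intro sum.cong refl) (simp add: orthonormal_cols_unit[OF A])
  finally show ?thesis .
qed

text \<open>The signs are real, so only the real part \<open>T\<close> of A diag(d) A^* matters, and
  it is symmetric. Squared signs equal 1, so its diagonal contributes exactly the trace, which is
  the subtracted mean. What remains is a chaos of degree two with coefficients 2 T; the factor 4
  from squaring them turns 9 into 36.\<close>

lemma quadratic_form_sign_fourth_mean:
  assumes A: "orthonormal_cols m N A"
  shows "sign_mean m (\<lambda>S. ((\<Sum>i<N. d i * (cmod (\<Sum>j<m. cnj (A j i) * complex_of_real (sign_of S j)))\<^sup>2)
      - (\<Sum>i<N. d i)) ^ 4) \<le> (36 * (\<Sum>i<N. (d i)\<^sup>2))\<^sup>2"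
proof -
  define T where "T = (\<lambda>j k. Re (\<Sum>i<N. complex_of_real (d i) * A j i * cnj (A k i)))"
  have T: "T j k = (\<Sum>i<N. d i * (Re (A j i) * Re (A k i) + Im (A j i) * Im (A k i)))" for j k
    by (simp add: T_def algebra_simps)
  have sym: "T j k = T k j" for j k by (simp add: T mult.commute)
  have diag: "(\<Sum>j<m. T j j) = (\<Sum>i<N. d i)"
  proof -
    have "(\<Sum>j<m. T j j) = (\<Sum>j<m. \<Sum>i<N. d i * (cmod (A j i))\<^sup>2)"
      by (simp only: T cmod_power2) (simp add: power2_eq_square)
    also have "\<dots> = (\<Sum>i<N. d i * (\<Sum>j<m. (cmod (A j i))\<^sup>2))"
      by (subst sum.swap) (simp add: sum_distrib_left)
    also have "\<dots> = (\<Sum>i<N. d i)"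
      by (intro sum.cong refl) (simp add: orthonormal_cols_unit[OF A])
    finally show ?thesis .
  qed
  have expand: "(\<Sum>i<N. d i * (cmod (\<Sum>j<m. cnj (A j i) * complex_of_real (sign_of S j)))\<^sup>2) - (\<Sum>i<N. d i)
      = (\<Sum>j<m. (\<Sum>k<j. 2 * T k j * sign_of S k) * sign_of S j)" for S
  proof -
    have "(cmod (\<Sum>j<m. cnj (A j i) * complex_of_real (sign_of S j)))\<^sup>2
        = (\<Sum>j<m. \<Sum>k<m. (Re (A j i) * Re (A k i) + Im (A j i) * Im (A k i)) * (sign_of S j * sign_of S k))" for i
    proof -
      have "(cmod (\<Sum>j<m. cnj (A j i) * complex_of_real (sign_of S j)))\<^sup>2
          = (\<Sum>j<m. Re (A j i) * sign_of S j)\<^sup>2 + (\<Sum>j<m. Im (A j i) * sign_of S j)\<^sup>2"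
        by (simp add: cmod_power2 sum_negf)
      also have "\<dots> = (\<Sum>j<m. \<Sum>k<m. (Re (A j i) * Re (A k i) + Im (A j i) * Im (A k i)) * (sign_of S j * sign_of S k))"
        by (simp add: power2_eq_square sum_product sum.distrib distrib_left distrib_right mult_ac)
      finally show ?thesis .
    qed
    then have "(\<Sum>i<N. d i * (cmod (\<Sum>j<m. cnj (A j i) * complex_of_real (sign_of S j)))\<^sup>2)
        = (\<Sum>i<N. \<Sum>j<m. \<Sum>k<m. d i * (Re (A j i) * Re (A k i) + Im (A j i) * Im (A k i)) * (sign_of S j * sign_of S k))"
      by (simp add: sum_distrib_left mult.assoc)
    also have "\<dots> = (\<Sum>j<m. \<Sum>k<m. T j k * (sign_of S j * sign_of S k))"
      unfolding T sum_distrib_right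
      by (subst sum.swap, rule sum.cong[OF refl], subst sum.swap) simp
    also have "\<dots> = (\<Sum>j<m. T j j * (sign_of S j * sign_of S j)) + 2 * (\<Sum>j<m. \<Sum>k<j. T k j * (sign_of S k * sign_of S j))"
      by (rule sum_symmetric_square) (simp add: sym mult.commute)
    also have "(\<Sum>j<m. T j j * (sign_of S j * sign_of S j)) = (\<Sum>i<N. d i)"
      using diag by (simp flip: power2_eq_square)
    finally show ?thesis
      by (simp add: sum_distrib_left sum_distrib_right mult_ac)
  qed
  have "sign_mean m (\<lambda>S. ((\<Sum>i<N. d i * (cmod (\<Sum>j<m. cnj (A j i) * complex_of_real (sign_of S j)))\<^sup>2)
      - (\<Sum>i<N. d i)) ^ 4) \<le> (9 * (\<Sum>j<m. \<Sum>k<j. (2 * T k j)\<^sup>2))\<^sup>2"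
    unfolding expand by (rule quadratic_sign_fourth_mean)
  also have "\<dots> \<le> (36 * (\<Sum>i<N. (d i)\<^sup>2))\<^sup>2"
  proof (rule power_mono)
    have "(\<Sum>j<m. \<Sum>k<j. (T k j)\<^sup>2) \<le> (\<Sum>j<m. \<Sum>k<m. (T k j)\<^sup>2)"
      by (intro sum_mono sum_mono2) auto
    also have "\<dots> \<le> (\<Sum>j<m. \<Sum>k<m. (cmod (\<Sum>i<N. complex_of_real (d i) * A k i * cnj (A j i)))\<^sup>2)"
      unfolding T_def by (intro sum_mono) (simp add: cmod_power2 del: Re_sum Im_sum)
    also have "\<dots> = (\<Sum>i<N. (d i)\<^sup>2)"
      by (subst sum.swap) (rule orthonormal_cols_frobenius[OF A])
    finally show "9 * (\<Sum>j<m. \<Sum>k<j. (2 * T k j)\<^sup>2) \<le> 36 * (\<Sum>i<N. (d i)\<^sup>2)"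
      by (simp add: power_mult_distrib flip: sum_distrib_left)
  qed (auto intro!: sum_nonneg)
  finally show ?thesis .
qed

text \<open>Real and imaginary parts are treated separately with |z|^4 \<le> 2 (Re z)^4 + 2 (Im
  z)^4, which gives 2 * 3^2 = 18.\<close>

lemma complex_linear_sign_fourth_mean:
  "sign_mean m (\<lambda>S. cmod (\<Sum>j<m. b j * complex_of_real (sign_of S j)) ^ 4) \<le> 18 * (\<Sum>j<m. (cmod (b j))\<^sup>2)\<^sup>2"
proof -
  let ?R = "\<lambda>S. \<Sum>j<m. Re (b j) * sign_of S j" and ?I = "\<lambda>S. \<Sum>j<m. Im (b j) * sign_of S j"
  have "cmod (\<Sum>j<m. b j * complex_of_real (sign_of S j)) ^ 4 \<le> 2 * ?R S ^ 4 + 2 * ?I S ^ 4" for S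
  proof -
    have "cmod (\<Sum>j<m. b j * complex_of_real (sign_of S j)) ^ 4 = ((cmod (\<Sum>j<m. b j * complex_of_real (sign_of S j)))\<^sup>2)\<^sup>2"
      by (simp flip: power_mult)
    also have "\<dots> = ((?R S)\<^sup>2 + (?I S)\<^sup>2)\<^sup>2" by (simp add: cmod_power2)
    also have "\<dots> \<le> 2 * ((?R S)\<^sup>2)\<^sup>2 + 2 * ((?I S)\<^sup>2)\<^sup>2"
      by (smt (verit) power2_diff power2_sum zero_le_power2)
    finally show ?thesis by (simp flip: power_mult)
  qed
  then have "sign_mean m (\<lambda>S. cmod (\<Sum>j<m. b j * complex_of_real (sign_of S j)) ^ 4)
      \<le> 2 * sign_mean m (\<lambda>S. ?R S ^ 4) + 2 * sign_mean m (\<lambda>S. ?I S ^ 4)"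
    unfolding sign_mean_cmult[symmetric] sign_mean_add[symmetric] by (rule sign_mean_mono)
  also have "\<dots> \<le> 2 * (3 * (\<Sum>j<m. (Re (b j))\<^sup>2))\<^sup>2 + 2 * (3 * (\<Sum>j<m. (Im (b j))\<^sup>2))\<^sup>2"
    by (intro add_mono mult_left_mono linear_sign_fourth_mean) auto
  also have "\<dots> \<le> 18 * (\<Sum>j<m. (cmod (b j))\<^sup>2)\<^sup>2"
  proof -
    have "0 \<le> (\<Sum>j<m. (Re (b j))\<^sup>2)" "0 \<le> (\<Sum>j<m. (Im (b j))\<^sup>2)" by (auto intro: sum_nonneg)
    then show ?thesis
      by (simp add: cmod_power2 sum.distrib power2_sum power_mult_distrib)
  qed
  finally show ?thesis .
qed

section \<open>Moments of invariant forms\<close>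

text \<open>If the integral does not depend on the sign pattern, the average over patterns may be
  taken inside the integral. There it can be estimated pointwise, by the sign bounds above.\<close>

lemma nn_integral_sign_mean:
  assumes "\<And>S. S \<subseteq> {..<m} \<Longrightarrow> (\<lambda>w. F S w) \<in> borel_measurable M" "\<And>S w. 0 \<le> F S w"
    and "\<And>S. S \<subseteq> {..<m} \<Longrightarrow> (\<integral>\<^sup>+w. ennreal (F S w) \<partial>M) = I"
  shows "I = (\<integral>\<^sup>+w. ennreal (sign_mean m (\<lambda>S. F S w)) \<partial>M)"
proof -
  have "(\<integral>\<^sup>+w. ennreal (sign_mean m (\<lambda>S. F S w)) \<partial>M) = (\<integral>\<^sup>+w. (\<Sum>S\<in>Pow {..<m}. ennreal (F S w)) * ennreal (1 / 2 ^ m) \<partial>M)"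
  proof (intro nn_integral_cong)
    fix w
    have "ennreal (sign_mean m (\<lambda>S. F S w)) = ennreal ((\<Sum>S\<in>Pow {..<m}. F S w) * (1 / 2 ^ m))"
      by (simp add: sign_mean_def)
    also have "\<dots> = (\<Sum>S\<in>Pow {..<m}. ennreal (F S w)) * ennreal (1 / 2 ^ m)"
      using assms(2) by (subst ennreal_mult) (auto intro!: sum_nonneg simp: sum_ennreal)
    finally show "ennreal (sign_mean m (\<lambda>S. F S w)) = (\<Sum>S\<in>Pow {..<m}. ennreal (F S w)) * ennreal (1 / 2 ^ m)" .
  qed
  also have "\<dots> = (\<Sum>S\<in>Pow {..<m}. \<integral>\<^sup>+w. ennreal (F S w) \<partial>M) * ennreal (1 / 2 ^ m)"
  proof -
    have m: "(\<lambda>w. ennreal (F S w)) \<in> borel_measurable M" if "S \<in> Pow {..<m}" for S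
      using assms(1)[of S] that by simp
    have "(\<lambda>w. \<Sum>S\<in>Pow {..<m}. ennreal (F S w)) \<in> borel_measurable M"
      by (rule borel_measurable_sum) (rule m)
    then show ?thesis
      using nn_integral_sum[where f = "\<lambda>S w. ennreal (F S w)" and P = "Pow {..<m}" and M = M, OF m]
      by (simp only: nn_integral_multc)
  qed
  also have "\<dots> = of_nat (2 ^ m) * I * ennreal (1 / 2 ^ m)"
    using assms(3) by (simp add: card_Pow)
  also have "\<dots> = (ennreal (2 ^ m) * ennreal (1 / 2 ^ m)) * I"
    by (simp only: mult_ac) (metis ennreal_of_nat_eq_real_of_nat of_nat_numeral of_nat_power)
  also have "\<dots> = I"
    by (subst ennreal_mult[symmetric]) auto
  finally show ?thesis by simp
qed

text \<open>Rotational invariance lets the deterministic vector be replaced by a random sign vector.\<close>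

lemma (in prob_space) invariant_quadratic_form_moment:
  assumes meas: "\<And>a. \<Phi> a \<in> borel_measurable M"
    and \<Phi>: "\<And>a w. \<Phi> a w = ((\<Sum>i<N. d w i * (cmod (\<Sum>j<m. cnj (A w j i) * a j))\<^sup>2) - s / m * (\<Sum>i<N. d w i)) ^ 4"
    and inv: "\<And>a b :: nat \<Rightarrow> complex. (\<Sum>j<m. (cmod (a j))\<^sup>2) = s \<Longrightarrow> (\<Sum>j<m. (cmod (b j))\<^sup>2) = s \<Longrightarrow>
        (\<integral>\<^sup>+w. ennreal (\<Phi> a w) \<partial>M) = (\<integral>\<^sup>+w. ennreal (\<Phi> b w) \<partial>M)"
    and orth: "AE w in M. orthonormal_cols m N (A w)"
    and d: "\<And>w i. \<bar>d w i\<bar> \<le> K" and N: "N \<le> m" "0 < m"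
    and a: "(\<Sum>j<m. (cmod (a j))\<^sup>2) = s"
  shows "(\<integral>\<^sup>+w. ennreal (\<Phi> a w) \<partial>M) \<le> ennreal (1296 * K ^ 4 * s ^ 4 / (real m)\<^sup>2)"
proof -
  have s: "0 \<le> s" using a by (auto intro: sum_nonneg)
  \<comment> \<open>The scaling gives every sign pattern the squared norm \<open>s\<close> of the
    vector it replaces, as the invariance hypothesis demands.\<close>
  define \<epsilon> where "\<epsilon> = (\<lambda>S j. complex_of_real (sqrt (s / m)) * complex_of_real (sign_of S j))"
  have \<epsilon>: "(\<Sum>j<m. (cmod (\<epsilon> S j))\<^sup>2) = s" for S
    using s N by (simp add: \<epsilon>_def norm_mult power_mult_distrib)
  have "(\<integral>\<^sup>+w. ennreal (\<Phi> a w) \<partial>M) = (\<integral>\<^sup>+w. ennreal (sign_mean m (\<lambda>S. \<Phi> (\<epsilon> S) w)) \<partial>M)"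
  proof (rule nn_integral_sign_mean)
    show "0 \<le> \<Phi> (\<epsilon> S) w" for S w by (simp add: \<Phi>)
  qed (auto intro: meas inv[OF \<epsilon> a])
  also have "\<dots> \<le> (\<integral>\<^sup>+w. ennreal (1296 * K ^ 4 * s ^ 4 / (real m)\<^sup>2) \<partial>M)"
  proof (rule nn_integral_mono_AE)
    show "AE w in M. ennreal (sign_mean m (\<lambda>S. \<Phi> (\<epsilon> S) w)) \<le> ennreal (1296 * K ^ 4 * s ^ 4 / (real m)\<^sup>2)"
      using orth
    proof eventually_elim
      case (elim w)
      have "\<Phi> (\<epsilon> S) w = (s / m) ^ 4 * ((\<Sum>i<N. d w i * (cmod (\<Sum>j<m. cnj (A w j i) * complex_of_real (sign_of S j)))\<^sup>2)
          - (\<Sum>i<N. d w i)) ^ 4" for S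
      proof -
        have "(\<Sum>j<m. cnj (A w j i) * \<epsilon> S j) = complex_of_real (sqrt (s / m)) * (\<Sum>j<m. cnj (A w j i) * complex_of_real (sign_of S j))" for i
          by (simp add: \<epsilon>_def sum_distrib_left mult_ac)
        then have "(cmod (\<Sum>j<m. cnj (A w j i) * \<epsilon> S j))\<^sup>2 = s / m * (cmod (\<Sum>j<m. cnj (A w j i) * complex_of_real (sign_of S j)))\<^sup>2" for i
          using s by (simp add: norm_mult power_mult_distrib)
        then have "\<Phi> (\<epsilon> S) w = (s / m * ((\<Sum>i<N. d w i * (cmod (\<Sum>j<m. cnj (A w j i) * complex_of_real (sign_of S j)))\<^sup>2)
          - (\<Sum>i<N. d w i))) ^ 4"
          unfolding \<Phi> right_diff_distrib by (simp add: sum_distrib_left mult_ac)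
        then show ?thesis by (simp only: power_mult_distrib)
      qed
      then have "sign_mean m (\<lambda>S. \<Phi> (\<epsilon> S) w) \<le> (s / m) ^ 4 * (36 * (\<Sum>i<N. (d w i)\<^sup>2))\<^sup>2"
        using mult_left_mono[OF quadratic_form_sign_fourth_mean[OF elim, of "d w"], of "(s / m) ^ 4"]
        by (simp add: sign_mean_cmult)
      \<comment> \<open>At most \<open>m\<close> weights of size \<open>K\<close> occur. The fourth
        power of s / m against the square of m K^2 leaves the summable rate m^-2, and 36^2 =
        1296.\<close>
      also have "\<dots> \<le> (s / m) ^ 4 * (36 * (m * K\<^sup>2))\<^sup>2"
      proof (intro mult_left_mono power_mono)
        have "(\<Sum>i<N. (d w i)\<^sup>2) \<le> (\<Sum>i<N. K\<^sup>2)"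
          by (intro sum_mono) (metis d abs_le_square_iff abs_of_nonneg abs_ge_zero order_trans)
        also have "\<dots> \<le> m * K\<^sup>2" using N by (simp add: mult_right_mono)
        finally show "(\<Sum>i<N. (d w i)\<^sup>2) \<le> m * K\<^sup>2" .
      qed (auto intro: sum_nonneg)
      also have "\<dots> = 1296 * K ^ 4 * s ^ 4 / (real m)\<^sup>2"
        using N by (simp add: power_mult_distrib power_divide field_simps)
      finally show ?case by (rule ennreal_leI)
    qed
  qed
  also have "\<dots> = ennreal (1296 * K ^ 4 * s ^ 4 / (real m)\<^sup>2)"
    by (simp add: emeasure_space_1)
  finally show ?thesis .
qed

text \<open>The same exchange for a form that is linear in \<open>a\<close>. The weights
  \<open>d\<close> may be random and need only a bound on their square sum: the sign average
  produces the squared norm of A applied to \<open>d\<close>, up to conjugation, which the isometry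
  identifies.\<close>

lemma (in prob_space) invariant_linear_form_moment:
  assumes meas: "\<And>a. \<Phi> a \<in> borel_measurable M"
    and \<Phi>: "\<And>a w. \<Phi> a w = cmod (\<Sum>i<N. d w i * (\<Sum>j<m. cnj (A w j i) * a j)) ^ 4"
    and inv: "\<And>a b :: nat \<Rightarrow> complex. (\<Sum>j<m. (cmod (a j))\<^sup>2) = s \<Longrightarrow> (\<Sum>j<m. (cmod (b j))\<^sup>2) = s \<Longrightarrow>
        (\<integral>\<^sup>+w. ennreal (\<Phi> a w) \<partial>M) = (\<integral>\<^sup>+w. ennreal (\<Phi> b w) \<partial>M)"
    and orth: "AE w in M. orthonormal_cols m N (A w)"
    and d: "AE w in M. (\<Sum>i<N. (cmod (d w i))\<^sup>2) \<le> K" and N: "0 < m"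
    and a: "(\<Sum>j<m. (cmod (a j))\<^sup>2) = s"
  shows "(\<integral>\<^sup>+w. ennreal (\<Phi> a w) \<partial>M) \<le> ennreal (18 * K\<^sup>2 * s\<^sup>2 / (real m)\<^sup>2)"
proof -
  have s: "0 \<le> s" using a by (auto intro: sum_nonneg)
  define \<epsilon> where "\<epsilon> = (\<lambda>S j. complex_of_real (sqrt (s / m)) * complex_of_real (sign_of S j))"
  have \<epsilon>: "(\<Sum>j<m. (cmod (\<epsilon> S j))\<^sup>2) = s" for S
    using s N by (simp add: \<epsilon>_def norm_mult power_mult_distrib)
  have "(\<integral>\<^sup>+w. ennreal (\<Phi> a w) \<partial>M) = (\<integral>\<^sup>+w. ennreal (sign_mean m (\<lambda>S. \<Phi> (\<epsilon> S) w)) \<partial>M)"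
  proof (rule nn_integral_sign_mean)
    show "0 \<le> \<Phi> (\<epsilon> S) w" for S w by (simp add: \<Phi>)
  qed (auto intro: meas inv[OF \<epsilon> a])
  also have "\<dots> \<le> (\<integral>\<^sup>+w. ennreal (18 * K\<^sup>2 * s\<^sup>2 / (real m)\<^sup>2) \<partial>M)"
  proof (rule nn_integral_mono_AE)
    show "AE w in M. ennreal (sign_mean m (\<lambda>S. \<Phi> (\<epsilon> S) w)) \<le> ennreal (18 * K\<^sup>2 * s\<^sup>2 / (real m)\<^sup>2)"
      using orth d
    proof eventually_elim
      case (elim w)
      let ?b = "\<lambda>j. \<Sum>i<N. d w i * cnj (A w j i)"
      have "\<Phi> (\<epsilon> S) w = (s / m)\<^sup>2 * cmod (\<Sum>j<m. ?b j * complex_of_real (sign_of S j)) ^ 4" for S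
      proof -
        have "(\<Sum>i<N. d w i * (\<Sum>j<m. cnj (A w j i) * \<epsilon> S j))
            = complex_of_real (sqrt (s / m)) * (\<Sum>j<m. ?b j * complex_of_real (sign_of S j))"
          unfolding \<epsilon>_def sum_distrib_left sum_distrib_right by (subst sum.swap) (simp add: mult_ac)
        then have "\<Phi> (\<epsilon> S) w = sqrt (s / m) ^ 4 * cmod (\<Sum>j<m. ?b j * complex_of_real (sign_of S j)) ^ 4"
          unfolding \<Phi> using s by (simp add: norm_mult power_mult_distrib)
        moreover have "sqrt (s / m) ^ 4 = (sqrt (s / m) ^ 2) ^ 2" by (simp flip: power_mult)
        ultimately show ?thesis using s by simp
      qed
      then have "sign_mean m (\<lambda>S. \<Phi> (\<epsilon> S) w) \<le> (s / m)\<^sup>2 * (18 * (\<Sum>j<m. (cmod (?b j))\<^sup>2)\<^sup>2)"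
        using mult_left_mono[OF complex_linear_sign_fourth_mean[of m ?b], of "(s / m)\<^sup>2"]
        by (simp add: sign_mean_cmult)
      also have "\<dots> = (s / m)\<^sup>2 * (18 * (\<Sum>i<N. (cmod (d w i))\<^sup>2)\<^sup>2)"
        by (simp only: orthonormal_cols_sum_square[OF elim(1)])
      also have "\<dots> \<le> (s / m)\<^sup>2 * (18 * K\<^sup>2)"
        using elim(2) by (intro mult_left_mono power_mono) (auto intro: sum_nonneg)
      also have "\<dots> = 18 * K\<^sup>2 * s\<^sup>2 / (real m)\<^sup>2"
        by (simp add: power_divide)
      finally show ?case by (rule ennreal_leI)
    qed
  qed
  also have "\<dots> = ennreal (18 * K\<^sup>2 * s\<^sup>2 / (real m)\<^sup>2)"
    by (simp add: emeasure_space_1)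
  finally show ?thesis .
qed

section \<open>From fourth moments to almost sure convergence\<close>

text \<open>Summable fourth moments make the random series of fourth powers integrable, hence almost
  surely finite, so its terms vanish in the limit. This replaces a Borel-Cantelli argument.\<close>

lemma AE_tendsto_zero_fourth_moment:
  fixes Z :: "nat \<Rightarrow> 'a \<Rightarrow> real"
  assumes meas: "\<And>n. Z n \<in> borel_measurable M"
    and bd: "\<forall>\<^sub>F n in sequentially. (\<integral>\<^sup>+w. ennreal (\<bar>Z n w\<bar> ^ 4) \<partial>M) \<le> ennreal (C / (real n)\<^sup>2)"
    and C: "0 \<le> C"
  shows "AE w in M. (\<lambda>n. Z n w) \<longlonglongrightarrow> 0"
proof -
  obtain n0 where n0: "\<And>n. n \<ge> n0 \<Longrightarrow> (\<integral>\<^sup>+w. ennreal (\<bar>Z n w\<bar> ^ 4) \<partial>M) \<le> ennreal (C / (real n)\<^sup>2)"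
    using bd by (auto simp: eventually_sequentially)
  have sm: "summable (\<lambda>n. C / (real (n + n0))\<^sup>2)"
  proof -
    have "summable (\<lambda>n. C * inverse (real n ^ 2))"
      by (intro summable_mult inverse_power_summable) simp
    then show ?thesis by (subst summable_iff_shift) (simp add: divide_inverse)
  qed
  have "(\<integral>\<^sup>+w. (\<Sum>n. ennreal (\<bar>Z (n + n0) w\<bar> ^ 4)) \<partial>M) = (\<Sum>n. \<integral>\<^sup>+w. ennreal (\<bar>Z (n + n0) w\<bar> ^ 4) \<partial>M)"
    using meas by (intro nn_integral_suminf) measurable
  also have "\<dots> \<le> (\<Sum>n. ennreal (C / (real (n + n0))\<^sup>2))"
    by (intro suminf_le n0) auto
  also have "\<dots> = ennreal (\<Sum>n. C / (real (n + n0))\<^sup>2)"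
    by (rule suminf_ennreal2[OF _ sm]) (use C in auto)
  finally have "(\<integral>\<^sup>+w. (\<Sum>n. ennreal (\<bar>Z (n + n0) w\<bar> ^ 4)) \<partial>M) \<noteq> \<infinity>"
    by (metis ennreal_neq_top infinity_ennreal_def neq_top_trans)
  then have "AE w in M. (\<Sum>n. ennreal (\<bar>Z (n + n0) w\<bar> ^ 4)) \<noteq> \<infinity>"
    using meas by (intro nn_integral_PInf_AE) measurable
  then show ?thesis
  proof eventually_elim
    case (elim w)
    have "summable (\<lambda>n. \<bar>Z (n + n0) w\<bar> ^ 4)"
      by (rule summable_suminf_not_top) (use elim in auto)
    then have "(\<lambda>n. \<bar>Z (n + n0) w\<bar> ^ 4) \<longlonglongrightarrow> 0" by (rule summable_LIMSEQ_zero)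
    then have "(\<lambda>n. root 4 (\<bar>Z (n + n0) w\<bar> ^ 4)) \<longlonglongrightarrow> root 4 0"
      by (rule tendsto_real_root)
    then have "(\<lambda>n. Z (n + n0) w) \<longlonglongrightarrow> 0"
      by (subst (asm) real_root_power_cancel) (auto simp: tendsto_rabs_zero_iff)
    then show ?case by (rule LIMSEQ_offset)
  qed
qed

text \<open>With \<open>p\<close> the projection of \<open>a\<close> to the span of the columns,
  both the squared norm of \<open>p\<close> and its inner product with \<open>a\<close> equal the
  sum on the left; expand the squared norm of a - p.\<close>

lemma orthonormal_cols_bessel:
  assumes A: "orthonormal_cols k l A"
  shows "(\<Sum>i<l. (cmod (\<Sum>j<k. cnj (A j i) * a j))\<^sup>2) \<le> (\<Sum>j<k. (cmod (a j))\<^sup>2)"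
proof -
  define y where "y = (\<lambda>i. \<Sum>j<k. cnj (A j i) * a j)"
  define p where "p = (\<lambda>j. \<Sum>i<l. y i * A j i)"
  have p: "(\<Sum>j<k. (cmod (p j))\<^sup>2) = (\<Sum>i<l. (cmod (y i))\<^sup>2)"
  proof -
    have "cmod (p j) = cmod (\<Sum>i<l. cnj (y i) * cnj (A j i))" for j
      using complex_mod_cnj[of "p j"] by (simp add: p_def)
    then show ?thesis using orthonormal_cols_sum_square[OF A, of "\<lambda>i. cnj (y i)"] by simp
  qed
  have cross: "(\<Sum>j<k. cnj (p j) * a j) = complex_of_real (\<Sum>i<l. (cmod (y i))\<^sup>2)"
  proof -
    have "(\<Sum>j<k. cnj (p j) * a j) = (\<Sum>i<l. cnj (y i) * (\<Sum>j<k. cnj (A j i) * a j))"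
      unfolding p_def cnj_sum sum_distrib_left sum_distrib_right by (subst sum.swap) (simp add: mult_ac)
    also have "\<dots> = (\<Sum>i<l. cnj (y i) * y i)" by (simp add: y_def)
    also have "\<dots> = complex_of_real (\<Sum>i<l. (cmod (y i))\<^sup>2)"
      by (simp add: complex_norm_square mult.commute del: of_real_power)
    finally show ?thesis .
  qed
  have "0 \<le> (\<Sum>j<k. (cmod (a j - p j))\<^sup>2)" by (intro sum_nonneg) auto
  also have "\<dots> = (\<Sum>j<k. (cmod (a j))\<^sup>2 + (cmod (p j))\<^sup>2 - 2 * Re (cnj (p j) * a j))"
    by (intro sum.cong refl, unfold cmod_power2) (simp add: power2_eq_square algebra_simps)
  also have "\<dots> = (\<Sum>j<k. (cmod (a j))\<^sup>2) + (\<Sum>j<k. (cmod (p j))\<^sup>2) - 2 * Re (\<Sum>j<k. cnj (p j) * a j)"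
    by (simp add: sum.distrib sum_subtractf sum_distrib_left)
  also have "\<dots> = (\<Sum>j<k. (cmod (a j))\<^sup>2) - (\<Sum>i<l. (cmod (y i))\<^sup>2)"
    unfolding p cross by simp
  finally show ?thesis by (simp add: y_def)
qed

section \<open>Rotational invariance of Haar matrices\<close>

lemma mat_adjoint_dim [simp]: "dim_row (mat_adjoint A) = dim_col A" "dim_col (mat_adjoint A) = dim_row A"
  by (auto simp: mat_adjoint_def)

lemma mat_adjoint_index [simp]:
  "i < dim_col A \<Longrightarrow> j < dim_row A \<Longrightarrow> mat_adjoint A $$ (i, j) = cnj (A $$ (j, i))" for A :: "complex mat"
  by (simp add: mat_adjoint_def mat_of_rows_index)

lemma mat_adjoint_carrier [simp]: "A \<in> carrier_mat m n \<Longrightarrow> mat_adjoint A \<in> carrier_mat n m"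
  by (rule carrier_matI) simp_all

lemma unitary_matI:
  assumes "U \<in> carrier_mat m m" "\<And>k l. k < m \<Longrightarrow> l < m \<Longrightarrow> (\<Sum>j<m. cnj (U $$ (j, k)) * U $$ (j, l)) = (if k = l then 1 else 0)"
  shows "unitary_mat m U"
proof -
  have d: "dim_row U = m" "dim_col U = m" using assms(1) by simp_all
  have "mat_adjoint U * U = 1\<^sub>m m"
  proof (rule eq_matI)
    fix k l assume "k < dim_row (1\<^sub>m m :: complex mat)" "l < dim_col (1\<^sub>m m :: complex mat)"
    then show "(mat_adjoint U * U) $$ (k, l) = (1\<^sub>m m :: complex mat) $$ (k, l)"
      using assms(2)[of k l] d by (simp add: scalar_prod_def atLeast0LessThan)
  qed (simp_all add: d)
  then show ?thesis using assms(1) by (simp add: unitary_mat_def)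
qed

text \<open>A complex Householder reflection \<open>I - w w\<^sup>* / (w\<^sup>* a)\<close> with \<open>w = a - b\<close>; if \<open>w\<^sup>* a = 0\<close>, then
  \<open>a = b\<close> and the junk value of the division makes the reflection the identity.\<close>

lemma unitary_maps_equal_norm:
  fixes a b :: "nat \<Rightarrow> complex"
  assumes ab: "(\<Sum>j<m. (cmod (a j))\<^sup>2) = (\<Sum>j<m. (cmod (b j))\<^sup>2)"
  obtains U where "unitary_mat m U" "\<And>k. k < m \<Longrightarrow> (\<Sum>j<m. cnj (U $$ (j, k)) * a j) = b k"
proof -
  define w where "w = (\<lambda>j. a j - b j)"
  define c where "c = (\<Sum>k<m. cnj (w k) * a k)"
  define s where "s = 1 / c"
  define W where "W = (\<Sum>k<m. cnj (w k) * w k)"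
  have norm: "(\<Sum>j<m. a j * cnj (a j)) = (\<Sum>j<m. b j * cnj (b j))"
    using arg_cong[OF ab, of complex_of_real] by (simp add: complex_norm_square del: of_real_power)
  \<comment> \<open>This is where equality of the norms enters: it gives 2 Re (w^* a) =
    |w|^2.\<close>
  have cc: "c + cnj c = W"
  proof -
    have "c + cnj c - W = (\<Sum>k<m. a k * cnj (a k)) - (\<Sum>k<m. b k * cnj (b k))"
      unfolding c_def W_def w_def cnj_sum sum.distrib[symmetric] sum_subtractf[symmetric]
      by (intro sum.cong refl) (simp add: algebra_simps)
    then show ?thesis using norm by simp
  qed
  \<comment> \<open>\<open>V\<close> is the reflection 1 - s w w^* with s = 1 / (w^* a), so V a = a
    - w = b. The matrix \<open>U\<close> is its adjoint, because the claim is about the action of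
    U^*.\<close>
  define V where "V = (\<lambda>k j. (if k = j then 1 else 0) - s * w k * cnj (w j))"
  define U where "U = mat m m (\<lambda>(j, k). cnj (V k j))"
  \<comment> \<open>The scalar condition under which V V^* is the identity. For c = 0 the division
    gives s = 0 and both sides vanish.\<close>
  have ss: "s + cnj s = s * cnj s * W"
    unfolding cc[symmetric] s_def by (cases "c = 0") (auto simp: field_simps)
  have "(\<Sum>j<m. V k j * cnj (V l j)) = (if k = l then 1 else 0)" if "k < m" "l < m" for k l
  proof -
    have "(\<Sum>j<m. V k j * cnj (V l j)) = (\<Sum>j<m. (if k = j then (if l = j then 1 else 0) else 0)
       - (if k = j then cnj s * cnj (w l) * w j else 0) - (if l = j then s * w k * cnj (w j) else 0)
       + s * cnj s * w k * cnj (w l) * (cnj (w j) * w j))"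
      by (intro sum.cong refl) (auto simp: V_def algebra_simps)
    also have "\<dots> = (if k = l then 1 else 0) - cnj s * cnj (w l) * w k - s * w k * cnj (w l)
       + s * cnj s * w k * cnj (w l) * W"
      using that by (auto simp: sum.distrib sum_subtractf W_def sum_distrib_left[symmetric])
    also have "\<dots> = (if k = l then 1 else 0) - (s + cnj s - s * cnj s * W) * (w k * cnj (w l))"
      by (simp add: algebra_simps)
    finally show ?thesis using ss by simp
  qed
  then have "unitary_mat m U"
    by (intro unitary_matI) (auto simp: U_def)
  moreover have "(\<Sum>j<m. cnj (U $$ (j, k)) * a j) = b k" if "k < m" for k
  proof -
    have "(\<Sum>j<m. cnj (U $$ (j, k)) * a j) = (\<Sum>j<m. (if k = j then a j else 0) - s * w k * (cnj (w j) * a j))"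
      by (intro sum.cong refl) (use that in \<open>auto simp: U_def V_def algebra_simps\<close>)
    also have "\<dots> = a k - s * w k * c"
      using that by (simp add: sum_subtractf c_def flip: sum_distrib_left)
    also have "\<dots> = b k"
    proof (cases "c = 0")
      case True
      then have "W = 0" using cc by simp
      then have "complex_of_real (\<Sum>j<m. (cmod (w j))\<^sup>2) = 0"
        by (simp add: W_def complex_norm_square mult.commute del: of_real_power)
      then have "(\<Sum>j<m. (cmod (w j))\<^sup>2) = 0" by (simp only: of_real_eq_0_iff)
      then have "w k = 0" using that by (simp add: sum_nonneg_eq_0_iff)
      then show ?thesis by (simp add: w_def)
    next
      case False
      then show ?thesis by (simp add: s_def w_def)
    qed
    finally show ?thesis .
  qed
  ultimately show ?thesis using that by blast
qed

section \<open>Measurability of matrix-valued maps\<close>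

lemma borel_measurable_cnj [measurable]: "cnj \<in> borel_measurable borel"
  by (intro borel_measurable_continuous_onI continuous_intros)

lemma space_mat_space [simp]: "space (mat_space m n) = carrier_mat m n"
  by (simp add: mat_space_def)

lemma measurable_mat_entry:
  assumes "i < m" "j < n"
  shows "(\<lambda>A. A $$ (i, j)) \<in> borel_measurable (mat_space m n)"
proof -
  let ?I = "{..<m} \<times> {..<n}"
  have "(\<lambda>A. \<lambda>p\<in>?I. A $$ p) \<in> measurable (mat_space m n) (PiM ?I (\<lambda>_. borel :: complex measure))"
    unfolding mat_space_def by (rule measurable_vimage_algebra1) (auto simp: space_PiM)
  then have "(\<lambda>A. (\<lambda>p\<in>?I. A $$ p) (i, j)) \<in> borel_measurable (mat_space m n)"
    by (rule measurable_compose[OF _ measurable_component_singleton]) (use assms in auto)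
  then show ?thesis using assms by simp
qed

lemma measurable_mat_spaceI:
  assumes "\<And>x. x \<in> space M \<Longrightarrow> f x \<in> carrier_mat m n"
    and "\<And>i j. i < m \<Longrightarrow> j < n \<Longrightarrow> (\<lambda>x. f x $$ (i, j)) \<in> borel_measurable M"
  shows "f \<in> measurable M (mat_space m n)"
  unfolding mat_space_def
  by (rule measurable_vimage_algebra2) (use assms in \<open>auto intro!: measurable_restrict\<close>)

lemma measurable_mat_mult_left:
  assumes U: "U \<in> carrier_mat m m"
  shows "(\<lambda>A. U * A) \<in> measurable (mat_space m n) (mat_space m n)"
proof (rule measurable_mat_spaceI)
  fix i j assume ij: "i < m" "j < n"
  have "(\<lambda>A. \<Sum>k<m. U $$ (i, k) * A $$ (k, j)) \<in> borel_measurable (mat_space m n)"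
    using ij by (intro borel_measurable_sum borel_measurable_times measurable_mat_entry) auto
  moreover have "(U * A) $$ (i, j) = (\<Sum>k<m. U $$ (i, k) * A $$ (k, j))" if "A \<in> space (mat_space m n)" for A
    using that ij U by (auto simp: scalar_prod_def atLeast0LessThan)
  ultimately show "(\<lambda>A. (U * A) $$ (i, j)) \<in> borel_measurable (mat_space m n)"
    using measurable_cong[of "mat_space m n" "\<lambda>A. (U * A) $$ (i, j)" "\<lambda>A. \<Sum>k<m. U $$ (i, k) * A $$ (k, j)"]
    by blast
qed (use U in auto)

section \<open>Invariance of joint laws\<close>

text \<open>Under independence the joint law is the product of the marginal laws. Replacing one
  component by an image with the same marginal law keeps the family independent, hence leaves the
  joint law unchanged.\<close>

lemma (in prob_space) indep_vars_replace_distr: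
  assumes ind: "indep_vars M' X I" and i: "i \<in> I"
    and T: "T \<in> measurable (M' i) (M' i)"
    and eq: "distr M (M' i) (\<lambda>w. T (X i w)) = distr M (M' i) (X i)"
    and \<Phi>: "\<Phi> \<in> borel_measurable (PiM I M')"
  shows "(\<integral>\<^sup>+w. \<Phi> (\<lambda>k\<in>I. X k w) \<partial>M) = (\<integral>\<^sup>+w. \<Phi> (\<lambda>k\<in>I. if k = i then T (X i w) else X k w) \<partial>M)"
proof -
  define Y where "Y = (\<lambda>k w. if k = i then T (X i w) else X k w)"
  have rv: "random_variable (M' k) (X k)" if "k \<in> I" for k
    using ind that by (simp add: indep_vars_def)
  have Yeq: "Y = (\<lambda>k w. (if k = i then T else (\<lambda>x. x)) (X k w))"
    by (auto simp: Y_def fun_eq_iff)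
  have indY: "indep_vars M' Y I"
    unfolding Yeq by (rule indep_vars_compose2[OF ind]) (use T in auto)
  then have rvY: "random_variable (M' k) (Y k)" if "k \<in> I" for k
    using that by (simp add: indep_vars_def)
  have ne: "I \<noteq> {}" using i by auto
  have mX: "(\<lambda>w. \<lambda>k\<in>I. X k w) \<in> measurable M (PiM I M')"
    by (rule measurable_restrict) (rule rv)
  have mY: "(\<lambda>w. \<lambda>k\<in>I. Y k w) \<in> measurable M (PiM I M')"
    by (rule measurable_restrict) (rule rvY)
  have "distr M (M' k) (X k) = distr M (M' k) (Y k)" if "k \<in> I" for k
    using eq by (cases "k = i") (auto simp: Y_def)
  then have "PiM I (\<lambda>k. distr M (M' k) (X k)) = PiM I (\<lambda>k. distr M (M' k) (Y k))"
    by (intro PiM_cong) auto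
  then have D: "distr M (PiM I M') (\<lambda>w. \<lambda>k\<in>I. X k w) = distr M (PiM I M') (\<lambda>w. \<lambda>k\<in>I. Y k w)"
    using indep_vars_iff_distr_eq_PiM'[OF ne rv] indep_vars_iff_distr_eq_PiM'[OF ne rvY] ind indY by simp
  have "(\<integral>\<^sup>+w. \<Phi> (\<lambda>k\<in>I. X k w) \<partial>M) = (\<integral>\<^sup>+x. \<Phi> x \<partial>distr M (PiM I M') (\<lambda>w. \<lambda>k\<in>I. X k w))"
    using mX \<Phi> by (simp add: nn_integral_distr)
  also have "\<dots> = (\<integral>\<^sup>+w. \<Phi> (\<lambda>k\<in>I. Y k w) \<partial>M)"
    unfolding D using mY \<Phi> by (simp add: nn_integral_distr)
  finally show ?thesis by (simp add: Y_def)
qed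

text \<open>Take a unitary U with U^* a = b. Then (U X)^* a = X^* b while U X has the law of X. The
  hypothesis \<open>cong\<close> says that \<open>F\<close> reads component \<open>i\<close> only
  through its first argument, so the replacement of X by U X is invisible elsewhere.\<close>

lemma (in prob_space) invariant_adjoint_action:
  assumes ind: "indep_vars M' X I" and i: "i \<in> I" and M': "M' i = mat_space m n"
    and inv: "\<And>U. unitary_mat m U \<Longrightarrow> distr M (mat_space m n) (\<lambda>w. U * X i w) = distr M (mat_space m n) (X i)"
    and F: "\<And>a. (\<lambda>x. F (\<lambda>l. \<Sum>j<m. cnj (x i $$ (j, l)) * a j) x) \<in> borel_measurable (PiM I M')"
    and cong: "\<And>y y' x x'. (\<And>l. l < n \<Longrightarrow> y l = y' l) \<Longrightarrow> (\<And>k. k \<in> I \<Longrightarrow> k \<noteq> i \<Longrightarrow> x k = x' k) \<Longrightarrow> F y x = F y' x'"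
    and ab: "(\<Sum>j<m. (cmod (a j))\<^sup>2) = (\<Sum>j<m. (cmod (b j))\<^sup>2)"
  shows "(\<integral>\<^sup>+w. F (\<lambda>l. \<Sum>j<m. cnj (X i w $$ (j, l)) * a j) (\<lambda>k. X k w) \<partial>M)
    = (\<integral>\<^sup>+w. F (\<lambda>l. \<Sum>j<m. cnj (X i w $$ (j, l)) * b j) (\<lambda>k. X k w) \<partial>M)"
proof -
  obtain U where U: "unitary_mat m U" and Ua: "\<And>k. k < m \<Longrightarrow> (\<Sum>j<m. cnj (U $$ (j, k)) * a j) = b k"
    using unitary_maps_equal_norm[OF ab] by blast
  have Uc: "U \<in> carrier_mat m m" using U by (simp add: unitary_mat_def)
  have rv: "random_variable (mat_space m n) (X i)"
    using ind i M' by (metis indep_vars_def)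
  have "(\<integral>\<^sup>+w. F (\<lambda>l. \<Sum>j<m. cnj (X i w $$ (j, l)) * a j) (\<lambda>k. X k w) \<partial>M)
     = (\<integral>\<^sup>+w. F (\<lambda>l. \<Sum>j<m. cnj ((\<lambda>k\<in>I. X k w) i $$ (j, l)) * a j) (\<lambda>k\<in>I. X k w) \<partial>M)"
    by (intro nn_integral_cong cong) (use i in auto)
  also have "\<dots> = (\<integral>\<^sup>+w. F (\<lambda>l. \<Sum>j<m. cnj ((\<lambda>k\<in>I. if k = i then U * X i w else X k w) i $$ (j, l)) * a j)
      (\<lambda>k\<in>I. if k = i then U * X i w else X k w) \<partial>M)"
    by (rule indep_vars_replace_distr[OF ind i _ _ F])
      (use inv[OF U] M' measurable_mat_mult_left[OF Uc] in auto)
  also have "\<dots> = (\<integral>\<^sup>+w. F (\<lambda>l. \<Sum>j<m. cnj (X i w $$ (j, l)) * b j) (\<lambda>k. X k w) \<partial>M)"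
  proof (intro nn_integral_cong cong)
    fix w l assume w: "w \<in> space M" and l: "l < n"
    then have Xc: "X i w \<in> carrier_mat m n" using measurable_space[OF rv] by auto
    have "(\<Sum>j<m. cnj ((U * X i w) $$ (j, l)) * a j) = (\<Sum>j<m. \<Sum>k<m. cnj (U $$ (j, k) * X i w $$ (k, l)) * a j)"
      using Uc Xc l by (intro sum.cong refl) (auto simp: scalar_prod_def atLeast0LessThan sum_distrib_right)
    also have "\<dots> = (\<Sum>k<m. cnj (X i w $$ (k, l)) * (\<Sum>j<m. cnj (U $$ (j, k)) * a j))"
      by (subst sum.swap) (simp add: sum_distrib_left mult_ac)
    also have "\<dots> = (\<Sum>k<m. cnj (X i w $$ (k, l)) * b k)"
      by (simp add: Ua)
    finally show "(\<Sum>j<m. cnj ((\<lambda>k\<in>I. if k = i then U * X i w else X k w) i $$ (j, l)) * a j)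
        = (\<Sum>j<m. cnj (X i w $$ (j, l)) * b j)"
      using i by simp
  qed auto
  finally show ?thesis .
qed

lemma (in prob_space) haar_left_invariant:
  assumes X: "X \<in> measurable M (mat_space m n)"
    and inv: "\<And>U. unitary_mat m U \<Longrightarrow> distr (distr M (mat_space m n) X) (mat_space m n) (\<lambda>A. U * A) = distr M (mat_space m n) X"
    and U: "unitary_mat m U"
  shows "distr M (mat_space m n) (\<lambda>w. U * X w) = distr M (mat_space m n) X"
proof -
  have "U \<in> carrier_mat m m" using U by (simp add: unitary_mat_def)
  then show ?thesis
    using inv[OF U] distr_distr[OF measurable_mat_mult_left X, of U] by (simp add: comp_def)
qed

section \<open>The noise model at a fixed size\<close>

locale haar_model = prob_space M for M :: "'w measure" +
  fixes m n :: nat and L G R :: "'w \<Rightarrow> complex mat"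
  assumes ind: "indep_vars (\<lambda>i. if i = (2::nat) then mat_space n m else mat_space m m)
        (\<lambda>i. if i = 0 then L else if i = 1 then G else R) {0, 1, 2}"
    and haar_L: "haar_unitary m (distr M (mat_space m m) L)"
    and haar_R: "\<exists>H cs. haar_unitary n H \<and> inj_on cs {..<m} \<and> (\<forall>j<m. cs j < n) \<and>
        distr M (mat_space n m) R = distr H (mat_space n m) (\<lambda>W. mat n m (\<lambda>(i, j). W $$ (i, cs j)))"
begin

lemma measurable_L: "L \<in> measurable M (mat_space m m)"
  and measurable_G: "G \<in> measurable M (mat_space m m)"
  and measurable_R: "R \<in> measurable M (mat_space n m)"
proof -
  have *: "random_variable (if i = 2 then mat_space n m else mat_space m m) (if i = 0 then L else if i = 1 then G else R)"
    if "i \<in> {0, 1, 2}" for i :: nat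
    using ind that by (auto simp: indep_vars_def)
  show "L \<in> measurable M (mat_space m m)" "G \<in> measurable M (mat_space m m)" "R \<in> measurable M (mat_space n m)"
    using *[of 0] *[of 1] *[of 2] by auto
qed

lemma carrier_LGR: 
  assumes "w \<in> space M"
  shows "L w \<in> carrier_mat m m" "G w \<in> carrier_mat m m" "R w \<in> carrier_mat n m"
  using measurable_space[OF measurable_L assms] measurable_space[OF measurable_G assms]
    measurable_space[OF measurable_R assms] by auto

lemma AE_orthonormal_L: "AE w in M. orthonormal_cols m m (\<lambda>j i. L w $$ (j, i))"
proof -
  have "AE w in M. unitary_mat m (L w)"
    using haar_L AE_distrD[OF measurable_L, of "unitary_mat m"] by (auto simp: haar_unitary_def)
  then show ?thesis
  proof eventually_elim
    case (elim w)
    then have c: "L w \<in> carrier_mat m m" and u: "mat_adjoint (L w) * L w = 1\<^sub>m m" by (auto simp: unitary_mat_def)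
    show ?case unfolding orthonormal_cols_def
    proof (intro allI impI)
      fix i k assume ik: "i < m" "k < m"
      have "(mat_adjoint (L w) * L w) $$ (i, k) = (\<Sum>j<m. cnj (L w $$ (j, i)) * L w $$ (j, k))"
        using c ik by (auto simp: scalar_prod_def atLeast0LessThan)
      then show "(\<Sum>j<m. cnj (L w $$ (j, i)) * L w $$ (j, k)) = (if i = k then 1 else 0)"
        using u ik by simp
    qed
  qed
qed

lemma invariant_L:
  "unitary_mat m U \<Longrightarrow> distr M (mat_space m m) (\<lambda>w. U * L w) = distr M (mat_space m m) L"
  using haar_L by (intro haar_left_invariant measurable_L) (auto simp: haar_unitary_def)

lemma column_selection:
  obtains H cs where "haar_unitary n H" "inj_on cs {..<m}" "\<And>j. j < m \<Longrightarrow> cs j < n"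
    "(\<lambda>W. mat n m (\<lambda>(i, j). W $$ (i, cs j))) \<in> measurable H (mat_space n m)"
    "distr M (mat_space n m) R = distr H (mat_space n m) (\<lambda>W. mat n m (\<lambda>(i, j). W $$ (i, cs j)))"
proof -
  obtain H cs where H: "haar_unitary n H" "inj_on cs {..<m}" "\<And>j. j < m \<Longrightarrow> cs j < n"
    "distr M (mat_space n m) R = distr H (mat_space n m) (\<lambda>W. mat n m (\<lambda>(i, j). W $$ (i, cs j)))"
    using haar_R by blast
  have [measurable_cong]: "sets H = sets (mat_space n n)" using H(1) by (simp add: haar_unitary_def)
  have "(\<lambda>W. mat n m (\<lambda>(i, j). W $$ (i, cs j))) \<in> measurable (mat_space n n) (mat_space n m)"
    using H(3) by (intro measurable_mat_spaceI) (auto intro!: measurable_mat_entry)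
  then have "(\<lambda>W. mat n m (\<lambda>(i, j). W $$ (i, cs j))) \<in> measurable H (mat_space n m)"
    by (simp cong: measurable_cong_sets)
  with H that show ?thesis by blast
qed

text \<open>\<open>R\<close> is described through its law alone. Orthonormality is therefore checked
  on columns selected from a Haar matrix and carried over by the distribution, for which the event
  has to be measurable.\<close>

lemma AE_orthonormal_R: "AE w in M. orthonormal_cols n m (\<lambda>j i. R w $$ (j, i))"
proof -
  obtain H cs where H: "haar_unitary n H" "inj_on cs {..<m}" "\<And>j. j < m \<Longrightarrow> cs j < n"
    and sel: "(\<lambda>W. mat n m (\<lambda>(i, j). W $$ (i, cs j))) \<in> measurable H (mat_space n m)"
    and D: "distr M (mat_space n m) R = distr H (mat_space n m) (\<lambda>W. mat n m (\<lambda>(i, j). W $$ (i, cs j)))"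
    using column_selection by blast
  let ?P = "\<lambda>A. orthonormal_cols n m (\<lambda>j i. A $$ (j, i))"
  have meas: "{A \<in> space (mat_space n m). ?P A} \<in> sets (mat_space n m)"
  proof -
    have "(\<lambda>A. \<Sum>j<n. cnj (A $$ (j, i)) * A $$ (j, k)) \<in> borel_measurable (mat_space n m)" if "i < m" "k < m" for i k
      using that by (intro borel_measurable_sum borel_measurable_times measurable_mat_entry
          measurable_compose[OF measurable_mat_entry borel_measurable_cnj]) auto
    then have "Measurable.pred (mat_space n m) (\<lambda>A. \<forall>i\<in>{..<m}. \<forall>k\<in>{..<m}.
        (\<Sum>j<n. cnj (A $$ (j, i)) * A $$ (j, k)) = (if i = k then 1 else 0))"
      by (intro pred_intros_finite pred_eq_const1) auto
    then have "{A \<in> space (mat_space n m). \<forall>i\<in>{..<m}. \<forall>k\<in>{..<m}.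
        (\<Sum>j<n. cnj (A $$ (j, i)) * A $$ (j, k)) = (if i = k then 1 else 0)} \<in> sets (mat_space n m)"
      by (rule predE)
    then show ?thesis by (simp only: orthonormal_cols_def Ball_def lessThan_iff)
  qed
  have "AE W in H. unitary_mat n W" using H(1) by (simp add: haar_unitary_def)
  then have "AE W in H. ?P (mat n m (\<lambda>(i, j). W $$ (i, cs j)))"
  proof eventually_elim
    case (elim W)
    then have c: "W \<in> carrier_mat n n" and u: "mat_adjoint W * W = 1\<^sub>m n" by (auto simp: unitary_mat_def)
    show ?case unfolding orthonormal_cols_def
    proof (intro allI impI)
      fix i k assume ik: "i < m" "k < m"
      then have "(mat_adjoint W * W) $$ (cs i, cs k) = (\<Sum>j<n. cnj (W $$ (j, cs i)) * W $$ (j, cs k))"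
        using c H(3) by (auto simp: scalar_prod_def atLeast0LessThan)
      moreover have "cs i = cs k \<longleftrightarrow> i = k" using H(2) ik by (auto simp: inj_on_def)
      ultimately show "(\<Sum>j<n. cnj (mat n m (\<lambda>(i, j). W $$ (i, cs j)) $$ (j, i)) * mat n m (\<lambda>(i, j). W $$ (i, cs j)) $$ (j, k))
          = (if i = k then 1 else 0)"
        using u ik H(3) by simp
    qed
  qed
  then have "AE A in distr M (mat_space n m) R. ?P A"
    unfolding D using AE_distr_iff[OF sel meas] by simp
  then show ?thesis by (rule AE_distrD[OF measurable_R])
qed

text \<open>Multiplication from the left acts on each column separately, so it commutes with the
  selection of columns and the Haar invariance is inherited.\<close>

lemma invariant_R:
  assumes U: "unitary_mat n U"
  shows "distr M (mat_space n m) (\<lambda>w. U * R w) = distr M (mat_space n m) R"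
proof -
  obtain H cs where H: "haar_unitary n H" "inj_on cs {..<m}" "\<And>j. j < m \<Longrightarrow> cs j < n"
    and sel: "(\<lambda>W. mat n m (\<lambda>(i, j). W $$ (i, cs j))) \<in> measurable H (mat_space n m)"
    and D: "distr M (mat_space n m) R = distr H (mat_space n m) (\<lambda>W. mat n m (\<lambda>(i, j). W $$ (i, cs j)))"
    using column_selection by blast
  let ?s = "\<lambda>W. mat n m (\<lambda>(i, j). W $$ (i, cs j))"
  have sH: "sets H = sets (mat_space n n)" using H(1) by (simp add: haar_unitary_def)
  have spH: "space H = carrier_mat n n" using sets_eq_imp_space_eq[OF sH] by simp
  have Uc: "U \<in> carrier_mat n n" using U by (simp add: unitary_mat_def)
  have HU: "(\<lambda>A. U * A) \<in> measurable H (mat_space n n)"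
    using measurable_mat_mult_left[OF Uc, of n] sH by (simp cong: measurable_cong_sets)
  have sel': "?s \<in> measurable (mat_space n n) (mat_space n m)"
    using sel sH by (simp cong: measurable_cong_sets)
  have "distr (distr M (mat_space n m) R) (mat_space n m) (\<lambda>A. U * A) = distr H (mat_space n m) (\<lambda>W. U * ?s W)"
    unfolding D using distr_distr[OF measurable_mat_mult_left[OF Uc] sel] by (simp add: comp_def)
  also have "\<dots> = distr H (mat_space n m) (\<lambda>W. ?s (U * W))"
  proof (rule distr_cong[OF refl refl])
    fix W assume "W \<in> space H"
    then have "W \<in> carrier_mat n n" by (simp add: spH)
    then show "U * ?s W = ?s (U * W)"
      using Uc H(3) by (intro eq_matI) (auto simp: scalar_prod_def)
  qed
  also have "\<dots> = distr (distr H (mat_space n n) (\<lambda>A. U * A)) (mat_space n m) ?s"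
    using distr_distr[OF sel' HU] by (simp add: comp_def)
  also have "distr H (mat_space n n) (\<lambda>A. U * A) = H"
    using H(1) U by (simp add: haar_unitary_def)
  also have "distr H (mat_space n m) ?s = distr M (mat_space n m) R" by (simp add: D)
  finally show ?thesis
    using distr_distr[OF measurable_mat_mult_left[OF Uc] measurable_R] by (simp add: comp_def)
qed

definition gam :: "'w \<Rightarrow> nat \<Rightarrow> real" where "gam w i = Re (G w $$ (i, i))"

lemma measurable_entries [measurable]:
  "i < m \<Longrightarrow> j < m \<Longrightarrow> (\<lambda>w. L w $$ (i, j)) \<in> borel_measurable M"
  "i < n \<Longrightarrow> j < m \<Longrightarrow> (\<lambda>w. R w $$ (i, j)) \<in> borel_measurable M"
  "i < m \<Longrightarrow> (\<lambda>w. gam w i) \<in> borel_measurable M"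
  using measurable_compose[OF measurable_L measurable_mat_entry]
    measurable_compose[OF measurable_R measurable_mat_entry]
    measurable_compose[OF measurable_compose[OF measurable_G measurable_mat_entry] borel_measurable_Re]
  by (auto simp: gam_def)

abbreviation PLGR :: "(nat \<Rightarrow> complex mat) measure" where
  "PLGR \<equiv> PiM {0, Suc 0, 2} (\<lambda>i. if i = 2 then mat_space n m else mat_space m m)"

lemma PLGR_entries [measurable]:
  "i < m \<Longrightarrow> j < m \<Longrightarrow> (\<lambda>x. x 0 $$ (i, j)) \<in> borel_measurable PLGR"
  "i < m \<Longrightarrow> j < m \<Longrightarrow> (\<lambda>x. x (Suc 0) $$ (i, j)) \<in> borel_measurable PLGR"
  "i < n \<Longrightarrow> j < m \<Longrightarrow> (\<lambda>x. x 2 $$ (i, j)) \<in> borel_measurable PLGR"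
proof -
  have c: "(\<lambda>x. x k) \<in> measurable PLGR (if k = 2 then mat_space n m else mat_space m m)" if "k \<in> {0, Suc 0, 2}" for k
    using that by (rule measurable_component_singleton)
  show "(\<lambda>x. x 0 $$ (i, j)) \<in> borel_measurable PLGR" if "i < m" "j < m"
    by (rule measurable_compose[OF _ measurable_mat_entry[OF that]]) (use c[of 0] in simp)
  show "(\<lambda>x. x (Suc 0) $$ (i, j)) \<in> borel_measurable PLGR" if "i < m" "j < m"
    by (rule measurable_compose[OF _ measurable_mat_entry[OF that]]) (use c[of "Suc 0"] in simp)
  show "(\<lambda>x. x 2 $$ (i, j)) \<in> borel_measurable PLGR" if "i < n" "j < m"
    by (rule measurable_compose[OF _ measurable_mat_entry[OF that]]) (use c[of 2] in simp)
qed

lemma invariant_L_functional: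
  assumes F: "\<And>a. (\<lambda>x. F (\<lambda>l. \<Sum>j<m. cnj (x 0 $$ (j, l)) * a j) x) \<in> borel_measurable PLGR"
    and cong: "\<And>y y' x x'. (\<And>l. l < m \<Longrightarrow> y l = y' l) \<Longrightarrow> x (Suc 0) = x' (Suc 0) \<Longrightarrow> x 2 = x' 2 \<Longrightarrow> F y x = F y' x'"
    and ab: "(\<Sum>j<m. (cmod (a j))\<^sup>2) = (\<Sum>j<m. (cmod (b j))\<^sup>2)"
  shows "(\<integral>\<^sup>+w. F (\<lambda>l. \<Sum>j<m. cnj (L w $$ (j, l)) * a j) (\<lambda>k. if k = 0 then L w else if k = Suc 0 then G w else R w) \<partial>M)
    = (\<integral>\<^sup>+w. F (\<lambda>l. \<Sum>j<m. cnj (L w $$ (j, l)) * b j) (\<lambda>k. if k = 0 then L w else if k = Suc 0 then G w else R w) \<partial>M)"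
proof -
  let ?X = "\<lambda>i::nat. if i = 0 then L else if i = 1 then G else R"
  have "(\<integral>\<^sup>+w. F (\<lambda>l. \<Sum>j<m. cnj (?X 0 w $$ (j, l)) * a j) (\<lambda>k. ?X k w) \<partial>M)
    = (\<integral>\<^sup>+w. F (\<lambda>l. \<Sum>j<m. cnj (?X 0 w $$ (j, l)) * b j) (\<lambda>k. ?X k w) \<partial>M)"
  proof (rule invariant_adjoint_action[OF ind _ _ _ _ _ ab])
    show "(0::nat) \<in> {0, 1, 2}" "(if (0::nat) = 2 then mat_space n m else mat_space m m) = mat_space m m" by simp_all
    show "distr M (mat_space m m) (\<lambda>w. U * ?X 0 w) = distr M (mat_space m m) (?X 0)" if "unitary_mat m U" for U
      using invariant_L[OF that] by simp
    show "(\<lambda>x. F (\<lambda>l. \<Sum>j<m. cnj (x 0 $$ (j, l)) * a j) x) \<in> borel_measurable (PiM {0, 1, 2} (\<lambda>i. if i = 2 then mat_space n m else mat_space m m))" for a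
      using F[of a] by simp
    show "F y x = F y' x'" if "\<And>l. l < m \<Longrightarrow> y l = y' l" "\<And>k::nat. k \<in> {0, 1, 2} \<Longrightarrow> k \<noteq> 0 \<Longrightarrow> x k = x' k" for y y' x x'
      by (rule cong[OF that(1)]) (auto intro: that(2))
  qed
  moreover have "(\<lambda>k. ?X k w) = (\<lambda>k. if k = 0 then L w else if k = Suc 0 then G w else R w)" for w by auto
  ultimately show ?thesis by simp
qed

lemma invariant_R_functional:
  assumes F: "\<And>a. (\<lambda>x. F (\<lambda>l. \<Sum>j<n. cnj (x 2 $$ (j, l)) * a j) x) \<in> borel_measurable PLGR"
    and cong: "\<And>y y' x x'. (\<And>l. l < m \<Longrightarrow> y l = y' l) \<Longrightarrow> x (Suc 0) = x' (Suc 0) \<Longrightarrow> x 0 = x' 0 \<Longrightarrow> F y x = F y' x'"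
    and ab: "(\<Sum>j<n. (cmod (a j))\<^sup>2) = (\<Sum>j<n. (cmod (b j))\<^sup>2)"
  shows "(\<integral>\<^sup>+w. F (\<lambda>l. \<Sum>j<n. cnj (R w $$ (j, l)) * a j) (\<lambda>k. if k = 0 then L w else if k = Suc 0 then G w else R w) \<partial>M)
    = (\<integral>\<^sup>+w. F (\<lambda>l. \<Sum>j<n. cnj (R w $$ (j, l)) * b j) (\<lambda>k. if k = 0 then L w else if k = Suc 0 then G w else R w) \<partial>M)"
proof -
  let ?X = "\<lambda>i::nat. if i = 0 then L else if i = 1 then G else R"
  have "(\<integral>\<^sup>+w. F (\<lambda>l. \<Sum>j<n. cnj (?X 2 w $$ (j, l)) * a j) (\<lambda>k. ?X k w) \<partial>M)
    = (\<integral>\<^sup>+w. F (\<lambda>l. \<Sum>j<n. cnj (?X 2 w $$ (j, l)) * b j) (\<lambda>k. ?X k w) \<partial>M)"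
  proof (rule invariant_adjoint_action[OF ind _ _ _ _ _ ab])
    show "(2::nat) \<in> {0, 1, 2}" "(if (2::nat) = 2 then mat_space n m else mat_space m m) = mat_space n m" by simp_all
    show "distr M (mat_space n m) (\<lambda>w. U * ?X 2 w) = distr M (mat_space n m) (?X 2)" if "unitary_mat n U" for U
      using invariant_R[OF that] by simp
    show "(\<lambda>x. F (\<lambda>l. \<Sum>j<n. cnj (x 2 $$ (j, l)) * a j) x) \<in> borel_measurable (PiM {0, 1, 2} (\<lambda>i. if i = 2 then mat_space n m else mat_space m m))" for a
      using F[of a] by simp
    show "F y x = F y' x'" if "\<And>l. l < m \<Longrightarrow> y l = y' l" "\<And>k::nat. k \<in> {0, 1, 2} \<Longrightarrow> k \<noteq> 2 \<Longrightarrow> x k = x' k" for y y' x x'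
      by (rule cong[OF that(1)]) (auto intro: that(2))
  qed
  moreover have "(\<lambda>k. ?X k w) = (\<lambda>k. if k = 0 then L w else if k = Suc 0 then G w else R w)" for w by auto
  ultimately show ?thesis by simp
qed

lemma quadratic_moment_L:
  assumes h [measurable]: "h \<in> borel_measurable borel" and hK: "\<And>x. \<bar>h x\<bar> \<le> K" and m: "0 < m"
    and a: "(\<Sum>j<m. (cmod (a j))\<^sup>2) = s"
  shows "(\<integral>\<^sup>+w. ennreal (((\<Sum>i<m. h (gam w i) * (cmod (\<Sum>j<m. cnj (L w $$ (j, i)) * a j))\<^sup>2)
      - s / m * (\<Sum>i<m. h (gam w i))) ^ 4) \<partial>M) \<le> ennreal (1296 * K ^ 4 * s ^ 4 / (real m)\<^sup>2)"
proof (rule invariant_quadratic_form_moment[where A = "\<lambda>w j i. L w $$ (j, i)" and d = "\<lambda>w i. h (gam w i)"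
      and \<Phi> = "\<lambda>a w. ((\<Sum>i<m. h (gam w i) * (cmod (\<Sum>j<m. cnj (L w $$ (j, i)) * a j))\<^sup>2) - s / m * (\<Sum>i<m. h (gam w i))) ^ 4" and N = m])
  fix a b :: "nat \<Rightarrow> complex" assume "(\<Sum>j<m. (cmod (a j))\<^sup>2) = s" "(\<Sum>j<m. (cmod (b j))\<^sup>2) = s"
  then have ab: "(\<Sum>j<m. (cmod (a j))\<^sup>2) = (\<Sum>j<m. (cmod (b j))\<^sup>2)" by simp
  show "(\<integral>\<^sup>+w. ennreal (((\<Sum>i<m. h (gam w i) * (cmod (\<Sum>j<m. cnj (L w $$ (j, i)) * a j))\<^sup>2) - s / m * (\<Sum>i<m. h (gam w i))) ^ 4) \<partial>M)
    = (\<integral>\<^sup>+w. ennreal (((\<Sum>i<m. h (gam w i) * (cmod (\<Sum>j<m. cnj (L w $$ (j, i)) * b j))\<^sup>2) - s / m * (\<Sum>i<m. h (gam w i))) ^ 4) \<partial>M)"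
  proof -
    let ?F = "\<lambda>y x. ennreal (((\<Sum>i<m. h (Re (x (Suc 0) $$ (i, i))) * (cmod (y i))\<^sup>2) - s / m * (\<Sum>i<m. h (Re (x (Suc 0) $$ (i, i))))) ^ 4)"
    have "(\<lambda>x. ?F (\<lambda>l. \<Sum>j<m. cnj (x 0 $$ (j, l)) * a j) x) \<in> borel_measurable PLGR" for a :: "nat \<Rightarrow> complex"
      by measurable
    then have "(\<integral>\<^sup>+w. ?F (\<lambda>l. \<Sum>j<m. cnj (L w $$ (j, l)) * a j) (\<lambda>k. if k = 0 then L w else if k = Suc 0 then G w else R w) \<partial>M) = (\<integral>\<^sup>+w. ?F (\<lambda>l. \<Sum>j<m. cnj (L w $$ (j, l)) * b j) (\<lambda>k. if k = 0 then L w else if k = Suc 0 then G w else R w) \<partial>M)"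
    proof (rule invariant_L_functional[where F = ?F, OF _ _ ab])
      fix y y' :: "nat \<Rightarrow> complex" and x x' :: "nat \<Rightarrow> complex mat"
      assume y: "\<And>l. l < m \<Longrightarrow> y l = y' l" and x: "x (Suc 0) = x' (Suc 0)" "x 2 = x' 2"
      have "(\<Sum>i<m. h (Re (x (Suc 0) $$ (i, i))) * (cmod (y i))\<^sup>2)
        = (\<Sum>i<m. h (Re (x' (Suc 0) $$ (i, i))) * (cmod (y' i))\<^sup>2)"
        by (intro sum.cong refl) (simp add: y x)
      then show "?F y x = ?F y' x'" by (simp only: x)
    qed
    then show ?thesis by (simp add: gam_def)
  qed
qed (use AE_orthonormal_L hK m a in \<open>auto\<close>)

lemma quadratic_moment_R:
  assumes h [measurable]: "h \<in> borel_measurable borel" and hK: "\<And>x. \<bar>h x\<bar> \<le> K" and m: "m \<le> n" "0 < n"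
    and a: "(\<Sum>j<n. (cmod (a j))\<^sup>2) = s"
  shows "(\<integral>\<^sup>+w. ennreal (((\<Sum>i<m. h (gam w i) * (cmod (\<Sum>j<n. cnj (R w $$ (j, i)) * a j))\<^sup>2)
      - s / n * (\<Sum>i<m. h (gam w i))) ^ 4) \<partial>M) \<le> ennreal (1296 * K ^ 4 * s ^ 4 / (real n)\<^sup>2)"
proof (rule invariant_quadratic_form_moment[where A = "\<lambda>w j i. R w $$ (j, i)" and d = "\<lambda>w i. h (gam w i)"
      and \<Phi> = "\<lambda>a w. ((\<Sum>i<m. h (gam w i) * (cmod (\<Sum>j<n. cnj (R w $$ (j, i)) * a j))\<^sup>2) - s / n * (\<Sum>i<m. h (gam w i))) ^ 4" and N = m])
  fix a b :: "nat \<Rightarrow> complex" assume "(\<Sum>j<n. (cmod (a j))\<^sup>2) = s" "(\<Sum>j<n. (cmod (b j))\<^sup>2) = s"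
  then have ab: "(\<Sum>j<n. (cmod (a j))\<^sup>2) = (\<Sum>j<n. (cmod (b j))\<^sup>2)" by simp
  show "(\<integral>\<^sup>+w. ennreal (((\<Sum>i<m. h (gam w i) * (cmod (\<Sum>j<n. cnj (R w $$ (j, i)) * a j))\<^sup>2) - s / n * (\<Sum>i<m. h (gam w i))) ^ 4) \<partial>M)
    = (\<integral>\<^sup>+w. ennreal (((\<Sum>i<m. h (gam w i) * (cmod (\<Sum>j<n. cnj (R w $$ (j, i)) * b j))\<^sup>2) - s / n * (\<Sum>i<m. h (gam w i))) ^ 4) \<partial>M)"
  proof -
    let ?F = "\<lambda>y x. ennreal (((\<Sum>i<m. h (Re (x (Suc 0) $$ (i, i))) * (cmod (y i))\<^sup>2) - s / n * (\<Sum>i<m. h (Re (x (Suc 0) $$ (i, i))))) ^ 4)"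
    have "(\<lambda>x. ?F (\<lambda>l. \<Sum>j<n. cnj (x 2 $$ (j, l)) * a j) x) \<in> borel_measurable PLGR" for a :: "nat \<Rightarrow> complex"
      by measurable
    then have "(\<integral>\<^sup>+w. ?F (\<lambda>l. \<Sum>j<n. cnj (R w $$ (j, l)) * a j) (\<lambda>k. if k = 0 then L w else if k = Suc 0 then G w else R w) \<partial>M) = (\<integral>\<^sup>+w. ?F (\<lambda>l. \<Sum>j<n. cnj (R w $$ (j, l)) * b j) (\<lambda>k. if k = 0 then L w else if k = Suc 0 then G w else R w) \<partial>M)"
    proof (rule invariant_R_functional[where F = ?F, OF _ _ ab])
      fix y y' :: "nat \<Rightarrow> complex" and x x' :: "nat \<Rightarrow> complex mat"
      assume y: "\<And>l. l < m \<Longrightarrow> y l = y' l" and x: "x (Suc 0) = x' (Suc 0)" "x 0 = x' 0"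
      have "(\<Sum>i<m. h (Re (x (Suc 0) $$ (i, i))) * (cmod (y i))\<^sup>2)
        = (\<Sum>i<m. h (Re (x' (Suc 0) $$ (i, i))) * (cmod (y' i))\<^sup>2)"
        by (intro sum.cong refl) (simp add: y x)
      then show "?F y x = ?F y' x'" by (simp only: x)
    qed
    then show ?thesis by (simp add: gam_def)
  qed
qed (use AE_orthonormal_R hK m a in \<open>auto\<close>)

text \<open>The sum is read as a linear form in L^* a. The side of \<open>R\<close> is absorbed into
  the random weights, whose square sum is bounded by Bessel's inequality; invariance is used for
  \<open>L\<close> only.\<close>

lemma cross_moment:
  assumes h [measurable]: "h \<in> borel_measurable borel" and hK: "\<And>x. \<bar>h x\<bar> \<le> K" and m: "0 < m"
    and a: "(\<Sum>j<m. (cmod (a j))\<^sup>2) = s" and b: "(\<Sum>j<n. (cmod (b j))\<^sup>2) = s'"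
  shows "(\<integral>\<^sup>+w. ennreal (cmod (\<Sum>i<m. complex_of_real (h (gam w i)) * cnj (\<Sum>j<n. cnj (R w $$ (j, i)) * b j)
      * (\<Sum>j<m. cnj (L w $$ (j, i)) * a j)) ^ 4) \<partial>M) \<le> ennreal (18 * (K\<^sup>2 * s')\<^sup>2 * s\<^sup>2 / (real m)\<^sup>2)"
proof (rule invariant_linear_form_moment[where A = "\<lambda>w j i. L w $$ (j, i)" and N = m
      and d = "\<lambda>w i. complex_of_real (h (gam w i)) * cnj (\<Sum>j<n. cnj (R w $$ (j, i)) * b j)"
      and \<Phi> = "\<lambda>a w. cmod (\<Sum>i<m. complex_of_real (h (gam w i)) * cnj (\<Sum>j<n. cnj (R w $$ (j, i)) * b j)
      * (\<Sum>j<m. cnj (L w $$ (j, i)) * a j)) ^ 4"])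
  fix a b' :: "nat \<Rightarrow> complex" assume "(\<Sum>j<m. (cmod (a j))\<^sup>2) = s" "(\<Sum>j<m. (cmod (b' j))\<^sup>2) = s"
  then have ab: "(\<Sum>j<m. (cmod (a j))\<^sup>2) = (\<Sum>j<m. (cmod (b' j))\<^sup>2)" by simp
  show "(\<integral>\<^sup>+w. ennreal (cmod (\<Sum>i<m. complex_of_real (h (gam w i)) * cnj (\<Sum>j<n. cnj (R w $$ (j, i)) * b j)
      * (\<Sum>j<m. cnj (L w $$ (j, i)) * a j)) ^ 4) \<partial>M)
    = (\<integral>\<^sup>+w. ennreal (cmod (\<Sum>i<m. complex_of_real (h (gam w i)) * cnj (\<Sum>j<n. cnj (R w $$ (j, i)) * b j)
      * (\<Sum>j<m. cnj (L w $$ (j, i)) * b' j)) ^ 4) \<partial>M)"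
  proof -
    let ?F = "\<lambda>y x. ennreal (cmod (\<Sum>i<m. complex_of_real (h (Re (x (Suc 0) $$ (i, i)))) * cnj (\<Sum>j<n. cnj (x 2 $$ (j, i)) * b j) * y i) ^ 4)"
    have "(\<lambda>x. ?F (\<lambda>l. \<Sum>j<m. cnj (x 0 $$ (j, l)) * a j) x) \<in> borel_measurable PLGR" for a :: "nat \<Rightarrow> complex"
      by measurable
    then have "(\<integral>\<^sup>+w. ?F (\<lambda>l. \<Sum>j<m. cnj (L w $$ (j, l)) * a j) (\<lambda>k. if k = 0 then L w else if k = Suc 0 then G w else R w) \<partial>M) = (\<integral>\<^sup>+w. ?F (\<lambda>l. \<Sum>j<m. cnj (L w $$ (j, l)) * b' j) (\<lambda>k. if k = 0 then L w else if k = Suc 0 then G w else R w) \<partial>M)"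
    proof (rule invariant_L_functional[where F = ?F, OF _ _ ab])
      fix y y' :: "nat \<Rightarrow> complex" and x x' :: "nat \<Rightarrow> complex mat"
      assume y: "\<And>l. l < m \<Longrightarrow> y l = y' l" and x: "x (Suc 0) = x' (Suc 0)" "x 2 = x' 2"
      have "(\<Sum>i<m. complex_of_real (h (Re (x (Suc 0) $$ (i, i)))) * cnj (\<Sum>j<n. cnj (x 2 $$ (j, i)) * b j) * y i)
        = (\<Sum>i<m. complex_of_real (h (Re (x' (Suc 0) $$ (i, i)))) * cnj (\<Sum>j<n. cnj (x' 2 $$ (j, i)) * b j) * y' i)"
        by (intro sum.cong refl) (simp add: y x)
      then show "?F y x = ?F y' x'" by (simp only: x)
    qed
    then show ?thesis by (simp add: gam_def)
  qed
next
  show "AE w in M. (\<Sum>i<m. (cmod (complex_of_real (h (gam w i)) * cnj (\<Sum>j<n. cnj (R w $$ (j, i)) * b j)))\<^sup>2) \<le> K\<^sup>2 * s'"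
    using AE_orthonormal_R
  proof eventually_elim
    case (elim w)
    have "(\<Sum>i<m. (cmod (complex_of_real (h (gam w i)) * cnj (\<Sum>j<n. cnj (R w $$ (j, i)) * b j)))\<^sup>2)
        \<le> (\<Sum>i<m. K\<^sup>2 * (cmod (\<Sum>j<n. cnj (R w $$ (j, i)) * b j))\<^sup>2)"
      unfolding norm_mult power_mult_distrib norm_of_real complex_mod_cnj
      by (intro sum_mono mult_right_mono power_mono hK) auto
    also have "\<dots> \<le> K\<^sup>2 * s'"
      unfolding sum_distrib_left[symmetric] b[symmetric]
      by (intro mult_left_mono orthonormal_cols_bessel[OF elim]) auto
    finally show ?case .
  qed
qed (use AE_orthonormal_L m a in \<open>auto\<close>)

end

section \<open>Weighted moment limits\<close>

text \<open>A geometric sum solved for its top power. For large |z| the first term on the right is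
  small, the second is a multiple of a resolvent, and the others are lower powers: the shape needed
  to extract moments by induction.\<close>

lemma power_geometric_resolvent:
  fixes t z :: complex
  assumes "t \<noteq> z"
  shows "t ^ k = t ^ Suc k / (t - z) - z ^ Suc k / (t - z) - (\<Sum>j<k. t ^ j * z ^ (k - j))"
proof -
  have "t ^ Suc k - z ^ Suc k = (t - z) * (\<Sum>j<Suc k. t ^ j * z ^ (k - j))"
    by (subst diff_power_eq_sum) (simp add: mult.commute)
  then have "(t ^ Suc k - z ^ Suc k) / (t - z) = t ^ k + (\<Sum>j<k. t ^ j * z ^ (k - j))"
    using assms by simp
  then show ?thesis by (simp add: diff_divide_distrib algebra_simps)
qed

lemma (in prob_space) integrable_bounded_AE:
  fixes f :: "'a \<Rightarrow> 'b::{banach, second_countable_topology}"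
  assumes "f \<in> borel_measurable M" "AE x in M. norm (f x) \<le> B"
  shows "integrable M f"
  by (rule integrable_const_bound[OF assms(2,1)])

text \<open>Induction on \<open>k\<close> with the preceding identity at z = \<i> y. For fixed
  \<open>y\<close> the resolvent term converges by hypothesis and the lower powers by induction,
  while the remainder is at most K^(k+1) / y uniformly in \<open>n\<close>. So \<open>y\<close> is
  chosen first and \<open>n\<close> afterwards. Natural values of \<open>y\<close> suffice, which
  keeps the hypotheses countable.\<close>

lemma moments_of_stieltjes:
  fixes t :: "nat \<Rightarrow> nat \<Rightarrow> real"
  assumes \<pi>: "prob_space \<pi>" "sets \<pi> = sets borel" and supp: "AE x in \<pi>. \<bar>x\<bar> \<le> K"
    and t: "\<forall>\<^sub>F n in sequentially. \<forall>i<N n. \<bar>t n i\<bar> \<le> K" and N: "\<forall>\<^sub>F n in sequentially. 0 < N n"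
    and lim: "\<And>y::nat. 0 < y \<Longrightarrow> (\<lambda>n. (\<Sum>i<N n. 1 / (complex_of_real (t n i) - \<i> * of_nat y)) / of_nat (N n))
        \<longlonglongrightarrow> stieltjes \<pi> (\<i> * of_nat y)"
  shows "(\<lambda>n. (\<Sum>i<N n. complex_of_real (t n i) ^ k) / of_nat (N n)) \<longlonglongrightarrow> (LINT x|\<pi>. complex_of_real x ^ k)"
proof (induction k rule: less_induct)
  case (less k)
  interpret \<pi>: prob_space \<pi> by fact
  have [measurable_cong]: "sets \<pi> = sets borel" by fact
  have K: "0 \<le> K"
  proof -
    have "AE x in \<pi>. 0 \<le> K" using supp by eventually_elim auto
    then show ?thesis by simp
  qed
  define mn where "mn = (\<lambda>n j. (\<Sum>i<N n. complex_of_real (t n i) ^ j) / of_nat (N n))"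
  define mo where "mo = (\<lambda>j. LINT x|\<pi>. complex_of_real x ^ j)"
  define F where "F = (\<lambda>n (y::nat). (\<Sum>i<N n. 1 / (complex_of_real (t n i) - \<i> * of_nat y)) / of_nat (N n))"
  have ne: "complex_of_real s \<noteq> \<i> * of_nat y" if "0 < y" for s and y :: nat
    using that by (auto simp: complex_eq_iff)
  have cm: "real y \<le> cmod (complex_of_real s - \<i> * of_nat y)" for s and y :: nat
    using abs_Im_le_cmod[of "complex_of_real s - \<i> * of_nat y"] by simp
  have err: "cmod (complex_of_real s ^ Suc k / (complex_of_real s - \<i> * of_nat y)) \<le> K ^ Suc k / real y"
    if "0 < y" "\<bar>s\<bar> \<le> K" for s and y :: nat
    unfolding norm_divide norm_power norm_of_real
    by (intro frac_le power_mono cm) (use that K in auto)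
  have ident: "complex_of_real s ^ k = complex_of_real s ^ Suc k / (complex_of_real s - \<i> * of_nat y)
      - (\<i> * of_nat y) ^ Suc k * (1 / (complex_of_real s - \<i> * of_nat y))
      - (\<Sum>j<k. complex_of_real s ^ j * (\<i> * of_nat y) ^ (k - j))" if "0 < y" for s and y :: nat
    using power_geometric_resolvent[OF ne[OF that], of s k] by simp
  have int: "integrable \<pi> (\<lambda>x. complex_of_real x ^ j)" for j
    by (rule \<pi>.integrable_bounded_AE[where B = "K ^ j"])
      (use supp in \<open>auto simp: norm_power elim!: eventually_mono intro: power_mono\<close>)
  have int1: "integrable \<pi> (\<lambda>x. 1 / (complex_of_real x - \<i> * of_nat y))" if "0 < y" for y :: nat
  proof (rule \<pi>.integrable_bounded_AE[where B = "1 / real y"])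
    show "AE x in \<pi>. cmod (1 / (complex_of_real x - \<i> * of_nat y)) \<le> 1 / real y"
      unfolding norm_divide norm_one by (intro AE_I2 frac_le cm) (use that in auto)
  qed simp
  have int2: "integrable \<pi> (\<lambda>x. complex_of_real x ^ Suc k / (complex_of_real x - \<i> * of_nat y))"
    if "0 < y" for y :: nat
    by (rule \<pi>.integrable_bounded_AE[where B = "K ^ Suc k / real y"])
      (use supp err[OF that] in \<open>auto elim!: eventually_mono\<close>)
  have main: "\<forall>\<^sub>F n in sequentially. dist (mn n k) (mo k) < e" if "0 < e" for e
  proof -
    \<comment> \<open>There are two remainders, one for the empirical mean and one for the integral;
      the constant 4 makes their sum less than \<open>e / 2\<close>.\<close>
    obtain y :: nat where y0: "4 * K ^ Suc k / e < real y" using reals_Archimedean2 by blast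
    have "0 \<le> 4 * K ^ Suc k / e" using K \<open>0 < e\<close> by simp
    then have "0 < real y" using y0 by linarith
    moreover have "4 * K ^ Suc k < real y * e" using y0 \<open>0 < e\<close> by (simp add: pos_divide_less_eq)
    ultimately have y: "0 < y" "2 * (K ^ Suc k / real y) < e / 2"
      by (simp_all add: field_simps)
    let ?z = "\<i> * of_nat y :: complex"
    define R where "R = (\<lambda>n. cmod (?z ^ Suc k) * cmod (F n y - stieltjes \<pi> ?z)
        + (\<Sum>j<k. cmod (mn n j - mo j) * cmod (?z ^ (k - j))))"
    have "R \<longlonglongrightarrow> cmod (?z ^ Suc k) * cmod (stieltjes \<pi> ?z - stieltjes \<pi> ?z) + (\<Sum>j<k. cmod (mo j - mo j) * cmod (?z ^ (k - j)))"
      unfolding R_def F_def mn_def mo_def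
      by (intro tendsto_intros lim[OF y(1)] less.IH) auto
    then have "\<forall>\<^sub>F n in sequentially. R n < e / 2"
      using \<open>0 < e\<close> by (intro order_tendstoD(2)) auto
    with t N show ?thesis
    proof eventually_elim
      case (elim n)
      have "mn n k = (\<Sum>i<N n. complex_of_real (t n i) ^ Suc k / (complex_of_real (t n i) - ?z)) / of_nat (N n)
          - ?z ^ Suc k * F n y - (\<Sum>j<k. mn n j * ?z ^ (k - j))" (is "_ = ?E - _ - _")
      proof -
        have "mn n k = (\<Sum>i<N n. complex_of_real (t n i) ^ Suc k / (complex_of_real (t n i) - ?z)
            - ?z ^ Suc k * (1 / (complex_of_real (t n i) - ?z))
            - (\<Sum>j<k. complex_of_real (t n i) ^ j * ?z ^ (k - j))) / of_nat (N n)"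
          unfolding mn_def by (subst ident[OF y(1)]) simp
        also have "\<dots> = ?E - ?z ^ Suc k * F n y - (\<Sum>i<N n. \<Sum>j<k. complex_of_real (t n i) ^ j * ?z ^ (k - j)) / of_nat (N n)"
          unfolding F_def sum_subtractf sum_distrib_left[symmetric] diff_divide_distrib by simp
        also have "(\<Sum>i<N n. \<Sum>j<k. complex_of_real (t n i) ^ j * ?z ^ (k - j)) / of_nat (N n) = (\<Sum>j<k. mn n j * ?z ^ (k - j))"
          by (subst sum.swap) (simp add: mn_def sum_distrib_right sum_divide_distrib)
        finally show ?thesis .
      qed
      moreover have "mo k = (LINT x|\<pi>. complex_of_real x ^ Suc k / (complex_of_real x - ?z))
          - ?z ^ Suc k * stieltjes \<pi> ?z - (\<Sum>j<k. mo j * ?z ^ (k - j))" (is "_ = ?E' - _ - _")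
      proof -
        have "mo k = (LINT x|\<pi>. complex_of_real x ^ Suc k / (complex_of_real x - ?z)
            - ?z ^ Suc k * (1 / (complex_of_real x - ?z))
            - (\<Sum>j<k. complex_of_real x ^ j * ?z ^ (k - j)))"
          unfolding mo_def by (subst ident[OF y(1)]) simp
        also have "\<dots> = ?E' - ?z ^ Suc k * stieltjes \<pi> ?z - (\<Sum>j<k. mo j * ?z ^ (k - j))"
          using int int1[OF y(1)] int2[OF y(1)]
          by (simp add: stieltjes_def mo_def Bochner_Integration.integral_diff Bochner_Integration.integral_sum
              del: power_Suc times_divide_eq_right)
        finally show ?thesis .
      qed
      ultimately have "mn n k - mo k = ?E - ?E' - ?z ^ Suc k * (F n y - stieltjes \<pi> ?z)
          - (\<Sum>j<k. (mn n j - mo j) * ?z ^ (k - j))"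
        by (simp only: left_diff_distrib sum_subtractf) (simp add: algebra_simps)
      then have "cmod (mn n k - mo k) \<le> cmod ?E + cmod ?E' + cmod (?z ^ Suc k * (F n y - stieltjes \<pi> ?z))
          + cmod (\<Sum>j<k. (mn n j - mo j) * ?z ^ (k - j))"
        by (smt (verit) norm_triangle_ineq4)
      also have "\<dots> \<le> K ^ Suc k / real y + K ^ Suc k / real y + R n"
      proof -
        have "cmod (\<Sum>i<N n. complex_of_real (t n i) ^ Suc k / (complex_of_real (t n i) - ?z)) \<le> of_nat (card {..<N n}) * (K ^ Suc k / real y)"
          by (rule sum_norm_bound) (use elim err[OF y(1)] in auto)
        then have 1: "cmod ?E \<le> K ^ Suc k / real y"
          using elim by (simp add: norm_divide pos_divide_le_eq mult.commute)
        have 2: "cmod ?E' \<le> K ^ Suc k / real y"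
        proof -
          have "cmod ?E' \<le> (LINT x|\<pi>. cmod (complex_of_real x ^ Suc k / (complex_of_real x - ?z)))"
            by (rule integral_norm_bound)
          also have "\<dots> \<le> (LINT x|\<pi>. K ^ Suc k / real y)"
            by (rule integral_mono_AE) (use int2[OF y(1)] supp err[OF y(1)] in \<open>auto elim!: eventually_mono\<close>)
          finally show ?thesis by (simp add: \<pi>.prob_space)
        qed
        have 3: "cmod (\<Sum>j<k. (mn n j - mo j) * ?z ^ (k - j)) \<le> (\<Sum>j<k. cmod (mn n j - mo j) * cmod (?z ^ (k - j)))"
          by (rule order_trans[OF norm_sum]) (simp add: norm_mult)
        show ?thesis using 1 2 3 unfolding R_def norm_mult by linarith
      qed
      also have "\<dots> < e" using y(2) elim(3) by linarith
      finally show ?case by (simp add: dist_norm)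
    qed
  qed
  show ?case
    using main unfolding tendsto_iff mn_def mo_def by blast
qed

section \<open>Weak convergence of complex weights\<close>

text \<open>The complex measures with mass \<open>W n i\<close> at \<open>t n i\<close> have bounded
  total variation, and their moments tend to those of the density \<open>g\<close> against \<pi>.
  Moments are what the random sums provide directly. The filter is a parameter because limits are
  later taken along cluster filters.\<close>

definition weight_lim ::
  "nat filter \<Rightarrow> (nat \<Rightarrow> nat) \<Rightarrow> (nat \<Rightarrow> nat \<Rightarrow> real) \<Rightarrow> real measure \<Rightarrow> (nat \<Rightarrow> nat \<Rightarrow> complex) \<Rightarrow> (real \<Rightarrow> complex) \<Rightarrow> bool"
  where "weight_lim F N t \<pi> W g \<longleftrightarrow>
    (\<exists>C. \<forall>\<^sub>F n in F. (\<Sum>i<N n. cmod (W n i)) \<le> C) \<and>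
    (\<forall>k. ((\<lambda>n. \<Sum>i<N n. complex_of_real (t n i ^ k) * W n i) \<longlongrightarrow> (LINT x|\<pi>. complex_of_real (x ^ k) * g x)) F)"

lemma weight_lim_mono: "weight_lim G N t \<pi> W g \<Longrightarrow> F \<le> G \<Longrightarrow> weight_lim F N t \<pi> W g"
  unfolding weight_lim_def by (meson filter_leD tendsto_mono)

text \<open>On a compact interval bounded variation and convergence of moments give convergence
  against continuous functions, by Weierstrass approximation. The test function may itself vary with
  \<open>n\<close>, as does a resolvent evaluated at an empirical eigenvalue.\<close>

lemma weight_lim_uniform:
  assumes W: "weight_lim F N t \<pi> W g"
    and \<pi>: "prob_space \<pi>" "sets \<pi> = sets borel" and supp: "AE x in \<pi>. x \<in> {a..b}"
    and t: "\<forall>\<^sub>F n in F. \<forall>i<N n. t n i \<in> {a..b}"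
    and g: "g \<in> borel_measurable borel" "AE x in \<pi>. cmod (g x) \<le> B"
    and h: "continuous_on {a..b} h" "h \<in> borel_measurable borel"
    and H: "uniform_limit {a..b} H h F"
  shows "((\<lambda>n. \<Sum>i<N n. complex_of_real (H n (t n i)) * W n i) \<longlongrightarrow> (LINT x|\<pi>. complex_of_real (h x) * g x)) F"
  unfolding tendsto_iff
proof (intro allI impI)
  fix e :: real assume e: "0 < e"
  interpret \<pi>: prob_space \<pi> by fact
  have [measurable_cong]: "sets \<pi> = sets borel" by fact
  note [measurable] = g(1) h(2)
  obtain C where C: "\<forall>\<^sub>F n in F. (\<Sum>i<N n. cmod (W n i)) \<le> C"
    using W by (auto simp: weight_lim_def)
  have B: "0 \<le> B"
  proof -
    have "AE x in \<pi>. 0 \<le> B" using g(2) by eventually_elim (meson norm_ge_zero order_trans)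
    then show ?thesis by simp
  qed
  \<comment> \<open>Replacing \<open>H n\<close> by the polynomial costs 2 d on a measure of
    variation at most |C|, and replacing the polynomial by \<open>h\<close> under \<pi> costs d B;
    together they must stay under e / 2.\<close>
  define d where "d = e / (2 * (2 * \<bar>C\<bar> + B + 1))"
  have d: "0 < d" "d * (2 * \<bar>C\<bar> + B) < e / 2"
  proof -
    have p: "0 < 2 * \<bar>C\<bar> + B + 1" using B by linarith
    show d0: "0 < d" unfolding d_def using e p by simp
    have "d * (2 * \<bar>C\<bar> + B + 1) = e / 2" unfolding d_def using p by (simp add: field_simps)
    then show "d * (2 * \<bar>C\<bar> + B) < e / 2" using d0 by (simp add: algebra_simps)
  qed
  obtain p where p: "real_polynomial_function p" "\<And>x. x \<in> {a..b} \<Longrightarrow> \<bar>h x - p x\<bar> < d"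
    using Stone_Weierstrass_real_polynomial_function[OF compact_Icc h(1) d(1)] by blast
  then obtain cf m where pc: "p = (\<lambda>x. \<Sum>i\<le>m. cf i * x ^ i)"
    by (auto simp: real_polynomial_function_iff_sum)
  have [measurable]: "p \<in> borel_measurable borel" unfolding pc by measurable
  define K where "K = max \<bar>a\<bar> \<bar>b\<bar>"
  have int: "integrable \<pi> (\<lambda>x. complex_of_real (x ^ k) * g x)" for k
  proof (rule \<pi>.integrable_bounded_AE[where B = "K ^ k * B"])
    show "AE x in \<pi>. cmod (complex_of_real (x ^ k) * g x) \<le> K ^ k * B"
      using supp g(2) by eventually_elim
        (auto simp: norm_mult norm_power K_def intro!: mult_mono power_mono)
  qed measurable
  have hb: "\<exists>D. \<forall>x\<in>{a..b}. \<bar>h x\<bar> \<le> D"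
    using compact_continuous_image[OF h(1) compact_Icc] 
    by (auto dest!: compact_imp_bounded simp: bounded_iff)
  then obtain Dh where Dh: "\<And>x. x \<in> {a..b} \<Longrightarrow> \<bar>h x\<bar> \<le> Dh" by blast
  have inth: "integrable \<pi> (\<lambda>x. complex_of_real (h x) * g x)"
  proof (rule \<pi>.integrable_bounded_AE[where B = "Dh * B"])
    show "AE x in \<pi>. cmod (complex_of_real (h x) * g x) \<le> Dh * B"
      using supp g(2)
    proof eventually_elim
      case (elim x)
      have "\<bar>h x\<bar> * cmod (g x) \<le> Dh * B"
        by (rule mult_mono) (use Dh[OF elim(1)] elim(2) in auto)
      then show ?case by (simp add: norm_mult)
    qed
  qed measurable
  have peq: "complex_of_real (p x) * w = (\<Sum>i\<le>m. complex_of_real (cf i) * (complex_of_real (x ^ i) * w))" for x w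
    unfolding pc by (simp add: sum_distrib_right mult.assoc)
  have intp: "integrable \<pi> (\<lambda>x. complex_of_real (p x) * g x)"
    unfolding peq using int by auto
  have limp: "((\<lambda>n. \<Sum>i<N n. complex_of_real (p (t n i)) * W n i) \<longlongrightarrow> (LINT x|\<pi>. complex_of_real (p x) * g x)) F"
  proof -
    have "(LINT x|\<pi>. complex_of_real (p x) * g x) = (\<Sum>i\<le>m. complex_of_real (cf i) * (LINT x|\<pi>. complex_of_real (x ^ i) * g x))"
      unfolding peq using int by (subst Bochner_Integration.integral_sum) (auto simp: of_real_power)
    moreover have "(\<Sum>i<N n. complex_of_real (p (t n i)) * W n i)
        = (\<Sum>k\<le>m. complex_of_real (cf k) * (\<Sum>i<N n. complex_of_real (t n i ^ k) * W n i))" for n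
      unfolding peq by (subst sum.swap) (simp add: sum_distrib_left)
    ultimately show ?thesis
      using W by (auto simp: weight_lim_def intro!: tendsto_sum tendsto_mult_left)
  qed
  have 1: "\<forall>\<^sub>F n in F. dist (\<Sum>i<N n. complex_of_real (p (t n i)) * W n i) (LINT x|\<pi>. complex_of_real (p x) * g x) < e / 2"
    using limp e unfolding tendsto_iff by (meson half_gt_zero)
  have 2: "\<forall>\<^sub>F n in F. \<forall>x\<in>{a..b}. dist (H n x) (h x) < d"
    using H d(1) by (auto simp: uniform_limit_iff)
  have 3: "cmod ((LINT x|\<pi>. complex_of_real (p x) * g x) - (LINT x|\<pi>. complex_of_real (h x) * g x)) \<le> d * B"
  proof -
    have "cmod ((LINT x|\<pi>. complex_of_real (p x) * g x) - (LINT x|\<pi>. complex_of_real (h x) * g x))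
        = cmod (LINT x|\<pi>. complex_of_real (p x) * g x - complex_of_real (h x) * g x)"
      using intp inth by simp
    also have "\<dots> \<le> (LINT x|\<pi>. cmod (complex_of_real (p x) * g x - complex_of_real (h x) * g x))"
      by (rule integral_norm_bound)
    also have "\<dots> \<le> (LINT x|\<pi>. d * B)"
    proof (rule integral_mono_AE)
      show "AE x in \<pi>. cmod (complex_of_real (p x) * g x - complex_of_real (h x) * g x) \<le> d * B"
        using supp g(2)
      proof eventually_elim
        case (elim x)
        have "\<bar>p x - h x\<bar> * cmod (g x) \<le> d * B"
          by (rule mult_mono) (use p(2)[OF elim(1)] elim(2) d in \<open>auto simp: abs_minus_commute\<close>)
        then show ?case by (metis norm_mult norm_of_real of_real_diff left_diff_distrib)
      qed
    qed (use intp inth in auto)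
    finally show ?thesis by (simp add: \<pi>.prob_space)
  qed
  show "\<forall>\<^sub>F n in F. dist (\<Sum>i<N n. complex_of_real (H n (t n i)) * W n i) (LINT x|\<pi>. complex_of_real (h x) * g x) < e"
    using 1 2 C t
  proof eventually_elim
    case (elim n)
    have "cmod ((\<Sum>i<N n. complex_of_real (H n (t n i)) * W n i) - (\<Sum>i<N n. complex_of_real (p (t n i)) * W n i))
        = cmod (\<Sum>i<N n. complex_of_real (H n (t n i) - p (t n i)) * W n i)"
      by (simp add: sum_subtractf left_diff_distrib)
    also have "\<dots> \<le> (\<Sum>i<N n. (2 * d) * cmod (W n i))"
    proof (rule sum_norm_le)
      fix i assume "i \<in> {..<N n}"
      then have "t n i \<in> {a..b}" using elim(4) by auto
      then have "\<bar>H n (t n i) - p (t n i)\<bar> \<le> 2 * d"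
        using elim(2) p(2)[of "t n i"] unfolding dist_real_def by (smt (verit))
      then show "cmod (complex_of_real (H n (t n i) - p (t n i)) * W n i) \<le> (2 * d) * cmod (W n i)"
        unfolding norm_mult norm_of_real by (rule mult_right_mono) auto
    qed
    also have "\<dots> = 2 * d * (\<Sum>i<N n. cmod (W n i))" by (simp add: sum_distrib_left)
    also have "\<dots> \<le> 2 * d * \<bar>C\<bar>" using elim(3) d(1) by (intro mult_left_mono) auto
    finally have "dist (\<Sum>i<N n. complex_of_real (H n (t n i)) * W n i) (\<Sum>i<N n. complex_of_real (p (t n i)) * W n i) \<le> 2 * d * \<bar>C\<bar>"
      by (simp add: dist_norm)
    moreover have "dist (LINT x|\<pi>. complex_of_real (p x) * g x) (LINT x|\<pi>. complex_of_real (h x) * g x) \<le> d * B"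
      using 3 by (simp add: dist_norm)
    moreover have "2 * d * \<bar>C\<bar> + d * B < e / 2" using d(2) by (simp add: algebra_simps)
    ultimately show ?case
      using elim(1)
        dist_triangle[of "\<Sum>i<N n. complex_of_real (H n (t n i)) * W n i" "LINT x|\<pi>. complex_of_real (h x) * g x"
          "\<Sum>i<N n. complex_of_real (p (t n i)) * W n i"]
        dist_triangle[of "\<Sum>i<N n. complex_of_real (p (t n i)) * W n i" "LINT x|\<pi>. complex_of_real (h x) * g x"
          "LINT x|\<pi>. complex_of_real (p x) * g x"]
      by linarith
  qed
qed

section \<open>Cluster points along finer filters\<close>

text \<open>The role of repeated extraction of subsequences is played by refining a filter once per
  member of the family; convergence already reached survives each refinement.\<close>

lemma finite_family_cluster:
  fixes f :: "'i \<Rightarrow> nat \<Rightarrow> 'a::heine_borel"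
  assumes "finite I" "G \<noteq> bot" "\<And>i. i \<in> I \<Longrightarrow> \<exists>S. bounded S \<and> eventually (\<lambda>n. f i n \<in> S) G"
  shows "\<exists>F\<le>G. F \<noteq> bot \<and> (\<forall>i\<in>I. \<exists>l. (f i \<longlongrightarrow> l) F)"
  using assms(1,3)
proof (induction I)
  case empty then show ?case using assms(2) by auto
next
  case (insert i I)
  then obtain F where F: "F \<le> G" "F \<noteq> bot" "\<And>j. j \<in> I \<Longrightarrow> \<exists>l. (f j \<longlongrightarrow> l) F" by auto
  obtain S where S: "bounded S" "eventually (\<lambda>n. f i n \<in> S) G" using insert.prems by blast
  have "compact (closure S)" using S(1) by (simp add: compact_closure)
  moreover have "eventually (\<lambda>x. x \<in> closure S) (filtermap (f i) F)"
    unfolding eventually_filtermap using filter_leD[OF F(1) S(2)]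
    by (auto elim!: eventually_mono intro: closure_subset[THEN subsetD])
  ultimately obtain x where x: "inf (nhds x) (filtermap (f i) F) \<noteq> bot"
    using F(2) unfolding compact_filter by (metis filtermap_bot_iff)
  \<comment> \<open>Pulling back the neighbourhoods of the cluster point \<open>x\<close> forces
    convergence to \<open>x\<close>; being a cluster point is exactly what keeps the refined filter
    proper.\<close>
  let ?F = "inf (filtercomap (f i) (nhds x)) F"
  have "?F \<noteq> bot"
  proof
    assume "?F = bot"
    then obtain P Q where PQ: "eventually P (filtercomap (f i) (nhds x))" "eventually Q F" "\<And>y. \<not> (P y \<and> Q y)"
      unfolding trivial_limit_def eventually_inf by auto
    then obtain R where R: "eventually R (nhds x)" "\<And>y. R (f i y) \<Longrightarrow> P y"
      unfolding eventually_filtercomap by auto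
    have "eventually (\<lambda>y. \<not> R y) (filtermap (f i) F)"
      unfolding eventually_filtermap using PQ(2) by (rule eventually_mono) (use PQ(3) R(2) in blast)
    then have "eventually (\<lambda>_. False) (inf (nhds x) (filtermap (f i) F))"
      unfolding eventually_inf using R(1) by blast
    then show False using x by (simp add: trivial_limit_def)
  qed
  moreover have "(f i \<longlongrightarrow> x) ?F"
    by (metis filterlim_filtercomap filterlim_mono inf.cobounded1 order_refl)
  moreover have le: "?F \<le> F" by simp
  moreover have "?F \<le> G" using le F(1) by (rule order_trans)
  moreover have "\<exists>l. (f j \<longlongrightarrow> l) ?F" if "j \<in> I" for j
    using F(3)[OF that] tendsto_mono[OF le] by blast
  ultimately show ?case
    by (intro exI[of _ ?F]) auto
qed

text \<open>If convergence failed, restrict to the indices at distance at least \<open>e\<close>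
  from the limit: this is a proper filter none of whose proper refinements can converge to
  \<open>l\<close>.\<close>

lemma tendsto_by_clusters:
  fixes f :: "nat \<Rightarrow> 'a::metric_space"
  assumes "\<And>G. G \<le> sequentially \<Longrightarrow> G \<noteq> bot \<Longrightarrow> \<exists>F\<le>G. F \<noteq> bot \<and> (f \<longlongrightarrow> l) F"
  shows "f \<longlonglongrightarrow> l"
proof (rule ccontr)
  assume "\<not> f \<longlonglongrightarrow> l"
  then obtain e where e: "0 < e" "\<not> (\<forall>\<^sub>F n in sequentially. dist (f n) l < e)"
    unfolding tendsto_iff by blast
  let ?G = "inf sequentially (principal {n. \<not> dist (f n) l < e})"
  have "?G \<noteq> bot"
    using e(2) by (auto simp: trivial_limit_def eventually_inf_principal)
  then obtain F where F: "F \<le> ?G" "F \<noteq> bot" "(f \<longlongrightarrow> l) F" using assms[of ?G] by auto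
  have "\<forall>\<^sub>F n in F. dist (f n) l < e" using F(3) e(1) by (auto simp: tendsto_iff)
  moreover have "\<forall>\<^sub>F n in F. \<not> dist (f n) l < e"
    by (rule filter_leD[OF F(1)]) (simp add: eventually_inf_principal)
  ultimately have "\<forall>\<^sub>F n in F. False" by eventually_elim auto
  then show False using F(2) by (simp add: trivial_limit_def)
qed

section \<open>Almost sure limits for the noise\<close>

lemma weight_lim_cnj:
  assumes "weight_lim F N t \<pi> W g"
  shows "weight_lim F N t \<pi> (\<lambda>n i. cnj (W n i)) (\<lambda>x. cnj (g x))"
proof -
  have "((\<lambda>n. \<Sum>i<N n. complex_of_real (t n i ^ k) * cnj (W n i)) \<longlongrightarrow> (LINT x|\<pi>. complex_of_real (x ^ k) * cnj (g x))) F" for k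
  proof -
    have "((\<lambda>n. cnj (\<Sum>i<N n. complex_of_real (t n i ^ k) * W n i)) \<longlongrightarrow> cnj (LINT x|\<pi>. complex_of_real (x ^ k) * g x)) F"
      using assms by (intro tendsto_cnj) (auto simp: weight_lim_def)
    moreover have "cnj (LINT x|\<pi>. complex_of_real (x ^ k) * g x) = (LINT x|\<pi>. cnj (complex_of_real (x ^ k) * g x))"
      by (rule Bochner_Integration.integral_cnj[symmetric])
    ultimately show ?thesis by simp
  qed
  then show ?thesis using assms by (simp add: weight_lim_def)
qed

lemma eventually_linear_lower_bound:
  assumes "(\<lambda>n. real (N n) / real n) \<longlonglongrightarrow> c" "0 < c"
  shows "\<forall>\<^sub>F n in sequentially. 0 < N n \<and> real n * (c / 2) \<le> real (N n)"
proof -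
  have "\<forall>\<^sub>F n in sequentially. c / 2 < real (N n) / real n"
    using assms by (intro order_tendstoD(1)) auto
  then show ?thesis using eventually_gt_at_top[of 0]
  proof eventually_elim
    case (elim n)
    then have "real n * (c / 2) < real (N n)" by (simp add: pos_less_divide_eq mult.commute)
    moreover have "0 \<le> real n * (c / 2)" using assms(2) by simp
    ultimately show ?case by (metis less_eq_real_def of_nat_0_less_iff order_le_less_trans)
  qed
qed

lemma filterlim_linear_ratio:
  assumes "(\<lambda>n. real (N n) / real n) \<longlonglongrightarrow> c" "0 < c"
  shows "filterlim N at_top sequentially"
proof -
  have "filterlim (\<lambda>n. real n * (c / 2)) at_top sequentially"
    by (rule filterlim_at_top_mult_tendsto_pos[OF tendsto_const _ filterlim_real_sequentially]) (use assms in simp)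
  then have "filterlim (\<lambda>n. real (N n)) at_top sequentially"
    by (rule filterlim_at_top_mono) (use eventually_linear_lower_bound[OF assms] in \<open>auto elim!: eventually_mono\<close>)
  then show ?thesis by (simp add: filterlim_sequentially_iff_filterlim_real)
qed

text \<open>Only u + v and u + \<i> v are needed, since the first recovers the real part of the
  product and the second its imaginary part.\<close>

lemma polarization:
  "cnj u * v = (complex_of_real ((cmod (u + v))\<^sup>2) - complex_of_real ((cmod u)\<^sup>2) - complex_of_real ((cmod v)\<^sup>2)) / 2
    + \<i> * (complex_of_real ((cmod u)\<^sup>2) + complex_of_real ((cmod v)\<^sup>2) - complex_of_real ((cmod (u + \<i> * v))\<^sup>2)) / 2"
  by (simp add: complex_eq_iff cmod_power2) (simp add: power2_eq_square algebra_simps)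

lemma norm_bound_add:
  assumes "\<And>n. (\<Sum>j<m n. (cmod (a n j))\<^sup>2) \<le> C" "\<And>n. (\<Sum>j<m n. (cmod (b n j))\<^sup>2) \<le> C" "cmod z = 1"
  shows "(\<Sum>j<m n. (cmod (a n j + z * b n j))\<^sup>2) \<le> 4 * C"
proof -
  have "(\<Sum>j<m n. (cmod (a n j + z * b n j))\<^sup>2) \<le> (\<Sum>j<m n. 2 * (cmod (a n j))\<^sup>2 + 2 * (cmod (b n j))\<^sup>2)"
  proof (rule sum_mono)
    fix j
    have "cmod (a n j + z * b n j) \<le> cmod (a n j) + cmod (b n j)"
      using norm_triangle_ineq[of "a n j" "z * b n j"] assms(3) by (simp add: norm_mult)
    then have "(cmod (a n j + z * b n j))\<^sup>2 \<le> (cmod (a n j) + cmod (b n j))\<^sup>2" by (intro power_mono) auto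
    also have "\<dots> \<le> 2 * (cmod (a n j))\<^sup>2 + 2 * (cmod (b n j))\<^sup>2"
      by (smt (verit) power2_diff power2_sum zero_le_power2)
    finally show "(cmod (a n j + z * b n j))\<^sup>2 \<le> 2 * (cmod (a n j))\<^sup>2 + 2 * (cmod (b n j))\<^sup>2" .
  qed
  also have "\<dots> \<le> 4 * C" using assms(1,2)[of n] by (simp add: sum.distrib flip: sum_distrib_left)
  finally show ?thesis .
qed

lemma sum_cmod_mult_le:
  "(\<Sum>i\<in>I. cmod (u i * v i)) \<le> (\<Sum>i\<in>I. (cmod (u i))\<^sup>2) + (\<Sum>i\<in>I. (cmod (v i))\<^sup>2)"
proof -
  have "cmod (u i * v i) \<le> (cmod (u i))\<^sup>2 + (cmod (v i))\<^sup>2" for i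
  proof -
    have "0 \<le> cmod (u i) * cmod (v i)" by simp
    then show ?thesis
      using sum_squares_bound[of "cmod (u i)" "cmod (v i)"] unfolding norm_mult by linarith
  qed
  then show ?thesis unfolding sum.distrib[symmetric] by (intro sum_mono)
qed

section \<open>Almost sure weight limits along the sequence of models\<close>

locale haar_sequence = prob_space M for M :: "'w measure" +
  fixes N :: "nat \<Rightarrow> nat" and c :: real and L Gam R :: "nat \<Rightarrow> 'w \<Rightarrow> complex mat"
    and \<pi> :: "real measure" and B :: real
  assumes model: "\<And>n. haar_model M (N n) n (L n) (Gam n) (R n)"
    and N_le: "\<And>n. N n \<le> n" and N_lim: "(\<lambda>n. real (N n) / real n) \<longlonglongrightarrow> c" and c_pos: "0 < c"
    and gam_bound: "AE w in M. \<forall>\<^sub>F n in sequentially. \<forall>i<N n. (Re (Gam n w $$ (i, i)))\<^sup>2 \<le> B"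
    and trace_lim: "AE w in M. \<forall>k. (\<lambda>n. (\<Sum>i<N n. complex_of_real ((Re (Gam n w $$ (i, i)))\<^sup>2) ^ k) / of_nat (N n))
        \<longlonglongrightarrow> (LINT x|\<pi>. complex_of_real x ^ k)"
begin

definition ga :: "'w \<Rightarrow> nat \<Rightarrow> nat \<Rightarrow> real" where "ga w n i = Re (Gam n w $$ (i, i))"
definition lco :: "(nat \<Rightarrow> nat \<Rightarrow> complex) \<Rightarrow> 'w \<Rightarrow> nat \<Rightarrow> nat \<Rightarrow> complex" where
  "lco a w n i = (\<Sum>j<N n. cnj (L n w $$ (j, i)) * a n j)"
definition rco :: "(nat \<Rightarrow> nat \<Rightarrow> complex) \<Rightarrow> 'w \<Rightarrow> nat \<Rightarrow> nat \<Rightarrow> complex" where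
  "rco b w n i = (\<Sum>j<n. cnj (R n w $$ (j, i)) * b n j)"

lemma N_large: "\<forall>\<^sub>F n in sequentially. 0 < N n \<and> real n * (c / 2) \<le> real (N n)"
  by (rule eventually_linear_lower_bound[OF N_lim c_pos])

lemma measurable_seq [measurable]:
  "i < N n \<Longrightarrow> j < N n \<Longrightarrow> (\<lambda>w. L n w $$ (i, j)) \<in> borel_measurable M"
  "i < n \<Longrightarrow> j < N n \<Longrightarrow> (\<lambda>w. R n w $$ (i, j)) \<in> borel_measurable M"
  "i < N n \<Longrightarrow> (\<lambda>w. ga w n i) \<in> borel_measurable M"
  using haar_model.measurable_entries[OF model, of _ n] by (auto simp: haar_model.gam_def[OF model] ga_def)

lemma quadratic_L:
  assumes h [measurable]: "h \<in> borel_measurable borel" and hK: "\<And>x. \<bar>h x\<bar> \<le> K"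
    and a: "\<And>n. (\<Sum>j<N n. (cmod (a n j))\<^sup>2) \<le> C"
  shows "AE w in M. (\<lambda>n. (\<Sum>i<N n. h (ga w n i) * (cmod (lco a w n i))\<^sup>2)
      - (\<Sum>j<N n. (cmod (a n j))\<^sup>2) / N n * (\<Sum>i<N n. h (ga w n i))) \<longlonglongrightarrow> 0"
\<comment> \<open>The moment bound is of order \<open>N n\<close>^-2; eventually \<open>N n\<close>
  is at least n c / 2, which produces the factor (2 / c)^2 against n^-2.\<close>
proof (rule AE_tendsto_zero_fourth_moment[where C = "1296 * K ^ 4 * C ^ 4 * (2 / c)\<^sup>2"])
  have C: "0 \<le> C" using a[of 0] by (meson order_trans sum_nonneg zero_le_power2)
  have K: "0 \<le> K" using hK[of 0] by linarith
  show "\<forall>\<^sub>F n in sequentially. (\<integral>\<^sup>+w. ennreal (\<bar>(\<Sum>i<N n. h (ga w n i) * (cmod (lco a w n i))\<^sup>2)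
      - (\<Sum>j<N n. (cmod (a n j))\<^sup>2) / N n * (\<Sum>i<N n. h (ga w n i))\<bar> ^ 4) \<partial>M)
      \<le> ennreal (1296 * K ^ 4 * C ^ 4 * (2 / c)\<^sup>2 / (real n)\<^sup>2)"
    using N_large eventually_gt_at_top[of 0]
  proof eventually_elim
    case (elim n)
    let ?s = "\<Sum>j<N n. (cmod (a n j))\<^sup>2"
    have "(\<integral>\<^sup>+w. ennreal (\<bar>(\<Sum>i<N n. h (ga w n i) * (cmod (lco a w n i))\<^sup>2)
      - ?s / N n * (\<Sum>i<N n. h (ga w n i))\<bar> ^ 4) \<partial>M) \<le> ennreal (1296 * K ^ 4 * ?s ^ 4 / (real (N n))\<^sup>2)"
      using haar_model.quadratic_moment_L[OF model, of h K n "a n" ?s] elim h hK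
      by (simp add: haar_model.gam_def[OF model] ga_def lco_def)
    also have "1296 * K ^ 4 * ?s ^ 4 / (real (N n))\<^sup>2 \<le> 1296 * K ^ 4 * C ^ 4 / (real n * (c / 2))\<^sup>2"
      using elim c_pos C K a[of n]
      by (intro frac_le mult_left_mono power_mono) (auto intro!: sum_nonneg)
    also have "\<dots> = 1296 * K ^ 4 * C ^ 4 * (2 / c)\<^sup>2 / (real n)\<^sup>2"
      by (simp add: power_mult_distrib power_divide)
    finally show ?case by (simp add: ennreal_leI)
  qed
  show "0 \<le> 1296 * K ^ 4 * C ^ 4 * (2 / c)\<^sup>2" by simp
qed (unfold lco_def, measurable)

lemma quadratic_R:
  assumes h [measurable]: "h \<in> borel_measurable borel" and hK: "\<And>x. \<bar>h x\<bar> \<le> K"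
    and a: "\<And>n. (\<Sum>j<n. (cmod (a n j))\<^sup>2) \<le> C"
  shows "AE w in M. (\<lambda>n. (\<Sum>i<N n. h (ga w n i) * (cmod (rco a w n i))\<^sup>2)
      - (\<Sum>j<n. (cmod (a n j))\<^sup>2) / n * (\<Sum>i<N n. h (ga w n i))) \<longlonglongrightarrow> 0"
proof (rule AE_tendsto_zero_fourth_moment[where C = "1296 * K ^ 4 * C ^ 4"])
  have C: "0 \<le> C" using a[of 0] by (meson order_trans sum_nonneg zero_le_power2)
  have K: "0 \<le> K" using hK[of 0] by linarith
  show "\<forall>\<^sub>F n in sequentially. (\<integral>\<^sup>+w. ennreal (\<bar>(\<Sum>i<N n. h (ga w n i) * (cmod (rco a w n i))\<^sup>2)
      - (\<Sum>j<n. (cmod (a n j))\<^sup>2) / n * (\<Sum>i<N n. h (ga w n i))\<bar> ^ 4) \<partial>M)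
      \<le> ennreal (1296 * K ^ 4 * C ^ 4 / (real n)\<^sup>2)"
    using eventually_gt_at_top[of 0]
  proof eventually_elim
    case (elim n)
    let ?s = "\<Sum>j<n. (cmod (a n j))\<^sup>2"
    have "(\<integral>\<^sup>+w. ennreal (\<bar>(\<Sum>i<N n. h (ga w n i) * (cmod (rco a w n i))\<^sup>2)
      - ?s / n * (\<Sum>i<N n. h (ga w n i))\<bar> ^ 4) \<partial>M) \<le> ennreal (1296 * K ^ 4 * ?s ^ 4 / (real n)\<^sup>2)"
      using haar_model.quadratic_moment_R[OF model, of h K n "a n" ?s] elim h hK N_le[of n]
      by (simp add: haar_model.gam_def[OF model] ga_def rco_def)
    also have "1296 * K ^ 4 * ?s ^ 4 / (real n)\<^sup>2 \<le> 1296 * K ^ 4 * C ^ 4 / (real n)\<^sup>2"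
      using elim C K a[of n]
      by (intro divide_right_mono mult_left_mono power_mono) (auto intro!: sum_nonneg)
    finally show ?case by (simp add: ennreal_leI)
  qed
  show "0 \<le> 1296 * K ^ 4 * C ^ 4" by simp
qed (unfold rco_def, measurable)

lemma cross_LR:
  assumes h [measurable]: "h \<in> borel_measurable borel" and hK: "\<And>x. \<bar>h x\<bar> \<le> K"
    and a: "\<And>n. (\<Sum>j<N n. (cmod (a n j))\<^sup>2) \<le> C" and b: "\<And>n. (\<Sum>j<n. (cmod (b n j))\<^sup>2) \<le> C"
  shows "AE w in M. (\<lambda>n. \<Sum>i<N n. complex_of_real (h (ga w n i)) * cnj (rco b w n i) * lco a w n i) \<longlonglongrightarrow> 0"
proof -
  have C: "0 \<le> C" using a[of 0] by (meson order_trans sum_nonneg zero_le_power2)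
  have K: "0 \<le> K" using hK[of 0] by linarith
  have "AE w in M. (\<lambda>n. cmod (\<Sum>i<N n. complex_of_real (h (ga w n i)) * cnj (rco b w n i) * lco a w n i)) \<longlonglongrightarrow> 0"
  proof (rule AE_tendsto_zero_fourth_moment[where C = "18 * (K\<^sup>2 * C)\<^sup>2 * C\<^sup>2 * (2 / c)\<^sup>2"])
    show "\<forall>\<^sub>F n in sequentially. (\<integral>\<^sup>+w. ennreal (\<bar>cmod (\<Sum>i<N n. complex_of_real (h (ga w n i)) * cnj (rco b w n i) * lco a w n i)\<bar> ^ 4) \<partial>M)
        \<le> ennreal (18 * (K\<^sup>2 * C)\<^sup>2 * C\<^sup>2 * (2 / c)\<^sup>2 / (real n)\<^sup>2)"
      using N_large eventually_gt_at_top[of 0]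
    proof eventually_elim
      case (elim n)
      let ?s = "\<Sum>j<N n. (cmod (a n j))\<^sup>2" and ?s' = "\<Sum>j<n. (cmod (b n j))\<^sup>2"
      have "(\<integral>\<^sup>+w. ennreal (\<bar>cmod (\<Sum>i<N n. complex_of_real (h (ga w n i)) * cnj (rco b w n i) * lco a w n i)\<bar> ^ 4) \<partial>M)
          \<le> ennreal (18 * (K\<^sup>2 * ?s')\<^sup>2 * ?s\<^sup>2 / (real (N n))\<^sup>2)"
        using haar_model.cross_moment[OF model, of h K n "a n" ?s "b n" ?s'] elim h hK
        by (simp add: haar_model.gam_def[OF model] ga_def rco_def lco_def del: cnj_sum)
      also have "18 * (K\<^sup>2 * ?s')\<^sup>2 * ?s\<^sup>2 / (real (N n))\<^sup>2 \<le> 18 * (K\<^sup>2 * C)\<^sup>2 * C\<^sup>2 / (real n * (c / 2))\<^sup>2"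
        using elim c_pos C K a[of n] b[of n]
        by (intro frac_le mult_mono power_mono order_refl) (auto intro!: sum_nonneg mult_nonneg_nonneg)
      also have "\<dots> = 18 * (K\<^sup>2 * C)\<^sup>2 * C\<^sup>2 * (2 / c)\<^sup>2 / (real n)\<^sup>2"
        by (simp add: power_mult_distrib power_divide)
      finally show ?case by (simp add: ennreal_leI)
    qed
    show "0 \<le> 18 * (K\<^sup>2 * C)\<^sup>2 * C\<^sup>2 * (2 / c)\<^sup>2" using C by simp
  qed (unfold rco_def lco_def, measurable)
  then show ?thesis by (simp add: tendsto_norm_zero_iff)
qed

text \<open>Polarization is applied simultaneously to the random sums and to the deterministic inner
  products. The normalisation \<open>d n\<close> is left open: it is \<open>N n\<close> on the side
  of \<open>L\<close> and \<open>n\<close> on the side of \<open>R\<close>.\<close>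

lemma bilinear_from_quadratic:
  fixes y :: "(nat \<Rightarrow> nat \<Rightarrow> complex) \<Rightarrow> 'w \<Rightarrow> nat \<Rightarrow> nat \<Rightarrow> complex" and m d :: "nat \<Rightarrow> nat" and hh :: "'w \<Rightarrow> nat \<Rightarrow> nat \<Rightarrow> real"
  assumes quad: "\<And>a C. (\<And>n. (\<Sum>j<m n. (cmod (a n j))\<^sup>2) \<le> C) \<Longrightarrow>
      AE w in M. (\<lambda>n. (\<Sum>i<N n. hh w n i * (cmod (y a w n i))\<^sup>2) - (\<Sum>j<m n. (cmod (a n j))\<^sup>2) / d n * (\<Sum>i<N n. hh w n i)) \<longlonglongrightarrow> 0"
    and lin: "\<And>a b z w n i. y (\<lambda>n j. a n j + z * b n j) w n i = y a w n i + z * y b w n i"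
    and a: "\<And>n. (\<Sum>j<m n. (cmod (a n j))\<^sup>2) \<le> C" and b: "\<And>n. (\<Sum>j<m n. (cmod (b n j))\<^sup>2) \<le> C"
  shows "AE w in M. (\<lambda>n. (\<Sum>i<N n. complex_of_real (hh w n i) * (cnj (y a w n i) * y b w n i))
      - (\<Sum>j<m n. cnj (a n j) * b n j) / of_nat (d n) * (\<Sum>i<N n. complex_of_real (hh w n i))) \<longlonglongrightarrow> 0"
proof -
  define Q where "Q = (\<lambda>a w n. complex_of_real ((\<Sum>i<N n. hh w n i * (cmod (y a w n i))\<^sup>2)
      - (\<Sum>j<m n. (cmod (a n j))\<^sup>2) / d n * (\<Sum>i<N n. hh w n i)))"
  have Q: "AE w in M. (\<lambda>n. Q f w n) \<longlonglongrightarrow> 0" if "\<And>n. (\<Sum>j<m n. (cmod (f n j))\<^sup>2) \<le> C'" for f C'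
    using quad[OF that]
  proof eventually_elim
    case (elim w)
    have "(\<lambda>n. Q f w n) \<longlonglongrightarrow> complex_of_real 0"
      unfolding Q_def by (rule tendsto_of_real) (rule elim)
    then show ?case by simp
  qed
  have id: "(\<Sum>i<N n. complex_of_real (hh w n i) * (cnj (y a w n i) * y b w n i))
      - (\<Sum>j<m n. cnj (a n j) * b n j) / of_nat (d n) * (\<Sum>i<N n. complex_of_real (hh w n i))
      = (Q (\<lambda>n j. a n j + 1 * b n j) w n - Q a w n - Q b w n) / 2
        + \<i> * (Q a w n + Q b w n - Q (\<lambda>n j. a n j + \<i> * b n j) w n) / 2" for w n
  proof -
    have Qe: "Q f w n = (\<Sum>i<N n. complex_of_real (hh w n i) * complex_of_real ((cmod (y f w n i))\<^sup>2))
      - (\<Sum>j<m n. complex_of_real ((cmod (f n j))\<^sup>2)) / of_nat (d n) * (\<Sum>i<N n. complex_of_real (hh w n i))" for f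
      by (simp add: Q_def)
    have s: "(\<Sum>k\<in>I. g k * (cnj (u k) * v k)) = ((\<Sum>k\<in>I. g k * complex_of_real ((cmod (u k + 1 * v k))\<^sup>2))
        - (\<Sum>k\<in>I. g k * complex_of_real ((cmod (u k))\<^sup>2)) - (\<Sum>k\<in>I. g k * complex_of_real ((cmod (v k))\<^sup>2))) / 2
        + \<i> * ((\<Sum>k\<in>I. g k * complex_of_real ((cmod (u k))\<^sup>2)) + (\<Sum>k\<in>I. g k * complex_of_real ((cmod (v k))\<^sup>2))
         - (\<Sum>k\<in>I. g k * complex_of_real ((cmod (u k + \<i> * v k))\<^sup>2))) / 2" for g u v and I :: "nat set"
    proof -
      have "(\<Sum>k\<in>I. g k * (cnj (u k) * v k)) = (\<Sum>k\<in>I. (g k * complex_of_real ((cmod (u k + 1 * v k))\<^sup>2)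
        - g k * complex_of_real ((cmod (u k))\<^sup>2) - g k * complex_of_real ((cmod (v k))\<^sup>2)) / 2
        + \<i> * (g k * complex_of_real ((cmod (u k))\<^sup>2) + g k * complex_of_real ((cmod (v k))\<^sup>2)
         - g k * complex_of_real ((cmod (u k + \<i> * v k))\<^sup>2)) / 2)"
        by (intro sum.cong refl, subst polarization) (simp add: field_simps)
      then show ?thesis
        by (simp only: sum.distrib sum_subtractf sum_divide_distrib[symmetric] sum_distrib_left[symmetric])
    qed
    have alg: "((A1 - A2 - A3) / 2 + \<i> * (A2 + A3 - A4) / 2) - ((P1 - P2 - P3) / 2 + \<i> * (P2 + P3 - P4) / 2) / dd * H
        = ((A1 - P1 / dd * H) - (A2 - P2 / dd * H) - (A3 - P3 / dd * H)) / 2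
          + \<i> * ((A2 - P2 / dd * H) + (A3 - P3 / dd * H) - (A4 - P4 / dd * H)) / 2" for A1 A2 A3 A4 P1 P2 P3 P4 dd H :: complex
      by (simp add: algebra_simps diff_divide_distrib add_divide_distrib)
    have s1: "(\<Sum>k\<in>I. cnj (u k) * v k) = ((\<Sum>k\<in>I. complex_of_real ((cmod (u k + 1 * v k))\<^sup>2))
        - (\<Sum>k\<in>I. complex_of_real ((cmod (u k))\<^sup>2)) - (\<Sum>k\<in>I. complex_of_real ((cmod (v k))\<^sup>2))) / 2
        + \<i> * ((\<Sum>k\<in>I. complex_of_real ((cmod (u k))\<^sup>2)) + (\<Sum>k\<in>I. complex_of_real ((cmod (v k))\<^sup>2))
         - (\<Sum>k\<in>I. complex_of_real ((cmod (u k + \<i> * v k))\<^sup>2))) / 2" for u v and I :: "nat set"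
      using s[of "\<lambda>_. 1" u v I] by (simp del: of_real_power)
    have e1: "Q (\<lambda>n j. a n j + z * b n j) w n = (\<Sum>i<N n. complex_of_real (hh w n i) * complex_of_real ((cmod (y a w n i + z * y b w n i))\<^sup>2))
      - (\<Sum>j<m n. complex_of_real ((cmod (a n j + z * b n j))\<^sup>2)) / of_nat (d n) * (\<Sum>i<N n. complex_of_real (hh w n i))" for z
      by (subst Qe) (simp only: lin)
    show ?thesis
      unfolding s[of "\<lambda>i. complex_of_real (hh w n i)" "\<lambda>i. y a w n i" "\<lambda>i. y b w n i" "{..<N n}"]
        s1[of "\<lambda>j. a n j" "\<lambda>j. b n j" "{..<m n}"] e1[of 1] e1[of \<i>] Qe[of a] Qe[of b]
      by (rule alg)
  qed
  have qz: "AE w in M. (\<lambda>n. Q (\<lambda>n j. a n j + z * b n j) w n) \<longlonglongrightarrow> 0" if "cmod z = 1" for z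
    by (rule Q) (rule norm_bound_add[OF a b that])
  have "AE w in M. (\<lambda>n. Q a w n) \<longlonglongrightarrow> 0" "AE w in M. (\<lambda>n. Q b w n) \<longlonglongrightarrow> 0"
    "AE w in M. (\<lambda>n. Q (\<lambda>n j. a n j + 1 * b n j) w n) \<longlonglongrightarrow> 0" "AE w in M. (\<lambda>n. Q (\<lambda>n j. a n j + \<i> * b n j) w n) \<longlonglongrightarrow> 0"
    using Q[OF a] Q[OF b] qz[of 1] qz[of \<i>] by simp_all
  then show ?thesis unfolding id
  proof eventually_elim
    case (elim w)
    have "(\<lambda>n. (Q (\<lambda>n j. a n j + 1 * b n j) w n - Q a w n - Q b w n) / 2
        + \<i> * (Q a w n + Q b w n - Q (\<lambda>n j. a n j + \<i> * b n j) w n) / 2) \<longlonglongrightarrow> (0 - 0 - 0) / 2 + \<i> * (0 + 0 - 0) / 2"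
      by (intro tendsto_intros elim) auto
    then show ?case by simp
  qed
qed

text \<open>Powers are unbounded, but the moment estimates need a bounded test function. By
  \<open>gam_bound\<close> the cut has almost surely no effect for large \<open>n\<close>.\<close>

definition trunc :: "nat \<Rightarrow> real \<Rightarrow> real" where
  "trunc k x = (if x\<^sup>2 \<le> B then x ^ k else 0)"

lemma trunc_measurable [measurable]: "trunc k \<in> borel_measurable borel"
  unfolding trunc_def by measurable

lemma trunc_bound: "\<bar>trunc k x\<bar> \<le> (sqrt \<bar>B\<bar>) ^ k"
proof (cases "x\<^sup>2 \<le> B")
  case True
  then have "\<bar>x\<bar> \<le> sqrt \<bar>B\<bar>" by (intro real_le_rsqrt) auto
  then show ?thesis using True by (simp add: trunc_def power_abs power_mono)
qed (simp add: trunc_def)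

lemma lco_linear: "lco (\<lambda>n j. a n j + z * b n j) w n i = lco a w n i + z * lco b w n i"
  by (simp add: lco_def sum.distrib sum_distrib_left algebra_simps)

lemma rco_linear: "rco (\<lambda>n j. a n j + z * b n j) w n i = rco a w n i + z * rco b w n i"
  by (simp add: rco_def sum.distrib sum_distrib_left algebra_simps)

lemma AE_lco_bound: "AE w in M. \<forall>n. (\<Sum>i<N n. (cmod (lco a w n i))\<^sup>2) \<le> (\<Sum>j<N n. (cmod (a n j))\<^sup>2)"
  unfolding AE_all_countable
proof
  fix n
  show "AE w in M. (\<Sum>i<N n. (cmod (lco a w n i))\<^sup>2) \<le> (\<Sum>j<N n. (cmod (a n j))\<^sup>2)"
    using haar_model.AE_orthonormal_L[OF model, of n]
    by eventually_elim (use orthonormal_cols_bessel in \<open>auto simp: lco_def\<close>)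
qed

lemma AE_rco_bound: "AE w in M. \<forall>n. (\<Sum>i<N n. (cmod (rco a w n i))\<^sup>2) \<le> (\<Sum>j<n. (cmod (a n j))\<^sup>2)"
  unfolding AE_all_countable
proof
  fix n
  show "AE w in M. (\<Sum>i<N n. (cmod (rco a w n i))\<^sup>2) \<le> (\<Sum>j<n. (cmod (a n j))\<^sup>2)"
    using haar_model.AE_orthonormal_R[OF model, of n]
    by eventually_elim (use orthonormal_cols_bessel in \<open>auto simp: rco_def\<close>)
qed

lemma trace_trunc:
  assumes "\<forall>\<^sub>F n in sequentially. \<forall>i<N n. (Re (Gam n w $$ (i, i)))\<^sup>2 \<le> B"
    and "\<forall>k. (\<lambda>n. (\<Sum>i<N n. complex_of_real ((Re (Gam n w $$ (i, i)))\<^sup>2) ^ k) / of_nat (N n)) \<longlonglongrightarrow> (LINT x|\<pi>. complex_of_real x ^ k)"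
  shows "(\<lambda>n. (\<Sum>i<N n. complex_of_real (trunc (2 * k) (ga w n i))) / of_nat (N n)) \<longlonglongrightarrow> (LINT x|\<pi>. complex_of_real x ^ k)"
proof (rule Lim_transform_eventually)
  show "(\<lambda>n. (\<Sum>i<N n. complex_of_real ((Re (Gam n w $$ (i, i)))\<^sup>2) ^ k) / of_nat (N n)) \<longlonglongrightarrow> (LINT x|\<pi>. complex_of_real x ^ k)"
    using assms(2) by blast
  show "\<forall>\<^sub>F n in sequentially. (\<Sum>i<N n. complex_of_real ((Re (Gam n w $$ (i, i)))\<^sup>2) ^ k) / of_nat (N n)
      = (\<Sum>i<N n. complex_of_real (trunc (2 * k) (ga w n i))) / of_nat (N n)"
    using assms(1) by eventually_elim (simp add: trunc_def ga_def power_mult)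
qed

text \<open>A Haar rotation spreads the mass of a fixed pair of vectors evenly over the
  \<open>N n\<close> coordinates. The weighted sum therefore behaves as the inner product times a
  normalised trace, and the density is the constant \<open>l\<close>.\<close>

lemma AE_weight_lim_LL:
  assumes a: "\<And>n. (\<Sum>j<N n. (cmod (a n j))\<^sup>2) \<le> C" and b: "\<And>n. (\<Sum>j<N n. (cmod (b n j))\<^sup>2) \<le> C"
    and ab: "(\<lambda>n. \<Sum>j<N n. cnj (a n j) * b n j) \<longlonglongrightarrow> l"
  shows "AE w in M. weight_lim sequentially N (\<lambda>n i. (ga w n i)\<^sup>2) \<pi> (\<lambda>n i. cnj (lco a w n i) * lco b w n i) (\<lambda>x. l)"
proof -
  have "AE w in M. \<forall>k. (\<lambda>n. (\<Sum>i<N n. complex_of_real (trunc (2 * k) (ga w n i)) * (cnj (lco a w n i) * lco b w n i))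
      - (\<Sum>j<N n. cnj (a n j) * b n j) / of_nat (N n) * (\<Sum>i<N n. complex_of_real (trunc (2 * k) (ga w n i)))) \<longlonglongrightarrow> 0"
    unfolding AE_all_countable
    by (intro allI, rule bilinear_from_quadratic[where y = lco and C = C, OF _ lco_linear a b])
      (rule quadratic_L[OF trunc_measurable trunc_bound])
  with gam_bound trace_lim AE_lco_bound[of a] AE_lco_bound[of b] show ?thesis
  proof eventually_elim
    case (elim w)
    have "(\<Sum>i<N n. cmod (cnj (lco a w n i) * lco b w n i)) \<le> 2 * C" for n
      using sum_cmod_mult_le[of "\<lambda>i. cnj (lco a w n i)" "\<lambda>i. lco b w n i" "{..<N n}"] elim(3,4) a[of n] b[of n]
      by (smt (verit) complex_mod_cnj sum.cong)
    moreover have "(\<lambda>n. \<Sum>i<N n. complex_of_real (((ga w n i)\<^sup>2) ^ k) * (cnj (lco a w n i) * lco b w n i))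
        \<longlonglongrightarrow> (LINT x|\<pi>. complex_of_real (x ^ k) * l)" for k
    proof (rule Lim_transform_eventually)
      have "(\<lambda>n. ((\<Sum>i<N n. complex_of_real (trunc (2 * k) (ga w n i)) * (cnj (lco a w n i) * lco b w n i))
          - (\<Sum>j<N n. cnj (a n j) * b n j) / of_nat (N n) * (\<Sum>i<N n. complex_of_real (trunc (2 * k) (ga w n i))))
          + (\<Sum>j<N n. cnj (a n j) * b n j) * ((\<Sum>i<N n. complex_of_real (trunc (2 * k) (ga w n i))) / of_nat (N n)))
          \<longlonglongrightarrow> 0 + l * (LINT x|\<pi>. complex_of_real x ^ k)"
        using elim(5) by (intro tendsto_intros ab trace_trunc[OF elim(1,2)]) auto
      moreover have "0 + l * (LINT x|\<pi>. complex_of_real x ^ k) = (LINT x|\<pi>. complex_of_real (x ^ k) * l)"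
        by (simp add: mult.commute[of l])
      ultimately show "(\<lambda>n. \<Sum>i<N n. complex_of_real (trunc (2 * k) (ga w n i)) * (cnj (lco a w n i) * lco b w n i))
          \<longlonglongrightarrow> (LINT x|\<pi>. complex_of_real (x ^ k) * l)" by (simp add: mult.commute[of l])
      show "\<forall>\<^sub>F n in sequentially. (\<Sum>i<N n. complex_of_real (trunc (2 * k) (ga w n i)) * (cnj (lco a w n i) * lco b w n i))
          = (\<Sum>i<N n. complex_of_real (((ga w n i)\<^sup>2) ^ k) * (cnj (lco a w n i) * lco b w n i))"
        using elim(1) by eventually_elim (simp add: trunc_def ga_def power_mult)
    qed
    ultimately show ?case unfolding weight_lim_def
      by (intro conjI allI exI[of _ "2 * C"] always_eventually) auto
  qed
qed

text \<open>Here the mass is spread over \<open>n\<close> coordinates of which only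
  \<open>N n\<close> are seen, whence the factor \<open>c\<close>. The two factors \<gamma> raise
  the order of every moment by one, whence the factor x in the density.\<close>

lemma AE_weight_lim_RR:
  assumes a: "\<And>n. (\<Sum>j<n. (cmod (a n j))\<^sup>2) \<le> C" and b: "\<And>n. (\<Sum>j<n. (cmod (b n j))\<^sup>2) \<le> C"
    and ab: "(\<lambda>n. \<Sum>j<n. cnj (a n j) * b n j) \<longlonglongrightarrow> l"
  shows "AE w in M. weight_lim sequentially N (\<lambda>n i. (ga w n i)\<^sup>2) \<pi>
      (\<lambda>n i. cnj (complex_of_real (ga w n i) * rco a w n i) * (complex_of_real (ga w n i) * rco b w n i))
      (\<lambda>x. complex_of_real (c * x) * l)"
proof -
  have "AE w in M. \<forall>k. (\<lambda>n. (\<Sum>i<N n. complex_of_real (trunc (2 * k) (ga w n i)) * (cnj (rco a w n i) * rco b w n i))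
      - (\<Sum>j<n. cnj (a n j) * b n j) / of_nat n * (\<Sum>i<N n. complex_of_real (trunc (2 * k) (ga w n i)))) \<longlonglongrightarrow> 0"
    unfolding AE_all_countable
    by (intro allI, rule bilinear_from_quadratic[where y = rco and C = C, OF _ rco_linear a b])
      (rule quadratic_R[OF trunc_measurable trunc_bound])
  with gam_bound trace_lim AE_rco_bound[of a] AE_rco_bound[of b] show ?thesis
  proof eventually_elim
    case (elim w)
    have "\<forall>\<^sub>F n in sequentially. (\<Sum>i<N n. cmod (cnj (complex_of_real (ga w n i) * rco a w n i) * (complex_of_real (ga w n i) * rco b w n i))) \<le> \<bar>B\<bar> * (2 * C)"
      using elim(1)
    proof eventually_elim
      case (elim n)
      have "(\<Sum>i<N n. cmod (cnj (complex_of_real (ga w n i) * rco a w n i) * (complex_of_real (ga w n i) * rco b w n i)))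
          \<le> (\<Sum>i<N n. \<bar>B\<bar> * cmod (cnj (rco a w n i) * rco b w n i))"
      proof (rule sum_mono)
        fix i assume "i \<in> {..<N n}"
        then have "(ga w n i)\<^sup>2 \<le> \<bar>B\<bar>" using elim by (force simp: ga_def)
        then have "(ga w n i)\<^sup>2 * (cmod (rco a w n i) * cmod (rco b w n i)) \<le> \<bar>B\<bar> * (cmod (rco a w n i) * cmod (rco b w n i))"
          by (rule mult_right_mono) auto
        then show "cmod (cnj (complex_of_real (ga w n i) * rco a w n i) * (complex_of_real (ga w n i) * rco b w n i))
            \<le> \<bar>B\<bar> * cmod (cnj (rco a w n i) * rco b w n i)"
          by (simp add: norm_mult power2_eq_square abs_mult_self_eq mult_ac flip: abs_mult)
      qed
      also have "\<dots> \<le> \<bar>B\<bar> * (2 * C)"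
        unfolding sum_distrib_left[symmetric]
        using sum_cmod_mult_le[of "\<lambda>i. cnj (rco a w n i)" "\<lambda>i. rco b w n i" "{..<N n}"]
          \<open>\<forall>n. (\<Sum>i<N n. (cmod (rco a w n i))\<^sup>2) \<le> _ n\<close> \<open>\<forall>n. (\<Sum>i<N n. (cmod (rco b w n i))\<^sup>2) \<le> _ n\<close> a[of n] b[of n]
        by (intro mult_left_mono) (smt (verit) complex_mod_cnj sum.cong, simp)
      finally show ?case .
    qed
    moreover have "(\<lambda>n. \<Sum>i<N n. complex_of_real (((ga w n i)\<^sup>2) ^ k) * (cnj (complex_of_real (ga w n i) * rco a w n i) * (complex_of_real (ga w n i) * rco b w n i)))
        \<longlonglongrightarrow> (LINT x|\<pi>. complex_of_real (x ^ k) * (complex_of_real (c * x) * l))" for k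
    proof (rule Lim_transform_eventually)
      have "(\<lambda>n. ((\<Sum>i<N n. complex_of_real (trunc (2 * Suc k) (ga w n i)) * (cnj (rco a w n i) * rco b w n i))
          - (\<Sum>j<n. cnj (a n j) * b n j) / of_nat n * (\<Sum>i<N n. complex_of_real (trunc (2 * Suc k) (ga w n i))))
          + (\<Sum>j<n. cnj (a n j) * b n j) * complex_of_real (real (N n) / real n)
            * ((\<Sum>i<N n. complex_of_real (trunc (2 * Suc k) (ga w n i))) / of_nat (N n)))
          \<longlonglongrightarrow> 0 + l * complex_of_real c * (LINT x|\<pi>. complex_of_real x ^ Suc k)"
        using elim(5)[rule_format, of "Suc k"] 
        by (intro tendsto_add tendsto_mult tendsto_of_real ab N_lim trace_trunc[OF elim(1,2)])
      moreover have "0 + l * complex_of_real c * (LINT x|\<pi>. complex_of_real x ^ Suc k) = (LINT x|\<pi>. complex_of_real (x ^ k) * (complex_of_real (c * x) * l))"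
      proof -
        have "(LINT x|\<pi>. complex_of_real (x ^ k) * (complex_of_real (c * x) * l)) = (LINT x|\<pi>. (l * complex_of_real c) * complex_of_real x ^ Suc k)"
          by (intro Bochner_Integration.integral_cong refl) (simp add: mult_ac)
        then show ?thesis by (simp del: power_Suc)
      qed
      ultimately show "(\<lambda>n. (\<Sum>i<N n. complex_of_real (trunc (2 * Suc k) (ga w n i)) * (cnj (rco a w n i) * rco b w n i))
          - (\<Sum>j<n. cnj (a n j) * b n j) / of_nat n * (\<Sum>i<N n. complex_of_real (trunc (2 * Suc k) (ga w n i)))
          + (\<Sum>j<n. cnj (a n j) * b n j) * complex_of_real (real (N n) / real n)
            * ((\<Sum>i<N n. complex_of_real (trunc (2 * Suc k) (ga w n i))) / of_nat (N n)))
          \<longlonglongrightarrow> (LINT x|\<pi>. complex_of_real (x ^ k) * (complex_of_real (c * x) * l))" by simp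
      show "\<forall>\<^sub>F n in sequentially. (\<Sum>i<N n. complex_of_real (trunc (2 * Suc k) (ga w n i)) * (cnj (rco a w n i) * rco b w n i))
          - (\<Sum>j<n. cnj (a n j) * b n j) / of_nat n * (\<Sum>i<N n. complex_of_real (trunc (2 * Suc k) (ga w n i)))
          + (\<Sum>j<n. cnj (a n j) * b n j) * complex_of_real (real (N n) / real n)
            * ((\<Sum>i<N n. complex_of_real (trunc (2 * Suc k) (ga w n i))) / of_nat (N n))
          = (\<Sum>i<N n. complex_of_real (((ga w n i)\<^sup>2) ^ k) * (cnj (complex_of_real (ga w n i) * rco a w n i) * (complex_of_real (ga w n i) * rco b w n i)))"
        using elim(1) N_large
      proof eventually_elim
        case (elim n)
        have "trunc (2 * Suc k) (ga w n i) = ((ga w n i)\<^sup>2) ^ k * (ga w n i * ga w n i)" if "i < N n" for i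
          using elim that by (simp add: trunc_def ga_def power_mult[symmetric] flip: power2_eq_square)
        then have "(\<Sum>i<N n. complex_of_real (((ga w n i)\<^sup>2) ^ k) * (cnj (complex_of_real (ga w n i) * rco a w n i) * (complex_of_real (ga w n i) * rco b w n i)))
            = (\<Sum>i<N n. complex_of_real (trunc (2 * Suc k) (ga w n i)) * (cnj (rco a w n i) * rco b w n i))"
          by (intro sum.cong refl) (simp add: mult_ac del: of_real_power)
        moreover have "(\<Sum>j<n. cnj (a n j) * b n j) * complex_of_real (real (N n) / real n) * (Z / of_nat (N n))
            = (\<Sum>j<n. cnj (a n j) * b n j) / of_nat n * Z" for Z
          using elim by simp
        ultimately show ?case by simp
      qed
    qed
    ultimately show ?case unfolding weight_lim_def by auto
  qed
qed

text \<open>A single factor \<gamma> leaves odd powers 2 k + 1, so the limits come from the cross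
  moment bound and no trace limit is involved.\<close>

lemma AE_weight_lim_RL:
  assumes a: "\<And>n. (\<Sum>j<N n. (cmod (a n j))\<^sup>2) \<le> C" and b: "\<And>n. (\<Sum>j<n. (cmod (b n j))\<^sup>2) \<le> C"
  shows "AE w in M. weight_lim sequentially N (\<lambda>n i. (ga w n i)\<^sup>2) \<pi>
      (\<lambda>n i. cnj (complex_of_real (ga w n i) * rco b w n i) * lco a w n i) (\<lambda>x. 0)"
proof -
  have "AE w in M. \<forall>k. (\<lambda>n. \<Sum>i<N n. complex_of_real (trunc (2 * k + 1) (ga w n i)) * cnj (rco b w n i) * lco a w n i) \<longlonglongrightarrow> 0"
    unfolding AE_all_countable by (intro allI, rule cross_LR[OF trunc_measurable trunc_bound a b])
  with gam_bound AE_lco_bound[of a] AE_rco_bound[of b] show ?thesis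
  proof eventually_elim
    case (elim w)
    have "\<forall>\<^sub>F n in sequentially. (\<Sum>i<N n. cmod (cnj (complex_of_real (ga w n i) * rco b w n i) * lco a w n i)) \<le> \<bar>B\<bar> * C + C"
      using elim(1)
    proof eventually_elim
      case (elim n)
      have "(\<Sum>i<N n. (cmod (cnj (complex_of_real (ga w n i) * rco b w n i)))\<^sup>2) \<le> (\<Sum>i<N n. \<bar>B\<bar> * (cmod (rco b w n i))\<^sup>2)"
      proof (rule sum_mono)
        fix i assume "i \<in> {..<N n}"
        then have "(ga w n i)\<^sup>2 \<le> \<bar>B\<bar>" using elim by (force simp: ga_def)
        then show "(cmod (cnj (complex_of_real (ga w n i) * rco b w n i)))\<^sup>2 \<le> \<bar>B\<bar> * (cmod (rco b w n i))\<^sup>2"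
          by (simp add: norm_mult power_mult_distrib mult_right_mono)
      qed
      also have "\<dots> \<le> \<bar>B\<bar> * C"
        unfolding sum_distrib_left[symmetric]
        using \<open>\<forall>n. (\<Sum>i<N n. (cmod (rco b w n i))\<^sup>2) \<le> _ n\<close> b[of n] by (intro mult_left_mono) (auto intro: order_trans)
      finally show ?case
        using sum_cmod_mult_le[of "\<lambda>i. cnj (complex_of_real (ga w n i) * rco b w n i)" "\<lambda>i. lco a w n i" "{..<N n}"]
          \<open>\<forall>n. (\<Sum>i<N n. (cmod (lco a w n i))\<^sup>2) \<le> _ n\<close>[rule_format, of n] a[of n]
        by linarith
    qed
    moreover have "(\<lambda>n. \<Sum>i<N n. complex_of_real (((ga w n i)\<^sup>2) ^ k) * (cnj (complex_of_real (ga w n i) * rco b w n i) * lco a w n i)) \<longlonglongrightarrow> 0" for k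
    proof (rule Lim_transform_eventually)
      show "(\<lambda>n. \<Sum>i<N n. complex_of_real (trunc (2 * k + 1) (ga w n i)) * cnj (rco b w n i) * lco a w n i) \<longlonglongrightarrow> 0"
        using elim(4) by blast
      show "\<forall>\<^sub>F n in sequentially. (\<Sum>i<N n. complex_of_real (trunc (2 * k + 1) (ga w n i)) * cnj (rco b w n i) * lco a w n i)
          = (\<Sum>i<N n. complex_of_real (((ga w n i)\<^sup>2) ^ k) * (cnj (complex_of_real (ga w n i) * rco b w n i) * lco a w n i))"
        using elim(1)
      proof eventually_elim
        case (elim n)
        have "trunc (2 * k + 1) (ga w n i) = ((ga w n i)\<^sup>2) ^ k * ga w n i" if "i < N n" for i
          using elim that by (simp add: trunc_def ga_def power_mult)
        then show ?case
          by (intro sum.cong refl) (simp add: mult_ac del: of_real_power)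
      qed
    qed
    ultimately show ?case unfolding weight_lim_def by auto
  qed
qed

end

section \<open>The limiting secular equation\<close>

lemma integral_uniform_limit:
  fixes F :: "'i filter"
  assumes \<pi>: "prob_space \<pi>" "sets \<pi> = sets borel" and supp: "AE x in \<pi>. x \<in> {a..b}"
    and H: "uniform_limit {a..b} H h F" "\<forall>\<^sub>F n in F. H n \<in> borel_measurable borel"
    and h: "h \<in> borel_measurable borel" "\<And>x. x \<in> {a..b} \<Longrightarrow> \<bar>h x\<bar> \<le> D"
    and g: "g \<in> borel_measurable borel" "\<And>x. x \<in> {a..b} \<Longrightarrow> \<bar>g x\<bar> \<le> B"
  shows "((\<lambda>n. LINT x|\<pi>. H n x * g x) \<longlongrightarrow> (LINT x|\<pi>. h x * g x :: real)) F"
  unfolding tendsto_iff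
proof (intro allI impI)
  fix e :: real assume e: "0 < e"
  interpret \<pi>: prob_space \<pi> by fact
  have [measurable_cong]: "sets \<pi> = sets borel" by fact
  note [measurable] = g(1) h(1)
  have d: "0 < e / (\<bar>B\<bar> + 1)" using e by simp
  have "\<forall>\<^sub>F n in F. \<forall>x\<in>{a..b}. dist (H n x) (h x) < e / (\<bar>B\<bar> + 1)"
    using H(1) d by (auto simp: uniform_limit_iff)
  then show "\<forall>\<^sub>F n in F. dist (LINT x|\<pi>. H n x * g x) (LINT x|\<pi>. h x * g x) < e"
    using H(2)
  proof eventually_elim
    case (elim n)
    note [measurable] = elim(2)
    have bd: "\<bar>(H n x - h x) * g x\<bar> \<le> e / (\<bar>B\<bar> + 1) * \<bar>B\<bar>" "\<bar>h x * g x\<bar> \<le> \<bar>D\<bar> * \<bar>B\<bar>" if "x \<in> {a..b}" for x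
    proof -
      have 1: "\<bar>H n x - h x\<bar> \<le> e / (\<bar>B\<bar> + 1)" using elim(1) that by (auto simp: dist_real_def intro: less_imp_le)
      have 2: "\<bar>g x\<bar> \<le> \<bar>B\<bar>" using g(2)[OF that] by linarith
      have 3: "\<bar>h x\<bar> \<le> \<bar>D\<bar>" using h(2)[OF that] by linarith
      show "\<bar>(H n x - h x) * g x\<bar> \<le> e / (\<bar>B\<bar> + 1) * \<bar>B\<bar>"
        unfolding abs_mult by (intro mult_mono 1 2) (use e in auto)
      show "\<bar>h x * g x\<bar> \<le> \<bar>D\<bar> * \<bar>B\<bar>"
        unfolding abs_mult by (intro mult_mono 3 2) auto
    qed
    have bd': "AE x in \<pi>. \<bar>(H n x - h x) * g x\<bar> \<le> e / (\<bar>B\<bar> + 1) * \<bar>B\<bar>"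
      using supp by eventually_elim (rule bd)
    have bd'': "AE x in \<pi>. \<bar>h x * g x\<bar> \<le> \<bar>D\<bar> * \<bar>B\<bar>"
      using supp by eventually_elim (rule bd)
    have i1: "integrable \<pi> (\<lambda>x. (H n x - h x) * g x)"
      by (rule \<pi>.integrable_bounded_AE[where B = "e / (\<bar>B\<bar> + 1) * \<bar>B\<bar>"]) (use bd' in simp_all)
    have i2: "integrable \<pi> (\<lambda>x. h x * g x)"
      by (rule \<pi>.integrable_bounded_AE[where B = "\<bar>D\<bar> * \<bar>B\<bar>"]) (use bd'' in simp_all)
    have "H n x * g x = (H n x - h x) * g x + h x * g x" for x by (simp add: algebra_simps)
    then have "(LINT x|\<pi>. H n x * g x) = (LINT x|\<pi>. (H n x - h x) * g x) + (LINT x|\<pi>. h x * g x)"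
      using i1 i2 by simp
    then have "dist (LINT x|\<pi>. H n x * g x) (LINT x|\<pi>. h x * g x) = \<bar>LINT x|\<pi>. (H n x - h x) * g x\<bar>"
      by (simp add: dist_real_def)
    also have "\<dots> \<le> (LINT x|\<pi>. \<bar>(H n x - h x) * g x\<bar>)" by (rule integral_abs_bound)
    also have "\<dots> \<le> (LINT x|\<pi>. e / (\<bar>B\<bar> + 1) * \<bar>B\<bar>)"
      by (rule integral_mono_AE) (use i1 bd' in simp_all)
    also have "\<dots> = e / (\<bar>B\<bar> + 1) * \<bar>B\<bar>" by (simp add: \<pi>.prob_space)
    also have "\<dots> < e" using e by (simp add: pos_divide_less_eq)
    finally show ?case .
  qed
qed

lemma resolvent_uniform_limit:
  fixes l :: "'i \<Rightarrow> real"
  assumes l: "(l \<longlongrightarrow> \<rho>) F" and b: "b < \<rho>"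
  shows "uniform_limit {a..b} (\<lambda>n x. 1 / (l n - x)) (\<lambda>x. 1 / (\<rho> - x)) F"
  unfolding uniform_limit_iff
proof (intro allI impI)
  fix e :: real assume e: "0 < e"
  \<comment> \<open>Half the gap: both denominators then stay at least d on the interval, and the
    difference of the resolvents is at most |l n - \<rho>| / d^2.\<close>
  define d where "d = (\<rho> - b) / 2"
  have d: "0 < d" using b by (simp add: d_def)
  have "\<forall>\<^sub>F n in F. dist (l n) \<rho> < min d (e * d\<^sup>2)"
    using l d e unfolding tendsto_iff by (metis min_less_iff_conj zero_less_mult_iff zero_less_power)
  then show "\<forall>\<^sub>F n in F. \<forall>x\<in>{a..b}. dist (1 / (l n - x)) (1 / (\<rho> - x)) < e"
  proof eventually_elim
    case (elim n)
    show ?case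
    proof
      fix x assume x: "x \<in> {a..b}"
      have 1: "d \<le> \<rho> - x" "d \<le> l n - x"
      proof -
        have "\<rho> - b = 2 * d" by (simp add: d_def)
        moreover have "\<bar>l n - \<rho>\<bar> < d" using elim by (simp add: dist_real_def)
        ultimately show "d \<le> \<rho> - x" "d \<le> l n - x" using x d unfolding atLeastAtMost_iff by linarith+
      qed
      have "1 / (l n - x) - 1 / (\<rho> - x) = (\<rho> - l n) / ((l n - x) * (\<rho> - x))"
        using 1 d by (simp add: field_simps)
      then have "dist (1 / (l n - x)) (1 / (\<rho> - x)) = \<bar>\<rho> - l n\<bar> / ((l n - x) * (\<rho> - x))"
        using 1 d by (simp add: dist_real_def abs_mult)
      also have "\<dots> \<le> \<bar>\<rho> - l n\<bar> / (d * d)"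
        using 1 d by (intro divide_left_mono mult_mono) auto
      also have "\<dots> < e"
        using elim d by (simp add: dist_real_def pos_divide_less_eq power2_eq_square abs_minus_commute)
      finally show "dist (1 / (l n - x)) (1 / (\<rho> - x)) < e" .
    qed
  qed
qed

lemma resolvent_bound:
  fixes \<rho> b x :: real
  assumes "x \<in> {a..b}" "b < \<rho>" shows "\<bar>1 / (\<rho> - x)\<bar> \<le> 1 / (\<rho> - b)" "1 / (\<rho> - a) \<le> 1 / (\<rho> - x)"
  using assms by (auto simp: frac_le)

lemma resolvent_product_uniform_limit:
  fixes l m :: "'i \<Rightarrow> real"
  assumes "(l \<longlongrightarrow> \<rho>) F" "(m \<longlongrightarrow> \<mu>) F" "b < \<rho>" "b < \<mu>"
  shows "uniform_limit {a..b} (\<lambda>n x. 1 / (l n - x) * (1 / (m n - x))) (\<lambda>x. 1 / (\<rho> - x) * (1 / (\<mu> - x))) F"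
proof -
  have "bounded ((\<lambda>x. 1 / (\<rho> - x)) ` {a..b})" if "b < \<rho>" for \<rho>
    unfolding bounded_iff using resolvent_bound(1)[OF _ that] by (intro exI[of _ "1 / (\<rho> - b)"]) auto
  then show ?thesis
    using assms by (intro uniform_lim_mult resolvent_uniform_limit)
qed

lemma resolvent_continuous: "b < \<rho> \<Longrightarrow> continuous_on {a..b} (\<lambda>x::real. 1 / (\<rho> - x))"
  by (intro continuous_intros) auto

section \<open>Transforms of the limit law to the right of its support\<close>

locale bounded_law =
  fixes \<pi> :: "real measure" and lmin lmax :: real
  assumes prob: "prob_space \<pi>" and sets_pi: "sets \<pi> = sets borel"
    and supp: "AE x in \<pi>. x \<in> {lmin..lmax}" and lmax_nonneg: "0 \<le> lmax"
begin

text \<open>The signs are chosen to make resolvents positive: \<open>m1\<close> is minus the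
  Stieltjes transform m, and \<open>m2 \<rho> \<rho>\<close> is the derivative of m. The variants
  \<open>t1\<close> and \<open>t2\<close> carry the extra weight x that comes with the side of
  \<open>R\<close>. Two arguments are kept because inner products of eigenvectors involve two
  eigenvalues.\<close>

definition m1 :: "real \<Rightarrow> real" where "m1 \<rho> = (LINT x|\<pi>. 1 / (\<rho> - x))"
definition t1 :: "real \<Rightarrow> real" where "t1 \<rho> = (LINT x|\<pi>. 1 / (\<rho> - x) * x)"
definition m2 :: "real \<Rightarrow> real \<Rightarrow> real" where "m2 \<rho> \<mu> = (LINT x|\<pi>. 1 / (\<rho> - x) * (1 / (\<mu> - x)))"
definition t2 :: "real \<Rightarrow> real \<Rightarrow> real" where "t2 \<rho> \<mu> = (LINT x|\<pi>. 1 / (\<rho> - x) * (1 / (\<mu> - x)) * x)"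

lemma lmin_le: "lmin \<le> lmax"
proof -
  interpret prob_space \<pi> by (rule prob)
  have "AE x in \<pi>. lmin \<le> lmax" using supp by eventually_elim auto
  then show ?thesis by simp
qed

lemma sets_cong [measurable_cong]: "sets \<pi> = sets borel" by (rule sets_pi)

lemma supp_mono: "a \<le> lmin \<Longrightarrow> lmax \<le> b \<Longrightarrow> AE x in \<pi>. x \<in> {a..b}"
  using supp by eventually_elim auto

lemma integrable_pi:
  assumes "f \<in> borel_measurable borel" "\<And>x. x \<in> {lmin..lmax} \<Longrightarrow> \<bar>f x\<bar> \<le> B"
  shows "integrable \<pi> (f :: real \<Rightarrow> real)"
proof -
  interpret prob_space \<pi> by (rule prob)
  note [measurable] = assms(1)
  show ?thesis
  proof (rule integrable_bounded_AE[where B = B])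
    show "AE x in \<pi>. norm (f x) \<le> B"
      using supp by eventually_elim (use assms(2) in simp)
  qed measurable
qed

lemma integrable_resolvents:
  assumes "lmax < \<rho>" "lmax < \<mu>"
  shows "integrable \<pi> (\<lambda>x. 1 / (\<rho> - x))" "integrable \<pi> (\<lambda>x. 1 / (\<rho> - x) * (1 / (\<mu> - x)))"
proof -
  show "integrable \<pi> (\<lambda>x. 1 / (\<rho> - x))"
    by (rule integrable_pi[where B = "1 / (\<rho> - lmax)"]) (use resolvent_bound(1)[OF _ assms(1)] in auto)
  show "integrable \<pi> (\<lambda>x. 1 / (\<rho> - x) * (1 / (\<mu> - x)))"
  proof (rule integrable_pi[where B = "1 / (\<rho> - lmax) * (1 / (\<mu> - lmax))"])
    fix x assume "x \<in> {lmin..lmax}"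
    then show "\<bar>1 / (\<rho> - x) * (1 / (\<mu> - x))\<bar> \<le> 1 / (\<rho> - lmax) * (1 / (\<mu> - lmax))"
      unfolding abs_mult by (intro mult_mono resolvent_bound(1)[OF _ assms(1)] resolvent_bound(1)[OF _ assms(2)]) (use assms in auto)
  qed measurable
qed

lemma m1_pos: assumes "lmax < \<rho>" shows "0 < m1 \<rho>"
proof -
  interpret prob_space \<pi> by (rule prob)
  have "(LINT x|\<pi>. 1 / (\<rho> - lmin)) \<le> m1 \<rho>"
    unfolding m1_def
  proof (rule integral_mono_AE)
    show "AE x in \<pi>. 1 / (\<rho> - lmin) \<le> 1 / (\<rho> - x)"
      using supp by eventually_elim (rule resolvent_bound(2)[OF _ assms])
  qed (use integrable_resolvents(1)[OF assms assms] in auto)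
  moreover have "0 < 1 / (\<rho> - lmin)" using assms lmin_le by simp
  ultimately show ?thesis by (simp add: prob_space del: zero_less_divide_1_iff)
qed

lemma m2_pos: assumes "lmax < \<rho>" "lmax < \<mu>" shows "0 < m2 \<rho> \<mu>"
proof -
  interpret prob_space \<pi> by (rule prob)
  have "(LINT x|\<pi>. 1 / (\<rho> - lmin) * (1 / (\<mu> - lmin))) \<le> m2 \<rho> \<mu>"
    unfolding m2_def
  proof (rule integral_mono_AE)
    show "AE x in \<pi>. 1 / (\<rho> - lmin) * (1 / (\<mu> - lmin)) \<le> 1 / (\<rho> - x) * (1 / (\<mu> - x))"
      using supp
    proof eventually_elim
      case (elim x)
      show ?case
        by (intro mult_mono resolvent_bound(2)[OF elim assms(1)] resolvent_bound(2)[OF elim assms(2)])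
          (use elim assms in auto)
    qed
  qed (use integrable_resolvents(2)[OF assms] in auto)
  moreover have "0 < 1 / (\<rho> - lmin) * (1 / (\<mu> - lmin))" using assms lmin_le by simp
  moreover have "(LINT x|\<pi>. 1 / (\<rho> - lmin) * (1 / (\<mu> - lmin))) = 1 / (\<rho> - lmin) * (1 / (\<mu> - lmin))"
    by (simp add: prob_space)
  ultimately show ?thesis by linarith
qed

lemma t1_eq: assumes "lmax < \<rho>" shows "t1 \<rho> = \<rho> * m1 \<rho> - 1"
proof -
  interpret prob_space \<pi> by (rule prob)
  have "t1 \<rho> = (LINT x|\<pi>. \<rho> * (1 / (\<rho> - x)) - 1)"
    unfolding t1_def
  proof (rule integral_cong_AE)
    show "AE x in \<pi>. 1 / (\<rho> - x) * x = \<rho> * (1 / (\<rho> - x)) - 1"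
      using supp by eventually_elim (use assms in \<open>auto simp: field_simps\<close>)
  qed measurable
  also have "\<dots> = \<rho> * m1 \<rho> - 1"
  proof -
    have "integrable \<pi> (\<lambda>x. \<rho> * (1 / (\<rho> - x)))" using integrable_resolvents(1)[OF assms assms] by (rule integrable_mult_right)
    then have "(LINT x|\<pi>. \<rho> * (1 / (\<rho> - x)) - 1) = (LINT x|\<pi>. \<rho> * (1 / (\<rho> - x))) - (LINT x|\<pi>. 1)"
      by (rule Bochner_Integration.integral_diff) simp
    also have "\<dots> = \<rho> * m1 \<rho> - 1"
      unfolding m1_def integral_mult_right_zero by (simp add: prob_space)
    finally show ?thesis .
  qed
  finally show ?thesis .
qed

lemma t2_eq: assumes "lmax < \<rho>" "lmax < \<mu>" shows "t2 \<rho> \<mu> = \<mu> * m2 \<rho> \<mu> - m1 \<rho>"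
proof -
  interpret prob_space \<pi> by (rule prob)
  have "t2 \<rho> \<mu> = (LINT x|\<pi>. \<mu> * (1 / (\<rho> - x) * (1 / (\<mu> - x))) - 1 / (\<rho> - x))"
    unfolding t2_def
  proof (rule integral_cong_AE)
    show "AE x in \<pi>. 1 / (\<rho> - x) * (1 / (\<mu> - x)) * x = \<mu> * (1 / (\<rho> - x) * (1 / (\<mu> - x))) - 1 / (\<rho> - x)"
      using supp
    proof eventually_elim
      case (elim x)
      have "1 / (\<mu> - x) * x = \<mu> * (1 / (\<mu> - x)) - 1" using elim assms by (auto simp: field_simps)
      then have "1 / (\<rho> - x) * (1 / (\<mu> - x) * x) = 1 / (\<rho> - x) * (\<mu> * (1 / (\<mu> - x)) - 1)" by simp
      then show ?case by (simp add: algebra_simps)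
    qed
  qed measurable
  also have "\<dots> = \<mu> * m2 \<rho> \<mu> - m1 \<rho>"
  proof -
    have "integrable \<pi> (\<lambda>x. \<mu> * (1 / (\<rho> - x) * (1 / (\<mu> - x))))"
      using integrable_resolvents(2)[OF assms] by (rule integrable_mult_right)
    then have "(LINT x|\<pi>. \<mu> * (1 / (\<rho> - x) * (1 / (\<mu> - x))) - 1 / (\<rho> - x))
        = (LINT x|\<pi>. \<mu> * (1 / (\<rho> - x) * (1 / (\<mu> - x)))) - (LINT x|\<pi>. 1 / (\<rho> - x))"
      using integrable_resolvents(1)[OF assms(1) assms(1)] by (rule Bochner_Integration.integral_diff)
    then show ?thesis unfolding m1_def m2_def integral_mult_right_zero .
  qed
  finally show ?thesis .
qed

lemma tendsto_m1: 
  assumes "(l \<longlongrightarrow> \<rho>) F" "lmax < \<rho>" shows "((\<lambda>n. m1 (l n)) \<longlongrightarrow> m1 \<rho>) F"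
  using integral_uniform_limit[OF prob sets_pi supp resolvent_uniform_limit[OF assms], of "1 / (\<rho> - lmax)" "\<lambda>_. 1" 1]
    resolvent_bound(1)[OF _ assms(2)] by (auto simp: m1_def)

lemma tendsto_m2:
  assumes "(l \<longlongrightarrow> \<rho>) F" "(k \<longlongrightarrow> \<mu>) F" "lmax < \<rho>" "lmax < \<mu>"
  shows "((\<lambda>n. m2 (l n) (k n)) \<longlongrightarrow> m2 \<rho> \<mu>) F"
proof -
  have "\<bar>1 / (\<rho> - x) * (1 / (\<mu> - x))\<bar> \<le> 1 / (\<rho> - lmax) * (1 / (\<mu> - lmax))" if "x \<in> {lmin..lmax}" for x
    unfolding abs_mult
    by (intro mult_mono resolvent_bound(1)[OF that assms(3)] resolvent_bound(1)[OF that assms(4)]) (use assms in auto)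
  then have "((\<lambda>n. LINT x|\<pi>. 1 / (l n - x) * (1 / (k n - x)) * 1) \<longlongrightarrow> (LINT x|\<pi>. 1 / (\<rho> - x) * (1 / (\<mu> - x)) * 1)) F"
    by (intro integral_uniform_limit[OF prob sets_pi supp resolvent_product_uniform_limit[OF assms], of _ _ 1]) auto
  then show ?thesis by (simp add: m2_def)
qed

text \<open>No differentiation under the integral is needed: by the resolvent identity the
  difference quotient at y equals \<open>- m2 y \<rho>\<close>, and \<open>m2\<close> is
  continuous.\<close>

lemma DERIV_m1: assumes "lmax < \<rho>" shows "(m1 has_real_derivative - m2 \<rho> \<rho>) (at \<rho>)"
  unfolding has_field_derivative_iff
proof (rule Lim_transform_eventually)
  show "((\<lambda>y. - m2 y \<rho>) \<longlongrightarrow> - m2 \<rho> \<rho>) (at \<rho>)"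
    by (intro tendsto_minus tendsto_m2 tendsto_ident_at tendsto_const assms)
  have "\<forall>\<^sub>F y in at \<rho>. lmax < y"
    using assms tendsto_ident_at[of \<rho> UNIV] order_tendstoD(1) by blast
  then show "\<forall>\<^sub>F y in at \<rho>. - m2 y \<rho> = (m1 y - m1 \<rho>) / (y - \<rho>)"
    using eventually_neq_at_within[of \<rho> \<rho> UNIV]
  proof eventually_elim
    case (elim y)
    have "m1 y - m1 \<rho> = (LINT x|\<pi>. 1 / (y - x) - 1 / (\<rho> - x))"
      using integrable_resolvents(1)[OF elim(1) elim(1)] integrable_resolvents(1)[OF assms assms] by (simp add: m1_def)
    also have "\<dots> = (LINT x|\<pi>. - (y - \<rho>) * (1 / (y - x) * (1 / (\<rho> - x))))"
    proof (rule integral_cong_AE)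
      show "AE x in \<pi>. 1 / (y - x) - 1 / (\<rho> - x) = - (y - \<rho>) * (1 / (y - x) * (1 / (\<rho> - x)))"
        using supp by eventually_elim (use elim(1) assms in \<open>auto simp: divide_simps algebra_simps\<close>)
    qed measurable
    also have "\<dots> = - (y - \<rho>) * m2 y \<rho>" unfolding m2_def by (rule integral_mult_right_zero)
    finally show ?case using elim(2) by (simp add: field_simps)
  qed
qed

lemma stieltjes_real: "stieltjes \<pi> (complex_of_real x) = complex_of_real (- m1 x)"
proof -
  have "stieltjes \<pi> (complex_of_real x) = (LINT t|\<pi>. complex_of_real (- (1 / (x - t))))"
    unfolding stieltjes_def
    by (intro Bochner_Integration.integral_cong refl)
      (metis minus_diff_eq minus_divide_right of_real_1 of_real_diff of_real_divide)
  then show ?thesis by (simp add: m1_def del: of_real_minus)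
qed

text \<open>Since \<open>t1 x = x * m1 x - 1\<close>, the product of x with the companion transform
  is -(1 + c t1 x); its sign cancels with that of m = - m1.\<close>

lemma gfun_eq: assumes "lmax < x" shows "gfun c \<pi> x = m1 x * (1 + c * t1 x)"
proof -
  have "x \<noteq> 0" using assms lmax_nonneg by simp
  have "stieltjes_tilde c \<pi> (complex_of_real x) = complex_of_real (- c * m1 x - (1 - c) / x)"
    by (simp add: stieltjes_tilde_def stieltjes_real)
  then have "gfun c \<pi> x = x * (- m1 x) * (- c * m1 x - (1 - c) / x)"
    unfolding gfun_def stieltjes_real by (simp flip: of_real_mult of_real_minus)
  also have "\<dots> = m1 x * (1 + c * t1 x)"
    unfolding t1_eq[OF assms] using \<open>x \<noteq> 0\<close> by (simp add: field_simps)
  finally show ?thesis .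
qed

lemma deriv_gfun:
  assumes "lmax < x"
  shows "deriv (gfun c \<pi>) x = - (m2 x x * (1 + c * t1 x) + m1 x * c * t2 x x)"
proof -
  have "((\<lambda>x. m1 x * (1 + c * (x * m1 x - 1))) has_real_derivative
      (- m2 x x) * (1 + c * (x * m1 x - 1)) + (c * (m1 x + x * (- m2 x x))) * m1 x) (at x)"
    using DERIV_m1[OF assms] by (auto intro!: derivative_eq_intros)
  moreover have "\<forall>\<^sub>F y in nhds x. m1 y * (1 + c * (y * m1 y - 1)) = gfun c \<pi> y"
    using eventually_nhds_in_open[of "{lmax<..}" x] assms
    by (auto elim!: eventually_mono simp: gfun_eq t1_eq)
  ultimately have "(gfun c \<pi> has_real_derivative
      (- m2 x x) * (1 + c * (x * m1 x - 1)) + (c * (m1 x + x * (- m2 x x))) * m1 x) (at x)"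
    by (subst (asm) DERIV_cong_ev[OF refl _ refl])
  then have "deriv (gfun c \<pi>) x = (- m2 x x) * (1 + c * (x * m1 x - 1)) + (c * (m1 x + x * (- m2 x x))) * m1 x"
    by (rule DERIV_imp_deriv)
  then show ?thesis using assms by (simp add: t1_eq t2_eq algebra_simps)
qed

text \<open>Splitting the quotient exhibits the two contributions to the squared norm of a limiting
  eigenvector, from the steering vectors and from the columns of S respectively. This is how \<zeta>
  will be recognised as a normalisation.\<close>

lemma zeta_eq:
  assumes x: "lmax < x" and pos: "0 < 1 + c * t1 x"
  shows "zeta c \<pi> x = m2 x x / (m1 x)\<^sup>2 + c * t2 x x / (m1 x * (1 + c * t1 x))"
proof -
  have "x \<noteq> 0" using x lmax_nonneg by simp
  have st: "stieltjes_tilde c \<pi> (complex_of_real x) = complex_of_real (- c * m1 x - (1 - c) / x)"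
    by (simp add: stieltjes_tilde_def stieltjes_real)
  have "x * (- c * m1 x - (1 - c) / x) = - (1 + c * t1 x)"
    using \<open>x \<noteq> 0\<close> by (simp add: t1_eq[OF x] field_simps)
  then have den: "x * (Re (stieltjes \<pi> (complex_of_real x)))\<^sup>2 * Re (stieltjes_tilde c \<pi> (complex_of_real x))
      = - ((m1 x)\<^sup>2 * (1 + c * t1 x))"
  proof -
    have "x * (- m1 x)\<^sup>2 * (- c * m1 x - (1 - c) / x) = (m1 x)\<^sup>2 * (x * (- c * m1 x - (1 - c) / x))" by (simp add: mult_ac)
    also have "\<dots> = - ((m1 x)\<^sup>2 * (1 + c * t1 x))" unfolding \<open>x * _ = _\<close> by (simp add: algebra_simps)
    finally show ?thesis unfolding st stieltjes_real Re_complex_of_real .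
  qed
  have "- a / - b = a / b" for a b :: real by simp
  then have "zeta c \<pi> x = (m2 x x * (1 + c * t1 x) + m1 x * c * t2 x x) / ((m1 x)\<^sup>2 * (1 + c * t1 x))"
    unfolding zeta_def den deriv_gfun[OF x] .
  also have "\<dots> = m2 x x / (m1 x)\<^sup>2 + c * t2 x x / (m1 x * (1 + c * t1 x))"
    using pos m1_pos[OF x] by (simp add: add_divide_distrib power2_eq_square)
  finally show ?thesis .
qed

end

lemma sum_lessThan_double:
  "(\<Sum>j<2 * r. f j) = (\<Sum>k<r. f k) + (\<Sum>k<r. f (r + k))" for f :: "nat \<Rightarrow> 'a::comm_monoid_add"
  using sum.nat_group[of f r 2] by (simp add: numeral_2_eq_2 mult.commute lessThan_atLeast0 sum.shift_bounds_nat_ivl[symmetric] add.commute)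

text \<open>Coordinates in the left singular basis of the noise: \<open>w n k\<close> stands for \<open>\<Gamma> R\<^sup>* s\<^sub>k\<close> when
  \<open>k < r\<close> and for \<open>L\<^sup>* b\<^bsub>k-r\<^esub>\<close> when \<open>r \<le> k < 2 r\<close>; \<open>t n\<close> lists the eigenvalues of the noise and \<open>SS n\<close> is
  the Gram matrix of the \<open>s\<^sub>k\<close>.\<close>

locale spiked_path = bounded_law \<pi> lmin lmax
  for \<pi> :: "real measure" and lmin lmax :: real +
  fixes N :: "nat \<Rightarrow> nat" and t :: "nat \<Rightarrow> nat \<Rightarrow> real" and c :: real and r :: nat and Om :: "nat \<Rightarrow> real"
    and w :: "nat \<Rightarrow> nat \<Rightarrow> nat \<Rightarrow> complex" and SS :: "nat \<Rightarrow> nat \<Rightarrow> nat \<Rightarrow> complex"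
  assumes c_pos: "0 < c" and r_pos: "0 < r" and Om_pos: "\<And>k. k < r \<Longrightarrow> 0 < Om k"
    and t_nonneg: "\<And>n i. 0 \<le> t n i"
    and t_bound: "\<And>\<kappa>. lmax < \<kappa> \<Longrightarrow> \<forall>\<^sub>F n in sequentially. \<forall>i<N n. t n i \<le> \<kappa>"
    and w_lim: "\<And>j k. j < 2 * r \<Longrightarrow> k < 2 * r \<Longrightarrow> weight_lim sequentially N t \<pi> (\<lambda>n i. cnj (w n j i) * w n k i)
        (\<lambda>x. if j = k then complex_of_real (if j < r then c * (Om j)\<^sup>2 * x else 1) else 0)"
    and SS_lim: "\<And>j k. j < r \<Longrightarrow> k < r \<Longrightarrow> (\<lambda>n. SS n j k) \<longlonglongrightarrow> (if j = k then complex_of_real ((Om j)\<^sup>2) else 0)"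
begin

definition dens :: "nat \<Rightarrow> real \<Rightarrow> real" where
  "dens j x = (if j < r then c * (Om j)\<^sup>2 * x else 1)"

text \<open>Left end of an interval that contains both the nonnegative points \<open>t n i\<close>
  and the support of \<pi>, whose lower end may have either sign.\<close>

definition lo :: real where "lo = min 0 lmin"

definition comb :: "nat \<Rightarrow> (nat \<Rightarrow> complex) \<Rightarrow> nat \<Rightarrow> complex" where
  "comb n v i = (\<Sum>j<2 * r. v j * w n j i)"

lemma dens_measurable [measurable]: "dens j \<in> borel_measurable borel"
  unfolding dens_def by measurable

text \<open>The interval ends at some \<kappa> beyond \<open>lmax\<close> because the points
  \<open>t n i\<close> are only eventually below every such \<kappa>. Resolvents remain continuous
  there as long as their level exceeds \<kappa>.\<close>

lemma weight_sum_tendsto: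
  assumes W: "weight_lim sequentially N t \<pi> W (\<lambda>x. complex_of_real (d x))" and F: "F \<le> sequentially"
    and d: "d \<in> borel_measurable borel" "continuous_on UNIV d"
    and \<kappa>: "lmax < \<kappa>" and h: "continuous_on {lo..\<kappa>} h" "h \<in> borel_measurable borel"
    and H: "uniform_limit {lo..\<kappa>} H h F"
  shows "((\<lambda>n. \<Sum>i<N n. complex_of_real (H n (t n i)) * W n i) \<longlongrightarrow> complex_of_real (LINT x|\<pi>. h x * d x)) F"
proof -
  have s: "AE x in \<pi>. x \<in> {lo..\<kappa>}" using supp_mono[of lo \<kappa>] \<kappa> by (auto simp: lo_def)
  have "compact (d ` {lo..\<kappa>})"
    by (rule compact_continuous_image[OF continuous_on_subset[OF d(2)] compact_Icc]) auto
  then have "bounded (d ` {lo..\<kappa>})" by (rule compact_imp_bounded)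
  then obtain B where "\<forall>x\<in>{lo..\<kappa>}. \<bar>d x\<bar> \<le> B"
    by (auto simp: bounded_iff)
  then have B: "\<bar>d x\<bar> \<le> B" if "x \<in> {lo..\<kappa>}" for x using that by blast
  have "((\<lambda>n. \<Sum>i<N n. complex_of_real (H n (t n i)) * W n i) \<longlongrightarrow> (LINT x|\<pi>. complex_of_real (h x) * complex_of_real (d x))) F"
  proof (rule weight_lim_uniform[OF weight_lim_mono[OF W F] prob sets_pi s _ _ _ h H])
    show "\<forall>\<^sub>F n in F. \<forall>i<N n. t n i \<in> {lo..\<kappa>}"
      using filter_leD[OF F t_bound[OF \<kappa>]] by eventually_elim (auto simp: lo_def t_nonneg min.coboundedI1)
    show "(\<lambda>x. complex_of_real (d x)) \<in> borel_measurable borel"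
      using d(1) by measurable
    show "AE x in \<pi>. cmod (complex_of_real (d x)) \<le> B"
      using s by eventually_elim (use B in simp)
  qed
  also have "(LINT x|\<pi>. complex_of_real (h x) * complex_of_real (d x)) = complex_of_real (LINT x|\<pi>. h x * d x)"
    by (simp flip: of_real_mult)
  finally show ?thesis .
qed

lemma w_lim': 
  assumes "j < 2 * r" "k < 2 * r"
  shows "weight_lim sequentially N t \<pi> (\<lambda>n i. cnj (w n j i) * w n k i) (\<lambda>x. complex_of_real (if j = k then dens j x else 0))"
proof -
  have "(\<lambda>x. if j = k then complex_of_real (if j < r then c * (Om j)\<^sup>2 * x else 1) else 0)
      = (\<lambda>x. complex_of_real (if j = k then dens j x else 0))"
    by (auto simp: dens_def fun_eq_iff)
  then show ?thesis using w_lim[OF assms] by simp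
qed

text \<open>After bilinear expansion the off-diagonal pairs have limit density 0, so only the
  diagonal survives.\<close>

lemma comb_pair_tendsto:
  assumes F: "F \<le> sequentially" and \<kappa>: "lmax < \<kappa>" and h: "continuous_on {lo..\<kappa>} h" "h \<in> borel_measurable borel"
    and H: "uniform_limit {lo..\<kappa>} H h F"
    and u: "\<And>j. j < 2 * r \<Longrightarrow> ((\<lambda>n. u n j) \<longlongrightarrow> U j) F" and v: "\<And>j. j < 2 * r \<Longrightarrow> ((\<lambda>n. v n j) \<longlongrightarrow> V j) F"
  shows "((\<lambda>n. \<Sum>i<N n. complex_of_real (H n (t n i)) * (cnj (comb n (u n) i) * comb n (v n) i))
    \<longlongrightarrow> (\<Sum>j<2 * r. cnj (U j) * V j * complex_of_real (LINT x|\<pi>. h x * dens j x))) F"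
proof -
  have eq: "(\<Sum>i<N n. complex_of_real (H n (t n i)) * (cnj (comb n (u n) i) * comb n (v n) i))
      = (\<Sum>j<2 * r. \<Sum>k<2 * r. cnj (u n j) * v n k * (\<Sum>i<N n. complex_of_real (H n (t n i)) * (cnj (w n j i) * w n k i)))" for n
  proof -
    have "(\<Sum>i<N n. complex_of_real (H n (t n i)) * (cnj (comb n (u n) i) * comb n (v n) i))
      = (\<Sum>i<N n. \<Sum>j<2 * r. \<Sum>k<2 * r. cnj (u n j) * v n k * (complex_of_real (H n (t n i)) * (cnj (w n j i) * w n k i)))"
      by (simp add: comb_def sum_product sum_distrib_left mult_ac)
    also have "\<dots> = (\<Sum>j<2 * r. \<Sum>k<2 * r. \<Sum>i<N n. cnj (u n j) * v n k * (complex_of_real (H n (t n i)) * (cnj (w n j i) * w n k i)))"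
      by (subst sum.swap, rule sum.cong[OF refl], subst sum.swap) simp
    finally show ?thesis by (simp add: sum_distrib_left)
  qed
  have "((\<lambda>n. \<Sum>j<2 * r. \<Sum>k<2 * r. cnj (u n j) * v n k * (\<Sum>i<N n. complex_of_real (H n (t n i)) * (cnj (w n j i) * w n k i)))
     \<longlongrightarrow> (\<Sum>j<2 * r. \<Sum>k<2 * r. cnj (U j) * V k * complex_of_real (LINT x|\<pi>. h x * (if j = k then dens j x else 0)))) F"
  proof (intro tendsto_sum tendsto_mult tendsto_cnj)
    fix j k assume "j \<in> {..<2 * r}" "k \<in> {..<2 * r}"
    then have jk: "j < 2 * r" "k < 2 * r" by auto
    show "((\<lambda>n. \<Sum>i<N n. complex_of_real (H n (t n i)) * (cnj (w n j i) * w n k i)) \<longlongrightarrow> complex_of_real (LINT x|\<pi>. h x * (if j = k then dens j x else 0))) F"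
      by (rule weight_sum_tendsto[OF w_lim'[OF jk] F _ _ \<kappa> h H]) (cases "j = k"; cases "j < r"; auto simp: dens_def intro!: continuous_intros)+
  qed (use u v in auto)
  also have "(\<Sum>j<2 * r. \<Sum>k<2 * r. cnj (U j) * V k * complex_of_real (LINT x|\<pi>. h x * (if j = k then dens j x else 0)))
      = (\<Sum>j<2 * r. \<Sum>k<2 * r. if j = k then cnj (U j) * V j * complex_of_real (LINT x|\<pi>. h x * dens j x) else 0)"
    by (intro sum.cong refl) auto
  also have "\<dots> = (\<Sum>j<2 * r. cnj (U j) * V j * complex_of_real (LINT x|\<pi>. h x * dens j x))"
    by simp
  finally show ?thesis unfolding eq .
qed

lemma comb_single_tendsto:
  assumes F: "F \<le> sequentially" and \<kappa>: "lmax < \<kappa>" and h: "continuous_on {lo..\<kappa>} h" "h \<in> borel_measurable borel"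
    and H: "uniform_limit {lo..\<kappa>} H h F" and j: "j < 2 * r"
    and v: "\<And>j. j < 2 * r \<Longrightarrow> ((\<lambda>n. v n j) \<longlongrightarrow> V j) F"
  shows "((\<lambda>n. \<Sum>i<N n. complex_of_real (H n (t n i)) * (cnj (w n j i) * comb n (v n) i))
    \<longlongrightarrow> V j * complex_of_real (LINT x|\<pi>. h x * dens j x)) F"
proof -
  have "comb n (\<lambda>k. if k = j then 1 else 0) i = w n j i" for n i
    using j by (simp add: comb_def if_distrib[of "\<lambda>x. x * _"] cong: if_cong)
  moreover have "(\<Sum>k<2 * r. cnj (if k = j then 1 else 0) * V k * complex_of_real (LINT x|\<pi>. h x * dens k x))
      = V j * complex_of_real (LINT x|\<pi>. h x * dens j x)"
    using j by (simp add: if_distrib[of "\<lambda>x. x * _"] if_distrib[of cnj] cong: if_cong)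
  ultimately show ?thesis
    using comb_pair_tendsto[OF F \<kappa> h H, of "\<lambda>n k. if k = j then 1 else 0" "\<lambda>k. if k = j then 1 else 0" v V] v by simp
qed

lemma integral_dens:
  "j < r \<Longrightarrow> (LINT x|\<pi>. h x * dens j x) = c * (Om j)\<^sup>2 * (LINT x|\<pi>. h x * x)"
  "(LINT x|\<pi>. h x * dens (r + j) x) = (LINT x|\<pi>. h x)"
proof -
  have "(\<lambda>x. h x * dens j x) = (\<lambda>x. c * (Om j)\<^sup>2 * (h x * x))" if "j < r"
    using that by (simp add: dens_def fun_eq_iff)
  then show "j < r \<Longrightarrow> (LINT x|\<pi>. h x * dens j x) = c * (Om j)\<^sup>2 * (LINT x|\<pi>. h x * x)"
    by (simp only: integral_mult_right_zero)
qed (simp add: dens_def)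

text \<open>The hypotheses do not say that the limit law lives on the half line; the signs needed below
  come from the nonnegative prelimit sums.\<close>

lemma integral_id_nonneg:
  assumes \<kappa>: "lmax < \<kappa>" and h: "continuous_on {lo..\<kappa>} h" "h \<in> borel_measurable borel" "\<And>x. x \<in> {lo..\<kappa>} \<Longrightarrow> 0 \<le> h x"
  shows "0 \<le> (LINT x|\<pi>. h x * x)"
proof -
  have "(\<lambda>n. \<Sum>i<N n. complex_of_real (h (t n i)) * (cnj (w n 0 i) * w n 0 i))
     \<longlonglongrightarrow> complex_of_real (LINT x|\<pi>. h x * dens 0 x)"
  proof (rule weight_sum_tendsto[OF _ _ _ _ \<kappa> h(1,2)])
    show "weight_lim sequentially N t \<pi> (\<lambda>n i. cnj (w n 0 i) * w n 0 i) (\<lambda>x. complex_of_real (dens 0 x))"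
      using w_lim'[of 0 0] r_pos by simp
    show "continuous_on UNIV (dens 0)" using r_pos unfolding dens_def by (auto intro!: continuous_intros)
  qed (auto intro: uniform_limit_const)
  then have "(\<lambda>n. Re (\<Sum>i<N n. complex_of_real (h (t n i)) * (cnj (w n 0 i) * w n 0 i))) \<longlonglongrightarrow> (LINT x|\<pi>. h x * dens 0 x)"
    using tendsto_Re by fastforce
  moreover have "\<forall>\<^sub>F n in sequentially. 0 \<le> Re (\<Sum>i<N n. complex_of_real (h (t n i)) * (cnj (w n 0 i) * w n 0 i))"
    using t_bound[OF \<kappa>]
  proof eventually_elim
    case (elim n)
    have "0 \<le> Re (complex_of_real (h (t n i)) * (cnj (w n 0 i) * w n 0 i))" if "i < N n" for i
    proof -
      have "t n i \<in> {lo..\<kappa>}" using elim that t_nonneg[of n i] by (auto simp: lo_def)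
      then show ?thesis using h(3) by simp
    qed
    then show ?case unfolding Re_sum by (intro sum_nonneg) auto
  qed
  ultimately have "0 \<le> (LINT x|\<pi>. h x * dens 0 x)"
    by (rule tendsto_lowerbound) simp
  then have "0 \<le> c * (Om 0)\<^sup>2 * (LINT x|\<pi>. h x * x)" by (simp only: integral_dens(1)[OF r_pos])
  moreover have "0 < c * (Om 0)\<^sup>2" using c_pos Om_pos[OF r_pos] by simp
  ultimately show ?thesis by (simp add: zero_le_mult_iff)
qed

lemma t1_nonneg: assumes "lmax < \<rho>" shows "0 \<le> t1 \<rho>"
proof -
  obtain \<kappa> where "lmax < \<kappa>" "\<kappa> < \<rho>" using dense[OF assms] by blast
  then show ?thesis unfolding t1_def
    by (intro integral_id_nonneg[of \<kappa>] resolvent_continuous) auto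
qed

lemma t2_nonneg: assumes "lmax < \<rho>" "lmax < \<mu>" shows "0 \<le> t2 \<rho> \<mu>"
proof -
  obtain \<kappa> where "lmax < \<kappa>" "\<kappa> < min \<rho> \<mu>" using dense[of lmax "min \<rho> \<mu>"] assms by auto
  then show ?thesis unfolding t2_def
    by (intro integral_id_nonneg[of \<kappa>] continuous_intros) auto
qed

text \<open>This is -\<rho> times the companion transform at \<rho>, so that
  \<open>m1 \<rho> * sf \<rho>\<close> is g(\<rho>).\<close>

definition sf :: "real \<Rightarrow> real" where "sf \<rho> = 1 + c * t1 \<rho>"

lemma sf_pos: "lmax < \<rho> \<Longrightarrow> 0 < sf \<rho>"
  using t1_nonneg c_pos unfolding sf_def by (simp add: add_pos_nonneg)

text \<open>The factor relating the limit inner product of two eigenvectors to that of their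
  coefficient vectors q. It is not visibly symmetric because \<open>Om k\<close> has been eliminated
  by the secular equation at \<rho>. On the diagonal it is \<zeta>.\<close>

definition Jf :: "real \<Rightarrow> real \<Rightarrow> real" where
  "Jf \<rho> \<mu> = m2 \<rho> \<mu> / (m1 \<rho> * m1 \<mu>) + c * t2 \<rho> \<mu> / (m1 \<rho> * sf \<rho>)"

lemma Jf_pos: assumes "lmax < \<rho>" "lmax < \<mu>" shows "0 < Jf \<rho> \<mu>"
  unfolding Jf_def
  using m1_pos[OF assms(1)] m1_pos[OF assms(2)] m2_pos[OF assms] t2_nonneg[OF assms] sf_pos[OF assms(1)] c_pos
  by (intro add_pos_nonneg) auto

lemma zeta_Jf: "lmax < \<rho> \<Longrightarrow> zeta c \<pi> \<rho> = Jf \<rho> \<rho>"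
  using zeta_eq[of \<rho> c] sf_pos[of \<rho>] by (simp add: Jf_def sf_def power2_eq_square)

lemma tendsto_zeta:
  assumes l: "(l \<longlongrightarrow> \<rho>) F" and \<rho>: "lmax < \<rho>"
  shows "((\<lambda>n. zeta c \<pi> (l n)) \<longlongrightarrow> zeta c \<pi> \<rho>) F"
proof (rule Lim_transform_eventually)
  let ?Z = "\<lambda>x. m2 x x / (m1 x * m1 x) + c * (x * m2 x x - m1 x) / (m1 x * (1 + c * (x * m1 x - 1)))"
  have Z: "zeta c \<pi> x = ?Z x" if "lmax < x" for x
    using zeta_Jf[OF that] that by (simp add: Jf_def sf_def t1_eq t2_eq)
  have "m1 \<rho> \<noteq> 0" "1 + c * (\<rho> * m1 \<rho> - 1) \<noteq> 0"
    using m1_pos[OF \<rho>] sf_pos[OF \<rho>] by (auto simp: sf_def t1_eq[OF \<rho>])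
  then have "((\<lambda>n. ?Z (l n)) \<longlongrightarrow> ?Z \<rho>) F"
    by (intro tendsto_intros tendsto_m1 tendsto_m2 l \<rho>) auto
  then show "((\<lambda>n. ?Z (l n)) \<longlongrightarrow> zeta c \<pi> \<rho>) F" by (simp only: Z[OF \<rho>])
  show "\<forall>\<^sub>F n in F. ?Z (l n) = zeta c \<pi> (l n)"
    using order_tendstoD(1)[OF l \<rho>] by eventually_elim (simp only: Z)
qed

end

section \<open>Parseval's identity for a full orthonormal family\<close>

text \<open>The scaled vectors are \<open>r\<close> orthonormal vectors in dimension
  \<open>r\<close>. A one-sided inverse of a square matrix is two-sided, which yields the
  completeness relation \<open>dual\<close> and with it the identity.\<close>

lemma orthogonal_family_parseval:
  fixes q :: "nat \<Rightarrow> nat \<Rightarrow> complex" and \<zeta> :: "nat \<Rightarrow> real" and \<alpha> :: "nat \<Rightarrow> complex"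
  assumes orth: "\<And>l l'. l < r \<Longrightarrow> l' < r \<Longrightarrow>
      complex_of_real (sqrt (\<zeta> l)) * complex_of_real (sqrt (\<zeta> l')) * (\<Sum>k<r. cnj (q l k) * q l' k) = (if l = l' then 1 else 0)"
    and \<zeta>: "\<And>l. l < r \<Longrightarrow> 0 \<le> \<zeta> l"
  shows "(\<Sum>l<r. (cmod (\<Sum>k<r. \<alpha> k * q l k))\<^sup>2 * \<zeta> l) = (\<Sum>k<r. (cmod (\<alpha> k))\<^sup>2)"
proof -
  define V where "V = mat r r (\<lambda>(l, k). complex_of_real (sqrt (\<zeta> l)) * cnj (q l k))"
  define W where "W = mat r r (\<lambda>(k, l). complex_of_real (sqrt (\<zeta> l)) * q l k)"
  have VW: "V * W = 1\<^sub>m r"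
  proof (rule eq_matI)
    fix i j assume "i < dim_row (1\<^sub>m r :: complex mat)" "j < dim_col (1\<^sub>m r :: complex mat)"
    then have ij: "i < r" "j < r" by auto
    have "(V * W) $$ (i, j) = (\<Sum>k<r. complex_of_real (sqrt (\<zeta> i)) * cnj (q i k) * (complex_of_real (sqrt (\<zeta> j)) * q j k))"
      using ij by (simp add: V_def W_def scalar_prod_def atLeast0LessThan)
    also have "\<dots> = complex_of_real (sqrt (\<zeta> i)) * complex_of_real (sqrt (\<zeta> j)) * (\<Sum>k<r. cnj (q i k) * q j k)"
      by (simp add: sum_distrib_left mult_ac)
    finally show "(V * W) $$ (i, j) = (1\<^sub>m r :: complex mat) $$ (i, j)"
      using orth[OF ij] ij by simp
  qed (simp_all add: V_def W_def)
  then have WV: "W * V = 1\<^sub>m r"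
    by (rule mat_mult_left_right_inverse[rotated 2]) (simp_all add: V_def W_def)
  have dual: "(\<Sum>l<r. complex_of_real (\<zeta> l) * q l k * cnj (q l k')) = (if k = k' then 1 else 0)" if "k < r" "k' < r" for k k'
  proof -
    have "(W * V) $$ (k, k') = (\<Sum>l<r. complex_of_real (sqrt (\<zeta> l)) * q l k * (complex_of_real (sqrt (\<zeta> l)) * cnj (q l k')))"
      using that by (simp add: V_def W_def scalar_prod_def atLeast0LessThan)
    also have "\<dots> = (\<Sum>l<r. complex_of_real (\<zeta> l) * q l k * cnj (q l k'))"
    proof (intro sum.cong refl)
      fix l assume "l \<in> {..<r}"
      then have "complex_of_real (sqrt (\<zeta> l)) * complex_of_real (sqrt (\<zeta> l)) = complex_of_real (\<zeta> l)"
        using \<zeta> by (simp flip: of_real_mult)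
      then show "complex_of_real (sqrt (\<zeta> l)) * q l k * (complex_of_real (sqrt (\<zeta> l)) * cnj (q l k')) = complex_of_real (\<zeta> l) * q l k * cnj (q l k')"
        by (simp add: mult_ac)
    qed
    finally show ?thesis using WV that by simp
  qed
  have "complex_of_real (\<Sum>l<r. (cmod (\<Sum>k<r. \<alpha> k * q l k))\<^sup>2 * \<zeta> l)
      = (\<Sum>l<r. \<Sum>k<r. \<Sum>k'<r. \<alpha> k * cnj (\<alpha> k') * (complex_of_real (\<zeta> l) * q l k * cnj (q l k')))"
  proof -
    have "complex_of_real ((cmod (\<Sum>k<r. \<alpha> k * q l k))\<^sup>2 * \<zeta> l)
        = (\<Sum>k<r. \<Sum>k'<r. (\<alpha> k * q l k) * cnj (\<alpha> k' * q l k')) * complex_of_real (\<zeta> l)" for l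
      by (simp only: of_real_mult complex_norm_square cnj_sum sum_product)
    moreover have "(\<Sum>k<r. \<Sum>k'<r. (\<alpha> k * q l k) * cnj (\<alpha> k' * q l k')) * complex_of_real (\<zeta> l) = (\<Sum>k<r. \<Sum>k'<r. \<alpha> k * cnj (\<alpha> k') * (complex_of_real (\<zeta> l) * q l k * cnj (q l k')))" for l
      by (simp add: sum_distrib_right sum_distrib_left mult_ac)
    ultimately show ?thesis
      unfolding of_real_sum by (intro sum.cong refl) (simp only:)
  qed
  also have "\<dots> = (\<Sum>k<r. \<Sum>k'<r. \<Sum>l<r. \<alpha> k * cnj (\<alpha> k') * (complex_of_real (\<zeta> l) * q l k * cnj (q l k')))"
    by (subst sum.swap, rule sum.cong[OF refl], subst sum.swap) simp
  also have "\<dots> = (\<Sum>k<r. \<Sum>k'<r. \<alpha> k * cnj (\<alpha> k') * (\<Sum>l<r. complex_of_real (\<zeta> l) * q l k * cnj (q l k')))"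
    by (simp add: sum_distrib_left)
  also have "\<dots> = (\<Sum>k<r. \<Sum>k'<r. if k = k' then \<alpha> k * cnj (\<alpha> k') else 0)"
    by (intro sum.cong refl) (auto simp: dual)
  also have "\<dots> = complex_of_real (\<Sum>k<r. (cmod (\<alpha> k))\<^sup>2)"
    by (simp add: complex_norm_square del: of_real_power)
  finally show ?thesis by (simp only: of_real_eq_iff)
qed

lemma weighted_inner_bound:
  assumes "(\<Sum>i\<in>I. cnj (f i) * f i) = 1" "(\<Sum>i\<in>I. cmod (cnj (u i) * u i)) \<le> C"
  shows "cmod (\<Sum>i\<in>I. cnj (u i) * f i) \<le> 1 + C"
proof -
  have 1: "(\<Sum>i\<in>I. (cmod (f i))\<^sup>2) = 1"
  proof -
    have "complex_of_real (\<Sum>i\<in>I. (cmod (f i))\<^sup>2) = 1"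
      using assms(1) by (simp add: complex_norm_square mult.commute del: of_real_power)
    then show ?thesis by (simp only: of_real_eq_1_iff)
  qed
  have "cmod (\<Sum>i\<in>I. cnj (u i) * f i) \<le> (\<Sum>i\<in>I. (cmod (f i))\<^sup>2 + cmod (cnj (u i) * u i))"
  proof (rule sum_norm_le)
    fix i
    have "0 \<le> cmod (u i) * cmod (f i)" by simp
    then show "cmod (cnj (u i) * f i) \<le> (cmod (f i))\<^sup>2 + cmod (cnj (u i) * u i)"
      using sum_squares_bound[of "cmod (u i)" "cmod (f i)"]
      unfolding norm_mult complex_mod_cnj power2_eq_square by linarith
  qed
  then show ?thesis using 1 assms(2) by (simp add: sum.distrib)
qed

section \<open>Existence of outliers\<close>

context spiked_path
begin

text \<open>The squared norm of \<Sigma>^* u in the coordinates e = L^* u: the pure noise, the two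
  mixed terms, and the pure signal with its Gram matrix.\<close>

definition quad_form :: "nat \<Rightarrow> (nat \<Rightarrow> complex) \<Rightarrow> complex" where
  "quad_form n e = (\<Sum>i<N n. complex_of_real (t n i) * (cnj (e i) * e i))
     + (\<Sum>k<r. cnj (\<Sum>i<N n. cnj (w n (r + k) i) * e i) * (\<Sum>i<N n. cnj (w n k i) * e i))
     + (\<Sum>k<r. (\<Sum>i<N n. cnj (w n (r + k) i) * e i) * cnj (\<Sum>i<N n. cnj (w n k i) * e i))
     + (\<Sum>k<r. \<Sum>j<r. cnj (\<Sum>i<N n. cnj (w n (r + k) i) * e i) * SS n k j * (\<Sum>i<N n. cnj (w n (r + j) i) * e i))"

text \<open>The test vector is the eigenvector formula at a prescribed level \<open>x\<close>, with
  q = \<open>m1 x\<close> p as an eigenvector would have in the limit. The second limit relation, p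
  = Om^2 sf q, is not imposed, and its defect is the factor
  \<open>m1 x * sf x * (Om k)\<^sup>2 - 1\<close>. Its sign decides whether the form exceeds
  \<open>x\<close> times the squared norm.\<close>

lemma quad_form_test_vector:
  assumes F: "F \<le> sequentially" and x: "lmax < x"
    and P: "\<And>k. k < r \<Longrightarrow> ((\<lambda>n. p n k) \<longlongrightarrow> P k) F"
    and e: "\<And>n. e n = (\<lambda>i. complex_of_real (1 / (x - t n i)) * comb n (\<lambda>j. if j < r then complex_of_real (m1 x) * p n j else p n (j - r)) i)"
  shows "((\<lambda>n. quad_form n (e n) - complex_of_real x * (\<Sum>i<N n. cnj (e n i) * e n i))
    \<longlongrightarrow> complex_of_real (\<Sum>k<r. (cmod (P k))\<^sup>2 * (m1 x * (m1 x * sf x * (Om k)\<^sup>2 - 1)))) F"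
proof -
  obtain \<kappa> where \<kappa>: "lmax < \<kappa>" "\<kappa> < x" using dense[OF x] by blast
  define v where "v = (\<lambda>n j. if j < r then complex_of_real (m1 x) * p n j else p n (j - r))"
  define V where "V = (\<lambda>j. if j < r then complex_of_real (m1 x) * P j else P (j - r))"
  define h where "h = (\<lambda>y::real. 1 / (x - y))"
  have v: "((\<lambda>n. v n j) \<longlongrightarrow> V j) F" if "j < 2 * r" for j
    using that P by (cases "j < r") (auto simp: v_def V_def intro!: tendsto_mult_left)
  have ev: "e n i = complex_of_real (h (t n i)) * comb n (v n) i" for n i
    by (simp add: e v_def h_def)
  have hc: "continuous_on {lo..\<kappa>} h" "h \<in> borel_measurable borel" "uniform_limit {lo..\<kappa>} (\<lambda>_::nat. h) h F"
    unfolding h_def by (auto intro: resolvent_continuous \<kappa> uniform_limit_const)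
  have Fn: "\<forall>\<^sub>F n in F. \<forall>i<N n. t n i \<le> \<kappa>" by (rule filter_leD[OF F t_bound[OF \<kappa>(1)]])
  have Ih: "(LINT y|\<pi>. h y * dens j y) = c * (Om j)\<^sup>2 * t1 x" if "j < r" for j
    using integral_dens(1)[OF that, of h] by (simp add: h_def t1_def)
  have Ih': "(LINT y|\<pi>. h y * dens (r + j) y) = m1 x" for j
    using integral_dens(2)[of h j] by (simp add: h_def m1_def)
  have single: "((\<lambda>n. \<Sum>i<N n. cnj (w n j i) * e n i) \<longlongrightarrow> V j * complex_of_real (LINT y|\<pi>. h y * dens j y)) F" if "j < 2 * r" for j
  proof -
    have "(\<Sum>i<N n. cnj (w n j i) * e n i) = (\<Sum>i<N n. complex_of_real (h (t n i)) * (cnj (w n j i) * comb n (v n) i))" for n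
      by (simp add: ev mult_ac)
    then show ?thesis using comb_single_tendsto[OF F \<kappa>(1) hc that, where v = v and V = V] v by simp
  qed
  have q: "((\<lambda>n. \<Sum>i<N n. cnj (w n (r + k) i) * e n i) \<longlongrightarrow> P k * complex_of_real (m1 x)) F" if "k < r" for k
    using single[of "r + k"] that by (simp add: Ih' V_def)
  have s: "((\<lambda>n. \<Sum>i<N n. cnj (w n k i) * e n i) \<longlongrightarrow> complex_of_real (m1 x) * P k * complex_of_real (c * (Om k)\<^sup>2 * t1 x)) F" if "k < r" for k
    using single[of k] that by (simp add: Ih V_def)
  have d: "((\<lambda>n. \<Sum>i<N n. complex_of_real (t n i) * (cnj (e n i) * e n i) - complex_of_real x * (cnj (e n i) * e n i))
      \<longlongrightarrow> - (\<Sum>j<2 * r. cnj (V j) * V j * complex_of_real (LINT y|\<pi>. h y * dens j y))) F"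
  proof (rule Lim_transform_eventually)
    show "((\<lambda>n. - (\<Sum>i<N n. complex_of_real (h (t n i)) * (cnj (comb n (v n) i) * comb n (v n) i)))
        \<longlongrightarrow> - (\<Sum>j<2 * r. cnj (V j) * V j * complex_of_real (LINT y|\<pi>. h y * dens j y))) F"
      by (intro tendsto_minus comb_pair_tendsto[OF F \<kappa>(1) hc] v)
    show "\<forall>\<^sub>F n in F. - (\<Sum>i<N n. complex_of_real (h (t n i)) * (cnj (comb n (v n) i) * comb n (v n) i))
        = (\<Sum>i<N n. complex_of_real (t n i) * (cnj (e n i) * e n i) - complex_of_real x * (cnj (e n i) * e n i))"
      using Fn
    proof eventually_elim
      case (elim n)
      have "complex_of_real (t n i) * (cnj (e n i) * e n i) - complex_of_real x * (cnj (e n i) * e n i)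
          = - (complex_of_real (h (t n i)) * (cnj (comb n (v n) i) * comb n (v n) i))" if "i < N n" for i
      proof -
        have "t n i < x" using elim that \<kappa> by force
        moreover have "- d * (1 / d * (1 / d)) = - (1 / d)" if "d \<noteq> 0" for d :: real using that by simp
        from this[of "x - t n i"] have "(t n i - x) * (h (t n i) * h (t n i)) = - h (t n i)" if "t n i < x"
          using that by (simp only: h_def minus_diff_eq)
        ultimately have "(t n i - x) * (h (t n i) * h (t n i)) = - h (t n i)" by blast
        then have "complex_of_real (t n i - x) * (complex_of_real (h (t n i)) * complex_of_real (h (t n i))) = - complex_of_real (h (t n i))"
          by (simp only: flip: of_real_mult of_real_minus)
        moreover have "complex_of_real (t n i) * (cnj (e n i) * e n i) - complex_of_real x * (cnj (e n i) * e n i)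
            = (complex_of_real (t n i - x) * (complex_of_real (h (t n i)) * complex_of_real (h (t n i)))) * (cnj (comb n (v n) i) * comb n (v n) i)"
          by (simp add: ev algebra_simps)
        ultimately show ?thesis by simp
      qed
      then show ?case by (simp add: sum_negf)
    qed
  qed
  have "((\<lambda>n. (\<Sum>i<N n. complex_of_real (t n i) * (cnj (e n i) * e n i) - complex_of_real x * (cnj (e n i) * e n i))
     + (\<Sum>k<r. cnj (\<Sum>i<N n. cnj (w n (r + k) i) * e n i) * (\<Sum>i<N n. cnj (w n k i) * e n i))
     + (\<Sum>k<r. (\<Sum>i<N n. cnj (w n (r + k) i) * e n i) * cnj (\<Sum>i<N n. cnj (w n k i) * e n i))
     + (\<Sum>k<r. \<Sum>j<r. cnj (\<Sum>i<N n. cnj (w n (r + k) i) * e n i) * SS n k j * (\<Sum>i<N n. cnj (w n (r + j) i) * e n i)))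
    \<longlongrightarrow> - (\<Sum>j<2 * r. cnj (V j) * V j * complex_of_real (LINT y|\<pi>. h y * dens j y))
     + (\<Sum>k<r. cnj (P k * complex_of_real (m1 x)) * (complex_of_real (m1 x) * P k * complex_of_real (c * (Om k)\<^sup>2 * t1 x)))
     + (\<Sum>k<r. (P k * complex_of_real (m1 x)) * cnj (complex_of_real (m1 x) * P k * complex_of_real (c * (Om k)\<^sup>2 * t1 x)))
     + (\<Sum>k<r. \<Sum>j<r. cnj (P k * complex_of_real (m1 x)) * (if k = j then complex_of_real ((Om k)\<^sup>2) else 0) * (P j * complex_of_real (m1 x)))) F"
    by (intro tendsto_add tendsto_sum tendsto_mult tendsto_cnj d q s tendsto_mono[OF F SS_lim]) auto
  also have "- (\<Sum>j<2 * r. cnj (V j) * V j * complex_of_real (LINT y|\<pi>. h y * dens j y))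
     + (\<Sum>k<r. cnj (P k * complex_of_real (m1 x)) * (complex_of_real (m1 x) * P k * complex_of_real (c * (Om k)\<^sup>2 * t1 x)))
     + (\<Sum>k<r. (P k * complex_of_real (m1 x)) * cnj (complex_of_real (m1 x) * P k * complex_of_real (c * (Om k)\<^sup>2 * t1 x)))
     + (\<Sum>k<r. \<Sum>j<r. cnj (P k * complex_of_real (m1 x)) * (if k = j then complex_of_real ((Om k)\<^sup>2) else 0) * (P j * complex_of_real (m1 x)))
     = complex_of_real (\<Sum>k<r. (cmod (P k))\<^sup>2 * (m1 x * (m1 x * sf x * (Om k)\<^sup>2 - 1)))" (is "?L = _")
  proof -
    have 1: "(\<Sum>j<2 * r. cnj (V j) * V j * complex_of_real (LINT y|\<pi>. h y * dens j y))
        = (\<Sum>k<r. complex_of_real ((cmod (P k))\<^sup>2) * complex_of_real (m1 x * m1 x * (c * (Om k)\<^sup>2 * t1 x)))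
         + (\<Sum>k<r. complex_of_real ((cmod (P k))\<^sup>2) * complex_of_real (m1 x))"
      unfolding sum_lessThan_double
      by (intro arg_cong2[where f = "(+)"] sum.cong refl)
        (simp_all add: V_def Ih Ih' complex_norm_square mult_ac del: of_real_power)
    have 2: "(\<Sum>k<r. \<Sum>j<r. cnj (P k * complex_of_real (m1 x)) * (if k = j then complex_of_real ((Om k)\<^sup>2) else 0) * (P j * complex_of_real (m1 x)))
        = (\<Sum>k<r. complex_of_real ((cmod (P k))\<^sup>2) * complex_of_real (m1 x * m1 x * (Om k)\<^sup>2))"
      by (intro sum.cong refl) (simp add: if_distrib[of "\<lambda>x. _ * x"] if_distrib[of "\<lambda>x. x * _"] complex_norm_square mult_ac del: of_real_power cong: if_cong)
    have 3: "?L = (\<Sum>k<r. - (complex_of_real ((cmod (P k))\<^sup>2) * complex_of_real (m1 x * m1 x * (c * (Om k)\<^sup>2 * t1 x)) + complex_of_real ((cmod (P k))\<^sup>2) * complex_of_real (m1 x))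
       + cnj (P k * complex_of_real (m1 x)) * (complex_of_real (m1 x) * P k * complex_of_real (c * (Om k)\<^sup>2 * t1 x))
       + (P k * complex_of_real (m1 x)) * cnj (complex_of_real (m1 x) * P k * complex_of_real (c * (Om k)\<^sup>2 * t1 x))
       + complex_of_real ((cmod (P k))\<^sup>2) * complex_of_real (m1 x * m1 x * (Om k)\<^sup>2))"
      unfolding 1 2 sum.distrib sum_negf by simp
    show ?thesis unfolding 3 of_real_sum
      by (intro sum.cong refl)
        (simp add: sf_def complex_norm_square algebra_simps del: of_real_power)
  qed
  finally show ?thesis
    unfolding quad_form_def sum_subtractf sum_distrib_left by (simp add: algebra_simps)
qed

text \<open>Suppose \<mu> n stays at or below \<open>x\<close> along a proper filter. The min-max
  vectors then give unit coefficient vectors on which the form minus \<open>x\<close> is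
  nonpositive. As \<open>r\<close> is fixed, these cluster at a unit vector \<open>P\<close>, at
  which the limit form is positive by \<open>above\<close>, a contradiction.\<close>

lemma outlier_existence:
  assumes x: "lmax < x" and above: "\<And>k. k < r \<Longrightarrow> 1 < m1 x * sf x * (Om k)\<^sup>2"
    and minmax: "\<forall>\<^sub>F n in sequentially. \<forall>E :: nat \<Rightarrow> nat \<Rightarrow> complex. \<exists>p. (\<Sum>k<r. (cmod (p k))\<^sup>2) = 1 \<and>
        Re (quad_form n (\<lambda>i. \<Sum>k<r. p k * E k i)) \<le> \<mu> n * (\<Sum>i<N n. (cmod (\<Sum>k<r. p k * E k i))\<^sup>2)"
  shows "\<forall>\<^sub>F n in sequentially. x < \<mu> n"
proof (rule ccontr)
  assume neg: "\<not> (\<forall>\<^sub>F n in sequentially. x < \<mu> n)"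
  let ?G = "inf sequentially (principal {n. \<not> x < \<mu> n})"
  have G: "?G \<noteq> bot" using neg by (auto simp: trivial_limit_def eventually_inf_principal)
  define E where "E = (\<lambda>n k i. complex_of_real (1 / (x - t n i)) * (complex_of_real (m1 x) * w n k i + w n (r + k) i))"
  define p where "p = (\<lambda>n. SOME p. (\<Sum>k<r. (cmod (p k))\<^sup>2) = 1 \<and>
        Re (quad_form n (\<lambda>i. \<Sum>k<r. p k * E n k i)) \<le> \<mu> n * (\<Sum>i<N n. (cmod (\<Sum>k<r. p k * E n k i))\<^sup>2))"
  have "\<forall>\<^sub>F n in sequentially. (\<Sum>k<r. (cmod (p n k))\<^sup>2) = 1 \<and>
        Re (quad_form n (\<lambda>i. \<Sum>k<r. p n k * E n k i)) \<le> \<mu> n * (\<Sum>i<N n. (cmod (\<Sum>k<r. p n k * E n k i))\<^sup>2)"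
    using minmax
  proof eventually_elim
    case (elim n)
    then show ?case unfolding p_def by (intro someI_ex[of "\<lambda>p. (\<Sum>k<r. (cmod (p k))\<^sup>2) = 1 \<and> _ p"]) blast
  qed
  then have p: "\<forall>\<^sub>F n in ?G. (\<Sum>k<r. (cmod (p n k))\<^sup>2) = 1 \<and>
        Re (quad_form n (\<lambda>i. \<Sum>k<r. p n k * E n k i)) \<le> \<mu> n * (\<Sum>i<N n. (cmod (\<Sum>k<r. p n k * E n k i))\<^sup>2) \<and> \<not> x < \<mu> n"
    by (simp add: eventually_inf_principal eventually_mono)
  have "\<exists>F\<le>?G. F \<noteq> bot \<and> (\<forall>k\<in>{..<r}. \<exists>l. ((\<lambda>n. p n k) \<longlongrightarrow> l) F)"
  proof (rule finite_family_cluster[OF _ G])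
    fix k assume k: "k \<in> {..<r}"
    have "\<forall>\<^sub>F n in ?G. p n k \<in> cball 0 1"
      using p
    proof eventually_elim
      case (elim n)
      have "(cmod (p n k))\<^sup>2 \<le> (\<Sum>k<r. (cmod (p n k))\<^sup>2)" using k by (intro member_le_sum) auto
      then show ?case using elim by (simp add: abs_square_le_1)
    qed
    then show "\<exists>S. bounded S \<and> (\<forall>\<^sub>F n in ?G. p n k \<in> S)" using bounded_cball by blast
  qed simp
  then obtain F P where F: "F \<le> ?G" "F \<noteq> bot" and P: "\<And>k. k < r \<Longrightarrow> ((\<lambda>n. p n k) \<longlongrightarrow> P k) F"
    by (metis lessThan_iff)
  have Fs: "F \<le> sequentially" using F(1) by (rule order_trans) simp
  define e where "e = (\<lambda>n i. \<Sum>k<r. p n k * E n k i)"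
  have e: "e n = (\<lambda>i. complex_of_real (1 / (x - t n i)) * comb n (\<lambda>j. if j < r then complex_of_real (m1 x) * p n j else p n (j - r)) i)" for n
  proof
    fix i
    show "e n i = complex_of_real (1 / (x - t n i)) * comb n (\<lambda>j. if j < r then complex_of_real (m1 x) * p n j else p n (j - r)) i"
      unfolding comb_def sum_lessThan_double sum.distrib[symmetric] sum_distrib_left e_def E_def
      by (intro sum.cong refl) (simp add: algebra_simps)
  qed
  let ?L = "\<Sum>k<r. (cmod (P k))\<^sup>2 * (m1 x * (m1 x * sf x * (Om k)\<^sup>2 - 1))"
  have lim: "((\<lambda>n. Re (quad_form n (e n) - complex_of_real x * (\<Sum>i<N n. cnj (e n i) * e n i))) \<longlongrightarrow> ?L) F"
    using tendsto_Re[OF quad_form_test_vector[OF Fs x P e]] by simp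
  have "\<forall>\<^sub>F n in F. Re (quad_form n (e n) - complex_of_real x * (\<Sum>i<N n. cnj (e n i) * e n i)) \<le> 0"
    using filter_leD[OF F(1) p]
  proof eventually_elim
    case (elim n)
    have s: "(\<Sum>i<N n. cnj (e n i) * e n i) = complex_of_real (\<Sum>i<N n. (cmod (e n i))\<^sup>2)"
      by (simp add: complex_norm_square mult.commute del: of_real_power)
    have "Re (quad_form n (e n)) \<le> \<mu> n * (\<Sum>i<N n. (cmod (e n i))\<^sup>2)" using elim by (simp add: e_def)
    also have "\<dots> \<le> x * (\<Sum>i<N n. (cmod (e n i))\<^sup>2)" using elim by (intro mult_right_mono sum_nonneg) auto
    finally show ?case unfolding s by simp
  qed
  then have "?L \<le> 0" by (rule tendsto_upperbound[OF lim _ F(2)])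
  moreover have "0 < ?L"
  proof -
    have "((\<lambda>n. \<Sum>k<r. (cmod (p n k))\<^sup>2) \<longlongrightarrow> (\<Sum>k<r. (cmod (P k))\<^sup>2)) F"
      by (intro tendsto_sum tendsto_power tendsto_norm P) auto
    moreover have "((\<lambda>n. \<Sum>k<r. (cmod (p n k))\<^sup>2) \<longlongrightarrow> 1) F"
      by (rule tendsto_eventually) (use filter_leD[OF F(1) p] in \<open>auto elim: eventually_mono\<close>)
    ultimately have one: "(\<Sum>k<r. (cmod (P k))\<^sup>2) = 1" using tendsto_unique[OF F(2)] by blast
    have pos: "0 < m1 x * (m1 x * sf x * (Om k)\<^sup>2 - 1)" if "k < r" for k
      using above[OF that] m1_pos[OF x] by simp
    obtain k where k: "k < r" "P k \<noteq> 0" using one by (metis (mono_tags, lifting) lessThan_iff norm_zero power_zero_numeral sum.neutral zero_neq_one)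
    show ?thesis
    proof (rule sum_pos2[of _ k])
      show "0 < (cmod (P k))\<^sup>2 * (m1 x * (m1 x * sf x * (Om k)\<^sup>2 - 1))"
        by (rule mult_pos_pos[OF _ pos[OF k(1)]]) (use k in simp)
      show "0 \<le> (cmod (P i))\<^sup>2 * (m1 x * (m1 x * sf x * (Om i)\<^sup>2 - 1))" if "i \<in> {..<r}" for i
        by (rule mult_nonneg_nonneg[OF _ less_imp_le[OF pos]]) (use that in auto)
    qed (use k in auto)
  qed
  ultimately show False by simp
qed

end

section \<open>Limits of the outlier eigenvectors\<close>

text \<open>\<open>v n l\<close> stacks q below index r and p from r on, so that \<open>comb\<close>
  attaches q to the vectors coming from S and p to the steering vectors. The relations for the
  coefficients run crosswise: q is an inner product with the steering vectors, and p involves those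
  coming from S.\<close>

locale spiked_eigen = spiked_path \<pi> lmin lmax N t c r Om w SS
  for \<pi> lmin lmax N t c r Om w SS +
  fixes lam :: "nat \<Rightarrow> nat \<Rightarrow> real" and e v :: "nat \<Rightarrow> nat \<Rightarrow> nat \<Rightarrow> complex" and x0 :: real
  assumes x0: "lmax < x0" and lam_ge: "\<forall>\<^sub>F n in sequentially. \<forall>l<r. x0 \<le> lam n l"
    and eig_eq: "\<forall>\<^sub>F n in sequentially. \<forall>l<r. \<forall>i<N n. complex_of_real (lam n l - t n i) * e n l i = comb n (v n l) i"
    and v_q: "\<forall>\<^sub>F n in sequentially. \<forall>l<r. \<forall>k<r. v n l k = (\<Sum>i<N n. cnj (w n (r + k) i) * e n l i)"
    and v_p: "\<forall>\<^sub>F n in sequentially. \<forall>l<r. \<forall>k<r. v n l (r + k) = (\<Sum>i<N n. cnj (w n k i) * e n l i) + (\<Sum>j<r. SS n k j * v n l j)"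
    and e_orth: "\<forall>\<^sub>F n in sequentially. \<forall>l<r. \<forall>l'<r. (\<Sum>i<N n. cnj (e n l i) * e n l' i) = (if l = l' then 1 else 0)"
begin

lemma weights_bounded: "\<exists>C\<ge>0. \<forall>\<^sub>F n in sequentially. \<forall>j<2 * r. (\<Sum>i<N n. cmod (cnj (w n j i) * w n j i)) \<le> C"
proof -
  have "\<exists>C. \<forall>\<^sub>F n in sequentially. (\<Sum>i<N n. cmod (cnj (w n j i) * w n j i)) \<le> C" if "j < 2 * r" for j
    using w_lim[OF that that] by (auto simp: weight_lim_def)
  then have "\<forall>j. \<exists>C. j < 2 * r \<longrightarrow> (\<forall>\<^sub>F n in sequentially. (\<Sum>i<N n. cmod (cnj (w n j i) * w n j i)) \<le> C)"
    by blast
  from choice[OF this] obtain C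
    where C: "\<And>j. j < 2 * r \<Longrightarrow> \<forall>\<^sub>F n in sequentially. (\<Sum>i<N n. cmod (cnj (w n j i) * w n j i)) \<le> C j"
    by blast
  have "\<forall>\<^sub>F n in sequentially. \<forall>j\<in>{..<2 * r}. (\<Sum>i<N n. cmod (cnj (w n j i) * w n j i)) \<le> C j"
    by (rule eventually_ball_finite) (use C in auto)
  then have "\<forall>\<^sub>F n in sequentially. \<forall>j<2 * r. (\<Sum>i<N n. cmod (cnj (w n j i) * w n j i)) \<le> (\<Sum>k<2 * r. \<bar>C k\<bar>)"
  proof eventually_elim
    case (elim n)
    show ?case
    proof (intro allI impI)
      fix j assume "j < 2 * r"
      then have "\<bar>C j\<bar> \<le> (\<Sum>k<2 * r. \<bar>C k\<bar>)" by (intro member_le_sum) auto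
      moreover have "(\<Sum>i<N n. cmod (cnj (w n j i) * w n j i)) \<le> C j" using elim \<open>j < 2 * r\<close> by auto
      ultimately show "(\<Sum>i<N n. cmod (cnj (w n j i) * w n j i)) \<le> (\<Sum>k<2 * r. \<bar>C k\<bar>)" by linarith
    qed
  qed
  then show ?thesis by (intro exI[of _ "\<Sum>k<2 * r. \<bar>C k\<bar>"]) (auto intro: sum_nonneg)
qed

text \<open>Compactness for the cluster argument. The vectors \<open>w\<close> have bounded norms
  and the eigenvectors are unit vectors, which bounds q; with the bounded Gram matrix this bounds p;
  finally the eigenvalue is bounded as a Rayleigh quotient.\<close>

lemma coefficients_bounded:
  "\<exists>C. \<forall>\<^sub>F n in sequentially. (\<forall>l<r. \<forall>j<2 * r. cmod (v n l j) \<le> C) \<and> (\<forall>l<r. \<bar>lam n l\<bar> \<le> C)"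
proof -
  obtain C where C: "0 \<le> C" "\<forall>\<^sub>F n in sequentially. \<forall>j<2 * r. (\<Sum>i<N n. cmod (cnj (w n j i) * w n j i)) \<le> C"
    using weights_bounded by blast
  have "\<forall>\<^sub>F n in sequentially. \<forall>p\<in>{..<r} \<times> {..<r}. cmod (SS n (fst p) (snd p)) \<le> \<bar>Om (fst p)\<bar>\<^sup>2 + 1"
  proof (rule eventually_ball_finite)
    show "\<forall>p\<in>{..<r} \<times> {..<r}. \<forall>\<^sub>F n in sequentially. cmod (SS n (fst p) (snd p)) \<le> \<bar>Om (fst p)\<bar>\<^sup>2 + 1"
    proof
      fix p assume "p \<in> {..<r} \<times> {..<r}"
      then have "(\<lambda>n. cmod (SS n (fst p) (snd p))) \<longlonglongrightarrow> cmod (if fst p = snd p then complex_of_real ((Om (fst p))\<^sup>2) else 0)"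
        by (intro tendsto_norm SS_lim) auto
      moreover have "cmod (if fst p = snd p then complex_of_real ((Om (fst p))\<^sup>2) else 0) < \<bar>Om (fst p)\<bar>\<^sup>2 + 1"
        by (simp add: norm_power add_nonneg_pos)
      ultimately show "\<forall>\<^sub>F n in sequentially. cmod (SS n (fst p) (snd p)) \<le> \<bar>Om (fst p)\<bar>\<^sup>2 + 1"
        using order_tendstoD(2) by (force elim!: eventually_mono intro: less_imp_le)
    qed
  qed simp
  moreover define S where "S = (\<Sum>k<r. \<bar>Om k\<bar>\<^sup>2 + 1)"
  ultimately have SSb: "\<forall>\<^sub>F n in sequentially. \<forall>k<r. \<forall>j<r. cmod (SS n k j) \<le> S"
  proof -
    assume a: "\<forall>\<^sub>F n in sequentially. \<forall>p\<in>{..<r} \<times> {..<r}. cmod (SS n (fst p) (snd p)) \<le> \<bar>Om (fst p)\<bar>\<^sup>2 + 1"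
    have "\<bar>Om k\<bar>\<^sup>2 + 1 \<le> S" if "k < r" for k
      unfolding S_def using that by (intro member_le_sum[of k _ "\<lambda>k. \<bar>Om k\<bar>\<^sup>2 + 1"]) auto
    note S = this
    show ?thesis using a
    proof eventually_elim
      case (elim n)
      show ?case
      proof (intro allI impI)
        fix k j assume "k < r" "j < r"
        then have "cmod (SS n k j) \<le> \<bar>Om k\<bar>\<^sup>2 + 1" using elim by auto
        then show "cmod (SS n k j) \<le> S" using S[OF \<open>k < r\<close>] by linarith
      qed
    qed
  qed
  define C1 where "C1 = (1 + C) + r * (S * (1 + C))"
  have S0: "0 \<le> S" unfolding S_def by (intro sum_nonneg) auto
  have C1: "1 + C \<le> C1" unfolding C1_def using C(1) S0 by simp
  define C2 where "C2 = (lmax + 1) + 2 * r * (C1 * (1 + C))"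
  have tb: "\<forall>\<^sub>F n in sequentially. \<forall>i<N n. t n i \<le> lmax + 1" by (rule t_bound) simp
  have "\<forall>\<^sub>F n in sequentially. (\<forall>l<r. \<forall>j<2 * r. cmod (v n l j) \<le> max C1 C2) \<and> (\<forall>l<r. \<bar>lam n l\<bar> \<le> max C1 C2)"
    using C(2) SSb eig_eq v_q v_p e_orth tb lam_ge
  proof eventually_elim
    case (elim n)
    have inner: "cmod (\<Sum>i<N n. cnj (w n j i) * e n l i) \<le> 1 + C" if "l < r" "j < 2 * r" for l j
    proof (rule weighted_inner_bound)
      show "(\<Sum>i<N n. cnj (e n l i) * e n l i) = 1" using elim(6) that(1) by simp
      show "(\<Sum>i<N n. cmod (cnj (w n j i) * w n j i)) \<le> C" using elim(1) that(2) by blast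
    qed
    have q: "cmod (v n l k) \<le> 1 + C" if "l < r" "k < r" for l k
      using inner[of l "r + k"] elim(4) that by simp
    have p: "cmod (v n l (r + k)) \<le> C1" if "l < r" "k < r" for l k
    proof -
      have "cmod (v n l (r + k)) \<le> cmod (\<Sum>i<N n. cnj (w n k i) * e n l i) + cmod (\<Sum>j<r. SS n k j * v n l j)"
        using elim(5) that norm_triangle_ineq by simp
      also have "cmod (\<Sum>j<r. SS n k j * v n l j) \<le> of_nat (card {..<r}) * (S * (1 + C))"
        by (rule sum_norm_bound) (use elim(2) q that S0 in \<open>auto simp: norm_mult intro!: mult_mono\<close>)
      finally show ?thesis using inner[of l k] that by (simp add: C1_def)
    qed
    have vb: "cmod (v n l j) \<le> C1" if "l < r" "j < 2 * r" for l j
    proof (cases "j < r")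
      case True then show ?thesis using q[OF that(1) True] C1 by linarith
    next
      case False then show ?thesis using p[of l "j - r"] that by simp
    qed
    have lb: "\<bar>lam n l\<bar> \<le> C2" if l: "l < r" for l
    proof -
      have one: "(\<Sum>i<N n. cnj (e n l i) * e n l i) = 1" using elim(6) l by simp
      have one': "(\<Sum>i<N n. (cmod (e n l i))\<^sup>2) = 1"
      proof -
        have "complex_of_real (\<Sum>i<N n. (cmod (e n l i))\<^sup>2) = 1"
          using one by (simp add: complex_norm_square mult.commute del: of_real_power)
        then show ?thesis by (simp only: of_real_eq_1_iff)
      qed
      have "complex_of_real (lam n l) = (\<Sum>i<N n. complex_of_real (lam n l) * (cnj (e n l i) * e n l i))"
        using one by (simp flip: sum_distrib_left)
      also have "\<dots> = (\<Sum>i<N n. complex_of_real (t n i) * (cnj (e n l i) * e n l i) + cnj (e n l i) * comb n (v n l) i)"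
      proof (intro sum.cong refl)
        fix i assume "i \<in> {..<N n}"
        then have "comb n (v n l) i = complex_of_real (lam n l - t n i) * e n l i" using elim(3) l by simp
        then have k: "complex_of_real (lam n l) * e n l i = comb n (v n l) i + complex_of_real (t n i) * e n l i"
          by (simp add: algebra_simps)
        have "complex_of_real (lam n l) * (cnj (e n l i) * e n l i) = cnj (e n l i) * (complex_of_real (lam n l) * e n l i)" by simp
        also have "\<dots> = complex_of_real (t n i) * (cnj (e n l i) * e n l i) + cnj (e n l i) * comb n (v n l) i"
          unfolding k by (simp add: algebra_simps)
        finally show "complex_of_real (lam n l) * (cnj (e n l i) * e n l i)
            = complex_of_real (t n i) * (cnj (e n l i) * e n l i) + cnj (e n l i) * comb n (v n l) i" .
      qed
      also have "\<dots> = (\<Sum>i<N n. complex_of_real (t n i) * (cnj (e n l i) * e n l i))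
          + (\<Sum>j<2 * r. v n l j * cnj (\<Sum>i<N n. cnj (w n j i) * e n l i))"
        unfolding sum.distrib comb_def sum_distrib_left cnj_sum
        by (subst (2) sum.swap) (simp add: mult_ac)
      finally have eq: "complex_of_real (lam n l) = \<dots>" .
      have "cmod (\<Sum>i<N n. complex_of_real (t n i) * (cnj (e n l i) * e n l i)) \<le> (\<Sum>i<N n. (lmax + 1) * (cmod (e n l i))\<^sup>2)"
      proof (rule sum_norm_le)
        fix i assume "i \<in> {..<N n}"
        then have "\<bar>t n i\<bar> \<le> lmax + 1" using elim(7) t_nonneg[of n i] by auto
        then show "cmod (complex_of_real (t n i) * (cnj (e n l i) * e n l i)) \<le> (lmax + 1) * (cmod (e n l i))\<^sup>2"
          by (simp add: norm_mult power2_eq_square mult_right_mono)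
      qed
      also have "\<dots> = lmax + 1" using one' by (simp flip: sum_distrib_left)
      finally have b1: "cmod (\<Sum>i<N n. complex_of_real (t n i) * (cnj (e n l i) * e n l i)) \<le> lmax + 1" .
      have b2: "cmod (\<Sum>j<2 * r. v n l j * cnj (\<Sum>i<N n. cnj (w n j i) * e n l i)) \<le> of_nat (card {..<2 * r}) * (C1 * (1 + C))"
      proof (rule sum_norm_bound)
        fix j assume "j \<in> {..<2 * r}"
        then have j: "j < 2 * r" by simp
        show "cmod (v n l j * cnj (\<Sum>i<N n. cnj (w n j i) * e n l i)) \<le> C1 * (1 + C)"
          unfolding norm_mult complex_mod_cnj
          by (intro mult_mono vb[OF l j] inner[OF l j]) (use C1 C(1) in auto)
      qed
      have "\<bar>lam n l\<bar> = cmod (complex_of_real (lam n l))" by simp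
      also have "\<dots> \<le> (lmax + 1) + of_nat (card {..<2 * r}) * (C1 * (1 + C))"
        unfolding eq by (rule norm_triangle_le) (use b1 b2 in linarith)
      finally show ?thesis by (simp add: C2_def)
    qed
    show ?case using vb lb by (auto intro: max.coboundedI1 max.coboundedI2)
  qed
  then show ?thesis by (rule exI)
qed

text \<open>Along a filter on which eigenvalues and coefficients converge, the eigenvalue relations
  pass to the limit and determine p from q. The q then form a weighted orthonormal basis, and the
  limit is the squared norm of \<alpha>, which no longer refers to the filter.\<close>

theorem outlier_projection_limit:
  fixes z :: "nat \<Rightarrow> nat \<Rightarrow> complex" and \<alpha> :: "nat \<Rightarrow> complex"
  assumes z: "\<And>j. j < 2 * r \<Longrightarrow> weight_lim sequentially N t \<pi> (\<lambda>n i. cnj (z n i) * w n j i) (\<lambda>x. if j < r then 0 else \<alpha> (j - r))"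
  shows "(\<lambda>n. \<Sum>l<r. (cmod (\<Sum>i<N n. cnj (z n i) * e n l i))\<^sup>2 * zeta c \<pi> (lam n l)) \<longlonglongrightarrow> (\<Sum>k<r. (cmod (\<alpha> k))\<^sup>2)"
proof (rule tendsto_by_clusters)
  fix G :: "nat filter" assume G: "G \<le> sequentially" "G \<noteq> bot"
  obtain C where C: "\<forall>\<^sub>F n in sequentially. (\<forall>l<r. \<forall>j<2 * r. cmod (v n l j) \<le> C) \<and> (\<forall>l<r. \<bar>lam n l\<bar> \<le> C)"
    using coefficients_bounded by blast
  have "\<exists>F\<le>G. F \<noteq> bot \<and> (\<forall>l\<in>{..<r}. \<exists>x. ((\<lambda>n. lam n l) \<longlongrightarrow> x) F)"
  proof (rule finite_family_cluster[OF _ G(2)])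
    fix l assume "l \<in> {..<r}"
    then have "\<forall>\<^sub>F n in G. lam n l \<in> cball 0 C"
      using filter_leD[OF G(1) C] by (auto elim!: eventually_mono)
    then show "\<exists>S. bounded S \<and> (\<forall>\<^sub>F n in G. lam n l \<in> S)" using bounded_cball by blast
  qed simp
  then obtain F0 \<rho>0 where F0: "F0 \<le> G" "F0 \<noteq> bot" and "\<forall>l\<in>{..<r}. \<exists>x. ((\<lambda>n. lam n l) \<longlongrightarrow> x) F0"
    by blast
  then have "\<exists>\<rho>. \<forall>l\<in>{..<r}. ((\<lambda>n. lam n l) \<longlongrightarrow> \<rho> l) F0" by (intro bchoice)
  then obtain \<rho> where \<rho>0: "\<And>l. l < r \<Longrightarrow> ((\<lambda>n. lam n l) \<longlongrightarrow> \<rho> l) F0" by blast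
  have F0s: "F0 \<le> sequentially" using F0(1) G(1) by (rule order_trans)
  \<comment> \<open>The eigenvalues are real and the coefficients complex, so the cluster lemma is
    applied once for each kind.\<close>
  have "\<exists>F\<le>F0. F \<noteq> bot \<and> (\<forall>p\<in>{..<r} \<times> {..<2 * r}. \<exists>x. ((\<lambda>n. v n (fst p) (snd p)) \<longlongrightarrow> x) F)"
  proof (rule finite_family_cluster[OF _ F0(2)])
    fix p assume "p \<in> {..<r} \<times> {..<2 * r}"
    then have "\<forall>\<^sub>F n in F0. v n (fst p) (snd p) \<in> cball 0 C"
      using filter_leD[OF F0s C] by (auto elim!: eventually_mono)
    then show "\<exists>S. bounded S \<and> (\<forall>\<^sub>F n in F0. v n (fst p) (snd p) \<in> S)" using bounded_cball by blast
  qed simp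
  then obtain F where F: "F \<le> F0" "F \<noteq> bot" and "\<forall>p\<in>{..<r} \<times> {..<2 * r}. \<exists>x. ((\<lambda>n. v n (fst p) (snd p)) \<longlongrightarrow> x) F"
    by blast
  then have "\<exists>V. \<forall>p\<in>{..<r} \<times> {..<2 * r}. ((\<lambda>n. v n (fst p) (snd p)) \<longlongrightarrow> V p) F" by (intro bchoice)
  then obtain V' where V': "\<forall>p\<in>{..<r} \<times> {..<2 * r}. ((\<lambda>n. v n (fst p) (snd p)) \<longlongrightarrow> V' p) F" by blast
  define V where "V = (\<lambda>l j. V' (l, j))"
  have V: "((\<lambda>n. v n l j) \<longlongrightarrow> V l j) F" if "l < r" "j < 2 * r" for l j
    using V'[rule_format, of "(l, j)"] that by (simp add: V_def)
  have Fs: "F \<le> sequentially" using F(1) F0s by (rule order_trans)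
  have \<rho>: "((\<lambda>n. lam n l) \<longlongrightarrow> \<rho> l) F" if "l < r" for l by (rule tendsto_mono[OF F(1) \<rho>0[OF that]])
  obtain \<kappa> where \<kappa>: "lmax < \<kappa>" "\<kappa> < x0" using dense[OF x0] by blast
  have \<rho>x: "x0 \<le> \<rho> l" if "l < r" for l
    by (rule tendsto_lowerbound[OF \<rho>[OF that] _ F(2)])
      (use filter_leD[OF Fs lam_ge] that in \<open>auto elim!: eventually_mono\<close>)
  then have \<rho>\<kappa>: "\<kappa> < \<rho> l" "lmax < \<rho> l" if "l < r" for l using that \<kappa> x0 by force+
  define h where "h = (\<lambda>l (y::real). 1 / (\<rho> l - y))"
  define H where "H = (\<lambda>l n (y::real). 1 / (lam n l - y))"
  have hc: "continuous_on {lo..\<kappa>} (h l)" "h l \<in> borel_measurable borel" "uniform_limit {lo..\<kappa>} (H l) (h l) F" if "l < r" for l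
    unfolding h_def H_def by (auto intro: resolvent_continuous resolvent_uniform_limit \<rho>\<kappa>[OF that] \<rho>[OF that])
  have hc2: "continuous_on {lo..\<kappa>} (\<lambda>y. h l y * h l' y)" "(\<lambda>y. h l y * h l' y) \<in> borel_measurable borel"
      "uniform_limit {lo..\<kappa>} (\<lambda>n y. H l n y * H l' n y) (\<lambda>y. h l y * h l' y) F" if "l < r" "l' < r" for l l'
  proof -
    show "continuous_on {lo..\<kappa>} (\<lambda>y. h l y * h l' y)"
      by (intro continuous_on_mult hc that)
    show "(\<lambda>y. h l y * h l' y) \<in> borel_measurable borel"
      using hc(2)[OF that(1)] hc(2)[OF that(2)] by simp
    show "uniform_limit {lo..\<kappa>} (\<lambda>n y. H l n y * H l' n y) (\<lambda>y. h l y * h l' y) F"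
      unfolding h_def H_def by (intro resolvent_product_uniform_limit \<rho> \<rho>\<kappa> that)
  qed
  have tb: "\<forall>\<^sub>F n in F. \<forall>i<N n. t n i \<le> \<kappa>" by (rule filter_leD[OF Fs t_bound[OF \<kappa>(1)]])
  have eqF: "\<forall>\<^sub>F n in F. \<forall>l<r. \<forall>i<N n. e n l i = complex_of_real (H l n (t n i)) * comb n (v n l) i"
    using filter_leD[OF Fs eig_eq] filter_leD[OF Fs lam_ge] tb
  proof eventually_elim
    case (elim n)
    show ?case
    proof (intro allI impI)
      fix l i assume li: "l < r" "i < N n"
      then have "lam n l - t n i \<noteq> 0" using elim(2,3) \<kappa> by force
      then have "complex_of_real (H l n (t n i)) * complex_of_real (lam n l - t n i) = 1"
        by (simp add: H_def flip: of_real_mult)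
      moreover have "comb n (v n l) i = complex_of_real (lam n l - t n i) * e n l i" using elim(1) li by simp
      ultimately show "e n l i = complex_of_real (H l n (t n i)) * comb n (v n l) i"
        by (metis mult.assoc mult_1)
    qed
  qed
  define \<mu> where "\<mu> = (\<lambda>l. m1 (\<rho> l))"
  have single: "((\<lambda>n. \<Sum>i<N n. cnj (w n j i) * e n l i) \<longlongrightarrow> V l j * complex_of_real (LINT y|\<pi>. h l y * dens j y)) F"
    if "l < r" "j < 2 * r" for l j
  proof (rule Lim_transform_eventually[OF comb_single_tendsto[OF Fs \<kappa>(1) hc[OF that(1)] that(2), where v = "\<lambda>n. v n l" and V = "V l"]])
    show "\<forall>\<^sub>F n in F. (\<Sum>i<N n. complex_of_real (H l n (t n i)) * (cnj (w n j i) * comb n (v n l) i)) = (\<Sum>i<N n. cnj (w n j i) * e n l i)"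
      using eqF by eventually_elim (use that in \<open>auto intro!: sum.cong\<close>)
  qed (rule V[OF that(1)])
  \<comment> \<open>In the inner product with a steering vector only the term of the same steering
    vector survives, with density 1, so q is p times the integral of the resolvent.\<close>
  have qeq: "V l k = V l (r + k) * complex_of_real (m1 (\<rho> l))" if "l < r" "k < r" for l k
  proof (rule tendsto_unique[OF F(2)])
    show "((\<lambda>n. v n l k) \<longlongrightarrow> V l k) F" using V that by simp
    show "((\<lambda>n. v n l k) \<longlongrightarrow> V l (r + k) * complex_of_real (m1 (\<rho> l))) F"
    proof (rule Lim_transform_eventually)
      show "((\<lambda>n. \<Sum>i<N n. cnj (w n (r + k) i) * e n l i) \<longlongrightarrow> V l (r + k) * complex_of_real (m1 (\<rho> l))) F"
        using single[of l "r + k"] that integral_dens(2)[of "h l" k] by (simp add: h_def m1_def)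
      show "\<forall>\<^sub>F n in F. (\<Sum>i<N n. cnj (w n (r + k) i) * e n l i) = v n l k"
        using filter_leD[OF Fs v_q] by eventually_elim (use that in simp)
    qed
  qed
  have peq: "V l (r + k) = complex_of_real ((Om k)\<^sup>2 * sf (\<rho> l)) * V l k" if "l < r" "k < r" for l k
  proof (rule tendsto_unique[OF F(2)])
    show "((\<lambda>n. v n l (r + k)) \<longlongrightarrow> V l (r + k)) F" using V that by simp
    show "((\<lambda>n. v n l (r + k)) \<longlongrightarrow> complex_of_real ((Om k)\<^sup>2 * sf (\<rho> l)) * V l k) F"
    proof (rule Lim_transform_eventually)
      have s: "((\<lambda>n. \<Sum>i<N n. cnj (w n k i) * e n l i) \<longlongrightarrow> V l k * complex_of_real (c * (Om k)\<^sup>2 * t1 (\<rho> l))) F"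
        using single[of l k] that integral_dens(1)[of k "h l"] by (simp add: h_def t1_def)
      have "((\<lambda>n. (\<Sum>i<N n. cnj (w n k i) * e n l i) + (\<Sum>j<r. SS n k j * v n l j)) \<longlongrightarrow>
          V l k * complex_of_real (c * (Om k)\<^sup>2 * t1 (\<rho> l)) + (\<Sum>j<r. (if k = j then complex_of_real ((Om k)\<^sup>2) else 0) * V l j)) F"
        by (intro tendsto_add s tendsto_sum tendsto_mult tendsto_mono[OF Fs SS_lim] V) (use that in auto)
      moreover have "V l k * complex_of_real (c * (Om k)\<^sup>2 * t1 (\<rho> l)) + (\<Sum>j<r. (if k = j then complex_of_real ((Om k)\<^sup>2) else 0) * V l j)
          = complex_of_real ((Om k)\<^sup>2 * sf (\<rho> l)) * V l k"
      proof -
        have "(\<Sum>j<r. (if k = j then complex_of_real ((Om k)\<^sup>2) else 0) * V l j) = (\<Sum>j<r. if k = j then complex_of_real ((Om k)\<^sup>2) * V l k else 0)"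
          by (intro sum.cong refl) auto
        also have "\<dots> = complex_of_real ((Om k)\<^sup>2) * V l k" using that by simp
        finally show ?thesis by (simp add: sf_def algebra_simps)
      qed
      ultimately show "((\<lambda>n. (\<Sum>i<N n. cnj (w n k i) * e n l i) + (\<Sum>j<r. SS n k j * v n l j)) \<longlongrightarrow> complex_of_real ((Om k)\<^sup>2 * sf (\<rho> l)) * V l k) F"
        by simp
      show "\<forall>\<^sub>F n in F. (\<Sum>i<N n. cnj (w n k i) * e n l i) + (\<Sum>j<r. SS n k j * v n l j) = v n l (r + k)"
        using filter_leD[OF Fs v_p] by eventually_elim (use that in simp)
    qed
  qed
  \<comment> \<open>Combining \<open>qeq\<close> and \<open>peq\<close> gives the secular equation
    m1 sf Om^2 = 1 for every index whose coefficient is not zero.\<close>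
  have supp_eq: "(Om k)\<^sup>2 = 1 / (m1 (\<rho> l) * sf (\<rho> l))" if "l < r" "k < r" "V l k \<noteq> 0" for l k
  proof -
    have "V l k = V l k * complex_of_real ((Om k)\<^sup>2 * sf (\<rho> l) * m1 (\<rho> l))"
      using qeq[OF that(1,2)] peq[OF that(1,2)] by (metis mult.assoc mult.commute of_real_mult)
    then have "complex_of_real ((Om k)\<^sup>2 * sf (\<rho> l) * m1 (\<rho> l)) = 1"
      using that(3) by (metis mult_cancel_left1)
    then have "(Om k)\<^sup>2 * sf (\<rho> l) * m1 (\<rho> l) = 1" by (simp only: of_real_eq_1_iff)
    then show ?thesis using m1_pos[OF \<rho>\<kappa>(2)[OF that(1)]] sf_pos[OF \<rho>\<kappa>(2)[OF that(1)]] by (simp add: field_simps)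
  qed
  have pV: "V l (r + k) = V l k / complex_of_real (m1 (\<rho> l))" if "l < r" "k < r" for l k
    using qeq[OF that] m1_pos[OF \<rho>\<kappa>(2)[OF that(1)]] by simp
  have orth0: "(\<Sum>j<2 * r. cnj (V l j) * V l' j * complex_of_real (LINT y|\<pi>. h l y * h l' y * dens j y)) = (if l = l' then 1 else 0)"
    if "l < r" "l' < r" for l l'
  proof (rule tendsto_unique[OF F(2)])
    show "((\<lambda>n. \<Sum>i<N n. cnj (e n l i) * e n l' i) \<longlongrightarrow> (\<Sum>j<2 * r. cnj (V l j) * V l' j * complex_of_real (LINT y|\<pi>. h l y * h l' y * dens j y))) F"
    proof (rule Lim_transform_eventually[OF comb_pair_tendsto[OF Fs \<kappa>(1) hc2[OF that], where u = "\<lambda>n. v n l" and v = "\<lambda>n. v n l'" and U = "V l" and V = "V l'"]])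
      show "\<forall>\<^sub>F n in F. (\<Sum>i<N n. complex_of_real (H l n (t n i) * H l' n (t n i)) * (cnj (comb n (v n l) i) * comb n (v n l') i)) = (\<Sum>i<N n. cnj (e n l i) * e n l' i)"
        using eqF by eventually_elim (use that in \<open>auto intro!: sum.cong\<close>)
    qed (use V that in auto)
    show "((\<lambda>n. \<Sum>i<N n. cnj (e n l i) * e n l' i) \<longlongrightarrow> (if l = l' then 1 else 0)) F"
      by (rule tendsto_eventually) (use filter_leD[OF Fs e_orth] that in \<open>auto elim!: eventually_mono\<close>)
  qed
  \<comment> \<open>Wherever \<open>V l k\<close> does not vanish, \<open>supp_eq\<close> replaces
    \<open>Om k\<close> by a quantity depending on \<rho> l alone. The sum over \<open>k\<close>
    then factors into a scalar and an ordinary inner product.\<close>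
  have orth1: "complex_of_real (Jf (\<rho> l) (\<rho> l')) * (\<Sum>k<r. cnj (V l k) * V l' k) = (if l = l' then 1 else 0)" if "l < r" "l' < r" for l l'
  proof -
    have "cnj (V l k) * V l' k * complex_of_real (c * (Om k)\<^sup>2 * t2 (\<rho> l) (\<rho> l'))
        = cnj (V l k) * V l' k * complex_of_real (c * t2 (\<rho> l) (\<rho> l') / (m1 (\<rho> l) * sf (\<rho> l)))" if "k < r" for k
      using supp_eq[OF \<open>l < r\<close> that] by (cases "V l k = 0") simp_all
    moreover have "cnj (V l (r + k)) * V l' (r + k) * complex_of_real (m2 (\<rho> l) (\<rho> l'))
        = cnj (V l k) * V l' k * complex_of_real (m2 (\<rho> l) (\<rho> l') / (m1 (\<rho> l) * m1 (\<rho> l')))" if "k < r" for k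
      using pV[OF \<open>l < r\<close> that] pV[OF \<open>l' < r\<close> that] by simp
    ultimately have "(\<Sum>j<2 * r. cnj (V l j) * V l' j * complex_of_real (LINT y|\<pi>. h l y * h l' y * dens j y))
        = (\<Sum>k<r. cnj (V l k) * V l' k * complex_of_real (c * t2 (\<rho> l) (\<rho> l') / (m1 (\<rho> l) * sf (\<rho> l))))
         + (\<Sum>k<r. cnj (V l k) * V l' k * complex_of_real (m2 (\<rho> l) (\<rho> l') / (m1 (\<rho> l) * m1 (\<rho> l'))))"
      unfolding sum_lessThan_double using integral_dens[where h = "\<lambda>y. h l y * h l' y"]
      by (intro arg_cong2[where f = "(+)"] sum.cong refl) (simp_all add: h_def t2_def m2_def)
    also have "\<dots> = complex_of_real (Jf (\<rho> l) (\<rho> l')) * (\<Sum>k<r. cnj (V l k) * V l' k)"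
      unfolding sum_distrib_right[symmetric] distrib_left[symmetric] of_real_add[symmetric]
      by (simp add: Jf_def add.commute mult.commute)
    finally show ?thesis using orth0[OF that] by simp
  qed
  have parseval: "(\<Sum>l<r. (cmod (\<Sum>k<r. \<alpha> k * V l k))\<^sup>2 * Jf (\<rho> l) (\<rho> l)) = (\<Sum>k<r. (cmod (\<alpha> k))\<^sup>2)"
  proof (rule orthogonal_family_parseval)
    show "0 \<le> Jf (\<rho> l) (\<rho> l)" if "l < r" for l using Jf_pos[OF \<rho>\<kappa>(2)[OF that] \<rho>\<kappa>(2)[OF that]] by simp
    fix l l' assume ll: "l < r" "l' < r"
    show "complex_of_real (sqrt (Jf (\<rho> l) (\<rho> l))) * complex_of_real (sqrt (Jf (\<rho> l') (\<rho> l'))) * (\<Sum>k<r. cnj (V l k) * V l' k) = (if l = l' then 1 else 0)"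
    proof (cases "l = l'")
      case True
      have "complex_of_real (sqrt (Jf (\<rho> l) (\<rho> l))) * complex_of_real (sqrt (Jf (\<rho> l) (\<rho> l))) = complex_of_real (Jf (\<rho> l) (\<rho> l))"
        using Jf_pos[OF \<rho>\<kappa>(2)[OF ll(1)] \<rho>\<kappa>(2)[OF ll(1)]] by (simp flip: of_real_mult)
      then show ?thesis using orth1[OF ll] True by simp
    next
      case False
      \<comment> \<open>\<open>Jf\<close> is positive for any two levels beyond the support, so
        orthogonality of eigenvectors passes to the coefficient vectors whether or not the two
        limits coincide.\<close>
      then have "(\<Sum>k<r. cnj (V l k) * V l' k) = 0"
        using orth1[OF ll] Jf_pos[OF \<rho>\<kappa>(2)[OF ll(1)] \<rho>\<kappa>(2)[OF ll(2)]] by simp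
      then show ?thesis using False by simp
    qed
  qed
  \<comment> \<open>Only the steering part of the eigenvector is seen by \<open>z\<close>; it
    contributes m1 p times \<alpha>, and m1 p is q.\<close>
  have zlim: "((\<lambda>n. \<Sum>i<N n. cnj (z n i) * e n l i) \<longlongrightarrow> (\<Sum>k<r. \<alpha> k * V l k)) F" if l: "l < r" for l
  proof (rule Lim_transform_eventually)
    have w1: "((\<lambda>n. \<Sum>i<N n. complex_of_real (H l n (t n i)) * (cnj (z n i) * w n j i))
        \<longlongrightarrow> (LINT y|\<pi>. complex_of_real (h l y) * (if j < r then 0 else \<alpha> (j - r)))) F" if j: "j < 2 * r" for j
    proof (rule weight_lim_uniform[OF weight_lim_mono[OF z[OF j] Fs] prob sets_pi supp_mono _ _ _ hc[OF l]])
      show "\<forall>\<^sub>F n in F. \<forall>i<N n. t n i \<in> {lo..\<kappa>}"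
        using tb by eventually_elim (auto simp: lo_def t_nonneg min.coboundedI1)
      show "AE x in \<pi>. cmod (if j < r then 0 else \<alpha> (j - r)) \<le> cmod (\<alpha> (j - r))" by simp
    qed (use \<kappa> in \<open>auto simp: lo_def\<close>)
    have "((\<lambda>n. \<Sum>j<2 * r. v n l j * (\<Sum>i<N n. complex_of_real (H l n (t n i)) * (cnj (z n i) * w n j i)))
        \<longlongrightarrow> (\<Sum>j<2 * r. V l j * (LINT y|\<pi>. complex_of_real (h l y) * (if j < r then 0 else \<alpha> (j - r))))) F"
      by (intro tendsto_sum tendsto_mult w1 V l) auto
    also have "(\<Sum>j<2 * r. V l j * (LINT y|\<pi>. complex_of_real (h l y) * (if j < r then 0 else \<alpha> (j - r)))) = (\<Sum>k<r. \<alpha> k * V l k)"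
    proof -
      have hm: "integral\<^sup>L \<pi> (h l) = m1 (\<rho> l)" by (simp add: h_def m1_def)
      have "(\<Sum>j<2 * r. V l j * (LINT y|\<pi>. complex_of_real (h l y) * (if j < r then 0 else \<alpha> (j - r))))
          = (\<Sum>k<r. V l (r + k) * (complex_of_real (m1 (\<rho> l)) * \<alpha> k))"
        unfolding sum_lessThan_double by (simp add: hm)
      also have "\<dots> = (\<Sum>k<r. \<alpha> k * V l k)"
        by (intro sum.cong refl) (use qeq[OF l] in \<open>simp add: mult_ac\<close>)
      finally show ?thesis .
    qed
    finally show "((\<lambda>n. \<Sum>j<2 * r. v n l j * (\<Sum>i<N n. complex_of_real (H l n (t n i)) * (cnj (z n i) * w n j i))) \<longlongrightarrow> (\<Sum>k<r. \<alpha> k * V l k)) F" .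
    show "\<forall>\<^sub>F n in F. (\<Sum>j<2 * r. v n l j * (\<Sum>i<N n. complex_of_real (H l n (t n i)) * (cnj (z n i) * w n j i))) = (\<Sum>i<N n. cnj (z n i) * e n l i)"
      using eqF
    proof eventually_elim
      case (elim n)
      have "(\<Sum>i<N n. cnj (z n i) * e n l i) = (\<Sum>i<N n. \<Sum>j<2 * r. v n l j * (complex_of_real (H l n (t n i)) * (cnj (z n i) * w n j i)))"
        using elim l by (intro sum.cong refl) (simp add: comb_def sum_distrib_left mult_ac)
      then show ?case by (subst (asm) sum.swap) (simp add: sum_distrib_left)
    qed
  qed
  have "((\<lambda>n. \<Sum>l<r. (cmod (\<Sum>i<N n. cnj (z n i) * e n l i))\<^sup>2 * zeta c \<pi> (lam n l)) \<longlongrightarrow> (\<Sum>l<r. (cmod (\<Sum>k<r. \<alpha> k * V l k))\<^sup>2 * zeta c \<pi> (\<rho> l))) F"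
    by (intro tendsto_sum tendsto_mult tendsto_power tendsto_norm zlim tendsto_zeta \<rho> \<rho>\<kappa>(2)) auto
  also have "(\<Sum>l<r. (cmod (\<Sum>k<r. \<alpha> k * V l k))\<^sup>2 * zeta c \<pi> (\<rho> l)) = (\<Sum>k<r. (cmod (\<alpha> k))\<^sup>2)"
    unfolding parseval[symmetric] by (intro sum.cong refl) (simp add: zeta_Jf \<rho>\<kappa>(2))
  finally show "\<exists>F\<le>G. F \<noteq> bot \<and> ((\<lambda>n. \<Sum>l<r. (cmod (\<Sum>i<N n. cnj (z n i) * e n l i))\<^sup>2 * zeta c \<pi> (lam n l)) \<longlongrightarrow> (\<Sum>k<r. (cmod (\<alpha> k))\<^sup>2)) F"
    using F F0(1) by (intro exI[of _ F]) (auto intro: order_trans)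
qed

end

section \<open>The perturbed matrix in singular coordinates\<close>

text \<open>The vector A^* a, for \<open>A\<close> given as an array with \<open>m\<close>
  rows.\<close>

definition lvec :: "nat \<Rightarrow> (nat \<Rightarrow> nat \<Rightarrow> complex) \<Rightarrow> (nat \<Rightarrow> complex) \<Rightarrow> nat \<Rightarrow> complex" where
  "lvec m A a i = (\<Sum>j<m. cnj (A j i) * a j)"

lemma lvec_sum: "lvec m A (\<lambda>j. \<Sum>k\<in>K. a k j * p k) i = (\<Sum>k\<in>K. lvec m A (a k) i * p k)"
  unfolding lvec_def sum_distrib_left sum_distrib_right
  by (subst sum.swap) (simp add: mult_ac)

lemma orthonormal_rows:
  assumes "orthonormal_cols m m A"
  shows "i < m \<Longrightarrow> j < m \<Longrightarrow> (\<Sum>l<m. A i l * cnj (A j l)) = (if i = j then 1 else 0)"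
proof -
  let ?V = "mat m m (\<lambda>(l, i). cnj (A i l))" and ?W = "mat m m (\<lambda>(i, l). A i l)"
  have "?V * ?W = 1\<^sub>m m"
    by (rule eq_matI) (use assms in \<open>auto simp: orthonormal_cols_def scalar_prod_def atLeast0LessThan\<close>)
  then have WV: "?W * ?V = 1\<^sub>m m"
    by (rule mat_mult_left_right_inverse[rotated 2]) simp_all
  assume ij: "i < m" "j < m"
  then have "(\<Sum>l<m. A i l * cnj (A j l)) = (?W * ?V) $$ (i, j)"
    by (simp add: scalar_prod_def atLeast0LessThan)
  then show ?thesis using WV ij by simp
qed

lemma unitary_parseval:
  assumes "orthonormal_cols m m A"
  shows "(\<Sum>l<m. cnj (lvec m A a l) * lvec m A b l) = (\<Sum>i<m. cnj (a i) * b i)"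
proof -
  have "(\<Sum>l<m. cnj (lvec m A a l) * lvec m A b l) = (\<Sum>l<m. \<Sum>i<m. \<Sum>j<m. cnj (a i) * b j * (A i l * cnj (A j l)))"
    unfolding lvec_def cnj_sum sum_product by (intro sum.cong refl) (simp add: mult_ac)
  also have "\<dots> = (\<Sum>i<m. \<Sum>j<m. \<Sum>l<m. cnj (a i) * b j * (A i l * cnj (A j l)))"
    by (subst sum.swap, rule sum.cong[OF refl], subst sum.swap) simp
  also have "\<dots> = (\<Sum>i<m. \<Sum>j<m. if i = j then cnj (a i) * b i else 0)"
    by (intro sum.cong refl) (auto simp: sum_distrib_left[symmetric] orthonormal_rows[OF assms])
  finally show ?thesis by simp
qed

lemma lvec_inverse:
  assumes "orthonormal_cols m N A" "i < N"
  shows "lvec m A (\<lambda>j. \<Sum>l<N. A j l * f l) i = f i"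
proof -
  have "lvec m A (\<lambda>j. \<Sum>l<N. A j l * f l) i = (\<Sum>l<N. f l * (\<Sum>j<m. cnj (A j i) * A j l))"
    unfolding lvec_def sum_distrib_left by (subst sum.swap) (simp add: mult_ac)
  also have "\<dots> = (\<Sum>l<N. if i = l then f l else 0)"
    using assms by (intro sum.cong refl) (auto simp: orthonormal_cols_def)
  finally show ?thesis using assms(2) by simp
qed

text \<open>There are r - 1 equations in r unknowns; the solution is normalised.\<close>

lemma homogeneous_system_nontrivial:
  fixes A :: "nat \<Rightarrow> nat \<Rightarrow> complex"
  assumes r: "0 < r"
  shows "\<exists>p. (\<Sum>k<r. (cmod (p k))\<^sup>2) = 1 \<and> (\<forall>l<r - 1. (\<Sum>k<r. A l k * p k) = 0)"
proof -
  define c where "c = (\<lambda>l. vec r (\<lambda>k. A l k))"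
  \<comment> \<open>Padding with a zero row makes the system square with determinant 0, which yields
    a nonzero kernel vector.\<close>
  define B where "B = mat\<^sub>r r r (\<lambda>i. if i = r - 1 then 0\<^sub>v r else c i)"
  have "det B = 0" unfolding B_def by (rule det_row_0) (use r in \<open>auto simp: c_def\<close>)
  moreover have B: "B \<in> carrier_mat r r" by (simp add: B_def)
  ultimately obtain v where v: "v \<in> carrier_vec r" "v \<noteq> 0\<^sub>v r" "B *\<^sub>v v = 0\<^sub>v r"
    using det_0_iff_vec_prod_zero_field[OF B] by blast
  define s where "s = (\<Sum>k<r. (cmod (v $ k))\<^sup>2)"
  have "s \<noteq> 0"
  proof
    assume "s = 0"
    then have "\<forall>k<r. v $ k = 0" unfolding s_def by (auto simp: sum_nonneg_eq_0_iff)
    then have "v = 0\<^sub>v r" using v(1) by (intro eq_vecI) auto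
    then show False using v(2) by simp
  qed
  moreover have "0 \<le> s" unfolding s_def by (intro sum_nonneg) auto
  ultimately have s: "0 < s" by simp
  define p where "p = (\<lambda>k. v $ k / complex_of_real (sqrt s))"
  have "(\<Sum>k<r. (cmod (p k))\<^sup>2) = 1"
    using s by (simp add: p_def norm_divide power_divide sum_divide_distrib[symmetric] s_def[symmetric])
  moreover have "(\<Sum>k<r. A l k * p k) = 0" if "l < r - 1" for l
  proof -
    have "(B *\<^sub>v v) $ l = (\<Sum>k<r. A l k * v $ k)"
      using that v(1) by (simp add: B_def c_def scalar_prod_def atLeast0LessThan)
    then have "(\<Sum>k<r. A l k * v $ k) = 0" using v(3) that by simp
    then show ?thesis by (simp add: p_def sum_divide_distrib[symmetric])
  qed
  ultimately show ?thesis by blast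
qed

section \<open>Algebra of signal plus noise at a fixed size\<close>

locale signal_plus_noise =
  fixes m n r :: nat and L R B S :: "nat \<Rightarrow> nat \<Rightarrow> complex" and g :: "nat \<Rightarrow> real" and Sg :: "nat \<Rightarrow> nat \<Rightarrow> complex"
  assumes L: "orthonormal_cols m m L" and R: "orthonormal_cols n m R"
    and Sg: "\<And>i a. i < m \<Longrightarrow> a < n \<Longrightarrow> Sg i a = (\<Sum>l<m. L i l * complex_of_real (g l) * cnj (R a l)) + (\<Sum>k<r. B i k * cnj (S a k))"
begin

text \<open>In matrix notation: \<open>y k\<close> is L^* b_k, \<open>xg k\<close> is \<Gamma> R^*
  s_k, \<open>gram\<close> is S^* S, \<open>adj u\<close> is \<Sigma>^* u, \<open>bq u\<close> is
  B^* u and \<open>sp u\<close> is S^* \<Sigma>^* u.\<close>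

abbreviation y :: "nat \<Rightarrow> nat \<Rightarrow> complex" where "y k \<equiv> lvec m L (\<lambda>j. B j k)"
abbreviation xg :: "nat \<Rightarrow> nat \<Rightarrow> complex" where "xg k i \<equiv> complex_of_real (g i) * lvec n R (\<lambda>j. S j k) i"
definition gram :: "nat \<Rightarrow> nat \<Rightarrow> complex" where "gram k j = (\<Sum>a<n. cnj (S a k) * S a j)"
definition adj :: "(nat \<Rightarrow> complex) \<Rightarrow> nat \<Rightarrow> complex" where "adj u a = (\<Sum>i<m. cnj (Sg i a) * u i)"
definition bq :: "(nat \<Rightarrow> complex) \<Rightarrow> nat \<Rightarrow> complex" where "bq u k = (\<Sum>i<m. cnj (B i k) * u i)"
definition sp :: "(nat \<Rightarrow> complex) \<Rightarrow> nat \<Rightarrow> complex" where "sp u k = (\<Sum>a<n. cnj (S a k) * adj u a)"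

lemma adj_eq:
  assumes "a < n"
  shows "adj u a = (\<Sum>l<m. R a l * (complex_of_real (g l) * lvec m L u l)) + (\<Sum>k<r. S a k * bq u k)"
proof -
  have "adj u a = (\<Sum>i<m. (\<Sum>l<m. cnj (L i l) * complex_of_real (g l) * R a l * u i) + (\<Sum>k<r. cnj (B i k) * S a k * u i))"
    unfolding adj_def using assms by (intro sum.cong refl) (simp add: Sg distrib_right sum_distrib_right)
  also have "\<dots> = (\<Sum>l<m. \<Sum>i<m. cnj (L i l) * complex_of_real (g l) * R a l * u i) + (\<Sum>k<r. \<Sum>i<m. cnj (B i k) * S a k * u i)"
    unfolding sum.distrib by (subst sum.swap, subst (2) sum.swap) simp
  finally show ?thesis by (simp add: lvec_def bq_def sum_distrib_left mult_ac)
qed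

lemma lvec_adj:
  assumes "l < m"
  shows "lvec n R (adj u) l = complex_of_real (g l) * lvec m L u l + (\<Sum>k<r. lvec n R (\<lambda>j. S j k) l * bq u k)"
proof -
  have "lvec n R (adj u) l = lvec n R (\<lambda>a. (\<Sum>l<m. R a l * (complex_of_real (g l) * lvec m L u l)) + (\<Sum>k<r. S a k * bq u k)) l"
    unfolding lvec_def[of n] by (intro sum.cong refl) (simp add: adj_eq)
  also have "\<dots> = lvec n R (\<lambda>a. \<Sum>l<m. R a l * (complex_of_real (g l) * lvec m L u l)) l + lvec n R (\<lambda>a. \<Sum>k<r. S a k * bq u k) l"
    by (simp add: lvec_def[of n] distrib_left sum.distrib)
  also have "lvec n R (\<lambda>a. \<Sum>l<m. R a l * (complex_of_real (g l) * lvec m L u l)) l = complex_of_real (g l) * lvec m L u l"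
    by (rule lvec_inverse[OF R assms])
  finally show ?thesis by (simp only: lvec_sum[of n R "\<lambda>k a. S a k"])
qed

lemma sp_eq: "sp u k = (\<Sum>i<m. cnj (xg k i) * lvec m L u i) + (\<Sum>j<r. gram k j * bq u j)"
proof -
  have "sp u k = (\<Sum>a<n. (\<Sum>l<m. cnj (S a k) * (R a l * (complex_of_real (g l) * lvec m L u l))) + (\<Sum>j<r. cnj (S a k) * (S a j * bq u j)))"
    unfolding sp_def by (intro sum.cong refl) (simp add: adj_eq distrib_left sum_distrib_left)
  also have "\<dots> = (\<Sum>l<m. \<Sum>a<n. cnj (S a k) * (R a l * (complex_of_real (g l) * lvec m L u l))) + (\<Sum>j<r. \<Sum>a<n. cnj (S a k) * (S a j * bq u j))"
    unfolding sum.distrib by (subst sum.swap, subst (2) sum.swap) simp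
  also have "\<dots> = (\<Sum>i<m. cnj (xg k i) * lvec m L u i) + (\<Sum>j<r. gram k j * bq u j)"
    unfolding lvec_def[of n] gram_def sum_distrib_left sum_distrib_right cnj_sum complex_cnj_mult complex_cnj_cnj complex_cnj_complex_of_real
    by (intro arg_cong2[where f = "(+)"] sum.cong refl) (simp_all add: mult_ac)
  finally show ?thesis .
qed

lemma bq_eq: "bq u k = (\<Sum>i<m. cnj (y k i) * lvec m L u i)"
  unfolding unitary_parseval[OF L] bq_def ..

text \<open>Apply L^* to \<Sigma> \<Sigma>^* u = \<mu> u. The left factor \<Sigma> splits into L
  \<Gamma> R^* and B S^*; the noise part meets R^* \<Sigma>^* u, which is \<Gamma> L^* u + R^* S q,
  and this produces \<Gamma>^2.\<close>

lemma eigen_equation: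
  assumes ev: "\<And>i. i < m \<Longrightarrow> (\<Sum>a<n. Sg i a * adj u a) = complex_of_real \<mu> * u i" and i: "i < m"
  shows "complex_of_real (\<mu> - (g i)\<^sup>2) * lvec m L u i = (\<Sum>k<r. bq u k * xg k i) + (\<Sum>k<r. sp u k * y k i)"
proof -
  have "complex_of_real \<mu> * lvec m L u i = lvec m L (\<lambda>j. \<Sum>a<n. Sg j a * adj u a) i"
    unfolding lvec_def sum_distrib_left[of "complex_of_real \<mu>"] by (intro sum.cong refl) (simp add: ev)
  also have "\<dots> = lvec m L (\<lambda>j. (\<Sum>l<m. L j l * (complex_of_real (g l) * lvec n R (adj u) l)) + (\<Sum>k<r. B j k * sp u k)) i"
  proof -
    have "(\<Sum>a<n. Sg j a * adj u a) = (\<Sum>l<m. L j l * (complex_of_real (g l) * lvec n R (adj u) l)) + (\<Sum>k<r. B j k * sp u k)" if "j < m" for j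
    proof -
      have "(\<Sum>a<n. Sg j a * adj u a) = (\<Sum>a<n. (\<Sum>l<m. L j l * complex_of_real (g l) * cnj (R a l) * adj u a) + (\<Sum>k<r. B j k * cnj (S a k) * adj u a))"
        using that by (intro sum.cong refl) (simp add: Sg distrib_right sum_distrib_right)
      also have "\<dots> = (\<Sum>l<m. \<Sum>a<n. L j l * complex_of_real (g l) * cnj (R a l) * adj u a) + (\<Sum>k<r. \<Sum>a<n. B j k * cnj (S a k) * adj u a)"
        unfolding sum.distrib by (subst sum.swap, subst (2) sum.swap) simp
      finally show ?thesis by (simp add: lvec_def[of n] sp_def sum_distrib_left mult_ac)
    qed
    then show ?thesis unfolding lvec_def[of m] by (intro sum.cong refl) simp
  qed
  also have "\<dots> = lvec m L (\<lambda>j. \<Sum>l<m. L j l * (complex_of_real (g l) * lvec n R (adj u) l)) i + lvec m L (\<lambda>j. \<Sum>k<r. B j k * sp u k) i"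
    by (simp add: lvec_def[of m] distrib_left sum.distrib)
  also have "lvec m L (\<lambda>j. \<Sum>l<m. L j l * (complex_of_real (g l) * lvec n R (adj u) l)) i = complex_of_real (g i) * lvec n R (adj u) i"
    by (rule lvec_inverse[OF L i])
  also have "\<dots> = complex_of_real ((g i)\<^sup>2) * lvec m L u i + (\<Sum>k<r. bq u k * xg k i)"
    unfolding lvec_adj[OF i] by (simp add: distrib_left sum_distrib_left power2_eq_square mult_ac)
  also have "lvec m L (\<lambda>j. \<Sum>k<r. B j k * sp u k) i = (\<Sum>k<r. sp u k * y k i)"
    by (simp only: lvec_sum[of m L "\<lambda>k j. B j k"] mult.commute)
  finally show ?thesis by (simp add: algebra_simps)
qed

text \<open>Only one of the two factors is expanded. The remaining sums are then R^* \<Sigma>^* u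
  and S^* \<Sigma>^* u, which \<open>lvec_adj\<close> and \<open>sp_eq\<close> have already
  evaluated.\<close>

lemma adj_norm:
  "(\<Sum>a<n. cnj (adj u a) * adj u a) = (\<Sum>i<m. complex_of_real ((g i)\<^sup>2) * (cnj (lvec m L u i) * lvec m L u i))
     + (\<Sum>k<r. cnj (bq u k) * (\<Sum>i<m. cnj (xg k i) * lvec m L u i))
     + (\<Sum>k<r. bq u k * cnj (\<Sum>i<m. cnj (xg k i) * lvec m L u i))
     + (\<Sum>k<r. \<Sum>j<r. cnj (bq u k) * gram k j * bq u j)"
proof -
  have "(\<Sum>a<n. cnj (adj u a) * adj u a)
      = (\<Sum>a<n. (\<Sum>l<m. cnj (adj u a) * (R a l * (complex_of_real (g l) * lvec m L u l))) + (\<Sum>k<r. cnj (adj u a) * (S a k * bq u k)))"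
    by (intro sum.cong refl) (simp add: adj_eq distrib_left sum_distrib_left)
  also have "\<dots> = (\<Sum>l<m. \<Sum>a<n. cnj (adj u a) * (R a l * (complex_of_real (g l) * lvec m L u l))) + (\<Sum>k<r. \<Sum>a<n. cnj (adj u a) * (S a k * bq u k))"
    unfolding sum.distrib by (subst sum.swap, subst (2) sum.swap) simp
  also have "\<dots> = (\<Sum>l<m. cnj (lvec n R (adj u) l) * (complex_of_real (g l) * lvec m L u l)) + (\<Sum>k<r. cnj (sp u k) * bq u k)"
    by (simp add: lvec_def[of n] sp_def sum_distrib_right sum_distrib_left mult_ac)
  also have "(\<Sum>l<m. cnj (lvec n R (adj u) l) * (complex_of_real (g l) * lvec m L u l))
      = (\<Sum>l<m. complex_of_real ((g l)\<^sup>2) * (cnj (lvec m L u l) * lvec m L u l) + (\<Sum>k<r. cnj (bq u k) * (cnj (xg k l) * lvec m L u l)))"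
    by (intro sum.cong refl) (simp add: lvec_adj distrib_left distrib_right sum_distrib_left sum_distrib_right power2_eq_square mult_ac)
  also have "\<dots> = (\<Sum>l<m. complex_of_real ((g l)\<^sup>2) * (cnj (lvec m L u l) * lvec m L u l)) + (\<Sum>k<r. cnj (bq u k) * (\<Sum>i<m. cnj (xg k i) * lvec m L u i))"
    unfolding sum.distrib sum_distrib_left by (subst (2) sum.swap) simp
  also have "(\<Sum>k<r. cnj (sp u k) * bq u k) = (\<Sum>k<r. bq u k * cnj (\<Sum>i<m. cnj (xg k i) * lvec m L u i)) + (\<Sum>k<r. \<Sum>j<r. cnj (bq u k) * gram k j * bq u j)"
  proof -
    have g: "cnj (gram k j) = gram j k" for k j by (simp add: gram_def mult.commute)
    have "(\<Sum>k<r. cnj (sp u k) * bq u k) = (\<Sum>k<r. bq u k * cnj (\<Sum>i<m. cnj (xg k i) * lvec m L u i) + (\<Sum>j<r. cnj (bq u j) * gram j k * bq u k))"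
      unfolding sp_eq by (intro sum.cong refl) (simp add: g distrib_left sum_distrib_left mult_ac)
    moreover have "(\<Sum>k<r. \<Sum>j<r. cnj (bq u j) * gram j k * bq u k) = (\<Sum>k<r. \<Sum>j<r. cnj (bq u k) * gram k j * bq u j)"
      by (rule sum.swap)
    ultimately show ?thesis unfolding sum.distrib by simp
  qed
  finally show ?thesis by (simp add: add.assoc)
qed

text \<open>The easy half of Courant-Fischer: a combination of the \<open>r\<close> vectors L E_k
  can be made orthogonal to the first r - 1 eigenvectors, and on such a vector the form is bounded
  by the r-th eigenvalue. The normalisation is put on the coefficients \<open>p\<close>, since the
  \<open>E k\<close> may be dependent.\<close>

lemma minmax_vector:
  assumes r: "0 < r" "r \<le> m"
    and ev: "\<And>l i. l < m \<Longrightarrow> i < m \<Longrightarrow> (\<Sum>a<n. Sg i a * adj (u l) a) = complex_of_real (\<mu> l) * u l i"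
    and orth: "orthonormal_cols m m (\<lambda>i l. u l i)"
    and dec: "\<And>l. r - 1 \<le> l \<Longrightarrow> l < m \<Longrightarrow> \<mu> l \<le> \<mu> (r - 1)"
  shows "\<exists>p f. (\<Sum>k<r. (cmod (p k))\<^sup>2) = 1 \<and> (\<forall>i<m. lvec m L f i = (\<Sum>k<r. p k * E k i)) \<and>
    Re (\<Sum>a<n. cnj (adj f a) * adj f a) \<le> \<mu> (r - 1) * (\<Sum>i<m. (cmod (\<Sum>k<r. p k * E k i))\<^sup>2)"
proof -
  define a where "a = (\<lambda>k j. \<Sum>l<m. L j l * E k l)"
  define c where "c = (\<lambda>b l. lvec m (\<lambda>i l. u l i) b l)"
  obtain p where p1: "(\<Sum>k<r. (cmod (p k))\<^sup>2) = 1" and p2: "\<And>l. l < r - 1 \<Longrightarrow> (\<Sum>k<r. c (a k) l * p k) = 0"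
    using homogeneous_system_nontrivial[OF r(1), of "\<lambda>l k. c (a k) l"] by blast
  define f where "f = (\<lambda>j. \<Sum>k<r. a k j * p k)"
  have Lf: "lvec m L f i = (\<Sum>k<r. p k * E k i)" if "i < m" for i
  proof -
    have "lvec m L f i = (\<Sum>k<r. lvec m L (a k) i * p k)" unfolding f_def by (rule lvec_sum)
    also have "\<dots> = (\<Sum>k<r. p k * E k i)"
      unfolding a_def lvec_inverse[OF L that] by (simp add: mult.commute)
    finally show ?thesis .
  qed
  have cf: "c f l = 0" if "l < r - 1" for l
    using p2[OF that] unfolding c_def f_def lvec_sum .
  have cadj: "c (\<lambda>i. \<Sum>a<n. Sg i a * adj f a) l = complex_of_real (\<mu> l) * c f l" if l: "l < m" for l
  proof -
    have "c (\<lambda>i. \<Sum>a<n. Sg i a * adj f a) l = (\<Sum>a<n. cnj (adj (u l) a) * adj f a)"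
      unfolding c_def lvec_def sum_distrib_left adj_def[of "u l"] cnj_sum sum_distrib_right
      by (subst sum.swap) (simp add: mult_ac)
    also have "\<dots> = cnj (\<Sum>i<m. (\<Sum>a<n. Sg i a * adj (u l) a) * cnj (f i))"
      unfolding adj_def[of f] sum_distrib_left sum_distrib_right cnj_sum
      by (subst sum.swap) (simp add: mult_ac)
    also have "\<dots> = complex_of_real (\<mu> l) * c f l"
      unfolding c_def lvec_def sum_distrib_left cnj_sum by (intro sum.cong refl) (use ev[OF l] in simp)
    finally show ?thesis .
  qed
  have "(\<Sum>a<n. cnj (adj f a) * adj f a) = (\<Sum>i<m. cnj (f i) * (\<Sum>a<n. Sg i a * adj f a))"
  proof -
    have "(\<Sum>a<n. cnj (adj f a) * adj f a) = (\<Sum>a<n. \<Sum>i<m. cnj (f i) * (Sg i a * adj f a))"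
      by (rule sum.cong[OF refl], subst adj_def[of f]) (simp add: sum_distrib_right sum_distrib_left mult_ac)
    then show ?thesis by (subst (asm) sum.swap) (simp add: sum_distrib_left)
  qed
  also have "\<dots> = (\<Sum>l<m. cnj (c f l) * c (\<lambda>i. \<Sum>a<n. Sg i a * adj f a) l)"
    unfolding c_def by (rule unitary_parseval[OF orth, symmetric])
  also have "\<dots> = (\<Sum>l<m. complex_of_real (\<mu> l * (cmod (c f l))\<^sup>2))"
    by (intro sum.cong refl) (simp add: cadj complex_norm_square mult_ac del: of_real_power)
  finally have 1: "Re (\<Sum>a<n. cnj (adj f a) * adj f a) = (\<Sum>l<m. \<mu> l * (cmod (c f l))\<^sup>2)"
    by (simp only: Re_sum Re_complex_of_real)
  have 2: "(\<Sum>l<m. \<mu> l * (cmod (c f l))\<^sup>2) \<le> (\<Sum>l<m. \<mu> (r - 1) * (cmod (c f l))\<^sup>2)"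
  proof (rule sum_mono)
    fix l assume "l \<in> {..<m}"
    then show "\<mu> l * (cmod (c f l))\<^sup>2 \<le> \<mu> (r - 1) * (cmod (c f l))\<^sup>2"
      using cf[of l] dec[of l] by (cases "l < r - 1") (auto intro: mult_right_mono)
  qed
  have 3: "(\<Sum>l<m. \<mu> (r - 1) * (cmod (c f l))\<^sup>2) = \<mu> (r - 1) * (\<Sum>i<m. (cmod (\<Sum>k<r. p k * E k i))\<^sup>2)"
  proof -
    have "complex_of_real (\<Sum>l<m. (cmod (c f l))\<^sup>2) = (\<Sum>l<m. cnj (c f l) * c f l)"
      by (simp add: complex_norm_square mult.commute del: of_real_power)
    also have "\<dots> = (\<Sum>i<m. cnj (lvec m L f i) * lvec m L f i)"
      unfolding c_def unitary_parseval[OF orth] unitary_parseval[OF L] ..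
    also have "\<dots> = (\<Sum>i<m. cnj (\<Sum>k<r. p k * E k i) * (\<Sum>k<r. p k * E k i))"
      by (intro sum.cong refl) (simp only: Lf lessThan_iff)
    also have "\<dots> = complex_of_real (\<Sum>i<m. (cmod (\<Sum>k<r. p k * E k i))\<^sup>2)"
      by (simp add: complex_norm_square mult.commute del: of_real_power cnj_sum)
    finally show ?thesis by (simp only: of_real_eq_iff flip: sum_distrib_left)
  qed
  have "Re (\<Sum>a<n. cnj (adj f a) * adj f a) \<le> \<mu> (r - 1) * (\<Sum>i<m. (cmod (\<Sum>k<r. p k * E k i))\<^sup>2)"
    using 2 unfolding 1 3 .
  then show ?thesis using p1 Lf by blast
qed

end

section \<open>The perturbed matrices as a spiked path\<close>

locale outlier_model = spiked_path \<pi> lmin lmax N "\<lambda>n i. (g n i)\<^sup>2" c r Om w SS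
  for \<pi> lmin lmax N g c r Om w SS +
  fixes Lf Rf Bf Sf Sg u :: "nat \<Rightarrow> nat \<Rightarrow> nat \<Rightarrow> complex" and lam :: "nat \<Rightarrow> nat \<Rightarrow> real" and x0 :: real
  assumes spn: "\<forall>\<^sub>F n in sequentially. signal_plus_noise (N n) n r (Lf n) (Rf n) (Bf n) (Sf n) (g n) (Sg n)"
    and w_eq: "\<And>n k i. w n k i = (if k < r then complex_of_real (g n i) * lvec n (Rf n) (\<lambda>j. Sf n j k) i
        else lvec (N n) (Lf n) (\<lambda>j. Bf n j (k - r)) i)"
    and SS_eq: "\<And>n k j. SS n k j = (\<Sum>a<n. cnj (Sf n a k) * Sf n a j)"
    and ev: "\<forall>\<^sub>F n in sequentially. \<forall>l<N n. \<forall>i<N n.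
        (\<Sum>a<n. Sg n i a * (\<Sum>b<N n. cnj (Sg n b a) * u n l b)) = complex_of_real (lam n l) * u n l i"
    and orth: "\<forall>\<^sub>F n in sequentially. orthonormal_cols (N n) (N n) (\<lambda>i l. u n l i)"
    and dec: "\<forall>\<^sub>F n in sequentially. \<forall>l<N n. (r - 1 \<le> l \<longrightarrow> lam n l \<le> lam n (r - 1)) \<and> (l \<le> r - 1 \<longrightarrow> lam n (r - 1) \<le> lam n l)"
    and r_le: "\<forall>\<^sub>F n in sequentially. r \<le> N n"
    and x0: "lmax < x0" and above: "\<And>k. k < r \<Longrightarrow> 1 < m1 x0 * sf x0 * (Om k)\<^sup>2"
begin

lemma outliers: "\<forall>\<^sub>F n in sequentially. x0 < lam n (r - 1)"
proof (rule outlier_existence[OF x0 above])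
  show "\<forall>\<^sub>F n in sequentially. \<forall>E :: nat \<Rightarrow> nat \<Rightarrow> complex. \<exists>p. (\<Sum>k<r. (cmod (p k))\<^sup>2) = 1 \<and>
      Re (quad_form n (\<lambda>i. \<Sum>k<r. p k * E k i)) \<le> lam n (r - 1) * (\<Sum>i<N n. (cmod (\<Sum>k<r. p k * E k i))\<^sup>2)"
    using spn ev orth dec r_le
  proof (eventually_elim, intro allI)
    fix n and E :: "nat \<Rightarrow> nat \<Rightarrow> complex"
    assume s: "signal_plus_noise (N n) n r (Lf n) (Rf n) (Bf n) (Sf n) (g n) (Sg n)"
      and ev: "\<forall>l<N n. \<forall>i<N n. (\<Sum>a<n. Sg n i a * (\<Sum>b<N n. cnj (Sg n b a) * u n l b)) = complex_of_real (lam n l) * u n l i"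
      and orth: "orthonormal_cols (N n) (N n) (\<lambda>i l. u n l i)"
      and dec: "\<forall>l<N n. (r - 1 \<le> l \<longrightarrow> lam n l \<le> lam n (r - 1)) \<and> (l \<le> r - 1 \<longrightarrow> lam n (r - 1) \<le> lam n l)" and r: "r \<le> N n"
    interpret signal_plus_noise "N n" n r "Lf n" "Rf n" "Bf n" "Sf n" "g n" "Sg n" by (rule s)
    obtain p f where p: "(\<Sum>k<r. (cmod (p k))\<^sup>2) = 1" and f: "\<forall>i<N n. lvec (N n) (Lf n) f i = (\<Sum>k<r. p k * E k i)"
      and le: "Re (\<Sum>a<n. cnj (adj f a) * adj f a) \<le> lam n (r - 1) * (\<Sum>i<N n. (cmod (\<Sum>k<r. p k * E k i))\<^sup>2)"
      using minmax_vector[OF r_pos r, of "u n" "lam n" E] ev orth dec unfolding adj_def by blast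
    have "quad_form n (\<lambda>i. \<Sum>k<r. p k * E k i) = (\<Sum>a<n. cnj (adj f a) * adj f a)"
    proof -
      have e: "(\<Sum>k<r. p k * E k i) = lvec (N n) (Lf n) f i" if "i < N n" for i using f that by simp
      have q: "(\<Sum>i<N n. cnj (w n (r + k) i) * (\<Sum>k<r. p k * E k i)) = bq f k" for k
        unfolding bq_eq by (intro sum.cong refl) (simp add: e w_eq)
      have s: "(\<Sum>i<N n. cnj (w n k i) * (\<Sum>k<r. p k * E k i)) = (\<Sum>i<N n. cnj (xg k i) * lvec (N n) (Lf n) f i)" if "k < r" for k
        by (intro sum.cong refl) (use that in \<open>simp add: e w_eq\<close>)
      have t: "(\<Sum>i<N n. complex_of_real ((g n i)\<^sup>2) * (cnj (\<Sum>k<r. p k * E k i) * (\<Sum>k<r. p k * E k i)))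
          = (\<Sum>i<N n. complex_of_real ((g n i)\<^sup>2) * (cnj (lvec (N n) (Lf n) f i) * lvec (N n) (Lf n) f i))"
        by (intro sum.cong refl) (simp only: e lessThan_iff)
      show ?thesis
        unfolding quad_form_def adj_norm t q gram_def SS_eq
        by (intro arg_cong2[where f = "(+)"] sum.cong refl) (simp_all only: s lessThan_iff)
    qed
    then show "\<exists>p. (\<Sum>k<r. (cmod (p k))\<^sup>2) = 1 \<and>
      Re (quad_form n (\<lambda>i. \<Sum>k<r. p k * E k i)) \<le> lam n (r - 1) * (\<Sum>i<N n. (cmod (\<Sum>k<r. p k * E k i))\<^sup>2)"
      using p le by auto
  qed
qed

lemma projection_limit:
  fixes a :: "nat \<Rightarrow> nat \<Rightarrow> complex" and \<alpha> :: "nat \<Rightarrow> complex"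
  assumes "\<And>j. j < 2 * r \<Longrightarrow> weight_lim sequentially N (\<lambda>n i. (g n i)\<^sup>2) \<pi> (\<lambda>n i. cnj (lvec (N n) (Lf n) (a n) i) * w n j i)
      (\<lambda>x. if j < r then 0 else \<alpha> (j - r))"
  shows "(\<lambda>n. \<Sum>l<r. (cmod (\<Sum>i<N n. cnj (a n i) * u n l i))\<^sup>2 * zeta c \<pi> (lam n l)) \<longlonglongrightarrow> (\<Sum>k<r. (cmod (\<alpha> k))\<^sup>2)"
proof -
  define bb where "bb = (\<lambda>n l k. \<Sum>i<N n. cnj (Bf n i k) * u n l i)"
  define ss where "ss = (\<lambda>n l k. \<Sum>a<n. cnj (Sf n a k) * (\<Sum>b<N n. cnj (Sg n b a) * u n l b))"
  define v where "v = (\<lambda>n l j. if j < r then bb n l j else ss n l (j - r))"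
  define e where "e = (\<lambda>n l i. lvec (N n) (Lf n) (u n l) i)"
  have main: "spiked_eigen \<pi> lmin lmax N (\<lambda>n i. (g n i)\<^sup>2) c r Om w SS lam e v x0"
  proof (unfold_locales, rule x0)
    show "\<forall>\<^sub>F n in sequentially. \<forall>l<r. x0 \<le> lam n l"
      using outliers dec r_le
    proof eventually_elim
      case (elim n)
      show ?case
      proof (intro allI impI)
        fix l assume "l < r"
        then have "lam n (r - 1) \<le> lam n l" using elim(2,3) by auto
        then show "x0 \<le> lam n l" using elim(1) by linarith
      qed
    qed
    show "\<forall>\<^sub>F n in sequentially. \<forall>l<r. \<forall>i<N n. complex_of_real (lam n l - (g n i)\<^sup>2) * e n l i = comb n (v n l) i"
      using spn ev r_le
    proof eventually_elim
      case (elim n)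
      interpret signal_plus_noise "N n" n r "Lf n" "Rf n" "Bf n" "Sf n" "g n" "Sg n" by (rule elim(1))
      show ?case
      proof (intro allI impI)
        fix l i assume li: "l < r" "i < N n"
        have "complex_of_real (lam n l - (g n i)\<^sup>2) * e n l i = (\<Sum>k<r. bq (u n l) k * xg k i) + (\<Sum>k<r. sp (u n l) k * y k i)"
          unfolding e_def by (rule eigen_equation) (use elim li in \<open>auto simp: adj_def\<close>)
        also have "\<dots> = comb n (v n l) i"
          unfolding comb_def sum_lessThan_double
          by (intro arg_cong2[where f = "(+)"] sum.cong refl)
            (simp_all add: v_def w_eq bb_def ss_def bq_def sp_def adj_def)
        finally show "complex_of_real (lam n l - (g n i)\<^sup>2) * e n l i = comb n (v n l) i" .
      qed
    qed
    show "\<forall>\<^sub>F n in sequentially. \<forall>l<r. \<forall>k<r. v n l k = (\<Sum>i<N n. cnj (w n (r + k) i) * e n l i)"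
      using spn
    proof eventually_elim
      case (elim n)
      interpret signal_plus_noise "N n" n r "Lf n" "Rf n" "Bf n" "Sf n" "g n" "Sg n" by (rule elim)
      have "bb n l k = (\<Sum>i<N n. cnj (y k i) * e n l i)" for l k
        using bq_eq[of "u n l" k] by (simp add: bb_def bq_def e_def)
      then show ?case by (simp add: v_def w_eq)
    qed
    show "\<forall>\<^sub>F n in sequentially. \<forall>l<r. \<forall>k<r. v n l (r + k) = (\<Sum>i<N n. cnj (w n k i) * e n l i) + (\<Sum>j<r. SS n k j * v n l j)"
      using spn
    proof eventually_elim
      case (elim n)
      interpret signal_plus_noise "N n" n r "Lf n" "Rf n" "Bf n" "Sf n" "g n" "Sg n" by (rule elim)
      have "ss n l k = (\<Sum>i<N n. cnj (xg k i) * e n l i) + (\<Sum>j<r. gram k j * bb n l j)" for l k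
        using sp_eq[of "u n l" k] by (simp add: ss_def sp_def adj_def bb_def bq_def e_def)
      then show ?case by (simp add: v_def w_eq SS_eq gram_def)
    qed
    show "\<forall>\<^sub>F n in sequentially. \<forall>l<r. \<forall>l'<r. (\<Sum>i<N n. cnj (e n l i) * e n l' i) = (if l = l' then 1 else 0)"
      using spn orth r_le
    proof eventually_elim
      case (elim n)
      interpret signal_plus_noise "N n" n r "Lf n" "Rf n" "Bf n" "Sf n" "g n" "Sg n" by (rule elim(1))
      show ?case
        unfolding e_def unitary_parseval[OF L] using elim(2,3) by (auto simp: orthonormal_cols_def)
    qed
  qed
  have "(\<lambda>n. \<Sum>l<r. (cmod (\<Sum>i<N n. cnj (lvec (N n) (Lf n) (a n) i) * e n l i))\<^sup>2 * zeta c \<pi> (lam n l)) \<longlonglongrightarrow> (\<Sum>k<r. (cmod (\<alpha> k))\<^sup>2)"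
    by (rule spiked_eigen.outlier_projection_limit[OF main assms])
  moreover have "\<forall>\<^sub>F n in sequentially. (\<Sum>l<r. (cmod (\<Sum>i<N n. cnj (lvec (N n) (Lf n) (a n) i) * e n l i))\<^sup>2 * zeta c \<pi> (lam n l))
      = (\<Sum>l<r. (cmod (\<Sum>i<N n. cnj (a n i) * u n l i))\<^sup>2 * zeta c \<pi> (lam n l))"
    using spn
  proof eventually_elim
    case (elim n)
    interpret signal_plus_noise "N n" n r "Lf n" "Rf n" "Bf n" "Sf n" "g n" "Sg n" by (rule elim)
    show ?case unfolding e_def unitary_parseval[OF L] ..
  qed
  ultimately show ?thesis by (rule Lim_transform_eventually)
qed

end

section \<open>Steering vectors and local maxima\<close>

text \<open>By the double angle formula |sin x| is 2 |sin (x/2)| |cos (x/2)|, and the cosine is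
  strictly below 1 in modulus unless sin (x/2) vanishes.\<close>

lemma abs_sin_less: assumes "x \<noteq> 0" shows "\<bar>sin x\<bar> < \<bar>x :: real\<bar>"
proof (cases "sin (x / 2) = 0")
  case True
  then show ?thesis using assms sin_double[of "x / 2"] by simp
next
  case False
  then have "0 < (sin (x / 2))\<^sup>2" by simp
  then have "(cos (x / 2))\<^sup>2 < 1" using sin_cos_squared_add[of "x / 2"] by linarith
  then have c: "\<bar>cos (x / 2)\<bar> < 1" by (simp add: abs_square_less_1)
  have "\<bar>sin x\<bar> = 2 * \<bar>sin (x / 2)\<bar> * \<bar>cos (x / 2)\<bar>"
    using sin_double[of "x / 2"] by (simp add: abs_mult)
  also have "\<dots> < 2 * \<bar>sin (x / 2)\<bar> * 1"
    by (rule mult_strict_left_mono[OF c]) (use False in simp)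
  also have "\<dots> \<le> \<bar>x\<bar>"
    using abs_sin_x_le_abs_x[of "x / 2"] by simp
  finally show ?thesis .
qed

lemma exp_chord_less: assumes "x \<noteq> 0" shows "cmod ((exp (\<i> * complex_of_real x) - 1) / (\<i> * complex_of_real x)) < 1"
proof -
  have "cmod (exp (\<i> * complex_of_real x) - 1) = 2 * \<bar>sin (x / 2)\<bar>" by (rule dist_exp_i_1)
  also have "\<dots> < \<bar>x\<bar>" using abs_sin_less[of "x / 2"] assms by simp
  finally show ?thesis using assms by (simp add: norm_divide norm_mult)
qed

lemma exp_mean_geometric:
  assumes "exp (\<i> * complex_of_real \<theta>) \<noteq> 1"
  shows "(\<Sum>l<N. exp (\<i> * complex_of_real (real l * \<theta>))) / of_nat N
    = (exp (\<i> * complex_of_real (real N * \<theta>)) - 1) / (of_nat N * (exp (\<i> * complex_of_real \<theta>) - 1))"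
proof -
  have "exp (\<i> * complex_of_real (real l * \<theta>)) = exp (\<i> * complex_of_real \<theta>) ^ l" for l
    by (simp add: exp_of_nat_mult[symmetric] mult_ac)
  then have "(\<Sum>l<N. exp (\<i> * complex_of_real (real l * \<theta>))) = (exp (\<i> * complex_of_real (real N * \<theta>)) - 1) / (exp (\<i> * complex_of_real \<theta>) - 1)"
    using geometric_sum[OF assms, of N] by simp
  then show ?thesis by (simp add: mult.commute)
qed

text \<open>The geometric sum stays bounded because the limit frequency is no multiple of 2 \<pi>,
  while the mean divides by \<open>N n\<close>.\<close>

lemma exp_mean_tendsto_zero:
  assumes N: "filterlim N at_top sequentially" and \<theta>: "\<theta> \<longlonglongrightarrow> \<theta>0" and ne: "exp (\<i> * complex_of_real \<theta>0) \<noteq> 1"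
  shows "(\<lambda>n. (\<Sum>l<N n. exp (\<i> * complex_of_real (real l * \<theta> n))) / of_nat (N n)) \<longlonglongrightarrow> 0"
proof -
  have lim: "(\<lambda>n. exp (\<i> * complex_of_real (\<theta> n)) - 1) \<longlonglongrightarrow> exp (\<i> * complex_of_real \<theta>0) - 1"
    by (intro tendsto_intros \<theta>)
  define d where "d = cmod (exp (\<i> * complex_of_real \<theta>0) - 1) / 2"
  have d: "0 < d" using ne by (simp add: d_def)
  have ev: "\<forall>\<^sub>F n in sequentially. d < cmod (exp (\<i> * complex_of_real (\<theta> n)) - 1)"
    using tendsto_norm[OF lim] d by (intro order_tendstoD(1)) (auto simp: d_def)
  have Nr: "filterlim (\<lambda>n. real (N n)) at_top sequentially"
    by (rule filterlim_compose[OF filterlim_real_sequentially N])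
  have "(\<lambda>n. (2 / d) / real (N n)) \<longlonglongrightarrow> 0"
    by (rule real_tendsto_divide_at_top[OF tendsto_const Nr])
  moreover have "\<forall>\<^sub>F n in sequentially. cmod ((\<Sum>l<N n. exp (\<i> * complex_of_real (real l * \<theta> n))) / of_nat (N n)) \<le> (2 / d) / real (N n)"
    using ev
  proof eventually_elim
    case (elim n)
    then have e: "exp (\<i> * complex_of_real (\<theta> n)) \<noteq> 1" using d by auto
    have "cmod (exp (\<i> * complex_of_real (real (N n) * \<theta> n)) - 1) \<le> 2"
      using norm_triangle_ineq4[of "exp (\<i> * complex_of_real (real (N n) * \<theta> n))" 1] by (simp only: norm_exp_i_times norm_one)
    then have "cmod (exp (\<i> * complex_of_real (real (N n) * \<theta> n)) - 1) / (real (N n) * cmod (exp (\<i> * complex_of_real (\<theta> n)) - 1)) \<le> 2 / (real (N n) * d)"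
      using elim d by (cases "N n = 0") (auto intro!: frac_le mult_left_mono simp del: of_real_mult)
    then show ?case
      unfolding exp_mean_geometric[OF e] norm_divide norm_mult norm_of_nat by (simp add: mult.commute)
  qed
  ultimately show ?thesis by (rule Lim_null_comparison[rotated])
qed

text \<open>Critical scaling: exp(\<i> \<theta>) - 1 is asymptotic to \<i> \<theta>, so the
  denominator of the geometric mean tends to \<i> \<tau>.\<close>

lemma exp_mean_tendsto_kernel:
  assumes N: "(\<lambda>n. real (N n) * \<theta> n) \<longlonglongrightarrow> \<tau>" and \<theta>: "\<theta> \<longlonglongrightarrow> 0" and ne: "\<tau> \<noteq> 0"
  shows "(\<lambda>n. (\<Sum>l<N n. exp (\<i> * complex_of_real (real l * \<theta> n))) / of_nat (N n)) \<longlonglongrightarrow> (exp (\<i> * complex_of_real \<tau>) - 1) / (\<i> * complex_of_real \<tau>)"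
proof (rule Lim_transform_eventually)
  have \<theta>ne: "\<forall>\<^sub>F n in sequentially. \<theta> n \<noteq> 0"
    using tendsto_imp_eventually_ne[OF N ne] by eventually_elim auto
  have "((\<lambda>z. (exp z - 1) / z) \<longlongrightarrow> 1) (at (0::complex))"
    using DERIV_exp[of "0::complex"] by (simp add: has_field_derivative_iff)
  moreover have "filterlim (\<lambda>n. \<i> * complex_of_real (\<theta> n)) (at 0) sequentially"
    unfolding filterlim_at using \<theta>ne by (auto intro!: tendsto_eq_intros \<theta> elim!: eventually_mono)
  ultimately have q: "(\<lambda>n. (exp (\<i> * complex_of_real (\<theta> n)) - 1) / (\<i> * complex_of_real (\<theta> n))) \<longlonglongrightarrow> 1"
    by (rule filterlim_compose)
  have "(\<lambda>n. (exp (\<i> * complex_of_real (real (N n) * \<theta> n)) - 1) / (\<i> * complex_of_real (real (N n) * \<theta> n) * ((exp (\<i> * complex_of_real (\<theta> n)) - 1) / (\<i> * complex_of_real (\<theta> n)))))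
      \<longlonglongrightarrow> (exp (\<i> * complex_of_real \<tau>) - 1) / (\<i> * complex_of_real \<tau> * 1)"
    by (intro tendsto_intros N q) (use ne in auto)
  then show "(\<lambda>n. (exp (\<i> * complex_of_real (real (N n) * \<theta> n)) - 1) / (\<i> * complex_of_real (real (N n) * \<theta> n) * ((exp (\<i> * complex_of_real (\<theta> n)) - 1) / (\<i> * complex_of_real (\<theta> n)))))
      \<longlonglongrightarrow> (exp (\<i> * complex_of_real \<tau>) - 1) / (\<i> * complex_of_real \<tau>)" by simp
  have "\<forall>\<^sub>F n in sequentially. (exp (\<i> * complex_of_real (\<theta> n)) - 1) / (\<i> * complex_of_real (\<theta> n)) \<noteq> 0"
    by (rule tendsto_imp_eventually_ne[OF q]) simp
  then show "\<forall>\<^sub>F n in sequentially. (exp (\<i> * complex_of_real (real (N n) * \<theta> n)) - 1) / (\<i> * complex_of_real (real (N n) * \<theta> n) * ((exp (\<i> * complex_of_real (\<theta> n)) - 1) / (\<i> * complex_of_real (\<theta> n))))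
      = (\<Sum>l<N n. exp (\<i> * complex_of_real (real l * \<theta> n))) / of_nat (N n)"
    using \<theta>ne
  proof eventually_elim
    case (elim n)
    then have e: "exp (\<i> * complex_of_real (\<theta> n)) \<noteq> 1" by auto
    show ?case unfolding exp_mean_geometric[OF e] using elim by simp
  qed
qed

lemma exp_i_ne_one: assumes "x \<noteq> 0" "\<bar>x\<bar> \<le> pi" shows "exp (\<i> * complex_of_real x) \<noteq> 1"
proof
  assume "exp (\<i> * complex_of_real x) = 1"
  then have "sin (x / 2) = 0" using dist_exp_i_1[of x] by simp
  moreover have "0 < sin (\<bar>x\<bar> / 2)" using assms by (intro sin_gt_zero) auto
  ultimately show False by (cases "0 \<le> x") auto
qed

lemma steer_inner:
  "(\<Sum>j<N. cnj (steer D N \<psi> $ j) * steer D N \<phi> $ j) = (\<Sum>l<N. exp (\<i> * complex_of_real (real l * (D * (\<psi> - \<phi>))))) / of_nat N"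
proof -
  have "cnj (steer D N \<psi> $ j) * steer D N \<phi> $ j = exp (\<i> * complex_of_real (real j * (D * (\<psi> - \<phi>)))) / of_nat N" if "j < N" for j
  proof -
    have s: "complex_of_real (sqrt (real N)) * complex_of_real (sqrt (real N)) = of_nat N"
      by (simp flip: of_real_mult)
    have "cnj (steer D N \<psi> $ j) * steer D N \<phi> $ j = exp (\<i> * complex_of_real (D * real j * \<psi>)) * exp (- \<i> * complex_of_real (D * real j * \<phi>)) / of_nat N"
      using that s by (simp add: steer_def exp_cnj)
    also have "exp (\<i> * complex_of_real (D * real j * \<psi>)) * exp (- \<i> * complex_of_real (D * real j * \<phi>)) = exp (\<i> * complex_of_real (real j * (D * (\<psi> - \<phi>))))"
      unfolding exp_add[symmetric] by (rule arg_cong[where f = exp]) (simp add: algebra_simps)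
    finally show ?thesis .
  qed
  then show ?thesis by (simp add: sum_divide_distrib)
qed

text \<open>An inequality, since the sum is empty for N = 0.\<close>

lemma steer_norm: "(\<Sum>j<N. (cmod (steer D N \<phi> $ j))\<^sup>2) \<le> 1"
  by (simp add: steer_def norm_divide power_divide norm_exp_i_times[of "- _", simplified])

section \<open>Trapping local maxima\<close>

text \<open>A maximum over the part of the window inside {0..b} cannot sit at an end of the window,
  where the value is below that at the centre. It may sit at 0 or b, which still makes it a local
  maximum relative to {0..b}. The points x0 + d and x0 - d may lie outside {0..b}.\<close>

lemma local_max_in_window:
  fixes f :: "real \<Rightarrow> real"
  assumes f: "continuous_on UNIV f" and x0: "x0 \<in> {0..b}" and d: "0 < d"
    and less: "f (x0 + d) < f x0" "f (x0 - d) < f x0"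
  shows "\<exists>x. local_max_on {0..b} f x \<and> \<bar>x - x0\<bar> \<le> d"
proof -
  let ?K = "{max 0 (x0 - d)..min b (x0 + d)}"
  have x0K: "x0 \<in> ?K" using x0 d by auto
  obtain x where x: "x \<in> ?K" "\<And>y. y \<in> ?K \<Longrightarrow> f y \<le> f x"
    using continuous_attains_sup[of ?K f] continuous_on_subset[OF f] x0K by (metis compact_Icc empty_iff subset_UNIV)
  have "x \<noteq> x0 + d" "x \<noteq> x0 - d" using less x(2)[OF x0K] by auto
  then have xs: "x0 - d < x" "x < x0 + d" using x(1) by auto
  define e where "e = min (x0 + d - x) (x - (x0 - d))"
  have "0 < e" using xs by (simp add: e_def)
  moreover have "f y \<le> f x" if "y \<in> {0..b}" "\<bar>y - x\<bar> < e" for y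
    by (rule x(2)) (use that in \<open>auto simp: e_def abs_less_iff\<close>)
  ultimately have "local_max_on {0..b} f x" using x(1) by (auto simp: local_max_on_def)
  then show ?thesis using xs by (intro exI[of _ x]) auto
qed

text \<open>A single sequence serves all accuracies: at stage \<open>n\<close> use the best accuracy
  attainable among the first \<open>n\<close> indices. \<open>J\<close> and \<open>x\<close> are
  meaningful only where some accuracy is attainable, and \<open>key\<close> is confined to that
  case.\<close>

lemma diagonal_selection:
  assumes "\<And>j::nat. \<forall>\<^sub>F n in sequentially. \<exists>x. Q n x \<and> h n x \<le> 1 / real (Suc j)"
  shows "\<exists>x. (\<forall>\<^sub>F n in sequentially. Q n (x n)) \<and> (\<forall>j. \<forall>\<^sub>F n in sequentially. h n (x n) \<le> 1 / real (Suc j))"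
proof -
  define P where "P = (\<lambda>n j. \<exists>x. Q n x \<and> h n x \<le> 1 / real (Suc j))"
  define J where "J = (\<lambda>n. Max {j. j \<le> n \<and> P n j})"
  define x where "x = (\<lambda>n. SOME x. Q n x \<and> h n x \<le> 1 / real (Suc (J n)))"
  have key: "Q n (x n) \<and> h n (x n) \<le> 1 / real (Suc j)" if "P n j" "j \<le> n" for n j
  proof -
    have "J n \<in> {j. j \<le> n \<and> P n j}" unfolding J_def by (rule Max_in) (use that in auto)
    then have "Q n (x n) \<and> h n (x n) \<le> 1 / real (Suc (J n))"
      unfolding x_def P_def by (intro someI_ex[of "\<lambda>x. Q n x \<and> h n x \<le> 1 / real (Suc (J n))"]) auto
    moreover have "j \<le> J n" unfolding J_def by (rule Max_ge) (use that in auto)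
    then have "1 / real (Suc (J n)) \<le> 1 / real (Suc j)" by (simp add: frac_le)
    ultimately show ?thesis by linarith
  qed
  have "\<forall>\<^sub>F n in sequentially. Q n (x n) \<and> h n (x n) \<le> 1 / real (Suc j)" for j
    using assms[of j] eventually_ge_at_top[of j] by eventually_elim (use key in \<open>auto simp: P_def\<close>)
  then show "\<exists>x. (\<forall>\<^sub>F n in sequentially. Q n (x n)) \<and> (\<forall>j. \<forall>\<^sub>F n in sequentially. h n (x n) \<le> 1 / real (Suc j))"
    by (intro exI[of _ x]) (auto simp: eventually_conj_iff)
qed

text \<open>For each \<open>j\<close> the limits at the three points x0 and x0 \<plusminus> 1 / ((j
  + 1) n) separate eventually, which traps a maximum; the diagonal choice then removes the
  dependence on \<open>j\<close>.\<close>

lemma local_maxima_converge: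
  fixes f :: "nat \<Rightarrow> real \<Rightarrow> real"
  assumes f: "\<And>n. continuous_on UNIV (f n)" and x0: "x0 \<in> {0..b}"
    and lim0: "(\<lambda>n. f n x0) \<longlonglongrightarrow> A"
    and lim: "\<And>s. s \<noteq> 0 \<Longrightarrow> s \<in> range (\<lambda>j. 1 / real (Suc j)) \<union> range (\<lambda>j. - 1 / real (Suc j)) \<Longrightarrow> \<exists>a<A. (\<lambda>n. f n (x0 + s / real n)) \<longlonglongrightarrow> a"
  shows "\<exists>ph. (\<forall>\<^sub>F n in sequentially. local_max_on {0..b} (f n) (ph n)) \<and> (\<lambda>n. real n * (ph n - x0)) \<longlonglongrightarrow> 0"
proof -
  have less: "\<forall>\<^sub>F n in sequentially. f n (x0 + s / real n) < f n x0"
    if s: "s \<noteq> 0" "s \<in> range (\<lambda>j. 1 / real (Suc j)) \<union> range (\<lambda>j. - 1 / real (Suc j))" for s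
  proof -
    obtain a where a: "a < A" "(\<lambda>n. f n (x0 + s / real n)) \<longlonglongrightarrow> a" using lim[OF s] by blast
    obtain y where y: "a < y" "y < A" using dense[OF a(1)] by blast
    show ?thesis
      using order_tendstoD(2)[OF a(2) y(1)] order_tendstoD(1)[OF lim0 y(2)] by eventually_elim simp
  qed
  have "\<forall>\<^sub>F n in sequentially. \<exists>x. local_max_on {0..b} (f n) x \<and> real n * \<bar>x - x0\<bar> \<le> 1 / real (Suc j)" for j
  proof -
    have r: "1 / real (Suc j) \<in> range (\<lambda>j. 1 / real (Suc j)) \<union> range (\<lambda>j. - 1 / real (Suc j))"
      "- 1 / real (Suc j) \<in> range (\<lambda>j. 1 / real (Suc j)) \<union> range (\<lambda>j. - 1 / real (Suc j))"
      by blast+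
    have "1 / real (Suc j) \<noteq> 0" "- 1 / real (Suc j) \<noteq> 0" by simp_all
    from less[OF this(1) r(1)] less[OF this(2) r(2)] eventually_gt_at_top[of 0]
    show ?thesis
    proof eventually_elim
      case (elim n)
      let ?d = "1 / real (Suc j) / real n"
      have "\<exists>x. local_max_on {0..b} (f n) x \<and> \<bar>x - x0\<bar> \<le> ?d"
        by (rule local_max_in_window[OF f x0]) (use elim in simp_all)
      then obtain x where x: "local_max_on {0..b} (f n) x" "\<bar>x - x0\<bar> \<le> ?d" by blast
      have "real n * \<bar>x - x0\<bar> \<le> real n * ?d" by (rule mult_left_mono[OF x(2)]) simp
      then show ?case using elim(3) x(1) by auto
    qed
  qed
  then obtain ph where ph: "\<forall>\<^sub>F n in sequentially. local_max_on {0..b} (f n) (ph n)"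
      "\<And>j. \<forall>\<^sub>F n in sequentially. real n * \<bar>ph n - x0\<bar> \<le> 1 / real (Suc j)"
    using diagonal_selection[of "\<lambda>n. local_max_on {0..b} (f n)" "\<lambda>n x. real n * \<bar>x - x0\<bar>"] by blast
  have "(\<lambda>n. real n * (ph n - x0)) \<longlonglongrightarrow> 0"
    unfolding tendsto_iff
  proof (intro allI impI)
    fix e :: real assume "0 < e"
    then obtain j where j: "1 / real (Suc j) < e" using nat_approx_posE by blast
    show "\<forall>\<^sub>F n in sequentially. dist (real n * (ph n - x0)) 0 < e"
      using ph(2)[of j] by eventually_elim (use j in \<open>simp add: abs_mult\<close>)
  qed
  then show ?thesis using ph(1) by blast
qed

section \<open>The spectrum of the noise and the estimator\<close>

lemma noise_entry:
  assumes L: "L \<in> carrier_mat m m" and G: "G \<in> carrier_mat m m" and R: "R \<in> carrier_mat n m"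
    and diag: "\<forall>i<m. \<forall>j<m. i \<noteq> j \<longrightarrow> G $$ (i, j) = 0" and re: "\<forall>i<m. Im (G $$ (i, i)) = 0"
    and ia: "i < m" "a < n"
  shows "(L * G * mat_adjoint R) $$ (i, a) = (\<Sum>l<m. L $$ (i, l) * complex_of_real (Re (G $$ (l, l))) * cnj (R $$ (a, l)))"
proof -
  have LG: "(L * G) $$ (i, l) = L $$ (i, l) * complex_of_real (Re (G $$ (l, l)))" if l: "l < m" for l
  proof -
    have "(L * G) $$ (i, l) = (\<Sum>k<m. L $$ (i, k) * G $$ (k, l))"
      using L G ia l by (simp add: scalar_prod_def atLeast0LessThan)
    also have "\<dots> = (\<Sum>k<m. if k = l then L $$ (i, l) * G $$ (l, l) else 0)"
      using diag l by (intro sum.cong refl) auto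
    also have "\<dots> = L $$ (i, l) * G $$ (l, l)" using l by simp
    also have "G $$ (l, l) = complex_of_real (Re (G $$ (l, l)))"
      using re l by (simp add: complex_eq_iff)
    finally show ?thesis by simp
  qed
  have "(L * G * mat_adjoint R) $$ (i, a) = (\<Sum>l<m. (L * G) $$ (i, l) * cnj (R $$ (a, l)))"
    using L G R ia by (simp add: scalar_prod_def atLeast0LessThan del: assoc_mult_mat)
  then show ?thesis using LG by simp
qed

lemma noise_gram:
  fixes X :: "complex mat"
  assumes X: "X \<in> carrier_mat m n" and ab: "a < m" "b < m"
    and ent: "\<And>i a. i < m \<Longrightarrow> a < n \<Longrightarrow> X $$ (i, a) = (\<Sum>l<m. L $$ (i, l) * complex_of_real (g l) * cnj (R $$ (a, l)))"
    and R: "orthonormal_cols n m (\<lambda>j i. R $$ (j, i))"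
  shows "(X * mat_adjoint X) $$ (a, b) = (\<Sum>l<m. L $$ (a, l) * complex_of_real ((g l)\<^sup>2) * cnj (L $$ (b, l)))"
proof -
  have "(X * mat_adjoint X) $$ (a, b) = (\<Sum>i<n. X $$ (a, i) * cnj (X $$ (b, i)))"
    using X ab by (simp add: scalar_prod_def atLeast0LessThan)
  also have "\<dots> = (\<Sum>i<n. \<Sum>l<m. \<Sum>k<m. L $$ (a, l) * complex_of_real (g l) * complex_of_real (g k) * cnj (L $$ (b, k)) * (cnj (R $$ (i, l)) * R $$ (i, k)))"
    using ab by (intro sum.cong refl) (simp add: ent sum_product mult_ac)
  also have "\<dots> = (\<Sum>l<m. \<Sum>k<m. \<Sum>i<n. L $$ (a, l) * complex_of_real (g l) * complex_of_real (g k) * cnj (L $$ (b, k)) * (cnj (R $$ (i, l)) * R $$ (i, k)))"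
    by (subst sum.swap, rule sum.cong[OF refl], subst sum.swap) simp
  also have "\<dots> = (\<Sum>l<m. \<Sum>k<m. if l = k then L $$ (a, l) * complex_of_real (g l) * complex_of_real (g l) * cnj (L $$ (b, l)) else 0)"
    unfolding sum_distrib_left[symmetric]
    by (intro sum.cong refl) (use R in \<open>auto simp: orthonormal_cols_def\<close>)
  finally show ?thesis by (simp add: power2_eq_square mult_ac)
qed

text \<open>The diagonalised resolvent \<open>C\<close> is shown to be a two-sided inverse, first so
  that \<open>mat_inverse\<close> does return a matrix, then to identify that matrix with
  \<open>C\<close>.\<close>

lemma trace_resolvent:
  fixes A :: "complex mat"
  assumes A: "A \<in> carrier_mat m m" and L: "orthonormal_cols m m (\<lambda>j i. L $$ (j, i))"
    and ent: "\<And>a b. a < m \<Longrightarrow> b < m \<Longrightarrow> A $$ (a, b) = (\<Sum>l<m. L $$ (a, l) * complex_of_real (t l) * cnj (L $$ (b, l)))"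
    and z: "Im z \<noteq> 0"
  shows "mat_trace (the (mat_inverse (A - z \<cdot>\<^sub>m 1\<^sub>m m))) = (\<Sum>l<m. 1 / (complex_of_real (t l) - z))"
proof -
  let ?B = "A - z \<cdot>\<^sub>m 1\<^sub>m m"
  define C where "C = mat m m (\<lambda>(a, b). \<Sum>l<m. L $$ (a, l) * (1 / (complex_of_real (t l) - z)) * cnj (L $$ (b, l)))"
  have tz: "complex_of_real (t l) - z \<noteq> 0" for l using z by (auto simp: complex_eq_iff)
  have cB: "?B \<in> carrier_mat m m" by (rule carrier_matI) simp_all
  have cC: "C \<in> carrier_mat m m" by (simp add: C_def)
  have B: "?B $$ (a, b) = (\<Sum>l<m. L $$ (a, l) * (complex_of_real (t l) - z) * cnj (L $$ (b, l)))" if ab: "a < m" "b < m" for a b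
  proof -
    have "(\<Sum>l<m. L $$ (a, l) * (complex_of_real (t l) - z) * cnj (L $$ (b, l)))
        = A $$ (a, b) - z * (\<Sum>l<m. L $$ (a, l) * cnj (L $$ (b, l)))"
      unfolding ent[OF ab] sum_distrib_left sum_subtractf[symmetric] by (intro sum.cong refl) (simp add: algebra_simps)
    also have "\<dots> = ?B $$ (a, b)" using ab A by (simp add: orthonormal_rows[OF L ab])
    finally show ?thesis ..
  qed
  have BC: "?B * C = 1\<^sub>m m"
  proof (rule eq_matI)
    fix a d assume "a < dim_row (1\<^sub>m m :: complex mat)" "d < dim_col (1\<^sub>m m :: complex mat)"
    then have ad: "a < m" "d < m" by auto
    have "(?B * C) $$ (a, d) = (\<Sum>b<m. ?B $$ (a, b) * C $$ (b, d))"
      using cB cC ad by (simp add: scalar_prod_def atLeast0LessThan)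
    also have "\<dots> = (\<Sum>b<m. \<Sum>l<m. \<Sum>k<m. L $$ (a, l) * (complex_of_real (t l) - z) * (1 / (complex_of_real (t k) - z)) * cnj (L $$ (d, k)) * (cnj (L $$ (b, l)) * L $$ (b, k)))"
      by (intro sum.cong refl) (use ad in \<open>simp add: B C_def sum_product mult_ac del: index_minus_mat\<close>)
    also have "\<dots> = (\<Sum>l<m. \<Sum>k<m. \<Sum>b<m. L $$ (a, l) * (complex_of_real (t l) - z) * (1 / (complex_of_real (t k) - z)) * cnj (L $$ (d, k)) * (cnj (L $$ (b, l)) * L $$ (b, k)))"
      by (subst sum.swap, rule sum.cong[OF refl], subst sum.swap) simp
    also have "\<dots> = (\<Sum>l<m. \<Sum>k<m. if l = k then L $$ (a, l) * cnj (L $$ (d, l)) else 0)"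
      unfolding sum_distrib_left[symmetric]
      by (intro sum.cong refl) (use L tz in \<open>auto simp: orthonormal_cols_def\<close>)
    also have "\<dots> = (1\<^sub>m m :: complex mat) $$ (a, d)" using ad by (simp add: orthonormal_rows[OF L ad])
    finally show "(?B * C) $$ (a, d) = (1\<^sub>m m :: complex mat) $$ (a, d)" .
  qed (use A in \<open>simp_all add: C_def\<close>)
  have CB: "C * ?B = 1\<^sub>m m" by (rule mat_mult_left_right_inverse[OF cB cC BC])
  have "mat_inverse ?B \<noteq> None"
  proof
    assume "mat_inverse ?B = None"
    then have "?B \<notin> Units (ring_mat TYPE(complex) m ())" by (rule mat_inverse(1)[OF cB])
    moreover have "?B \<in> Units (ring_mat TYPE(complex) m ())"
      unfolding Units_def using cB cC BC CB by (auto simp: ring_mat_simps)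
    ultimately show False by simp
  qed
  then obtain D where D: "mat_inverse ?B = Some D" by auto
  have DB: "D * ?B = 1\<^sub>m m" "D \<in> carrier_mat m m" using mat_inverse(2)[OF cB D] by auto
  have "C = (D * ?B) * C" using cC DB by simp
  also have "\<dots> = D * (?B * C)" by (rule assoc_mult_mat[OF DB(2) cB cC])
  also have "\<dots> = D" using BC DB(2) by simp
  finally have "D = C" ..
  then have "mat_trace (the (mat_inverse ?B)) = (\<Sum>a<m. \<Sum>l<m. L $$ (a, l) * (1 / (complex_of_real (t l) - z)) * cnj (L $$ (a, l)))"
    by (simp add: D mat_trace_def C_def)
  also have "\<dots> = (\<Sum>l<m. 1 / (complex_of_real (t l) - z) * (\<Sum>a<m. cnj (L $$ (a, l)) * L $$ (a, l)))"
    by (subst sum.swap) (simp add: sum_distrib_left mult_ac)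
  also have "\<dots> = (\<Sum>l<m. 1 / (complex_of_real (t l) - z))"
    by (intro sum.cong refl) (use L in \<open>auto simp: orthonormal_cols_def\<close>)
  finally show ?thesis .
qed

lemma eigenvalue_le_op_norm:
  assumes A: "A \<in> carrier_mat m m" and v: "v \<in> carrier_vec m" "vnorm v = 1"
    and ev: "A *\<^sub>v v = complex_of_real \<mu> \<cdot>\<^sub>v v"
  shows "\<bar>\<mu>\<bar> \<le> op_norm A"
proof -
  let ?S = "{vnorm (A *\<^sub>v v) | v. v \<in> carrier_vec (dim_col A) \<and> vnorm v = 1}"
  \<comment> \<open>The supremum in \<open>op_norm\<close> can be compared with its members only for
    a bounded set; a crude bound by the entries suffices.\<close>
  have "bdd_above ?S"
  proof (rule bdd_aboveI)
    fix x assume "x \<in> ?S"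
    then obtain v where v: "v \<in> carrier_vec m" "vnorm v = 1" and x: "x = vnorm (A *\<^sub>v v)" using A by auto
    have one: "(\<Sum>i<m. (cmod (v $ i))\<^sup>2) = 1" using v by (simp add: vnorm_def)
    have ent: "cmod (v $ j) \<le> 1" if "j < m" for j
    proof -
      have "(cmod (v $ j))\<^sup>2 \<le> (\<Sum>i<m. (cmod (v $ i))\<^sup>2)" using that by (intro member_le_sum) auto
      then show ?thesis using one by (simp add: abs_square_le_1)
    qed
    have "cmod ((A *\<^sub>v v) $ i) \<le> (\<Sum>j<m. cmod (A $$ (i, j)))" if "i < m" for i
    proof -
      have "(A *\<^sub>v v) $ i = (\<Sum>j<m. A $$ (i, j) * v $ j)"
        using A v that by (simp add: scalar_prod_def atLeast0LessThan)
      also have "cmod \<dots> \<le> (\<Sum>j<m. cmod (A $$ (i, j)))"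
        by (rule sum_norm_le) (use ent in \<open>auto simp: norm_mult intro!: mult_left_le\<close>)
      finally show ?thesis .
    qed
    then show "x \<le> sqrt (\<Sum>i<m. (\<Sum>j<m. cmod (A $$ (i, j)))\<^sup>2)"
      using A by (auto simp: x vnorm_def intro!: sum_mono power_mono)
  qed
  moreover have "vnorm (A *\<^sub>v v) = \<bar>\<mu>\<bar>"
  proof -
    have "vnorm (A *\<^sub>v v) = sqrt (\<bar>\<mu>\<bar>\<^sup>2 * (\<Sum>i<m. (cmod (v $ i))\<^sup>2))"
      unfolding ev using v(1) by (simp add: vnorm_def norm_mult power_mult_distrib sum_distrib_left)
    then show ?thesis using v by (simp add: vnorm_def)
  qed
  then have "\<bar>\<mu>\<bar> \<in> ?S" using v A by force
  ultimately show ?thesis unfolding op_norm_def by (intro cSup_upper)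
qed

lemma singular_value_le_op_norm:
  fixes A :: "complex mat"
  assumes A: "A \<in> carrier_mat m m" and L: "orthonormal_cols m m (\<lambda>j i. L $$ (j, i))"
    and ent: "\<And>a b. a < m \<Longrightarrow> b < m \<Longrightarrow> A $$ (a, b) = (\<Sum>l<m. L $$ (a, l) * complex_of_real (t l) * cnj (L $$ (b, l)))"
    and k: "k < m"
  shows "\<bar>t k\<bar> \<le> op_norm A"
proof (rule eigenvalue_le_op_norm[OF A])
  let ?v = "vec m (\<lambda>i. L $$ (i, k))"
  show "?v \<in> carrier_vec m" by simp
  show "vnorm ?v = 1" using orthonormal_cols_unit[OF L k] by (simp add: vnorm_def)
  show "A *\<^sub>v ?v = complex_of_real (t k) \<cdot>\<^sub>v ?v"
  proof (rule eq_vecI)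
    fix a assume "a < dim_vec (complex_of_real (t k) \<cdot>\<^sub>v ?v)"
    then have a: "a < m" by simp
    have "(A *\<^sub>v ?v) $ a = (\<Sum>b<m. A $$ (a, b) * L $$ (b, k))"
      using A a by (simp add: scalar_prod_def atLeast0LessThan)
    also have "\<dots> = (\<Sum>b<m. \<Sum>l<m. L $$ (a, l) * complex_of_real (t l) * (cnj (L $$ (b, l)) * L $$ (b, k)))"
      by (intro sum.cong refl) (use a in \<open>simp add: ent sum_distrib_right sum_distrib_left mult_ac\<close>)
    also have "\<dots> = (\<Sum>l<m. L $$ (a, l) * complex_of_real (t l) * (\<Sum>b<m. cnj (L $$ (b, l)) * L $$ (b, k)))"
      by (subst sum.swap) (simp add: sum_distrib_left)
    also have "\<dots> = (\<Sum>l<m. if l = k then L $$ (a, k) * complex_of_real (t k) else 0)"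
      by (intro sum.cong refl) (use L k in \<open>auto simp: orthonormal_cols_def\<close>)
    finally show "(A *\<^sub>v ?v) $ a = (complex_of_real (t k) \<cdot>\<^sub>v ?v) $ a" using a k by (simp add: mult.commute)
  qed (use A in simp)
qed

text \<open>The integral of exp(\<i> \<tau> x) over x in [0, 1], with its value at 0 put in by
  hand.\<close>

definition steer_kernel :: "real \<Rightarrow> complex" where
  "steer_kernel \<tau> = (if \<tau> = 0 then 1 else (exp (\<i> * complex_of_real \<tau>) - 1) / (\<i> * complex_of_real \<tau>))"

text \<open>For distinct angles D |\<phi> - \<psi>| lies in (0, \<pi>], so there is no aliasing
  modulo 2 \<pi> and the mean vanishes. For equal angles the frequency D s / n is of critical order,
  with N n times it tending to D c s.\<close>

lemma steer_inner_limit: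
  assumes N: "(\<lambda>n. real (N n) / real n) \<longlonglongrightarrow> c" "filterlim N at_top sequentially" and c: "c \<noteq> 0" and D: "0 < D"
    and \<phi>: "\<phi> \<in> {0..pi / D}" "\<psi> \<in> {0..pi / D}"
  shows "(\<lambda>n. \<Sum>j<N n. cnj (steer D (N n) (\<phi> + s / real n) $ j) * steer D (N n) \<psi> $ j)
    \<longlonglongrightarrow> (if \<phi> = \<psi> then steer_kernel (D * c * s) else 0)"
proof -
  define \<theta> where "\<theta> = (\<lambda>n. D * (\<phi> + s / real n - \<psi>))"
  have \<theta>: "\<theta> \<longlonglongrightarrow> D * (\<phi> + 0 - \<psi>)"
    unfolding \<theta>_def by (intro tendsto_intros lim_const_over_n)
  have Npos: "\<forall>\<^sub>F n in sequentially. 0 < N n"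
    by (rule eventually_compose_filterlim[OF eventually_gt_at_top N(2)])
  have "(\<lambda>n. (\<Sum>l<N n. exp (\<i> * complex_of_real (real l * \<theta> n))) / of_nat (N n)) \<longlonglongrightarrow> (if \<phi> = \<psi> then steer_kernel (D * c * s) else 0)"
  proof (cases "\<phi> = \<psi>")
    case False
    have "\<bar>\<phi> - \<psi>\<bar> \<le> pi / D" using \<phi> by (auto simp: abs_le_iff)
    then have "D * \<bar>\<phi> - \<psi>\<bar> \<le> D * (pi / D)" using D by (intro mult_left_mono) auto
    moreover have "\<bar>D * (\<phi> + 0 - \<psi>)\<bar> = D * \<bar>\<phi> - \<psi>\<bar>" unfolding abs_mult using D by simp
    ultimately have "\<bar>D * (\<phi> + 0 - \<psi>)\<bar> \<le> pi" using D by simp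
    then have "exp (\<i> * complex_of_real (D * (\<phi> + 0 - \<psi>))) \<noteq> 1"
      using False D by (intro exp_i_ne_one) auto
    then show ?thesis using exp_mean_tendsto_zero[OF N(2) \<theta>] False by simp
  next
    case True
    show ?thesis
    proof (cases "s = 0")
      case s: True
      have "(\<lambda>n. (\<Sum>l<N n. exp (\<i> * complex_of_real (real l * \<theta> n))) / of_nat (N n)) \<longlonglongrightarrow> 1"
        by (rule tendsto_eventually) (use Npos in \<open>auto elim!: eventually_mono simp: \<theta>_def s True\<close>)
      then show ?thesis using s True by (simp add: steer_kernel_def)
    next
      case s: False
      have "(\<lambda>n. D * s * (real (N n) / real n)) \<longlonglongrightarrow> D * s * c" by (intro tendsto_intros N)
      moreover have "real (N n) * \<theta> n = D * s * (real (N n) / real n)" for n by (simp add: \<theta>_def True)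
      ultimately have "(\<lambda>n. real (N n) * \<theta> n) \<longlonglongrightarrow> D * c * s" by (simp add: mult_ac)
      moreover have "\<theta> \<longlonglongrightarrow> 0" using \<theta> True by simp
      ultimately show ?thesis
        using exp_mean_tendsto_kernel[of N \<theta> "D * c * s"] s c D True by (simp add: steer_kernel_def)
    qed
  qed
  then show ?thesis by (simp add: steer_inner \<theta>_def)
qed

lemma steer_kernel_less: "\<tau> \<noteq> 0 \<Longrightarrow> cmod (steer_kernel \<tau>) < 1"
  using exp_chord_less by (simp add: steer_kernel_def)

lemma vinner_steer: "vinner (steer D N \<phi>) u = (\<Sum>i<N. cnj (steer D N \<phi> $ i) * u $ i)"
  by (simp add: vinner_def steer_def)

lemma continuous_chi_hat: "continuous_on UNIV (chi_hat c \<pi> D N r lam u)"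
proof -
  have "chi_hat c \<pi> D N r lam u = (\<lambda>\<phi>. \<Sum>k<r. (cmod (\<Sum>i<N. cnj (exp (- \<i> * complex_of_real (D * real i * \<phi>)) / complex_of_real (sqrt (real N))) * u k $ i))\<^sup>2 * zeta c \<pi> (lam k))"
    by (simp add: chi_hat_def vinner_def steer_def fun_eq_iff)
  moreover have "continuous_on UNIV (\<lambda>\<phi>. \<Sum>k<r. (cmod (\<Sum>i<N. cnj (exp (- \<i> * complex_of_real (D * real i * \<phi>)) / complex_of_real (sqrt (real N))) * u k $ i))\<^sup>2 * zeta c \<pi> (lam k))"
    by (cases "N = 0") (auto intro!: continuous_intros)
  ultimately show ?thesis by simp
qed

lemma decreasing_from:
  fixes f :: "nat \<Rightarrow> real"
  assumes "\<And>k. Suc k < m \<Longrightarrow> f (Suc k) \<le> f k" "i \<le> j" "j < m"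
  shows "f j \<le> f i"
  using assms(2,3)
proof (induction rule: dec_induct)
  case (step n)
  then show ?case using assms(1)[of n] by simp
qed simp

section \<open>Assembly on one event of probability one\<close>

theorem theorem3:
  fixes M :: "'w measure"
    and N :: "nat \<Rightarrow> nat" and c :: real
    and L Gam R :: "nat \<Rightarrow> 'w \<Rightarrow> complex mat"
    and X Sig :: "nat \<Rightarrow> 'w \<Rightarrow> complex mat"
    and \<pi> :: "real measure" and lmin lmax :: real
    and P S :: "nat \<Rightarrow> complex mat" and r :: nat
    and \<omega> :: "nat \<Rightarrow> nat \<Rightarrow> real" and Om :: "nat \<Rightarrow> real"
    and D :: real and \<phi> :: "nat \<Rightarrow> real"
    and lam :: "nat \<Rightarrow> 'w \<Rightarrow> nat \<Rightarrow> real"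
    and u :: "nat \<Rightarrow> 'w \<Rightarrow> nat \<Rightarrow> complex vec"
  defines "X \<equiv> (\<lambda>n w. L n w * Gam n w * mat_adjoint (R n w))"
    and "Sig \<equiv> (\<lambda>n w. X n w + P n)"
  assumes M: "prob_space M"
    \<comment> \<open>(A1)\<close>
    and A1_le: "\<forall>n. N n \<le> n"
    and A1_lim: "(\<lambda>n. real (N n) / real n) \<longlonglongrightarrow> c" and c_pos: "0 < c" and c_le: "c \<le> 1"
    \<comment> \<open>(A2)\<close>
    and A2_indep: "\<forall>n. prob_space.indep_vars M
        (\<lambda>i. if i = (2::nat) then mat_space n (N n) else mat_space (N n) (N n))
        (\<lambda>i. if i = 0 then L n else if i = 1 then Gam n else R n) {0, 1, 2}"
    and A2_L: "\<forall>n. haar_unitary (N n) (distr M (mat_space (N n) (N n)) (L n))"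
    and A2_Gam: "\<forall>n w. Gam n w \<in> carrier_mat (N n) (N n) \<and>
        (\<forall>i<N n. \<forall>j<N n. i \<noteq> j \<longrightarrow> Gam n w $$ (i, j) = 0) \<and>
        (\<forall>i<N n. Im (Gam n w $$ (i, i)) = 0 \<and> Re (Gam n w $$ (i, i)) \<ge> 0)"
    and A2_R: "\<forall>n. \<exists>H col. haar_unitary n H \<and> inj_on col {..<N n} \<and> (\<forall>j<N n. col j < n) \<and>
        distr M (mat_space n (N n)) (R n) =
        distr H (mat_space n (N n)) (\<lambda>W. mat n (N n) (\<lambda>(i, j). W $$ (i, col j)))"
    \<comment> \<open>(A3)\<close>
    and A3_pi: "sets \<pi> = sets borel" "prob_space \<pi>" "lmin \<le> lmax" "emeasure \<pi> {lmin..lmax} = 1"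
    and A3: "\<forall>z. Im z > 0 \<longrightarrow> (AE w in M. (\<lambda>n. mat_trace (the (mat_inverse
          (X n w * mat_adjoint (X n w) - z \<cdot>\<^sub>m 1\<^sub>m (N n)))) / of_nat (N n))
          \<longlonglongrightarrow> stieltjes \<pi> z)"
    \<comment> \<open>(A4)\<close>
    and A4: "AE w in M. (\<lambda>n. op_norm (X n w * mat_adjoint (X n w))) \<longlonglongrightarrow> lmax"
    \<comment> \<open>(A5)\<close>
    and r_pos: "0 < r"
    and P_carrier: "\<forall>n. P n \<in> carrier_mat (N n) n"
    and A5_svd: "\<forall>\<^sub>F n in sequentially. \<exists>U V.
        U \<in> carrier_mat (N n) r \<and> mat_adjoint U * U = 1\<^sub>m r \<and>
        V \<in> carrier_mat n r \<and> mat_adjoint V * V = 1\<^sub>m r \<and>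
        P n = U * mat_diag r (\<lambda>k. complex_of_real (\<omega> n k)) * mat_adjoint V \<and>
        (\<forall>k<r. 0 < \<omega> n k) \<and> (\<forall>k. Suc k < r \<longrightarrow> \<omega> n (Suc k) \<le> \<omega> n k)"
    and A5_lim: "\<forall>k<r. (\<lambda>n. \<omega> n k) \<longlonglongrightarrow> Om k"
    and A5_Om: "\<forall>k. Suc k < r \<longrightarrow> Om (Suc k) \<le> Om k" "0 < Om (r - 1)"
    \<comment> \<open>(A6)\<close>
    and D_pos: "0 < D"
    and A6_phi: "\<forall>k<r. \<phi> k \<in> {0..pi / D}" "inj_on \<phi> {..<r}"
    and A6_fact: "\<forall>\<^sub>F n in sequentially. S n \<in> carrier_mat n r \<and>
        P n = mat_of_cols (N n) (map (\<lambda>k. steer D (N n) (\<phi> k)) [0..<r]) * mat_adjoint (S n)"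
    and A6_S: "\<exists>C. \<forall>\<^sub>F n in sequentially. \<forall>i<r. \<forall>j<r.
        cmod (complex_of_real (sqrt (real n)) *
          (mat_adjoint (S n) * S n - mat_diag r (\<lambda>k. complex_of_real ((Om k)\<^sup>2))) $$ (i, j)) \<le> C"
    \<comment> \<open>(A7)\<close>
    and A7: "(\<exists>g0>0. (gfun c \<pi> \<longlongrightarrow> g0) (at_right lmax) \<and> (Om (r - 1))\<^sup>2 > 1 / g0)
             \<or> filterlim (gfun c \<pi>) at_top (at_right lmax)"
    \<comment> \<open>eigen-decomposition of Sig Sig^*: decreasing eigenvalues, orthonormal eigenvectors\<close>
    and eig: "\<forall>n w. (\<forall>k<N n. u n w k \<in> carrier_vec (N n) \<and>
          (Sig n w * mat_adjoint (Sig n w)) *\<^sub>v u n w k = complex_of_real (lam n w k) \<cdot>\<^sub>v u n w k) \<and>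
        (\<forall>j<N n. \<forall>k<N n. vinner (u n w j) (u n w k) = (if j = k then 1 else 0)) \<and>
        (\<forall>k. Suc k < N n \<longrightarrow> lam n w (Suc k) \<le> lam n w k)"
  shows "\<forall>k<r. AE w in M. \<exists>ph :: nat \<Rightarrow> real.
           (\<forall>\<^sub>F n in sequentially. lam n w (r - 1) > lmax \<and>
              local_max_on {0..pi / D} (chi_hat c \<pi> D (N n) r (lam n w) (u n w)) (ph n)) \<and>
           (\<lambda>n. real n * (ph n - \<phi> k)) \<longlonglongrightarrow> 0"
proof -
  interpret prob_space M by (rule M)
  define B where "B = lmax + 1"
  define g where "g = (\<lambda>w n i. Re (Gam n w $$ (i, i)))"
  have model: "haar_model M (N n) n (L n) (Gam n) (R n)" for n
    using A2_indep A2_L A2_R by (unfold_locales) auto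
  have Npos: "\<forall>\<^sub>F n in sequentially. 0 < N n \<and> real n * (c / 2) \<le> real (N n)"
    by (rule eventually_linear_lower_bound[OF A1_lim c_pos])
  have Nlim: "filterlim N at_top sequentially"
    by (rule filterlim_linear_ratio[OF A1_lim c_pos])
  have "AE w in M. \<forall>n. orthonormal_cols (N n) (N n) (\<lambda>j i. L n w $$ (j, i))"
    unfolding AE_all_countable using haar_model.AE_orthonormal_L[OF model] by blast
  moreover have "AE w in M. \<forall>n. orthonormal_cols n (N n) (\<lambda>j i. R n w $$ (j, i))"
    unfolding AE_all_countable using haar_model.AE_orthonormal_R[OF model] by blast
  moreover have "AE w in M. \<forall>n. L n w \<in> carrier_mat (N n) (N n) \<and> R n w \<in> carrier_mat n (N n)"
    by (rule AE_I2) (use haar_model.carrier_LGR[OF model] in blast)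
  ultimately have good: "AE w in M. \<forall>n. orthonormal_cols (N n) (N n) (\<lambda>j i. L n w $$ (j, i)) \<and> orthonormal_cols n (N n) (\<lambda>j i. R n w $$ (j, i))
      \<and> L n w \<in> carrier_mat (N n) (N n) \<and> R n w \<in> carrier_mat n (N n)"
    by eventually_elim auto
  have Gc: "Gam n w \<in> carrier_mat (N n) (N n)" "\<forall>i<N n. \<forall>j<N n. i \<noteq> j \<longrightarrow> Gam n w $$ (i, j) = 0"
      "\<forall>i<N n. Im (Gam n w $$ (i, i)) = 0" for n w
    using A2_Gam by auto
  have Xent: "X n w $$ (i, a) = (\<Sum>l<N n. L n w $$ (i, l) * complex_of_real (g w n l) * cnj (R n w $$ (a, l)))"
    if "L n w \<in> carrier_mat (N n) (N n)" "R n w \<in> carrier_mat n (N n)" "i < N n" "a < n" for n w i a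
    unfolding X_def g_def by (rule noise_entry[OF that(1) Gc(1) that(2) Gc(2,3) that(3,4)])
  have Xc: "X n w \<in> carrier_mat (N n) n"
    if "L n w \<in> carrier_mat (N n) (N n)" "R n w \<in> carrier_mat n (N n)" for n w
    unfolding X_def using that Gc(1)[of n w] by (intro carrier_matI) auto
  have XXc: "X n w * mat_adjoint (X n w) \<in> carrier_mat (N n) (N n)"
    if "L n w \<in> carrier_mat (N n) (N n)" "R n w \<in> carrier_mat n (N n)" for n w
    using Xc[OF that] by (intro carrier_matI) auto
  have gramX: "(X n w * mat_adjoint (X n w)) $$ (a, b) = (\<Sum>l<N n. L n w $$ (a, l) * complex_of_real ((g w n l)\<^sup>2) * cnj (L n w $$ (b, l)))"
    if "L n w \<in> carrier_mat (N n) (N n)" "R n w \<in> carrier_mat n (N n)" "orthonormal_cols n (N n) (\<lambda>j i. R n w $$ (j, i))"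
      "a < N n" "b < N n" for n w a b
    by (rule noise_gram[OF Xc[OF that(1,2)] that(4,5) Xent[OF that(1,2)] that(3)])
  have gop: "AE w in M. \<forall>n. \<forall>i<N n. (g w n i)\<^sup>2 \<le> op_norm (X n w * mat_adjoint (X n w))"
    using good
  proof eventually_elim
    case (elim w)
    show ?case
    proof (intro allI impI)
      fix n i assume i: "i < N n"
      have "\<bar>(g w n i)\<^sup>2\<bar> \<le> op_norm (X n w * mat_adjoint (X n w))"
        by (rule singular_value_le_op_norm[where L = "L n w", OF XXc]) (use elim i gramX[of n w] in auto)
      then show "(g w n i)\<^sup>2 \<le> op_norm (X n w * mat_adjoint (X n w))" by simp
    qed
  qed
  \<comment> \<open>One null set serves all \<kappa>, since the only random input is the convergence
    of the operator norms.\<close>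
  have gbound: "AE w in M. \<forall>\<kappa>>lmax. \<forall>\<^sub>F n in sequentially. \<forall>i<N n. (g w n i)\<^sup>2 \<le> \<kappa>"
    using gop A4
  proof eventually_elim
    case (elim w)
    show ?case
    proof (intro allI impI)
      fix \<kappa> assume "lmax < \<kappa>"
      then have "\<forall>\<^sub>F n in sequentially. op_norm (X n w * mat_adjoint (X n w)) < \<kappa>"
        using elim(2) by (rule order_tendstoD(2)[rotated])
      then show "\<forall>\<^sub>F n in sequentially. \<forall>i<N n. (g w n i)\<^sup>2 \<le> \<kappa>"
        by eventually_elim (use elim(1) in \<open>meson less_imp_le order_trans\<close>)
    qed
  qed
  \<comment> \<open>\<open>lmax\<close> is a limit of operator norms, which eventually dominate at
    least one squared singular value.\<close>
  have lmax_nonneg: "0 \<le> lmax"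
  proof -
    have "AE w in M. 0 \<le> lmax" using gop A4
    proof eventually_elim
      case (elim w)
      have "\<forall>\<^sub>F n in sequentially. 0 \<le> op_norm (X n w * mat_adjoint (X n w))"
        using Npos by eventually_elim (use elim(1) in \<open>meson order_trans zero_le_power2\<close>)
      then show ?case by (rule tendsto_lowerbound[OF elim(2)]) simp
    qed
    then show ?thesis by simp
  qed
  have supp: "AE x in \<pi>. x \<in> {lmin..lmax}"
  proof -
    interpret p: prob_space \<pi> by (rule A3_pi(2))
    have "{lmin..lmax} \<in> p.events" using A3_pi(1) by simp
    moreover have "p.prob {lmin..lmax} = 1" using A3_pi(4) by (simp add: p.emeasure_eq_measure)
    ultimately show ?thesis using p.AE_in_set_eq_1 by blast
  qed
  have trace: "AE w in M. \<forall>k. (\<lambda>n. (\<Sum>i<N n. complex_of_real ((g w n i)\<^sup>2) ^ k) / of_nat (N n)) \<longlonglongrightarrow> (LINT x|\<pi>. complex_of_real x ^ k)"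
  proof -
    have "AE w in M. \<forall>y::nat. 0 < y \<longrightarrow> (\<lambda>n. mat_trace (the (mat_inverse (X n w * mat_adjoint (X n w) - (\<i> * of_nat y) \<cdot>\<^sub>m 1\<^sub>m (N n)))) / of_nat (N n))
          \<longlonglongrightarrow> stieltjes \<pi> (\<i> * of_nat y)"
      unfolding AE_all_countable using A3 by (intro allI AE_impI) auto
    with good gbound show ?thesis
    proof eventually_elim
      case (elim w)
      have tr: "mat_trace (the (mat_inverse (X n w * mat_adjoint (X n w) - (\<i> * of_nat y) \<cdot>\<^sub>m 1\<^sub>m (N n))))
          = (\<Sum>i<N n. 1 / (complex_of_real ((g w n i)\<^sup>2) - \<i> * of_nat y))" if "0 < y" for n and y :: nat
        by (rule trace_resolvent[where L = "L n w", OF XXc]) (use elim(1) gramX[of n w] that in auto)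
      define K where "K = \<bar>lmin\<bar> + \<bar>lmax\<bar> + 1"
      show ?case
      proof (intro allI moments_of_stieltjes[OF A3_pi(2,1)])
        show "AE x in \<pi>. \<bar>x\<bar> \<le> K" using supp by eventually_elim (auto simp: K_def)
        have "\<forall>\<^sub>F n in sequentially. \<forall>i<N n. (g w n i)\<^sup>2 \<le> lmax + 1" using elim(2) by simp
        then show "\<forall>\<^sub>F n in sequentially. \<forall>i<N n. \<bar>(g w n i)\<^sup>2\<bar> \<le> K"
          by eventually_elim (auto simp: K_def)
        show "\<forall>\<^sub>F n in sequentially. 0 < N n" using Npos by eventually_elim simp
        show "(\<lambda>n. (\<Sum>i<N n. 1 / (complex_of_real ((g w n i)\<^sup>2) - \<i> * of_nat y)) / of_nat (N n)) \<longlonglongrightarrow> stieltjes \<pi> (\<i> * of_nat y)"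
          if "0 < y" for y :: nat
          using elim(3) that unfolding tr[OF that, symmetric] by blast
      qed
    qed
  qed
  interpret hs: haar_sequence M N c L Gam R \<pi> B
  proof unfold_locales
    show "AE w in M. \<forall>\<^sub>F n in sequentially. \<forall>i<N n. (Re (Gam n w $$ (i, i)))\<^sup>2 \<le> B"
      using gbound by eventually_elim (auto simp: B_def g_def)
    show "AE w in M. \<forall>k. (\<lambda>n. (\<Sum>i<N n. complex_of_real ((Re (Gam n w $$ (i, i)))\<^sup>2) ^ k) / of_nat (N n)) \<longlonglongrightarrow> (LINT x|\<pi>. complex_of_real x ^ k)"
      using trace by (simp add: g_def)
  qed (use A2_indep A2_L A2_R A1_le A1_lim c_pos in auto)
  have ga: "hs.ga w n i = g w n i" for w n i by (simp add: hs.ga_def g_def)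
  interpret bl: bounded_law \<pi> lmin lmax
    by (rule bounded_law.intro[OF A3_pi(2,1) supp lmax_nonneg])
  have Om_ge: "Om (r - 1) \<le> Om k" if "k < r" for k
    by (rule decreasing_from[of r Om k "r - 1"]) (use A5_Om that in auto)
  then have Om_pos: "0 < Om k" if "k < r" for k using A5_Om(2) that by force
  \<comment> \<open>The one-sided limit at \<open>lmax\<close> is turned into a strict inequality at
    one level beyond \<open>lmax\<close>. Since \<open>Om (r - 1)\<close> is the smallest value, the
    same level serves every index.\<close>
  obtain x0 where x0: "lmax < x0" "1 < gfun c \<pi> x0 * (Om (r - 1))\<^sup>2"
  proof -
    have sq: "0 < (Om (r - 1))\<^sup>2" using A5_Om(2) by simp
    have "\<forall>\<^sub>F x in at_right lmax. 1 / (Om (r - 1))\<^sup>2 < gfun c \<pi> x"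
      using A7
    proof
      assume "\<exists>g0>0. (gfun c \<pi> \<longlongrightarrow> g0) (at_right lmax) \<and> (Om (r - 1))\<^sup>2 > 1 / g0"
      then obtain g0 where g0: "0 < g0" "(gfun c \<pi> \<longlongrightarrow> g0) (at_right lmax)" "1 / g0 < (Om (r - 1))\<^sup>2" by blast
      have "1 / (Om (r - 1))\<^sup>2 < g0" using g0(1,3) sq by (simp add: field_simps)
      then show ?thesis using g0(2) by (rule order_tendstoD(1)[rotated])
    next
      assume "filterlim (gfun c \<pi>) at_top (at_right lmax)"
      then show ?thesis by (simp add: filterlim_at_top_dense)
    qed
    moreover have "\<forall>\<^sub>F x in at_right lmax. lmax < x" by (rule eventually_at_right_less)
    ultimately have "\<forall>\<^sub>F x in at_right lmax. 1 / (Om (r - 1))\<^sup>2 < gfun c \<pi> x \<and> lmax < x" by eventually_elim simp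
    then obtain x where "1 / (Om (r - 1))\<^sup>2 < gfun c \<pi> x" "lmax < x"
      using eventually_happens[of _ "at_right lmax"] by auto
    then show ?thesis using that[of x] sq by (simp add: pos_divide_less_eq)
  qed
  \<comment> \<open>The summand 1 leaves room between the limits of the squared column norms and the
    bound, so that the bound holds eventually. Below, Cs + 1 also covers the steering
    vectors.\<close>
  define Cs where "Cs = (\<Sum>k<r. (Om k)\<^sup>2 + 1)"
  \<comment> \<open>The moment lemmas need bounded vectors for every \<open>n\<close>, whereas S is
    controlled only eventually. For the other \<open>n\<close> the columns are put to zero in
    \<open>sv\<close>, which affects no limit.\<close>
  define goodS where "goodS = (\<lambda>n. S n \<in> carrier_mat n r \<and> (\<forall>k<r. (\<Sum>j<n. (cmod (S n $$ (j, k)))\<^sup>2) \<le> Cs))"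
  define sv where "sv = (\<lambda>k n j. if goodS n \<and> k < r then S n $$ (j, k) else 0)"
  define bv where "bv = (\<lambda>k n j. steer D (N n) (\<phi> k) $ j)"
  define av where "av = (\<lambda>k s n j. steer D (N n) (\<phi> k + s / real n) $ j)"
  have Cs0: "0 \<le> Cs" unfolding Cs_def by (intro sum_nonneg) auto
  have Sgram: "(mat_adjoint (S n) * S n) $$ (k, j) = (\<Sum>a<n. cnj (S n $$ (a, k)) * S n $$ (a, j))"
    if "S n \<in> carrier_mat n r" "k < r" "j < r" for n k j
    using that by (simp add: scalar_prod_def atLeast0LessThan)
  have Slim0: "(\<lambda>n. \<Sum>a<n. cnj (S n $$ (a, k)) * S n $$ (a, j)) \<longlonglongrightarrow> (if k = j then complex_of_real ((Om k)\<^sup>2) else 0)"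
    if kj: "k < r" "j < r" for k j
  proof -
    obtain C where C: "\<forall>\<^sub>F n in sequentially. \<forall>i<r. \<forall>j<r. cmod (complex_of_real (sqrt (real n)) *
          (mat_adjoint (S n) * S n - mat_diag r (\<lambda>k. complex_of_real ((Om k)\<^sup>2))) $$ (i, j)) \<le> C"
      using A6_S by blast
    have "(\<lambda>n. (\<Sum>a<n. cnj (S n $$ (a, k)) * S n $$ (a, j)) - (if k = j then complex_of_real ((Om k)\<^sup>2) else 0)) \<longlonglongrightarrow> 0"
    proof (rule Lim_null_comparison)
      show "\<forall>\<^sub>F n in sequentially. cmod ((\<Sum>a<n. cnj (S n $$ (a, k)) * S n $$ (a, j)) - (if k = j then complex_of_real ((Om k)\<^sup>2) else 0)) \<le> C / sqrt (real n)"
        using C A6_fact eventually_gt_at_top[of 0]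
      proof eventually_elim
        case (elim n)
        have E: "(mat_adjoint (S n) * S n - mat_diag r (\<lambda>k. complex_of_real ((Om k)\<^sup>2))) $$ (k, j)
            = (\<Sum>a<n. cnj (S n $$ (a, k)) * S n $$ (a, j)) - (if k = j then complex_of_real ((Om k)\<^sup>2) else 0)"
          using elim(2) kj by (subst index_minus_mat) (auto simp: Sgram mat_diag_def simp del: index_mult_mat(1))
        have "sqrt (real n) * cmod ((\<Sum>a<n. cnj (S n $$ (a, k)) * S n $$ (a, j)) - (if k = j then complex_of_real ((Om k)\<^sup>2) else 0)) \<le> C"
        proof -
          have "cmod (complex_of_real (sqrt (real n)) * (mat_adjoint (S n) * S n - mat_diag r (\<lambda>k. complex_of_real ((Om k)\<^sup>2))) $$ (k, j)) \<le> C"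
            using elim(1) kj by blast
          then show ?thesis unfolding E norm_mult norm_of_real by simp
        qed
        then show ?case using elim(3) by (simp add: pos_le_divide_eq mult.commute)
      qed
      show "(\<lambda>n. C / sqrt (real n)) \<longlonglongrightarrow> 0"
        by (intro real_tendsto_divide_at_top[OF tendsto_const] filterlim_compose[OF sqrt_at_top] filterlim_real_sequentially)
    qed
    then show ?thesis by (simp add: LIM_zero_iff)
  qed
  have goodS: "\<forall>\<^sub>F n in sequentially. goodS n"
  proof -
    have "\<forall>\<^sub>F n in sequentially. (\<Sum>j<n. (cmod (S n $$ (j, k)))\<^sup>2) \<le> Cs" if k: "k < r" for k
    proof -
      have "(\<lambda>n. Re (\<Sum>a<n. cnj (S n $$ (a, k)) * S n $$ (a, k))) \<longlonglongrightarrow> Re (complex_of_real ((Om k)\<^sup>2))"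
        using tendsto_Re[OF Slim0[OF k k]] by simp
      moreover have "Re (\<Sum>a<n. cnj (S n $$ (a, k)) * S n $$ (a, k)) = (\<Sum>j<n. (cmod (S n $$ (j, k)))\<^sup>2)" for n
        by (simp add: cmod_power2) (simp add: power2_eq_square)
      ultimately have "(\<lambda>n. \<Sum>j<n. (cmod (S n $$ (j, k)))\<^sup>2) \<longlonglongrightarrow> (Om k)\<^sup>2" by simp
      moreover have "(Om k)\<^sup>2 < Cs"
      proof -
        have "(Om k)\<^sup>2 + 1 \<le> Cs" unfolding Cs_def by (rule member_le_sum[of k _ "\<lambda>k. (Om k)\<^sup>2 + 1"]) (use k in auto)
        then show ?thesis by linarith
      qed
      ultimately show ?thesis using order_tendstoD(2) by (fastforce elim!: eventually_mono intro: less_imp_le)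
    qed
    then have "\<forall>\<^sub>F n in sequentially. \<forall>k\<in>{..<r}. (\<Sum>j<n. (cmod (S n $$ (j, k)))\<^sup>2) \<le> Cs"
      by (intro eventually_ball_finite) auto
    then show ?thesis using A6_fact by eventually_elim (auto simp: goodS_def)
  qed
  have sv_bound: "(\<Sum>j<n. (cmod (sv k n j))\<^sup>2) \<le> Cs + 1" for k n
  proof (cases "goodS n \<and> k < r")
    case True
    then have "(\<Sum>j<n. (cmod (S n $$ (j, k)))\<^sup>2) \<le> Cs" by (simp add: goodS_def)
    then show ?thesis using True by (simp add: sv_def)
  next
    case False
    then have "sv k n j = 0" for j by (simp only: sv_def if_False)
    then show ?thesis using Cs0 by simp
  qed
  have bv_bound: "(\<Sum>j<N n. (cmod (bv k n j))\<^sup>2) \<le> Cs + 1" for k n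
    unfolding bv_def using steer_norm[where N = "N n" and D = D and \<phi> = "\<phi> k"] Cs0 by linarith
  have av_bound: "(\<Sum>j<N n. (cmod (av k s n j))\<^sup>2) \<le> Cs + 1" for k s n
    unfolding av_def using steer_norm[where N = "N n" and D = D and \<phi> = "\<phi> k + s / real n"] Cs0 by linarith
  have sv_lim: "(\<lambda>n. \<Sum>a<n. cnj (sv k n a) * sv j n a) \<longlonglongrightarrow> (if k = j then complex_of_real ((Om k)\<^sup>2) else 0)"
    if kj: "k < r" "j < r" for k j
    by (rule Lim_transform_eventually[OF Slim0[OF kj]]) (use goodS kj in \<open>auto elim!: eventually_mono simp: sv_def\<close>)
  define \<alpha> where "\<alpha> = (\<lambda>(k::nat) s j. if k = j then steer_kernel (D * c * s) else 0)"
  have av_lim: "(\<lambda>n. \<Sum>j<N n. cnj (av k s n j) * bv l n j) \<longlonglongrightarrow> \<alpha> k s l" if "k < r" "l < r" for k l s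
  proof -
    have "\<phi> k = \<phi> l \<longleftrightarrow> k = l" using A6_phi(2) that by (auto simp: inj_on_def)
    then show ?thesis
      using steer_inner_limit[OF A1_lim Nlim _ D_pos, of "\<phi> k" "\<phi> l" s] A6_phi(1) that c_pos
      by (simp add: av_def bv_def \<alpha>_def)
  qed
  have bv_lim: "(\<lambda>n. \<Sum>j<N n. cnj (bv k n j) * bv l n j) \<longlonglongrightarrow> (if k = l then 1 else 0)" if "k < r" "l < r" for k l
    using av_lim[OF that, of 0] by (auto simp: av_def bv_def \<alpha>_def steer_kernel_def split: if_splits)
  define W where "W = (\<lambda>w n k i. if k < r then complex_of_real (g w n i) * hs.rco (sv k) w n i else hs.lco (bv (k - r)) w n i)"
  have W1: "W w n k i = complex_of_real (g w n i) * hs.rco (sv k) w n i" if "k < r" for w n k i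
    using that by (simp add: W_def)
  have W2: "W w n k i = hs.lco (bv (k - r)) w n i" if "\<not> k < r" for w n k i
    using that by (simp add: W_def)
  define T where "T = (\<lambda>w n i. (g w n i)\<^sup>2)"
  have T: "(\<lambda>n i. (hs.ga w n i)\<^sup>2) = T w" for w by (simp add: T_def ga)
  have W_lim: "AE w in M. weight_lim sequentially N (T w) \<pi> (\<lambda>n i. cnj (W w n j i) * W w n k i)
        (\<lambda>x. if j = k then complex_of_real (if j < r then c * (Om j)\<^sup>2 * x else 1) else 0)"
    if jk: "j < 2 * r" "k < 2 * r" for j k
  proof -
    consider "j < r" "k < r" | "j < r" "\<not> k < r" | "\<not> j < r" "k < r" | "\<not> j < r" "\<not> k < r" by blast
    then show ?thesis
    proof cases
      case 1
      have "(\<lambda>x. if j = k then complex_of_real (if j < r then c * (Om j)\<^sup>2 * x else 1) else 0)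
          = (\<lambda>x. complex_of_real (c * x) * (if j = k then complex_of_real ((Om j)\<^sup>2) else 0))"
        using 1 by (auto simp: fun_eq_iff)
      then show ?thesis
        unfolding W1[OF 1(1)] W1[OF 1(2)]
        using hs.AE_weight_lim_RR[OF sv_bound[of j] sv_bound[of k] sv_lim[OF 1], unfolded T, unfolded ga] by (simp only:)
    next
      case 2
      then have "j \<noteq> k" by auto
      then show ?thesis
        unfolding W1[OF 2(1)] W2[OF 2(2)]
        using hs.AE_weight_lim_RL[OF bv_bound[of "k - r"] sv_bound[of j], unfolded T, unfolded ga] by (simp only: if_False)
    next
      case 3
      then have "j \<noteq> k" by auto
      \<comment> \<open>The mixed limit is available in one order only; the other order is its
        complex conjugate.\<close>
      have "AE w in M. weight_lim sequentially N (T w) \<pi> (\<lambda>n i. cnj (cnj (complex_of_real (g w n i) * hs.rco (sv k) w n i) * hs.lco (bv (j - r)) w n i)) (\<lambda>x. cnj 0)"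
        using hs.AE_weight_lim_RL[OF bv_bound[of "j - r"] sv_bound[of k], unfolded T, unfolded ga]
        by eventually_elim (rule weight_lim_cnj)
      then show ?thesis
        unfolding W1[OF 3(2)] W2[OF 3(1)] complex_cnj_mult[of "cnj _"] complex_cnj_cnj
        using \<open>j \<noteq> k\<close> by (simp only: if_False complex_cnj_zero mult.commute)
    next
      case 4
      then have "j - r < r" "k - r < r" "j - r = k - r \<longleftrightarrow> j = k" using jk by auto
      have "(\<lambda>x. if j = k then complex_of_real (if j < r then c * (Om j)\<^sup>2 * x else 1) else 0) = (\<lambda>x. if j - r = k - r then 1 else 0)"
        using 4 \<open>j - r = k - r \<longleftrightarrow> j = k\<close> by (auto simp: fun_eq_iff)
      then show ?thesis
        unfolding W2[OF 4(1)] W2[OF 4(2)]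
        using hs.AE_weight_lim_LL[OF bv_bound[of "j - r"] bv_bound[of "k - r"] bv_lim[OF \<open>j - r < r\<close> \<open>k - r < r\<close>], unfolded T] by (simp only:)
    qed
  qed
  have W_all: "AE w in M. \<forall>j k. j < 2 * r \<longrightarrow> k < 2 * r \<longrightarrow> weight_lim sequentially N (T w) \<pi> (\<lambda>n i. cnj (W w n j i) * W w n k i)
        (\<lambda>x. if j = k then complex_of_real (if j < r then c * (Om j)\<^sup>2 * x else 1) else 0)"
    unfolding AE_all_countable using W_lim by (intro allI AE_impI) auto
  have Z_lim: "AE w in M. weight_lim sequentially N (T w) \<pi> (\<lambda>n i. cnj (hs.lco (av k s) w n i) * W w n j i) (\<lambda>x. if j < r then 0 else \<alpha> k s (j - r))"
    if "k < r" "j < 2 * r" for k s j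
  proof (cases "j < r")
    case True
    have "AE w in M. weight_lim sequentially N (T w) \<pi> (\<lambda>n i. cnj (cnj (complex_of_real (g w n i) * hs.rco (sv j) w n i) * hs.lco (av k s) w n i)) (\<lambda>x. cnj 0)"
      using hs.AE_weight_lim_RL[OF av_bound[of k s] sv_bound[of j], unfolded T, unfolded ga]
      by eventually_elim (rule weight_lim_cnj)
    then show ?thesis
      unfolding W1[OF True] complex_cnj_mult[of "cnj _"] complex_cnj_cnj
      using True by (simp only: if_True complex_cnj_zero mult.commute)
  next
    case False
    then have "j - r < r" using that by auto
    then show ?thesis
      unfolding W2[OF False]
      using hs.AE_weight_lim_LL[OF av_bound[of k s] bv_bound[of "j - r"] av_lim[OF that(1) \<open>j - r < r\<close>], unfolded T] False
      by (simp only: if_False)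
  qed
  define S0 where "S0 = insert (0::real) (range (\<lambda>j. 1 / real (Suc j)) \<union> range (\<lambda>j. - 1 / real (Suc j)))"
  have S0: "countable S0" by (simp add: S0_def)
  have Z_all: "AE w in M. \<forall>s\<in>S0. \<forall>k j. k < r \<longrightarrow> j < 2 * r \<longrightarrow> weight_lim sequentially N (T w) \<pi>
      (\<lambda>n i. cnj (hs.lco (av k s) w n i) * W w n j i) (\<lambda>x. if j < r then 0 else \<alpha> k s (j - r))"
    unfolding AE_ball_countable[OF S0] AE_all_countable using Z_lim by (intro ballI allI AE_impI) auto
  define SS where "SS = (\<lambda>n k j. \<Sum>a<n. cnj (sv k n a) * sv j n a)"
  have r_le: "\<forall>\<^sub>F n in sequentially. r \<le> N n"
    using Nlim by (simp add: filterlim_at_top)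
  have main: "AE w in M. \<forall>k<r. \<exists>ph :: nat \<Rightarrow> real.
           (\<forall>\<^sub>F n in sequentially. lam n w (r - 1) > lmax \<and>
              local_max_on {0..pi / D} (chi_hat c \<pi> D (N n) r (lam n w) (u n w)) (ph n)) \<and>
           (\<lambda>n. real n * (ph n - \<phi> k)) \<longlonglongrightarrow> 0"
    using good gbound W_all Z_all
  proof eventually_elim
    case (elim w)
    have sp: "spiked_path \<pi> lmin lmax N (\<lambda>n i. (g w n i)\<^sup>2) c r Om (W w) SS"
    proof unfold_locales
      show "\<forall>\<^sub>F n in sequentially. \<forall>i<N n. (g w n i)\<^sup>2 \<le> \<kappa>" if "lmax < \<kappa>" for \<kappa> using elim(2) that by blast
      show "weight_lim sequentially N (\<lambda>n i. (g w n i)\<^sup>2) \<pi> (\<lambda>n i. cnj (W w n j i) * W w n k i)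
          (\<lambda>x. if j = k then complex_of_real (if j < r then c * (Om j)\<^sup>2 * x else 1) else 0)" if "j < 2 * r" "k < 2 * r" for j k
        using elim(3) that unfolding T_def by blast
      show "(\<lambda>n. SS n j k) \<longlonglongrightarrow> (if j = k then complex_of_real ((Om j)\<^sup>2) else 0)" if "j < r" "k < r" for j k
        using sv_lim[OF that] by (simp add: SS_def)
    qed (use c_pos r_pos Om_pos in auto)
    have om: "outlier_model \<pi> lmin lmax N (g w) c r Om (W w) SS (\<lambda>n j i. L n w $$ (j, i)) (\<lambda>n j i. R n w $$ (j, i))
        (\<lambda>n j k. bv k n j) (\<lambda>n j k. sv k n j) (\<lambda>n i a. Sig n w $$ (i, a)) (\<lambda>n l i. u n w l $ i) (\<lambda>n. lam n w) x0"
    proof (rule outlier_model.intro[OF sp], unfold_locales)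
      show "\<forall>\<^sub>F n in sequentially. signal_plus_noise (N n) n r (\<lambda>j i. L n w $$ (j, i)) (\<lambda>j i. R n w $$ (j, i)) (\<lambda>j k. bv k n j) (\<lambda>j k. sv k n j) (g w n) (\<lambda>i a. Sig n w $$ (i, a))"
        using goodS A6_fact
      proof eventually_elim
        case (elim n)
        have e: "orthonormal_cols (N n) (N n) (\<lambda>j i. L n w $$ (j, i))" "orthonormal_cols n (N n) (\<lambda>j i. R n w $$ (j, i))"
          "L n w \<in> carrier_mat (N n) (N n)" "R n w \<in> carrier_mat n (N n)"
          using \<open>\<forall>n. orthonormal_cols (N n) (N n) _ \<and> _ n\<close> by auto
        show ?case
        proof
          fix i a assume ia: "i < N n" "a < n"
          have "P n $$ (i, a) = (\<Sum>k<r. bv k n i * cnj (sv k n a))"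
          proof -
            have d: "dim_row (S n) = n" "dim_col (S n) = r" using elim(2) by auto
            have "P n $$ (i, a) = (mat_of_cols (N n) (map (\<lambda>k. steer D (N n) (\<phi> k)) [0..<r]) * mat_adjoint (S n)) $$ (i, a)"
              using elim(2) by simp
            also have "\<dots> = (\<Sum>k<r. steer D (N n) (\<phi> k) $ i * cnj (S n $$ (a, k)))"
              using ia d by (simp add: scalar_prod_def atLeast0LessThan mat_of_cols_index)
            also have "\<dots> = (\<Sum>k<r. bv k n i * cnj (sv k n a))"
              using elim(1) by (intro sum.cong refl) (simp add: bv_def sv_def)
            finally show ?thesis .
          qed
          moreover have "Sig n w $$ (i, a) = X n w $$ (i, a) + P n $$ (i, a)"
            using carrier_matD[OF P_carrier[rule_format, of n]] ia by (simp add: Sig_def)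
          ultimately show "Sig n w $$ (i, a) = (\<Sum>l<N n. L n w $$ (i, l) * complex_of_real (g w n l) * cnj (R n w $$ (a, l))) + (\<Sum>k<r. bv k n i * cnj (sv k n a))"
            using Xent[OF e(3,4) ia] by simp
        qed (use e in auto)
      qed
      show "W w n k i = (if k < r then complex_of_real (g w n i) * lvec n (\<lambda>j i. R n w $$ (j, i)) (\<lambda>j. sv k n j) i
          else lvec (N n) (\<lambda>j i. L n w $$ (j, i)) (\<lambda>j. bv (k - r) n j) i)" for n k i
        by (simp add: W_def lvec_def hs.rco_def hs.lco_def)
      show "SS n k j = (\<Sum>a<n. cnj (sv k n a) * sv j n a)" for n k j by (simp add: SS_def)
      show "\<forall>\<^sub>F n in sequentially. \<forall>l<N n. \<forall>i<N n. (\<Sum>a<n. Sig n w $$ (i, a) * (\<Sum>b<N n. cnj (Sig n w $$ (b, a)) * u n w l $ b)) = complex_of_real (lam n w l) * u n w l $ i"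
      proof (intro always_eventually allI impI)
        fix n l i assume li: "l < N n" "i < N n"
        have Sc: "Sig n w \<in> carrier_mat (N n) n"
          using carrier_matD[OF P_carrier[rule_format, of n]] by (intro carrier_matI) (simp_all add: Sig_def)
        have uc: "u n w l \<in> carrier_vec (N n)" and eq: "(Sig n w * mat_adjoint (Sig n w)) *\<^sub>v u n w l = complex_of_real (lam n w l) \<cdot>\<^sub>v u n w l"
          using eig li by auto
        have "((Sig n w * mat_adjoint (Sig n w)) *\<^sub>v u n w l) $ i = (\<Sum>b<N n. (\<Sum>a<n. Sig n w $$ (i, a) * cnj (Sig n w $$ (b, a))) * u n w l $ b)"
          using Sc uc li by (simp add: scalar_prod_def atLeast0LessThan)
        also have "\<dots> = (\<Sum>a<n. Sig n w $$ (i, a) * (\<Sum>b<N n. cnj (Sig n w $$ (b, a)) * u n w l $ b))"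
          unfolding sum_distrib_right sum_distrib_left by (subst sum.swap) (simp add: mult_ac)
        finally show "(\<Sum>a<n. Sig n w $$ (i, a) * (\<Sum>b<N n. cnj (Sig n w $$ (b, a)) * u n w l $ b)) = complex_of_real (lam n w l) * u n w l $ i"
          using eq uc li by simp
      qed
      show "\<forall>\<^sub>F n in sequentially. orthonormal_cols (N n) (N n) (\<lambda>i l. u n w l $ i)"
      proof (intro always_eventually allI)
        fix n
        have d: "dim_vec (u n w l) = N n" if "l < N n" for l using eig that by auto
        have "\<forall>j<N n. \<forall>k<N n. vinner (u n w j) (u n w k) = (if j = k then 1 else 0)" using eig by blast
        then show "orthonormal_cols (N n) (N n) (\<lambda>i l. u n w l $ i)"
          unfolding orthonormal_cols_def vinner_def using d by simp
      qed
      show "\<forall>\<^sub>F n in sequentially. \<forall>l<N n. (r - 1 \<le> l \<longrightarrow> lam n w l \<le> lam n w (r - 1)) \<and> (l \<le> r - 1 \<longrightarrow> lam n w (r - 1) \<le> lam n w l)"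
        using r_le
      proof eventually_elim
        case (elim n)
        show ?case
          using decreasing_from[of "N n" "lam n w"] eig elim r_pos by auto
      qed
      show "\<forall>\<^sub>F n in sequentially. r \<le> N n" by (rule r_le)
      show "lmax < x0" by (rule x0)
      fix k assume k: "k < r"
      interpret spiked_path \<pi> lmin lmax N "\<lambda>n i. (g w n i)\<^sup>2" c r Om "W w" SS by (rule sp)
      have gp: "gfun c \<pi> x0 = bl.m1 x0 * sf x0" by (simp add: bl.gfun_eq[OF x0(1)] sf_def)
      have "1 < bl.m1 x0 * sf x0 * (Om (r - 1))\<^sup>2" using x0(2) by (simp add: gp)
      also have "\<dots> \<le> bl.m1 x0 * sf x0 * (Om k)\<^sup>2"
        using bl.m1_pos[OF x0(1)] sf_pos[OF x0(1)] Om_ge[OF k] A5_Om(2) by (intro mult_left_mono power_mono) auto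
      finally show "1 < bl.m1 x0 * sf x0 * (Om k)\<^sup>2" .
    qed
    have out: "\<forall>\<^sub>F n in sequentially. lmax < lam n w (r - 1)"
      using outlier_model.outliers[OF om] x0(1) by (auto elim!: eventually_mono)
    \<comment> \<open>The target is the steering vector at \<phi> k + s / n. Among its limit inner
      products with the steering vectors of the signal only the k-th survives, so the squared norm
      of \<alpha> is that of the kernel alone.\<close>
    have chi: "(\<lambda>n. chi_hat c \<pi> D (N n) r (lam n w) (u n w) (\<phi> k + s / real n)) \<longlonglongrightarrow> (cmod (steer_kernel (D * c * s)))\<^sup>2"
      if k: "k < r" and s: "s \<in> S0" for k s
    proof -
      have "(\<lambda>n. \<Sum>l<r. (cmod (\<Sum>i<N n. cnj (av k s n i) * u n w l $ i))\<^sup>2 * zeta c \<pi> (lam n w l)) \<longlonglongrightarrow> (\<Sum>j<r. (cmod (\<alpha> k s j))\<^sup>2)"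
      proof (rule outlier_model.projection_limit[OF om])
        fix j assume "j < 2 * r"
        then have "weight_lim sequentially N (T w) \<pi> (\<lambda>n i. cnj (hs.lco (av k s) w n i) * W w n j i) (\<lambda>x. if j < r then 0 else \<alpha> k s (j - r))"
          using elim(4) k s by blast
        then show "weight_lim sequentially N (\<lambda>n i. (g w n i)\<^sup>2) \<pi> (\<lambda>n i. cnj (lvec (N n) (\<lambda>j i. L n w $$ (j, i)) (av k s n) i) * W w n j i)
            (\<lambda>x. if j < r then 0 else \<alpha> k s (j - r))"
          by (simp add: T_def lvec_def hs.lco_def)
      qed
      moreover have "(\<Sum>j<r. (cmod (\<alpha> k s j))\<^sup>2) = (cmod (steer_kernel (D * c * s)))\<^sup>2"
      proof -
        have "(\<Sum>j<r. (cmod (\<alpha> k s j))\<^sup>2) = (\<Sum>j<r. if k = j then (cmod (steer_kernel (D * c * s)))\<^sup>2 else 0)"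
          by (intro sum.cong refl) (simp add: \<alpha>_def)
        then show ?thesis using k by simp
      qed
      ultimately show ?thesis by (simp add: chi_hat_def vinner_steer av_def)
    qed
    show ?case
    proof (intro allI impI)
      fix k assume k: "k < r"
      have "\<exists>ph. (\<forall>\<^sub>F n in sequentially. local_max_on {0..pi / D} (chi_hat c \<pi> D (N n) r (lam n w) (u n w)) (ph n)) \<and> (\<lambda>n. real n * (ph n - \<phi> k)) \<longlonglongrightarrow> 0"
      proof (rule local_maxima_converge)
        show "continuous_on UNIV (chi_hat c \<pi> D (N n) r (lam n w) (u n w))" for n by (rule continuous_chi_hat)
        show "\<phi> k \<in> {0..pi / D}" using A6_phi(1) k by blast
        show "(\<lambda>n. chi_hat c \<pi> D (N n) r (lam n w) (u n w) (\<phi> k)) \<longlonglongrightarrow> 1"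
          using chi[OF k, of 0] by (simp add: S0_def steer_kernel_def)
        fix s :: real assume s: "s \<noteq> 0" "s \<in> range (\<lambda>j. 1 / real (Suc j)) \<union> range (\<lambda>j. - 1 / real (Suc j))"
        have "D * c * s \<noteq> 0" using D_pos c_pos s by simp
        then have "(cmod (steer_kernel (D * c * s)))\<^sup>2 < 1" using steer_kernel_less by (simp add: abs_square_less_1)
        moreover have "s \<in> S0" using s(2) unfolding S0_def by blast
        ultimately show "\<exists>a<1. (\<lambda>n. chi_hat c \<pi> D (N n) r (lam n w) (u n w) (\<phi> k + s / real n)) \<longlonglongrightarrow> a"
          using chi[OF k] by blast
      qed
      then obtain ph where ph: "\<forall>\<^sub>F n in sequentially. local_max_on {0..pi / D} (chi_hat c \<pi> D (N n) r (lam n w) (u n w)) (ph n)"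
          "(\<lambda>n. real n * (ph n - \<phi> k)) \<longlonglongrightarrow> 0" by blast
      show "\<exists>ph. (\<forall>\<^sub>F n in sequentially. lmax < lam n w (r - 1) \<and> local_max_on {0..pi / D} (chi_hat c \<pi> D (N n) r (lam n w) (u n w)) (ph n))
          \<and> (\<lambda>n. real n * (ph n - \<phi> k)) \<longlonglongrightarrow> 0"
        using eventually_conj[OF out ph(1)] ph(2) by blast
    qed
  qed
  show ?thesis
    using main by (auto elim!: eventually_mono)
qed

end
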